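(* Let $p\in\mathbb{N}$, $p\geq 3$, $q$ the conjugate exponent, $t>0$, and $\alpha\in\mathbb{C}\setminus\{0\}$ with $\mathrm{Re}(\alpha)\leq 0$ if $p$ is even and $\mathrm{Re}(\alpha)=0$ if $p$ is odd. Let $u_0\in L^2(\mathbb{R})$ with $u_0(x)=\int_{\mathbb{R}}e^{ixy}d\mu_0(y)$ and $V(x)=\int_{\mathbb{R}}e^{ixy}d\nu(y)$, where $\mu_0,\nu$ are complex Borel measures on $\mathbb{R}$ of finite total variation. For $x\in\mathbb{R}$ define $f_{t,x}:\mathcal{B}_q\to\mathbb{C}$ by $$f_{t,x}(\eta)=u_0(x+\eta(0))\,e^{\int_0^tV(x+\eta(s))ds}.$$ Then $f_{t,x}\in\mathcal{F}(\mathcal{B}_q)$, and $I_{\Phi_p}(f_{t,x})=(T(t)u_0)(x)$ for almost every $x\in\mathbb{R}$, where $(T(t))_{t\geq0}$ is the strongly continuous semigroup on $L^2(\mathbb{R})$ solving the Cauchy problem $\partial_t u=(-i)^p\alpha\,\partial_x^pu+V(x)u$, $u(0,\cdot)=u_0$.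
   Context: $\mathcal{B}_r$ ($r\in(1,\infty)$) is the Banach space of absolutely continuous $\gamma:[0,t]\to\mathbb{R}$ with $\gamma(t)=0$ and weak derivative $\dot\gamma\in L^r([0,t])$, norm $(\int_0^t|\dot\gamma|^r)^{1/r}$; $\mathcal{B}_p^*\cong\mathcal{B}_q$ via $\langle\eta,\gamma\rangle=\int_0^t\dot\eta(s)\dot\gamma(s)ds$. $\mathcal{F}(\mathcal{B}_q)$ is the set of $f:\mathcal{B}_q\to\mathbb{C}$ of the form $f(\eta)=\int_{\mathcal{B}_p}e^{i\int_0^t\dot\eta\dot\gamma ds}d\mu_f(\gamma)$ for a complex Borel measure $\mu_f$ on $\mathcal{B}_p$ of finite total variation, and $I_{\Phi_p}(f)=\int_{\mathcal{B}_p}e^{(-1)^p\alpha\int_0^t\dot\gamma(s)^pds}d\mu_f(\gamma)$. The semigroup: let $A=\alpha\mathcal{D}_p$, where $\mathcal{D}_p$ is the self-adjoint operator on $L^2(\mathbb{R})$ with domain $\{u\in L^2: k\mapsto k^p\hat u(k)\in L^2\}$ and $\widehat{\mathcal{D}_pu}(k)=k^p\hat u(k)$ (so that $e^{tA}u=g^p_t*u$ with $g^p_t(x)=\frac1{2\pi}\int e^{ikx}e^{\alpha tk^p}dk$); let $B$ be multiplication by $V$ (bounded). $T(t)$ is the $C_0$-semigroup generated by $A+B$ on $D(A)$; equivalently $T(t)u_0$ is given by the $L^2$-convergent Dyson series $\sum_{n\ge0}S_n(t)u_0$, $S_0(t)u=e^{tA}u$, $S_n(t)u=\int_0^te^{(t-s)A}BS_{n-1}(s)u\,ds$.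 *)

theory Defs
  imports "HOL-Analysis.Analysis"
begin

definition Bsp :: "real \<Rightarrow> real \<Rightarrow> (real \<Rightarrow> real) set" where
  "Bsp r t = {\<gamma>. \<exists>g. g \<in> borel_measurable lborel
      \<and> set_integrable lborel {0..t} g
      \<and> set_integrable lborel {0..t} (\<lambda>s. \<bar>g s\<bar> powr r)
      \<and> (\<forall>s\<in>{0..t}. \<gamma> s = - (LBINT \<tau>=s..t. g \<tau>))
      \<and> (\<forall>s. s \<notin> {0..t} \<longrightarrow> \<gamma> s = 0)}"

text \<open>The weak derivative (determined almost everywhere on [0,t]).\<close>
definition Bdot :: "real \<Rightarrow> (real \<Rightarrow> real) \<Rightarrow> real \<Rightarrow> real" where
  "Bdot t \<gamma> = (SOME g. g \<in> borel_measurable lborel \<and> set_integrable lborel {0..t} g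
      \<and> (\<forall>s\<in>{0..t}. \<gamma> s = - (LBINT \<tau>=s..t. g \<tau>)))"

definition Bnorm :: "real \<Rightarrow> real \<Rightarrow> (real \<Rightarrow> real) \<Rightarrow> real" where
  "Bnorm r t \<gamma> = (LBINT s=0..t. \<bar>Bdot t \<gamma> s\<bar> powr r) powr (1 / r)"

definition Bopen :: "real \<Rightarrow> real \<Rightarrow> (real \<Rightarrow> real) set set" where
  "Bopen r t = {U. U \<subseteq> Bsp r t \<and>
     (\<forall>\<gamma>\<in>U. \<exists>e>0. {\<delta>\<in>Bsp r t. Bnorm r t (\<delta> - \<gamma>) < e} \<subseteq> U)}"

definition Bborel :: "real \<Rightarrow> real \<Rightarrow> (real \<Rightarrow> real) measure" where
  "Bborel r t = sigma (Bsp r t) (Bopen r t)"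

definition Bpair :: "real \<Rightarrow> (real \<Rightarrow> real) \<Rightarrow> (real \<Rightarrow> real) \<Rightarrow> real" where
  "Bpair t \<eta> \<gamma> = (LBINT s=0..t. Bdot t \<eta> s * Bdot t \<gamma> s)"

text \<open>A complex Borel measure mu of finite total variation on B_p is represented as
h \<cdot> M with M a finite (positive) Borel measure on B_p and h in L^1(M).\<close>
definition FB_rep :: "real \<Rightarrow> real \<Rightarrow> real \<Rightarrow> ((real \<Rightarrow> real) \<Rightarrow> complex)
    \<Rightarrow> (real \<Rightarrow> real) measure \<Rightarrow> ((real \<Rightarrow> real) \<Rightarrow> complex) \<Rightarrow> bool" where
  "FB_rep p q t f M h \<longleftrightarrow> sets M = sets (Bborel p t) \<and> finite_measure M \<and> integrable M h \<and>
     (\<forall>\<eta>\<in>Bsp q t. f \<eta> = (\<integral>\<gamma>. exp (\<i> * complex_of_real (Bpair t \<eta> \<gamma>)) * h \<gamma> \<partial>M))"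

definition inF :: "real \<Rightarrow> real \<Rightarrow> real \<Rightarrow> ((real \<Rightarrow> real) \<Rightarrow> complex) \<Rightarrow> bool" where
  "inF p q t f \<longleftrightarrow> (\<exists>M h. FB_rep p q t f M h)"

definition I_Phi :: "nat \<Rightarrow> complex \<Rightarrow> real \<Rightarrow> (real \<Rightarrow> real) measure
    \<Rightarrow> ((real \<Rightarrow> real) \<Rightarrow> complex) \<Rightarrow> complex" where
  "I_Phi p \<alpha> t M h = (\<integral>\<gamma>. exp ((-1) ^ p * \<alpha> *
       complex_of_real (LBINT s=0..t. (Bdot t \<gamma> s) ^ p)) * h \<gamma> \<partial>M)"

definition L2 :: "(real \<Rightarrow> complex) \<Rightarrow> bool" where
  "L2 u \<longleftrightarrow> u \<in> borel_measurable lborel \<and> integrable lborel (\<lambda>x. (cmod (u x))\<^sup>2)"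

definition L2norm :: "(real \<Rightarrow> complex) \<Rightarrow> real" where
  "L2norm u = sqrt (LINT x|lborel. (cmod (u x))\<^sup>2)"

definition FT2 :: "(real \<Rightarrow> complex) \<Rightarrow> (real \<Rightarrow> complex) \<Rightarrow> bool" where
  "FT2 u w \<longleftrightarrow> L2 u \<and> L2 w \<and>
     (\<lambda>n::nat. LINT k|lborel. (cmod (w k -
        (LBINT x=- real n..real n. exp (- \<i> * complex_of_real (k * x)) * u x)))\<^sup>2)
       \<longlonglongrightarrow> 0"

text \<open>Graph of A = alpha D_p: u in D(A) and v = A u.\<close>
definition A_rel :: "complex \<Rightarrow> nat \<Rightarrow> (real \<Rightarrow> complex) \<Rightarrow> (real \<Rightarrow> complex) \<Rightarrow> bool" where
  "A_rel \<alpha> p u v \<longleftrightarrow> L2 u \<and> L2 v \<and>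
     (\<exists>w. FT2 u w \<and> FT2 v (\<lambda>k. \<alpha> * complex_of_real k ^ p * w k))"

text \<open>T is a C_0-semigroup on L^2(R) (acting on representatives, respecting a.e. equality)
whose generator is A + B, B = multiplication by V, with domain D(A).\<close>
definition C0_generated :: "(real \<Rightarrow> (real \<Rightarrow> complex) \<Rightarrow> (real \<Rightarrow> complex))
    \<Rightarrow> complex \<Rightarrow> nat \<Rightarrow> (real \<Rightarrow> complex) \<Rightarrow> bool" where
  "C0_generated T \<alpha> p V \<longleftrightarrow>
     (\<forall>t\<ge>0. \<forall>u. L2 u \<longrightarrow> L2 (T t u))
   \<and> (\<forall>t\<ge>0. \<forall>u w. L2 u \<and> L2 w \<and> (AE x in lborel. u x = w x)
        \<longrightarrow> (AE x in lborel. T t u x = T t w x))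
   \<and> (\<forall>t\<ge>0. \<forall>u w a b. L2 u \<and> L2 w \<longrightarrow>
        (AE x in lborel. T t (\<lambda>y. a * u y + b * w y) x = a * T t u x + b * T t w x))
   \<and> (\<forall>t\<ge>0. \<exists>C. \<forall>u. L2 u \<longrightarrow> L2norm (T t u) \<le> C * L2norm u)
   \<and> (\<forall>u. L2 u \<longrightarrow> (AE x in lborel. T 0 u x = u x))
   \<and> (\<forall>s\<ge>0. \<forall>t\<ge>0. \<forall>u. L2 u \<longrightarrow> (AE x in lborel. T (s + t) u x = T s (T t u) x))
   \<and> (\<forall>u. L2 u \<longrightarrow> ((\<lambda>h. L2norm (\<lambda>x. T h u x - u x)) \<longlongrightarrow> 0) (at_right 0))
   \<and> (\<forall>u v. A_rel \<alpha> p u v \<longrightarrow>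
        ((\<lambda>h. L2norm (\<lambda>x. (T h u x - u x) / complex_of_real h - (v x + V x * u x)))
           \<longlongrightarrow> 0) (at_right 0))
   \<and> (\<forall>u z. L2 u \<and> L2 z \<and>
        ((\<lambda>h. L2norm (\<lambda>x. (T h u x - u x) / complex_of_real h - z x)) \<longlongrightarrow> 0) (at_right 0)
        \<longrightarrow> (\<exists>v. A_rel \<alpha> p u v))"

end

theory Submission
  imports Defs "HOL-Probability.Probability"
begin

text \<open>
  On the Fourier side the potential makes the frequency jump: \<open>N\<close> can be replaced by a probability measure
  with a bounded density \<open>h\<close>, and expanding \<open>exp (\<integral> V (x + \<eta> s) ds)\<close> gives a weighted sum over
  \<open>n\<close> of integrals over random kick times and \<open>N\<close>-distributed jumps \<open>y\<^sub>1, \<dots>, y\<^sub>n\<close>. The phase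
  \<open>exp (\<i> (\<eta> 0 y + \<Sum> \<eta> (s\<^sub>j) y\<^sub>j))\<close> is \<open>exp (\<i> \<langle>\<eta>, \<gamma>\<rangle>)\<close> for the path \<open>\<gamma>\<close> whose derivative is minus the
  piecewise constant frequency, so the law of \<open>\<gamma>\<close> represents \<open>f\<close>, and \<open>I_Phi\<close> of this representation is
  the Dyson series \<open>u x = \<integral> wave x y h0(y) dM0(y)\<close>.

  \<open>I_Phi\<close> does not depend on the representation: two complex measures with the same characteristic function
  agree on bounded functions of finitely many pairings, and \<open>\<integral> \<gamma>'(s)\<^sup>p ds\<close> is a limit of such functions, by
  averaging \<open>\<gamma>'\<close> over uniform partitions.

  If \<open>h\<close> has compact support and the Fourier transform of \<open>u0\<close> decays exponentially, the Dyson series is a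
  classical solution in the domain of the generator, and differentiating \<open>T (t - s) (u s)\<close> identifies it with
  \<open>T t u0\<close>. In general, truncate \<open>h\<close> and \<open>M0\<close> and mollify \<open>M0\<close> with a Gaussian; \<open>T t u0\<close> is then the
  \<open>L\<^sup>2\<close> limit and the Dyson series the pointwise limit of the approximate solutions.
\<close>

subsection \<open>Square integrable functions and the Fourier transform\<close>

text \<open>The semigroup is known only through \<open>C0_generated\<close>: it acts on
  representatives, comes without a bound that is uniform in time, and its derivative at 0 is
  available only on the domain of A. The Dyson series is therefore built independently of
  \<open>T\<close> and compared with it along classical solutions. This forces regular data first,
  and local boundedness of \<open>T\<close> has to be extracted from strong continuity.

  Two signs match. Paths vanish at t, so \<eta>(s) is minus the integral of its derivative over
  [s, t]; a phase \<eta>(s) y is thus a pairing with derivative - y on [s, t], and the factor (-1)^p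
  in \<open>I_Phi\<close> cancels this minus sign.

  The kick times are not drawn as ordered uniform points but by repeated uniform shrinking of
  [0, t]. Splitting off one kick is then a shift of an i.i.d. sequence, and the single recursion
  \<open>integral_last_kick\<close> gives both the exponential of the potential and Duhamel's
  formula. All phases are bounded because Re (\<alpha> y^p) \<le> 0.\<close>

lemma L2_measurable [measurable_dest]: "L2 u \<Longrightarrow> u \<in> borel_measurable borel"
  by (simp add: L2_def)

lemma L2norm_nonneg [simp]: "0 \<le> L2norm u"
  by (simp add: L2norm_def)

lemma L2_iff_nn_integral:
  "L2 u \<longleftrightarrow> u \<in> borel_measurable lborel \<and> (\<integral>\<^sup>+x. ennreal ((cmod (u x))\<^sup>2) \<partial>lborel) < \<infinity>"
  by (auto simp: L2_def integrable_iff_bounded)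

lemma L2norm_square: "(L2norm u)\<^sup>2 = (LINT x|lborel. (cmod (u x))\<^sup>2)"
  by (simp add: L2norm_def)

lemma nn_integral_L2norm: "L2 u \<Longrightarrow> (\<integral>\<^sup>+x. ennreal ((cmod (u x))\<^sup>2) \<partial>lborel) = ennreal ((L2norm u)\<^sup>2)"
  unfolding L2norm_square by (intro nn_integral_eq_integral) (auto simp: L2_def)

lemma L2_of_nn_integral_le:
  assumes "u \<in> borel_measurable lborel" "0 \<le> B"
    and "(\<integral>\<^sup>+x. ennreal ((cmod (u x))\<^sup>2) \<partial>lborel) \<le> ennreal (B\<^sup>2)"
  shows "L2 u" "L2norm u \<le> B"
proof -
  show u: "L2 u"
    using assms by (auto simp: L2_iff_nn_integral top.not_eq_extremum intro: le_less_trans)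
  have "ennreal ((L2norm u)\<^sup>2) \<le> ennreal (B\<^sup>2)"
    using assms nn_integral_L2norm[OF u] by simp
  then have "(L2norm u)\<^sup>2 \<le> B\<^sup>2"
    by (simp add: ennreal_le_iff)
  then show "L2norm u \<le> B"
    using assms(2) by (simp add: power2_le_iff_abs_le)
qed

text \<open>Fatou's lemma for the squared norms. It serves twice: for completeness in
  \<open>L2_series\<close>, and in the last limit, where the approximants are known to converge
  pointwise to the Dyson series.\<close>

lemma L2_fatou:
  fixes u :: "nat \<Rightarrow> real \<Rightarrow> complex"
  assumes u: "\<And>n. L2 (u n)" and B: "0 \<le> B" "\<forall>\<^sub>F n in sequentially. L2norm (u n) \<le> B"
    and v: "v \<in> borel_measurable lborel" and lim: "AE x in lborel. (\<lambda>n. u n x) \<longlonglongrightarrow> v x"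
  shows "L2 v" "L2norm v \<le> B"
proof -
  have m[measurable]: "u n \<in> borel_measurable borel" for n using u by (simp add: L2_def)
  have "(\<integral>\<^sup>+x. ennreal ((cmod (v x))\<^sup>2) \<partial>lborel) = (\<integral>\<^sup>+x. liminf (\<lambda>n. ennreal ((cmod (u n x))\<^sup>2)) \<partial>lborel)"
  proof (intro nn_integral_cong_AE)
    show "AE x in lborel. ennreal ((cmod (v x))\<^sup>2) = liminf (\<lambda>n. ennreal ((cmod (u n x))\<^sup>2))"
      using lim
    proof eventually_elim
      case (elim x)
      have "(\<lambda>n. ennreal ((cmod (u n x))\<^sup>2)) \<longlonglongrightarrow> ennreal ((cmod (v x))\<^sup>2)"
        by (intro tendsto_ennrealI tendsto_intros elim)
      then show ?case by (rule lim_imp_Liminf[OF trivial_limit_sequentially, symmetric])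
    qed
  qed
  also have "\<dots> \<le> liminf (\<lambda>n. \<integral>\<^sup>+x. ennreal ((cmod (u n x))\<^sup>2) \<partial>lborel)"
    by (rule nn_integral_liminf) measurable
  also have "\<dots> \<le> ennreal (B\<^sup>2)"
  proof -
    have "\<forall>\<^sub>F n in sequentially. (\<integral>\<^sup>+x. ennreal ((cmod (u n x))\<^sup>2) \<partial>lborel) \<le> ennreal (B\<^sup>2)"
      using B(2) by eventually_elim (auto simp: nn_integral_L2norm[OF u] intro!: ennreal_leI power_mono)
    then have "liminf (\<lambda>n. \<integral>\<^sup>+x. ennreal ((cmod (u n x))\<^sup>2) \<partial>lborel) \<le> liminf (\<lambda>n::nat. ennreal (B\<^sup>2))"
      by (rule Liminf_mono)
    then show ?thesis by (simp add: Liminf_const)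
  qed
  finally show "L2 v" "L2norm v \<le> B"
    by (rule L2_of_nn_integral_le[OF v B(1)])+
qed

lemma L2norm_cong_AE:
  assumes "L2 u" "L2 v" "AE x in lborel. u x = v x"
  shows "L2norm u = L2norm v"
proof -
  have "(LINT x|lborel. (cmod (u x))\<^sup>2) = (LINT x|lborel. (cmod (v x))\<^sup>2)"
    using assms by (intro integral_cong_AE) (auto simp: L2_def)
  then show ?thesis by (simp add: L2norm_def)
qed

lemma L2_scale: "L2 u \<Longrightarrow> L2 (\<lambda>x. c * u x)"
  by (auto simp: L2_def norm_mult power_mult_distrib)

lemma L2norm_scale: "L2norm (\<lambda>x. c * u x) = cmod c * L2norm u"
  by (simp add: L2norm_def norm_mult power_mult_distrib real_sqrt_mult)

lemma integrable_L2_mult: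
  fixes u v :: "real \<Rightarrow> complex"
  assumes "L2 u" "L2 v"
  shows "integrable lborel (\<lambda>x. u x * v x)"
proof (rule Bochner_Integration.integrable_bound)
  show "integrable lborel (\<lambda>x. (cmod (u x))\<^sup>2 + (cmod (v x))\<^sup>2)"
    using assms by (auto simp: L2_def)
  show "AE x in lborel. norm (u x * v x) \<le> norm ((cmod (u x))\<^sup>2 + (cmod (v x))\<^sup>2)"
  proof (intro AE_I2)
    fix x
    have "0 \<le> (cmod (u x) - cmod (v x))\<^sup>2 + ((cmod (u x))\<^sup>2 + (cmod (v x))\<^sup>2)" by simp
    then show "norm (u x * v x) \<le> norm ((cmod (u x))\<^sup>2 + (cmod (v x))\<^sup>2)"
      by (simp add: norm_mult power2_diff)
  qed
qed (use assms in \<open>auto simp: L2_def\<close>)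

lemma L2_Cauchy_Schwarz:
  assumes "L2 u" "L2 v"
  shows "(LINT x|lborel. cmod (u x) * cmod (v x)) \<le> L2norm u * L2norm v"
proof -
  have [measurable]: "u \<in> borel_measurable borel" "v \<in> borel_measurable borel"
    using assms by (auto simp: L2_def)
  let ?I = "LINT x|lborel. cmod (u x) * cmod (v x)"
  have int: "integrable lborel (\<lambda>x. cmod (u x) * cmod (v x))"
    using integrable_norm[OF integrable_L2_mult[OF assms]] by (simp add: norm_mult)
  have nn: "0 \<le> ?I" by (intro integral_nonneg_AE) auto
  have "(\<integral>\<^sup>+x. ennreal (cmod (u x)) * ennreal (cmod (v x)) \<partial>lborel)\<^sup>2
      \<le> (\<integral>\<^sup>+x. (ennreal (cmod (u x)))\<^sup>2 \<partial>lborel) * (\<integral>\<^sup>+x. (ennreal (cmod (v x)))\<^sup>2 \<partial>lborel)"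
    by (rule Cauchy_Schwarz_nn_integral) auto
  also have "\<dots> = ennreal ((L2norm u)\<^sup>2) * ennreal ((L2norm v)\<^sup>2)"
    using nn_integral_L2norm[OF assms(1)] nn_integral_L2norm[OF assms(2)]
    by (simp add: ennreal_power)
  also have "(\<integral>\<^sup>+x. ennreal (cmod (u x)) * ennreal (cmod (v x)) \<partial>lborel) = ennreal ?I"
    using nn_integral_eq_integral[OF int] by (simp add: ennreal_mult'')
  finally have "?I\<^sup>2 \<le> (L2norm u * L2norm v)\<^sup>2"
    using nn by (simp add: ennreal_power ennreal_mult''[symmetric] power_mult_distrib ennreal_le_iff)
  then show ?thesis
    using power2_le_imp_le by (metis L2norm_nonneg mult_nonneg_nonneg)
qed

lemma L2_add:
  assumes "L2 u" "L2 v"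
  shows "L2 (\<lambda>x. u x + v x)"
  unfolding L2_def
proof
  show [measurable]: "(\<lambda>x. u x + v x) \<in> borel_measurable lborel"
    using assms by (auto simp: L2_def)
  show "integrable lborel (\<lambda>x. (cmod (u x + v x))\<^sup>2)"
  proof (rule Bochner_Integration.integrable_bound)
    show "integrable lborel (\<lambda>x. 2 * (cmod (u x))\<^sup>2 + 2 * (cmod (v x))\<^sup>2)"
      using assms by (auto simp: L2_def)
    show "AE x in lborel. norm ((cmod (u x + v x))\<^sup>2) \<le> norm (2 * (cmod (u x))\<^sup>2 + 2 * (cmod (v x))\<^sup>2)"
    proof (intro AE_I2)
      fix x
      have "(cmod (u x + v x))\<^sup>2 \<le> (cmod (u x) + cmod (v x))\<^sup>2"
        by (intro power_mono norm_triangle_ineq) auto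
      also have "\<dots> \<le> 2 * (cmod (u x))\<^sup>2 + 2 * (cmod (v x))\<^sup>2"
        using zero_le_power2[of "cmod (u x) - cmod (v x)"] by (simp add: power2_diff power2_sum)
      finally show "norm ((cmod (u x + v x))\<^sup>2) \<le> norm (2 * (cmod (u x))\<^sup>2 + 2 * (cmod (v x))\<^sup>2)"
        by simp
    qed
  qed measurable
qed

lemma L2norm_triangle:
  assumes "L2 u" "L2 v"
  shows "L2norm (\<lambda>x. u x + v x) \<le> L2norm u + L2norm v"
proof (rule power2_le_imp_le)
  have int: "integrable lborel (\<lambda>x. cmod (u x) * cmod (v x))"
    using integrable_norm[OF integrable_L2_mult[OF assms]] by (simp add: norm_mult)
  have i2: "integrable lborel (\<lambda>x. (cmod (u x))\<^sup>2)" "integrable lborel (\<lambda>x. (cmod (v x))\<^sup>2)"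
    using assms by (auto simp: L2_def)
  have "(L2norm (\<lambda>x. u x + v x))\<^sup>2 = (LINT x|lborel. (cmod (u x + v x))\<^sup>2)"
    by (rule L2norm_square)
  also have "\<dots> \<le> (LINT x|lborel. (cmod (u x))\<^sup>2 + 2 * (cmod (u x) * cmod (v x)) + (cmod (v x))\<^sup>2)"
  proof (rule integral_mono)
    show "integrable lborel (\<lambda>x. (cmod (u x + v x))\<^sup>2)"
      using L2_add[OF assms] by (simp add: L2_def)
    fix x
    have "(cmod (u x + v x))\<^sup>2 \<le> (cmod (u x) + cmod (v x))\<^sup>2"
      by (intro power_mono norm_triangle_ineq) auto
    then show "(cmod (u x + v x))\<^sup>2 \<le> (cmod (u x))\<^sup>2 + 2 * (cmod (u x) * cmod (v x)) + (cmod (v x))\<^sup>2"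
      by (simp add: power2_sum algebra_simps)
  qed (use int i2 in auto)
  also have "\<dots> = (L2norm u)\<^sup>2 + 2 * (LINT x|lborel. cmod (u x) * cmod (v x)) + (L2norm v)\<^sup>2"
    using int i2 by (simp add: L2norm_square)
  also have "\<dots> \<le> (L2norm u + L2norm v)\<^sup>2"
    using L2_Cauchy_Schwarz[OF assms] by (simp add: power2_sum algebra_simps)
  finally show "(L2norm (\<lambda>x. u x + v x))\<^sup>2 \<le> (L2norm u + L2norm v)\<^sup>2" .
qed simp

lemma L2_lincomb: "L2 u \<Longrightarrow> L2 v \<Longrightarrow> L2 (\<lambda>x. a * u x + b * v x)"
  by (intro L2_add L2_scale)

lemma L2_diff: "L2 u \<Longrightarrow> L2 v \<Longrightarrow> L2 (\<lambda>x. u x - v x)"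
  using L2_lincomb[of u v 1 "-1"] by simp

lemma L2norm_triangle_diff: "L2 u \<Longrightarrow> L2 v \<Longrightarrow> L2norm (\<lambda>x. u x - v x) \<le> L2norm u + L2norm v"
  using L2norm_triangle[OF _ L2_scale[of v "-1"], of u] L2norm_scale[of "-1" v] by simp

lemma L2norm_minus_commute: "L2norm (\<lambda>x. u x - v x) = L2norm (\<lambda>x. v x - u x)"
  by (simp add: L2norm_def norm_minus_commute)

lemma L2norm_triangle3:
  assumes "L2 u" "L2 v" "L2 w"
  shows "L2norm (\<lambda>x. u x - w x) \<le> L2norm (\<lambda>x. u x - v x) + L2norm (\<lambda>x. v x - w x)"
  using L2norm_triangle[of "\<lambda>x. u x - v x" "\<lambda>x. v x - w x"] assms by (simp add: L2_diff)

lemma L2norm_diff_ge: "L2 u \<Longrightarrow> L2 v \<Longrightarrow> L2norm u - L2norm v \<le> L2norm (\<lambda>x. u x - v x)"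
  using L2norm_triangle[of "\<lambda>x. u x - v x" v] by (simp add: L2_diff)

lemma L2_0 [simp]: "L2 (\<lambda>x. 0)" and L2norm_0 [simp]: "L2norm (\<lambda>x. 0) = 0"
  by (auto simp: L2_def L2norm_def)

lemma L2_sum: "(\<And>i. i \<in> A \<Longrightarrow> L2 (u i)) \<Longrightarrow> L2 (\<lambda>x. \<Sum>i\<in>A. u i x)"
  by (induction A rule: infinite_finite_induct) (auto intro: L2_add)

lemma L2norm_sum: "(\<And>i. i \<in> A \<Longrightarrow> L2 (u i)) \<Longrightarrow> L2norm (\<lambda>x. \<Sum>i\<in>A. u i x) \<le> (\<Sum>i\<in>A. L2norm (u i))"
proof (induction A rule: infinite_finite_induct)
  case (insert i A)
  have "L2norm (\<lambda>x. u i x + (\<Sum>i\<in>A. u i x)) \<le> L2norm (u i) + L2norm (\<lambda>x. \<Sum>i\<in>A. u i x)"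
    using insert by (intro L2norm_triangle L2_sum) auto
  then show ?case using insert by force
qed auto

lemma L2_norm: "L2 u \<Longrightarrow> L2 (\<lambda>x. complex_of_real (cmod (u x)))"
  and L2norm_norm: "L2norm (\<lambda>x. complex_of_real (cmod (u x))) = L2norm u"
  by (auto simp: L2_def L2norm_def)

lemma L2_bounded_mult:
  assumes "L2 u" "V \<in> borel_measurable lborel" "\<And>x. cmod (V x) \<le> B"
  shows "L2 (\<lambda>x. V x * u x)" "L2norm (\<lambda>x. V x * u x) \<le> B * L2norm u"
proof -
  have B: "0 \<le> B" using assms(3)[of 0] norm_ge_zero order_trans by blast
  have [measurable]: "u \<in> borel_measurable borel" "V \<in> borel_measurable borel" 
    using assms by (auto simp: L2_def)
  have "(\<integral>\<^sup>+x. ennreal ((cmod (V x * u x))\<^sup>2) \<partial>lborel) \<le> (\<integral>\<^sup>+x. ennreal (B\<^sup>2) * ennreal ((cmod (u x))\<^sup>2) \<partial>lborel)"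
    by (intro nn_integral_mono)
       (auto simp: norm_mult power_mult_distrib ennreal_mult''[symmetric] intro!: ennreal_leI mult_right_mono power_mono assms(3))
  also have "\<dots> = ennreal ((B * L2norm u)\<^sup>2)"
    by (simp add: nn_integral_cmult nn_integral_L2norm[OF assms(1)] ennreal_mult'' power_mult_distrib)
  finally have *: "(\<integral>\<^sup>+x. ennreal ((cmod (V x * u x))\<^sup>2) \<partial>lborel) \<le> ennreal ((B * L2norm u)\<^sup>2)" .
  have "(\<lambda>x. V x * u x) \<in> borel_measurable lborel" "0 \<le> B * L2norm u" using B by auto
  then show "L2 (\<lambda>x. V x * u x)" "L2norm (\<lambda>x. V x * u x) \<le> B * L2norm u"
    by (rule L2_of_nn_integral_le[OF _ _ *])+
qed

text \<open>Riesz-Fischer in series form, with the tail of the norms as explicit error. The majorant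
  \<open>D\<close> takes values in \<open>ennreal\<close>, so its square can be integrated before
  convergence is known; finiteness of that integral gives absolute convergence almost
  everywhere.\<close>

lemma L2_series:
  fixes d :: "nat \<Rightarrow> real \<Rightarrow> complex"
  assumes d: "\<And>n. L2 (d n)" and s: "summable (\<lambda>n. L2norm (d n))"
  obtains x where "L2 x"
    "\<And>N. L2norm (\<lambda>y. x y - (\<Sum>n<N. d n y)) \<le> (\<Sum>n. L2norm (d (n + N)))"
proof -
  have [measurable]: "d n \<in> borel_measurable borel" for n using d by (simp add: L2_def)
  let ?S = "\<Sum>n. L2norm (d n)"
  have S0: "0 \<le> ?S" by (intro suminf_nonneg s) simp
  define D where "D y = (\<Sum>n. ennreal (cmod (d n y)))" for y
  have [measurable]: "D \<in> borel_measurable borel" unfolding D_def by measurable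
  have "(\<integral>\<^sup>+y. (D y)\<^sup>2 \<partial>lborel) = (\<integral>\<^sup>+y. (SUP N. ennreal ((\<Sum>n<N. cmod (d n y))\<^sup>2)) \<partial>lborel)"
  proof (intro nn_integral_cong)
    fix y
    have "(\<lambda>N. (\<Sum>n<N. ennreal (cmod (d n y)))) \<longlonglongrightarrow> D y"
      unfolding D_def by (rule summable_LIMSEQ) simp
    then have "(\<lambda>N. ((\<Sum>n<N. ennreal (cmod (d n y)))) * (\<Sum>n<N. ennreal (cmod (d n y)))) \<longlonglongrightarrow> D y * D y"
      by (intro tendsto_mult_ennreal) auto
    then have "(\<lambda>N. ennreal ((\<Sum>n<N. cmod (d n y))\<^sup>2)) \<longlonglongrightarrow> (D y)\<^sup>2"
      by (simp add: power2_eq_square sum_ennreal ennreal_mult'' sum_nonneg)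
    moreover have "(\<lambda>N. ennreal ((\<Sum>n<N. cmod (d n y))\<^sup>2)) \<longlonglongrightarrow> (SUP N. ennreal ((\<Sum>n<N. cmod (d n y))\<^sup>2))"
      by (intro LIMSEQ_SUP monoI ennreal_leI power_mono sum_mono2 sum_nonneg) auto
    ultimately show "(D y)\<^sup>2 = (SUP N. ennreal ((\<Sum>n<N. cmod (d n y))\<^sup>2))"
      using LIMSEQ_unique by blast
  qed
  also have "\<dots> = (SUP N. \<integral>\<^sup>+y. ennreal ((\<Sum>n<N. cmod (d n y))\<^sup>2) \<partial>lborel)"
    by (intro nn_integral_monotone_convergence_SUP)
       (auto simp: incseq_def le_fun_def intro!: ennreal_leI power_mono sum_mono2 sum_nonneg)
  also have "\<dots> \<le> ennreal (?S\<^sup>2)"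
  proof (rule SUP_least)
    fix N
    let ?u = "\<lambda>y. \<Sum>n<N. complex_of_real (cmod (d n y))"
    have u: "L2 ?u" by (intro L2_sum L2_norm d)
    have "L2norm ?u \<le> (\<Sum>n<N. L2norm (d n))"
      using L2norm_sum[of "{..<N}" "\<lambda>n y. complex_of_real (cmod (d n y))"] L2_norm[OF d] 
      by (simp add: L2norm_norm)
    also have "\<dots> \<le> ?S" by (intro sum_le_suminf s) auto
    finally have le: "L2norm ?u \<le> ?S" .
    have "(\<integral>\<^sup>+y. ennreal ((\<Sum>n<N. cmod (d n y))\<^sup>2) \<partial>lborel) = (\<integral>\<^sup>+y. ennreal ((cmod (?u y))\<^sup>2) \<partial>lborel)"
      by (simp flip: of_real_sum)
    also have "\<dots> = ennreal ((L2norm ?u)\<^sup>2)" by (rule nn_integral_L2norm[OF u])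
    also have "\<dots> \<le> ennreal (?S\<^sup>2)" by (intro ennreal_leI power_mono le) auto
    finally show "(\<integral>\<^sup>+y. ennreal ((\<Sum>n<N. cmod (d n y))\<^sup>2) \<partial>lborel) \<le> ennreal (?S\<^sup>2)" .
  qed
  finally have "(\<integral>\<^sup>+y. (D y)\<^sup>2 \<partial>lborel) < \<infinity>"
    by (rule le_less_trans) simp
  then have "AE y in lborel. (D y)\<^sup>2 \<noteq> \<infinity>"
    by (intro nn_integral_noteq_infinite) auto
  then have sm: "AE y in lborel. summable (\<lambda>n. cmod (d n y))"
  proof eventually_elim
    case (elim y)
    then have "D y \<noteq> top" by (auto simp: power2_eq_square ennreal_mult_eq_top_iff)
    then show ?case unfolding D_def by (intro summable_suminf_not_top) auto
  qed
  define x where "x y = (\<Sum>n. d n y)" for y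
  have [measurable]: "x \<in> borel_measurable borel" unfolding x_def by measurable
  have main: "L2 (\<lambda>y. x y - (\<Sum>n<N. d n y))"
     "L2norm (\<lambda>y. x y - (\<Sum>n<N. d n y)) \<le> (\<Sum>n. L2norm (d (n + N)))" for N
  proof -
    let ?u = "\<lambda>m y. \<Sum>n<m. d (n + N) y"
    have sN: "summable (\<lambda>n. L2norm (d (n + N)))" using s by (subst summable_iff_shift)
    have u: "L2 (?u m)" for m by (intro L2_sum d)
    have le: "L2norm (?u m) \<le> (\<Sum>n. L2norm (d (n + N)))" for m
    proof -
      have "L2norm (?u m) \<le> (\<Sum>n<m. L2norm (d (n + N)))" by (intro L2norm_sum d)
      also have "\<dots> \<le> (\<Sum>n. L2norm (d (n + N)))" by (intro sum_le_suminf sN) auto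
      finally show ?thesis .
    qed
    have lim: "AE y in lborel. (\<lambda>m. ?u m y) \<longlonglongrightarrow> x y - (\<Sum>n<N. d n y)"
      using sm
    proof eventually_elim
      case (elim y)
      then have "summable (\<lambda>n. d n y)" by (rule summable_norm_cancel)
      then have "(\<lambda>n. d (n + N) y) sums (x y - (\<Sum>n<N. d n y))"
        unfolding x_def by (intro sums_split_initial_segment summable_sums)
      then show ?case by (simp add: sums_def)
    qed
    have B0: "0 \<le> (\<Sum>n. L2norm (d (n + N)))" by (intro suminf_nonneg sN) simp
    show "L2 (\<lambda>y. x y - (\<Sum>n<N. d n y))" 
     "L2norm (\<lambda>y. x y - (\<Sum>n<N. d n y)) \<le> (\<Sum>n. L2norm (d (n + N)))"
      by (rule L2_fatou[OF u B0 _ _ lim]; simp add: le)+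
  qed
  show thesis
    using that main(1)[of 0] main(2) by simp
qed

text \<open>No factor 1 / (2 pi): a measure with density \<open>a\<close> has characteristic
  function \<open>ift a\<close>, which is the form in which \<open>u0\<close> and \<open>V\<close>
  are given. The price is the factor 2 pi in Plancherel's identity and in
  \<open>FT2_ift\<close>.\<close>

definition ift :: "(real \<Rightarrow> complex) \<Rightarrow> real \<Rightarrow> complex" where
  "ift a x = (LINT k|lborel. exp (\<i> * complex_of_real (x * k)) * a k)"

lemma norm_exp_ii_times [simp]: "cmod (exp (\<i> * complex_of_real x)) = 1"
  by (simp add: norm_exp_i_times)

lemma integrable_cexp_mult:
  fixes f :: "'a \<Rightarrow> complex" and g :: "'a \<Rightarrow> real"
  assumes "integrable M f" and [measurable]: "g \<in> borel_measurable M"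
  shows "integrable M (\<lambda>x. exp (\<i> * complex_of_real (g x)) * f x)"
  using assms by (intro Bochner_Integration.integrable_bound[OF assms(1)]) (auto simp: norm_mult)

lemma integrable_bounded_mult:
  fixes f g :: "'a \<Rightarrow> complex"
  assumes "integrable M f" "g \<in> borel_measurable M" "\<And>x. cmod (g x) \<le> B"
  shows "integrable M (\<lambda>x. g x * f x)"
proof (rule Bochner_Integration.integrable_bound)
  show "integrable M (\<lambda>x. B * cmod (f x))" using assms by auto
  show "AE x in M. norm (g x * f x) \<le> norm (B * cmod (f x))"
    using assms(3) by (auto simp: norm_mult abs_mult intro!: mult_mono order_trans[OF assms(3) abs_ge_self])
qed (use assms in auto)

lemma ift_measurable [measurable]:
  assumes [measurable]: "a \<in> borel_measurable borel"
  shows "ift a \<in> borel_measurable borel"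
  unfolding ift_def by measurable

lemma norm_ift_le: "cmod (ift a x) \<le> (LINT k|lborel. cmod (a k))"
  unfolding ift_def by (rule order_trans[OF integral_norm_bound]) (simp add: norm_mult)

lemma integrable_pair_mult:
  fixes f :: "'a \<Rightarrow> complex" and g :: "'b \<Rightarrow> complex"
  assumes "sigma_finite_measure M" "sigma_finite_measure N" "integrable M f" "integrable N g"
  shows "integrable (M \<Otimes>\<^sub>M N) (\<lambda>(x, y). f x * g y)"
proof -
  interpret M: sigma_finite_measure M by fact
  interpret N: sigma_finite_measure N by fact
  interpret pair_sigma_finite M N ..
  have [measurable]: "f \<in> borel_measurable M" "g \<in> borel_measurable N" using assms by auto
  show ?thesis
  proof (rule Fubini_integrable)
    show "integrable M (\<lambda>x. LINT y|N. norm (case (x, y) of (x, y) \<Rightarrow> f x * g y))"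
      using assms by (simp add: norm_mult)
    show "AE x in M. integrable N (\<lambda>y. case (x, y) of (x, y) \<Rightarrow> f x * g y)"
      using assms by simp
  qed measurable
qed

lemma borel_measurable_cnj [measurable (raw)]:
  "f \<in> borel_measurable M \<Longrightarrow> (\<lambda>x. cnj (f x)) \<in> borel_measurable M"
  by (rule borel_measurable_continuous_on[OF continuous_on_cnj[OF continuous_on_id]])

lemma norm_integral_le_nn_integral:
  fixes f :: "'a \<Rightarrow> complex"
  shows "ennreal (cmod (LINT x|M. f x)) \<le> (\<integral>\<^sup>+x. ennreal (cmod (f x)) \<partial>M)"
  by (cases "integrable M f") (auto simp: not_integrable_integral_eq intro: integral_norm_bound_ennreal)

lemma ift_multiplication_formula:
  assumes a: "integrable lborel a" and b: "integrable lborel b"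
  shows "(LINT x|lborel. b x * ift a x) = (LINT k|lborel. a k * ift b k)"
proof -
  have [measurable]: "a \<in> borel_measurable borel" "b \<in> borel_measurable borel" using a b by auto
  have "integrable (lborel \<Otimes>\<^sub>M lborel) (\<lambda>z. case z of (x, k) \<Rightarrow> b x * a k)"
    using integrable_pair_mult[OF _ _ b a] by (simp add: sigma_finite_lborel)
  then have "integrable (lborel \<Otimes>\<^sub>M lborel)
      (\<lambda>z. exp (\<i> * complex_of_real (fst z * snd z)) * (case z of (x, k) \<Rightarrow> b x * a k))"
    by (rule integrable_cexp_mult) measurable
  then have int: "integrable (lborel \<Otimes>\<^sub>M lborel) (\<lambda>(x, k). exp (\<i> * complex_of_real (x * k)) * (b x * a k))"
    by (simp add: case_prod_unfold)
  have "(LINT x|lborel. b x * ift a x) = (LINT x|lborel. LINT k|lborel. exp (\<i> * complex_of_real (x * k)) * (b x * a k))"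
    unfolding ift_def by (simp flip: integral_mult_right_zero add: mult_ac)
  also have "\<dots> = (LINT k|lborel. LINT x|lborel. exp (\<i> * complex_of_real (x * k)) * (b x * a k))"
    using lborel_pair.Fubini_integral[OF int] by simp
  also have "\<dots> = (LINT k|lborel. a k * ift b k)"
    unfolding ift_def by (simp flip: integral_mult_right_zero add: mult_ac)
  finally show ?thesis .
qed

section \<open>Gaussian regularisation and Plancherel's theorem\<close>

lemma integrable_std_normal: "integrable lborel (\<lambda>x. complex_of_real (std_normal_density x))"
  using integrable_normal_density[of 1 0] by simp

lemma integral_std_normal: "(LINT x|lborel. complex_of_real (std_normal_density x)) = 1"
  using integral_normal_density[of 1 0] by simp

lemma ift_std_normal: "ift (\<lambda>x. complex_of_real (std_normal_density x)) s = exp (- complex_of_real (s\<^sup>2) / 2)"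
proof -
  have "char std_normal_distribution s = complex_of_real (exp (- (s^2) / 2))"
    by (simp add: char_std_normal_distribution)
  moreover have "char std_normal_distribution s = ift (\<lambda>x. complex_of_real (std_normal_density x)) s"
    unfolding char_def ift_def
    by (subst integral_density) (auto simp: scaleR_conv_of_real mult_ac)
  ultimately show ?thesis by (simp add: exp_of_real[symmetric])
qed

text \<open>The regulariser exp (- y^2 / 2) is expressed through \<open>std_normal_density\<close>,
  so that its integrability and its transform come from the standard normal law.\<close>

lemma gauss_weight:
  "sqrt (2 * pi) * std_normal_density y = exp (- y\<^sup>2 / 2)"
  by (simp add: std_normal_density_def)

lemma integrable_gauss_scaled: 
  assumes "\<sigma> \<noteq> 0"
  shows "integrable lborel (\<lambda>x. complex_of_real (sqrt (2 * pi) * std_normal_density (\<sigma> * x)))"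
proof -
  have "integrable lborel (\<lambda>x. complex_of_real (std_normal_density (0 + \<sigma> * x)))"
    by (subst lborel_integrable_real_affine_iff) (use assms integrable_std_normal in auto)
  then show ?thesis by simp
qed

lemma ift_gauss_scaled:
  assumes "\<sigma> > 0"
  shows "ift (\<lambda>x. complex_of_real (sqrt (2 * pi) * std_normal_density (\<sigma> * x))) s
     = complex_of_real (2 * pi / \<sigma> * std_normal_density (s / \<sigma>))"
proof -
  have "ift (\<lambda>x. complex_of_real (std_normal_density x)) (s / \<sigma>)
    = \<bar>\<sigma>\<bar> *\<^sub>R (LINT x|lborel. exp (\<i> * complex_of_real (s / \<sigma> * (0 + \<sigma> * x))) * complex_of_real (std_normal_density (0 + \<sigma> * x)))"
    unfolding ift_def using assms by (subst lborel_integral_real_affine[where c=\<sigma> and t=0]) auto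
  then have "complex_of_real \<sigma> * (LINT x|lborel. exp (\<i> * complex_of_real (s * x)) * complex_of_real (std_normal_density (\<sigma> * x)))
     = exp (- complex_of_real ((s / \<sigma>)\<^sup>2) / 2)"
    using assms by (simp add: ift_std_normal scaleR_conv_of_real)
  also have "\<dots> = complex_of_real (sqrt (2 * pi) * std_normal_density (s / \<sigma>))"
    unfolding gauss_weight by (simp add: exp_of_real[symmetric])
  finally have *: "(LINT x|lborel. exp (\<i> * complex_of_real (s * x)) * complex_of_real (std_normal_density (\<sigma> * x)))
    = complex_of_real (sqrt (2 * pi) * std_normal_density (s / \<sigma>) / \<sigma>)"
    using assms by (simp add: field_simps)
  have "ift (\<lambda>x. complex_of_real (sqrt (2 * pi) * std_normal_density (\<sigma> * x))) s
     = complex_of_real (sqrt (2 * pi)) * (LINT x|lborel. exp (\<i> * complex_of_real (s * x)) * complex_of_real (std_normal_density (\<sigma> * x)))"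
    unfolding ift_def by (simp flip: integral_mult_right_zero add: mult_ac)
  also have "\<dots> = complex_of_real (sqrt (2 * pi) * (sqrt (2 * pi) * std_normal_density (s / \<sigma>) / \<sigma>))"
    unfolding * by simp
  also have "sqrt (2 * pi) * (sqrt (2 * pi) * std_normal_density (s / \<sigma>) / \<sigma>) = 2 * pi / \<sigma> * std_normal_density (s / \<sigma>)"
  proof -
    have "sqrt (2 * pi) * sqrt (2 * pi) = 2 * pi" by simp
    then show ?thesis by (metis (no_types, lifting) mult.assoc times_divide_eq_left times_divide_eq_right)
  qed
  finally show ?thesis .
qed

lemma cnj_ift: "cnj (ift a x) = ift (\<lambda>l. cnj (a (- l))) x"
proof -
  have "cnj (ift a x) = (LINT k|lborel. exp (\<i> * complex_of_real (x * (- k))) * cnj (a k))"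
    unfolding ift_def by (subst Bochner_Integration.integral_cnj[symmetric]) (simp add: exp_cnj)
  also have "\<dots> = (LINT k|lborel. exp (\<i> * complex_of_real (x * k)) * cnj (a (- k)))"
    by (subst lborel_integral_real_affine[where c="-1" and t=0]) auto
  finally show ?thesis by (simp add: ift_def)
qed

text \<open>The multiplication formula is applied twice, first to take \<open>ift\<close> off
  \<open>a\<close>, then, after \<open>cnj_ift\<close>, to put it on the Gaussian. The transformed
  Gaussian has width \<sigma>, and substituting l = - k + \<sigma> z normalises it. Without the
  weight \<open>ift a\<close> is merely bounded and the first application would lack an integrable
  partner.\<close>

lemma gauss_regularised_Plancherel:
  assumes a: "integrable lborel a" and \<sigma>: "\<sigma> > 0"
  shows "(LINT x|lborel. complex_of_real ((cmod (ift a x))\<^sup>2 * exp (- (\<sigma> * x)\<^sup>2 / 2)))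
    = 2 * pi * (LINT k|lborel. a k * (LINT z|lborel. cnj (a (k - \<sigma> * z)) * complex_of_real (std_normal_density z)))"
proof -
  have [measurable]: "a \<in> borel_measurable borel" using a by auto
  define g where "g x = complex_of_real (sqrt (2 * pi) * std_normal_density (\<sigma> * x))" for x
  have g: "integrable lborel g" unfolding g_def using \<sigma> by (intro integrable_gauss_scaled) auto
  have [measurable]: "g \<in> borel_measurable borel" using g by auto
  have ca: "integrable lborel (\<lambda>l. cnj (a (- l)))"
  proof -
    have "integrable lborel (\<lambda>l. a (0 + (-1) * l))"
      by (subst lborel_integrable_real_affine_iff) (use a in auto)
    then show ?thesis by simp
  qed
  have bint: "integrable lborel (\<lambda>x. cnj (ift a x) * g x)"
    by (intro integrable_bounded_mult[OF g, where B="LINT k|lborel. cmod (a k)"]) (auto simp: norm_ift_le)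
  have "(LINT x|lborel. complex_of_real ((cmod (ift a x))\<^sup>2 * exp (- (\<sigma> * x)\<^sup>2 / 2)))
     = (LINT x|lborel. (cnj (ift a x) * g x) * ift a x)"
  proof (intro Bochner_Integration.integral_cong refl)
    fix x
    have "g x = complex_of_real (exp (- (\<sigma> * x)\<^sup>2 / 2))" unfolding g_def gauss_weight ..
    then show "complex_of_real ((cmod (ift a x))\<^sup>2 * exp (- (\<sigma> * x)\<^sup>2 / 2)) = (cnj (ift a x) * g x) * ift a x"
      by (simp only: of_real_mult complex_norm_square mult_ac)
  qed
  also have "\<dots> = (LINT k|lborel. a k * ift (\<lambda>x. cnj (ift a x) * g x) k)"
    by (rule ift_multiplication_formula[OF a bint])
  also have "\<dots> = (LINT k|lborel. a k * (2 * pi * (LINT z|lborel. cnj (a (k - \<sigma> * z)) * complex_of_real (std_normal_density z))))"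
  proof (intro Bochner_Integration.integral_cong refl arg_cong2[where f="(*)"])
    fix k
    have gk: "integrable lborel (\<lambda>x. exp (\<i> * complex_of_real (x * k)) * g x)"
      by (intro integrable_cexp_mult g) measurable
    have "ift (\<lambda>x. cnj (ift a x) * g x) k = (LINT x|lborel. (exp (\<i> * complex_of_real (x * k)) * g x) * ift (\<lambda>l. cnj (a (- l))) x)"
      unfolding cnj_ift[symmetric] by (subst (1) ift_def) (simp add: mult_ac)
    also have "\<dots> = (LINT l|lborel. cnj (a (- l)) * ift (\<lambda>x. exp (\<i> * complex_of_real (x * k)) * g x) l)"
      by (rule ift_multiplication_formula[OF ca gk])
    also have "\<dots> = (LINT l|lborel. cnj (a (- l)) * complex_of_real (2 * pi / \<sigma> * std_normal_density ((k + l) / \<sigma>)))"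
    proof (intro Bochner_Integration.integral_cong refl arg_cong2[where f="(*)"])
      fix l
      have "ift (\<lambda>x. exp (\<i> * complex_of_real (x * k)) * g x) l = ift g (k + l)"
        unfolding ift_def by (simp add: exp_add[symmetric] algebra_simps mult_exp_exp)
      then show "ift (\<lambda>x. exp (\<i> * complex_of_real (x * k)) * g x) l = complex_of_real (2 * pi / \<sigma> * std_normal_density ((k + l) / \<sigma>))"
        using ift_gauss_scaled[OF \<sigma>] unfolding g_def by simp
    qed
    also have "\<dots> = \<bar>\<sigma>\<bar> *\<^sub>R (LINT z|lborel. cnj (a (- (- k + \<sigma> * z))) * complex_of_real (2 * pi / \<sigma> * std_normal_density ((k + (- k + \<sigma> * z)) / \<sigma>)))"
      by (rule lborel_integral_real_affine) (use \<sigma> in auto)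
    also have "\<dots> = 2 * pi * (LINT z|lborel. cnj (a (k - \<sigma> * z)) * complex_of_real (std_normal_density z))"
    proof -
      have "(LINT z|lborel. cnj (a (- (- k + \<sigma> * z))) * complex_of_real (2 * pi / \<sigma> * std_normal_density ((k + (- k + \<sigma> * z)) / \<sigma>)))
        = (LINT z|lborel. complex_of_real (2 * pi / \<sigma>) * (cnj (a (k - \<sigma> * z)) * complex_of_real (std_normal_density z)))"
        using \<sigma> by (intro Bochner_Integration.integral_cong refl) simp
      also have "\<dots> = complex_of_real (2 * pi / \<sigma>) * (LINT z|lborel. cnj (a (k - \<sigma> * z)) * complex_of_real (std_normal_density z))"
        by (rule integral_mult_right_zero)
      finally show ?thesis using \<sigma> by (simp add: scaleR_conv_of_real)
    qed
    finally show "ift (\<lambda>x. cnj (ift a x) * g x) k = 2 * pi * (LINT z|lborel. cnj (a (k - \<sigma> * z)) * complex_of_real (std_normal_density z))" .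
  qed
  also have "\<dots> = 2 * pi * (LINT k|lborel. a k * (LINT z|lborel. cnj (a (k - \<sigma> * z)) * complex_of_real (std_normal_density z)))"
    by (simp flip: integral_mult_right_zero add: mult_ac)
  finally show ?thesis .
qed


lemma ennreal_lincomb:
  assumes "0 \<le> A" "0 \<le> B" "0 \<le> f" "0 \<le> c"
  shows "ennreal c * (ennreal A * ennreal f + ennreal B * ennreal f) = ennreal (c * (A + B) * f)"
proof -
  have "ennreal A * ennreal f + ennreal B * ennreal f = ennreal ((A + B) * f)"
    using assms by (simp add: ennreal_mult distrib_right)
  then show ?thesis using assms by (simp add: ennreal_mult mult.assoc)
qed

text \<open>The regularised identity is bounded uniformly in \<sigma> by x y \<le> (x^2 + y^2) / 2
  and translation invariance; Fatou's lemma for \<sigma> tending to 0 then loses equality but needs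
  no continuity of \<open>a\<close>.\<close>

lemma Plancherel_le:
  assumes a: "integrable lborel a" "L2 a"
  shows "L2 (ift a)" "(L2norm (ift a))\<^sup>2 \<le> 2 * pi * (L2norm a)\<^sup>2"
proof -
  have [measurable]: "a \<in> borel_measurable borel" using a by auto
  define \<sigma> where "\<sigma> n = 1 / real (Suc n)" for n
  have \<sigma>: "\<sigma> n > 0" for n by (simp add: \<sigma>_def)
  have \<sigma>0: "\<sigma> \<longlonglongrightarrow> 0" unfolding \<sigma>_def by (rule LIMSEQ_Suc) (rule lim_1_over_n)
  let ?A = "\<integral>\<^sup>+k. ennreal ((cmod (a k))\<^sup>2) \<partial>lborel"
  have A: "?A = ennreal ((L2norm a)\<^sup>2)" by (rule nn_integral_L2norm[OF a(2)])
  let ?f = "\<lambda>n x. (cmod (ift a x))\<^sup>2 * exp (- (\<sigma> n * x)\<^sup>2 / 2)"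
  let ?\<phi> = std_normal_density
  have \<phi>: "(\<integral>\<^sup>+z. ennreal (?\<phi> z) \<partial>lborel) = 1"
    using nn_integral_eq_integral[OF integrable_normal_density[of 1 0]] integral_normal_density[of 1 0]
    by simp
  have intf: "integrable lborel (?f n)" for n
  proof (rule Bochner_Integration.integrable_bound)
    let ?B = "LINT k|lborel. cmod (a k)"
    show "integrable lborel (\<lambda>x. complex_of_real (?B\<^sup>2) * complex_of_real (sqrt (2 * pi) * std_normal_density (\<sigma> n * x)))"
      using integrable_gauss_scaled[of "\<sigma> n"] \<sigma>[of n] by simp
    show "AE x in lborel. norm (?f n x) \<le> norm (complex_of_real (?B\<^sup>2) * complex_of_real (sqrt (2 * pi) * std_normal_density (\<sigma> n * x)))"
    proof (intro AE_I2)
      fix x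
      have "(cmod (ift a x))\<^sup>2 \<le> ?B\<^sup>2" by (intro power_mono norm_ift_le) simp
      then show "norm (?f n x) \<le> norm (complex_of_real (?B\<^sup>2) * complex_of_real (sqrt (2 * pi) * std_normal_density (\<sigma> n * x)))"
        unfolding gauss_weight by (simp only: norm_mult norm_of_real abs_mult real_norm_def) (intro mult_mono, auto)
    qed
  qed measurable
  have bound: "(\<integral>\<^sup>+x. ennreal (?f n x) \<partial>lborel) \<le> ennreal (2 * pi * (L2norm a)\<^sup>2)" for n
  proof -
    let ?h = "\<lambda>k z. cmod (a k) * cmod (a (k - \<sigma> n * z)) * ?\<phi> z"
    have "(\<integral>\<^sup>+x. ennreal (?f n x) \<partial>lborel) = ennreal (LINT x|lborel. ?f n x)"
      by (rule nn_integral_eq_integral[OF intf]) simp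
    also have "(LINT x|lborel. ?f n x) = cmod (LINT x|lborel. complex_of_real (?f n x))"
    proof -
      have "0 \<le> (LINT x|lborel. ?f n x)" by (intro Bochner_Integration.integral_nonneg) simp
      then show ?thesis by (simp only: integral_complex_of_real norm_of_real abs_of_nonneg)
    qed
    also have "\<dots> = 2 * pi * cmod (LINT k|lborel. a k * (LINT z|lborel. cnj (a (k - \<sigma> n * z)) * complex_of_real (?\<phi> z)))"
      unfolding gauss_regularised_Plancherel[OF a(1) \<sigma>[of n]] by (simp add: norm_mult)
    also have "ennreal \<dots> \<le> ennreal (2 * pi) * (\<integral>\<^sup>+k. \<integral>\<^sup>+z. ennreal (?h k z) \<partial>lborel \<partial>lborel)"
    proof -
      have "ennreal (cmod (LINT k|lborel. a k * (LINT z|lborel. cnj (a (k - \<sigma> n * z)) * complex_of_real (?\<phi> z))))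
        \<le> (\<integral>\<^sup>+k. ennreal (cmod (a k * (LINT z|lborel. cnj (a (k - \<sigma> n * z)) * complex_of_real (?\<phi> z)))) \<partial>lborel)"
        by (rule norm_integral_le_nn_integral) 
      also have "\<dots> \<le> (\<integral>\<^sup>+k. \<integral>\<^sup>+z. ennreal (?h k z) \<partial>lborel \<partial>lborel)"
      proof (intro nn_integral_mono)
        fix k
        have "ennreal (cmod (a k * (LINT z|lborel. cnj (a (k - \<sigma> n * z)) * complex_of_real (?\<phi> z))))
          = ennreal (cmod (a k)) * ennreal (cmod (LINT z|lborel. cnj (a (k - \<sigma> n * z)) * complex_of_real (?\<phi> z)))"
          by (simp add: norm_mult ennreal_mult)
        also have "\<dots> \<le> ennreal (cmod (a k)) * (\<integral>\<^sup>+z. ennreal (cmod (cnj (a (k - \<sigma> n * z)) * complex_of_real (?\<phi> z))) \<partial>lborel)"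
          by (intro mult_left_mono norm_integral_le_nn_integral) auto
        also have "\<dots> = (\<integral>\<^sup>+z. ennreal (?h k z) \<partial>lborel)"
          by (subst nn_integral_cmult[symmetric]) (auto simp: norm_mult ennreal_mult mult.assoc)
        finally show "ennreal (cmod (a k * (LINT z|lborel. cnj (a (k - \<sigma> n * z)) * complex_of_real (?\<phi> z)))) \<le> (\<integral>\<^sup>+z. ennreal (?h k z) \<partial>lborel)" .
      qed
      finally show ?thesis by (simp add: ennreal_mult mult_left_mono)
    qed
    also have "(\<integral>\<^sup>+k. \<integral>\<^sup>+z. ennreal (?h k z) \<partial>lborel \<partial>lborel)
      \<le> (\<integral>\<^sup>+k. \<integral>\<^sup>+z. ennreal (1/2) * (ennreal ((cmod (a k))\<^sup>2) * ennreal (?\<phi> z) + ennreal ((cmod (a (k - \<sigma> n * z)))\<^sup>2) * ennreal (?\<phi> z)) \<partial>lborel \<partial>lborel)"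
    proof (intro nn_integral_mono)
      fix k z
      have "cmod (a k) * cmod (a (k - \<sigma> n * z)) \<le> 1/2 * ((cmod (a k))\<^sup>2 + (cmod (a (k - \<sigma> n * z)))\<^sup>2)"
        using zero_le_power2[of "cmod (a k) - cmod (a (k - \<sigma> n * z))"] by (simp add: power2_diff)
      then have "?h k z \<le> 1/2 * ((cmod (a k))\<^sup>2 + (cmod (a (k - \<sigma> n * z)))\<^sup>2) * ?\<phi> z"
        by (intro mult_right_mono) auto
      then show "ennreal (?h k z) \<le> ennreal (1/2) * (ennreal ((cmod (a k))\<^sup>2) * ennreal (?\<phi> z) + ennreal ((cmod (a (k - \<sigma> n * z)))\<^sup>2) * ennreal (?\<phi> z))"
        by (subst ennreal_lincomb) (auto intro: ennreal_leI)
    qed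
    also have "\<dots> = ennreal (1/2) * ((\<integral>\<^sup>+k. \<integral>\<^sup>+z. ennreal ((cmod (a k))\<^sup>2) * ennreal (?\<phi> z) \<partial>lborel \<partial>lborel)
        + (\<integral>\<^sup>+k. \<integral>\<^sup>+z. ennreal ((cmod (a (k - \<sigma> n * z)))\<^sup>2) * ennreal (?\<phi> z) \<partial>lborel \<partial>lborel))"
      by (simp add: nn_integral_cmult nn_integral_add)
    also have "(\<integral>\<^sup>+k. \<integral>\<^sup>+z. ennreal ((cmod (a k))\<^sup>2) * ennreal (?\<phi> z) \<partial>lborel \<partial>lborel) = ?A"
      by (simp add: nn_integral_cmult \<phi>)
    also have "(\<integral>\<^sup>+k. \<integral>\<^sup>+z. ennreal ((cmod (a (k - \<sigma> n * z)))\<^sup>2) * ennreal (?\<phi> z) \<partial>lborel \<partial>lborel)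
       = (\<integral>\<^sup>+z. \<integral>\<^sup>+k. ennreal ((cmod (a (k - \<sigma> n * z)))\<^sup>2) * ennreal (?\<phi> z) \<partial>lborel \<partial>lborel)"
      by (rule lborel_pair.Fubini') measurable
    also have "\<dots> = (\<integral>\<^sup>+z. ?A * ennreal (?\<phi> z) \<partial>lborel)"
    proof (intro nn_integral_cong)
      fix z
      have "(\<integral>\<^sup>+k. ennreal ((cmod (a (- (\<sigma> n * z) + 1 * k)))\<^sup>2) \<partial>lborel) = ?A"
        using nn_integral_real_affine[of "\<lambda>k. ennreal ((cmod (a k))\<^sup>2)" 1 "- (\<sigma> n * z)"] by simp
      then show "(\<integral>\<^sup>+k. ennreal ((cmod (a (k - \<sigma> n * z)))\<^sup>2) * ennreal (?\<phi> z) \<partial>lborel) = ?A * ennreal (?\<phi> z)"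
        by (simp add: nn_integral_multc)
    qed
    also have "\<dots> = ?A" by (simp add: nn_integral_cmult \<phi>)
    also have "ennreal (2 * pi) * (ennreal (1/2) * (?A + ?A)) = ennreal (2 * pi * (L2norm a)\<^sup>2)"
      unfolding A using ennreal_lincomb[of "(L2norm a)\<^sup>2" "(L2norm a)\<^sup>2" 1 "1/2"]
      by (simp add: ennreal_mult)
    finally show ?thesis by (simp add: mult_left_mono)
  qed
  have "(\<integral>\<^sup>+x. ennreal ((cmod (ift a x))\<^sup>2) \<partial>lborel) = (\<integral>\<^sup>+x. liminf (\<lambda>n. ennreal (?f n x)) \<partial>lborel)"
  proof (intro nn_integral_cong)
    fix x
    have "(\<lambda>n. ?f n x) \<longlonglongrightarrow> (cmod (ift a x))\<^sup>2 * exp (- (0 * x)\<^sup>2 / 2)"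
      by (intro tendsto_intros \<sigma>0) auto
    then have "(\<lambda>n. ennreal (?f n x)) \<longlonglongrightarrow> ennreal ((cmod (ift a x))\<^sup>2)"
      by (intro tendsto_ennrealI) simp
    then show "ennreal ((cmod (ift a x))\<^sup>2) = liminf (\<lambda>n. ennreal (?f n x))"
      by (rule lim_imp_Liminf[OF trivial_limit_sequentially, symmetric])
  qed
  also have "\<dots> \<le> liminf (\<lambda>n. \<integral>\<^sup>+x. ennreal (?f n x) \<partial>lborel)"
    by (rule nn_integral_liminf) measurable
  also have "\<dots> \<le> liminf (\<lambda>n::nat. ennreal (2 * pi * (L2norm a)\<^sup>2))"
    by (intro Liminf_mono always_eventually allI bound)
  also have "\<dots> = ennreal ((sqrt (2 * pi) * L2norm a)\<^sup>2)"
    by (simp add: Liminf_const power_mult_distrib)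
  finally have le: "(\<integral>\<^sup>+x. ennreal ((cmod (ift a x))\<^sup>2) \<partial>lborel) \<le> ennreal ((sqrt (2 * pi) * L2norm a)\<^sup>2)" .
  have m: "ift a \<in> borel_measurable lborel" and nn: "0 \<le> sqrt (2 * pi) * L2norm a" by simp_all
  show "L2 (ift a)" by (rule L2_of_nn_integral_le(1)[OF m nn le])
  have "(L2norm (ift a))\<^sup>2 \<le> (sqrt (2 * pi) * L2norm a)\<^sup>2"
    by (rule power_mono[OF L2_of_nn_integral_le(2)[OF m nn le] L2norm_nonneg])
  then show "(L2norm (ift a))\<^sup>2 \<le> 2 * pi * (L2norm a)\<^sup>2"
    by (simp add: power_mult_distrib)
qed

lemma L2norm_ift_le:
  assumes a: "integrable lborel a" "L2 a"
  shows "L2norm (ift a) \<le> sqrt (2 * pi) * L2norm a"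
proof (rule power2_le_imp_le)
  show "(L2norm (ift a))\<^sup>2 \<le> (sqrt (2 * pi) * L2norm a)\<^sup>2"
    using Plancherel_le(2)[OF a] by (simp add: power_mult_distrib)
qed simp

lemma L2_of_bounded_integrable:
  assumes "integrable lborel a" "\<And>k. cmod (a k) \<le> B"
  shows "L2 a" "(L2norm a)\<^sup>2 \<le> B * (LINT k|lborel. cmod (a k))"
proof -
  have *: "(cmod (a k))\<^sup>2 \<le> B * cmod (a k)" for k
    using assms(2)[of k] by (simp add: power2_eq_square mult_right_mono)
  have int: "integrable lborel (\<lambda>k. B * cmod (a k))" using assms by auto
  show "L2 a"
    unfolding L2_def using assms order_trans[OF * abs_ge_self]
    by (auto intro!: Bochner_Integration.integrable_bound[OF int])
  then show "(L2norm a)\<^sup>2 \<le> B * (LINT k|lborel. cmod (a k))"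
    unfolding L2norm_square using int * by (subst integral_mult_right_zero[symmetric], intro integral_mono) (auto simp: L2_def)
qed

text \<open>Continuity makes the Gaussian averages of \<open>a\<close> converge pointwise, so the
  regularised identity passes to the limit by dominated convergence. Equality matters in
  \<open>FT2_ift\<close>, where the norms of \<open>a\<close> and \<open>ift a\<close> have to
  cancel.\<close>

lemma Plancherel_continuous:
  assumes a: "integrable lborel a" and cont: "continuous_on UNIV a" and B: "\<And>k. cmod (a k) \<le> B"
  shows "(L2norm (ift a))\<^sup>2 = 2 * pi * (L2norm a)\<^sup>2"
proof -
  have [measurable]: "a \<in> borel_measurable borel" using a by auto
  have a2: "L2 a" by (rule L2_of_bounded_integrable[OF a B])
  define \<sigma> where "\<sigma> n = 1 / real (Suc n)" for n
  have \<sigma>: "\<sigma> n > 0" for n by (simp add: \<sigma>_def)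
  have \<sigma>0: "\<sigma> \<longlonglongrightarrow> 0" unfolding \<sigma>_def by (rule LIMSEQ_Suc) (rule lim_1_over_n)
  have L2i: "integrable lborel (\<lambda>x. (cmod (ift a x))\<^sup>2)"
    using Plancherel_le(1)[OF a a2] by (simp add: L2_def)
  let ?\<phi> = std_normal_density
  have 1: "(\<lambda>n. LINT x|lborel. complex_of_real ((cmod (ift a x))\<^sup>2 * exp (- (\<sigma> n * x)\<^sup>2 / 2)))
     \<longlonglongrightarrow> (LINT x|lborel. complex_of_real ((cmod (ift a x))\<^sup>2))"
  proof (rule integral_dominated_convergence[where w="\<lambda>x. (cmod (ift a x))\<^sup>2"])
    show "AE x in lborel. (\<lambda>n. complex_of_real ((cmod (ift a x))\<^sup>2 * exp (- (\<sigma> n * x)\<^sup>2 / 2))) \<longlonglongrightarrow> complex_of_real ((cmod (ift a x))\<^sup>2)"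
    proof (intro AE_I2)
      fix x
      have "(\<lambda>n. complex_of_real ((cmod (ift a x))\<^sup>2 * exp (- (\<sigma> n * x)\<^sup>2 / 2))) \<longlonglongrightarrow> complex_of_real ((cmod (ift a x))\<^sup>2 * exp (- (0 * x)\<^sup>2 / 2))"
        by (intro tendsto_intros \<sigma>0) auto
      then show "(\<lambda>n. complex_of_real ((cmod (ift a x))\<^sup>2 * exp (- (\<sigma> n * x)\<^sup>2 / 2))) \<longlonglongrightarrow> complex_of_real ((cmod (ift a x))\<^sup>2)"
        by simp
    qed
    show "AE x in lborel. norm (complex_of_real ((cmod (ift a x))\<^sup>2 * exp (- (\<sigma> n * x)\<^sup>2 / 2))) \<le> (cmod (ift a x))\<^sup>2" for n
      by (intro AE_I2) (auto simp: norm_mult norm_power mult_left_le)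
  qed (use L2i in auto)
  have B0: "0 \<le> B" using B[of 0] norm_ge_zero order_trans by blast
  have inner: "(\<lambda>n. LINT z|lborel. cnj (a (k - \<sigma> n * z)) * complex_of_real (?\<phi> z)) \<longlonglongrightarrow> cnj (a k)" for k
  proof -
    have "(\<lambda>n. LINT z|lborel. cnj (a (k - \<sigma> n * z)) * complex_of_real (?\<phi> z)) \<longlonglongrightarrow> (LINT z|lborel. cnj (a k) * complex_of_real (?\<phi> z))"
    proof (rule integral_dominated_convergence[where w="\<lambda>z. B * ?\<phi> z"])
      show "AE z in lborel. (\<lambda>n. cnj (a (k - \<sigma> n * z)) * complex_of_real (?\<phi> z)) \<longlonglongrightarrow> cnj (a k) * complex_of_real (?\<phi> z)"
      proof (intro AE_I2 tendsto_intros)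
        fix z
        have "isCont a k" using cont by (simp add: continuous_on_eq_continuous_at)
        moreover have "(\<lambda>n. k - \<sigma> n * z) \<longlonglongrightarrow> k - 0 * z" by (intro tendsto_intros \<sigma>0)
        ultimately show "(\<lambda>n. a (k - \<sigma> n * z)) \<longlonglongrightarrow> a k" by (auto intro: isCont_tendsto_compose)
      qed
    qed (use B in \<open>auto simp: norm_mult intro!: mult_right_mono\<close>)
    then show ?thesis by (simp add: integral_std_normal)
  qed
  have bnd: "cmod (LINT z|lborel. cnj (a (k - \<sigma> n * z)) * complex_of_real (?\<phi> z)) \<le> B" for k n
  proof -
    have "cmod (LINT z|lborel. cnj (a (k - \<sigma> n * z)) * complex_of_real (?\<phi> z)) \<le> (LINT z|lborel. cmod (cnj (a (k - \<sigma> n * z)) * complex_of_real (?\<phi> z)))"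
      by (rule integral_norm_bound)
    also have "\<dots> \<le> (LINT z|lborel. B * ?\<phi> z)"
    proof (rule integral_mono)
      show "integrable lborel (\<lambda>z. cmod (cnj (a (k - \<sigma> n * z)) * complex_of_real (?\<phi> z)))"
        using integrable_bounded_mult[OF integrable_std_normal, of "\<lambda>z. cnj (a (k - \<sigma> n * z))" B] B by auto
    qed (use B in \<open>auto simp: norm_mult intro!: mult_right_mono\<close>)
    also have "\<dots> = B" using integral_normal_density[of 1 0] by simp
    finally show ?thesis .
  qed
  have 2: "(\<lambda>n. LINT k|lborel. a k * (LINT z|lborel. cnj (a (k - \<sigma> n * z)) * complex_of_real (?\<phi> z)))
     \<longlonglongrightarrow> (LINT k|lborel. a k * cnj (a k))"
  proof (rule integral_dominated_convergence[where w="\<lambda>k. B * cmod (a k)"])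
    show "AE k in lborel. (\<lambda>n. a k * (LINT z|lborel. cnj (a (k - \<sigma> n * z)) * complex_of_real (?\<phi> z))) \<longlonglongrightarrow> a k * cnj (a k)"
      by (intro AE_I2 tendsto_intros inner)
    show "AE k in lborel. norm (a k * (LINT z|lborel. cnj (a (k - \<sigma> n * z)) * complex_of_real (?\<phi> z))) \<le> B * cmod (a k)" for n
      using bnd by (auto simp: norm_mult mult.commute[of B] intro!: mult_left_mono)
  qed (use a in auto)
  have "(LINT x|lborel. complex_of_real ((cmod (ift a x))\<^sup>2)) = 2 * pi * (LINT k|lborel. a k * cnj (a k))"
  proof (rule LIMSEQ_unique[OF 1])
    show "(\<lambda>n. LINT x|lborel. complex_of_real ((cmod (ift a x))\<^sup>2 * exp (- (\<sigma> n * x)\<^sup>2 / 2)))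
      \<longlonglongrightarrow> 2 * pi * (LINT k|lborel. a k * cnj (a k))"
      unfolding gauss_regularised_Plancherel[OF a \<sigma>] by (intro tendsto_intros 2)
  qed
  also have "(LINT k|lborel. a k * cnj (a k)) = (LINT k|lborel. complex_of_real ((cmod (a k))\<^sup>2))"
    by (simp only: complex_norm_square)
  finally have "complex_of_real ((L2norm (ift a))\<^sup>2) = complex_of_real (2 * pi * (L2norm a)\<^sup>2)"
    unfolding L2norm_square by (simp only: integral_complex_of_real of_real_mult of_real_numeral)
  then show ?thesis using of_real_eq_iff by blast
qed

text \<open>With \<open>u = ift a\<close> and \<open>b\<^sub>n\<close> the Fourier transform of \<open>u\<close> truncated to \<open>[-n, n]\<close>, expanding the
  square gives \<open>\<parallel>2\<pi>a - b\<^sub>n\<parallel>\<^sup>2 \<le> 2\<pi>(\<parallel>u\<parallel>\<^sup>2 - \<parallel>u 1\<^bsub>[-n,n]\<^esub>\<parallel>\<^sup>2)\<close>.\<close>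

lemma FT2_ift:
  fixes a :: "real \<Rightarrow> complex"
  assumes a: "integrable lborel a" and cont: "continuous_on UNIV a" and B: "\<And>k. cmod (a k) \<le> B"
  shows "FT2 (ift a) (\<lambda>k. 2 * pi * a k)"
proof -
  have [measurable]: "a \<in> borel_measurable borel" using a by auto
  have a2: "L2 a" by (rule L2_of_bounded_integrable[OF a B])
  define u where "u = ift a"
  have u2: "L2 u" unfolding u_def by (rule Plancherel_le[OF a a2])
  have [measurable]: "u \<in> borel_measurable borel" unfolding u_def by measurable
  \<comment> \<open>The interval is open to match \<open>LBINT x=- real n..real n\<close> in
    \<open>FT2\<close>, which integrates over \<open>einterval\<close>.\<close>
  define un where "un n x = indicator {- real n<..<real n} x *\<^sub>R u x" for n x
  have [measurable]: "un n \<in> borel_measurable borel" for n unfolding un_def by measurable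
  have unb: "cmod (un n x) \<le> indicator {- real n..real n} x * (LINT k|lborel. cmod (a k))" for n x
    using norm_ift_le[of a x] by (auto simp: un_def u_def indicator_def)
  have un1: "integrable lborel (un n)" for n
    by (rule Bochner_Integration.integrable_bound[where f="\<lambda>x. indicator {- real n..real n} x * (LINT k|lborel. cmod (a k))"])
      (use unb in \<open>auto intro: order_trans[OF _ abs_ge_self]\<close>)
  have un2: "L2 (un n)" for n
    by (rule L2_of_bounded_integrable[OF un1, of _ "LINT k|lborel. cmod (a k)"])
       (auto simp: un_def u_def indicator_def norm_ift_le)
  \<comment> \<open>The forward transform of the truncation is \<open>ift\<close> at the reflected
    frequency, so the upper Plancherel bound applies to it as well.\<close>
  define b where "b n k = ift (un n) (- k)" for n k
  have [measurable]: "b n \<in> borel_measurable borel" for n unfolding b_def by measurable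
  have bn: "L2norm (b n) = L2norm (ift (un n))" "L2 (b n)" for n
  proof -
    have iu: "L2 (ift (un n))" by (rule Plancherel_le[OF un1 un2])
    have "(\<integral>\<^sup>+x. ennreal ((cmod (b n x))\<^sup>2) \<partial>lborel) = (\<integral>\<^sup>+x. ennreal ((cmod (ift (un n) (0 + (-1) * x)))\<^sup>2) \<partial>lborel)"
      by (simp add: b_def)
    also have "\<dots> = (\<integral>\<^sup>+x. ennreal ((cmod (ift (un n) x))\<^sup>2) \<partial>lborel)"
      using nn_integral_real_affine[of "\<lambda>x. ennreal ((cmod (ift (un n) x))\<^sup>2)" "-1" 0] by simp
    finally have *: "(\<integral>\<^sup>+x. ennreal ((cmod (b n x))\<^sup>2) \<partial>lborel) = (\<integral>\<^sup>+x. ennreal ((cmod (ift (un n) x))\<^sup>2) \<partial>lborel)" .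
    show b2: "L2 (b n)" using * iu by (simp add: L2_iff_nn_integral)
    have "(L2norm (b n))\<^sup>2 = (L2norm (ift (un n)))\<^sup>2"
      using * by (simp add: nn_integral_L2norm b2 iu)
    then show "L2norm (b n) = L2norm (ift (un n))" by simp
  qed
  have ble: "(L2norm (b n))\<^sup>2 \<le> 2 * pi * (L2norm (un n))\<^sup>2" for n
    unfolding bn(1) by (rule Plancherel_le[OF un1 un2])
  \<comment> \<open>The cross term is real: the multiplication formula moves the transform from
    \<open>un n\<close> to \<open>a\<close>, and on the support of \<open>un n\<close> the functions
    \<open>u\<close> and \<open>un n\<close> coincide.\<close>
  have inner: "(LINT k|lborel. a k * cnj (b n k)) = complex_of_real ((L2norm (un n))\<^sup>2)" for n
  proof -
    have cun: "integrable lborel (\<lambda>x. cnj (un n x))" using un1 by auto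
    have "cnj (b n k) = ift (\<lambda>x. cnj (un n x)) k" for k
      unfolding b_def ift_def by (subst Bochner_Integration.integral_cnj[symmetric]) (simp add: exp_cnj)
    then have "(LINT k|lborel. a k * cnj (b n k)) = (LINT x|lborel. cnj (un n x) * u x)"
      unfolding u_def by (simp add: ift_multiplication_formula[OF a cun])
    also have "\<dots> = (LINT x|lborel. complex_of_real ((cmod (un n x))\<^sup>2))"
    proof (rule Bochner_Integration.integral_cong[OF refl])
      fix x
      have "cnj (un n x) * u x = cnj (un n x) * un n x" by (auto simp: un_def indicator_def)
      then show "cnj (un n x) * u x = complex_of_real ((cmod (un n x))\<^sup>2)"
        by (simp only: complex_norm_square mult.commute)
    qed
    finally show ?thesis unfolding L2norm_square by (simp only: integral_complex_of_real)
  qed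
  have main: "(LINT k|lborel. (cmod (2 * pi * a k - b n k))\<^sup>2) \<le> 2 * pi * ((L2norm u)\<^sup>2 - (L2norm (un n))\<^sup>2)" for n
  proof -
    have i1: "integrable lborel (\<lambda>k. (cmod (a k))\<^sup>2)" using a2 by (simp add: L2_def)
    have i2: "integrable lborel (\<lambda>k. (cmod (b n k))\<^sup>2)" using bn(2) by (simp add: L2_def)
    have "L2 (\<lambda>k. cnj (b n k))" using bn(2)[of n] by (auto simp: L2_def)
    then have i3: "integrable lborel (\<lambda>k. a k * cnj (b n k))" by (intro integrable_L2_mult a2)
    have "(LINT k|lborel. (cmod (2 * pi * a k - b n k))\<^sup>2)
      = (LINT k|lborel. 4 * pi\<^sup>2 * (cmod (a k))\<^sup>2 - 4 * pi * Re (a k * cnj (b n k)) + (cmod (b n k))\<^sup>2)"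
      by (intro Bochner_Integration.integral_cong refl)
         (simp only: cmod_power2, simp add: power2_eq_square algebra_simps)
    also have "\<dots> = 4 * pi\<^sup>2 * (L2norm a)\<^sup>2 - 4 * pi * Re (LINT k|lborel. a k * cnj (b n k)) + (L2norm (b n))\<^sup>2"
      using i1 i2 i3 integral_Re[OF i3] integrable_Re[OF i3] unfolding L2norm_square
      by (simp del: times_complex.simps)
    also have "\<dots> \<le> 4 * pi\<^sup>2 * (L2norm a)\<^sup>2 - 4 * pi * (L2norm (un n))\<^sup>2 + 2 * pi * (L2norm (un n))\<^sup>2"
      using ble[of n] unfolding inner by simp
    also have "\<dots> = 2 * pi * ((L2norm u)\<^sup>2 - (L2norm (un n))\<^sup>2)"
      using Plancherel_continuous[OF a cont B] unfolding u_def by (simp add: power2_eq_square algebra_simps)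
    finally show ?thesis .
  qed
  have "(\<lambda>n. LINT x|lborel. (cmod (un n x))\<^sup>2) \<longlonglongrightarrow> (LINT x|lborel. (cmod (u x))\<^sup>2)"
  proof (rule integral_dominated_convergence[where w="\<lambda>x. (cmod (u x))\<^sup>2"])
    show "AE x in lborel. (\<lambda>n. (cmod (un n x))\<^sup>2) \<longlonglongrightarrow> (cmod (u x))\<^sup>2"
    proof (intro AE_I2 tendsto_eventually)
      fix x :: real
      obtain m where "\<bar>x\<bar> < real m" using reals_Archimedean2 by blast
      then show "\<forall>\<^sub>F n in sequentially. (cmod (un n x))\<^sup>2 = (cmod (u x))\<^sup>2"
        by (intro eventually_sequentiallyI[of m]) (auto simp: un_def indicator_def)
    qed
  qed (use u2 in \<open>auto simp: L2_def un_def indicator_def\<close>)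
  then have "(\<lambda>n. 2 * pi * ((L2norm u)\<^sup>2 - (L2norm (un n))\<^sup>2)) \<longlonglongrightarrow> 2 * pi * ((L2norm u)\<^sup>2 - (L2norm u)\<^sup>2)"
    unfolding L2norm_square by (intro tendsto_intros)
  then have lim: "(\<lambda>n. 2 * pi * ((L2norm u)\<^sup>2 - (L2norm (un n))\<^sup>2)) \<longlonglongrightarrow> 0" by simp
  have "0 \<le> (LINT k|lborel. (cmod (2 * pi * a k - b n k))\<^sup>2)" for n by simp
  then have "(\<lambda>n. LINT k|lborel. (cmod (2 * pi * a k - b n k))\<^sup>2) \<longlonglongrightarrow> 0"
    using main by (intro tendsto_sandwich[OF always_eventually always_eventually tendsto_const lim]) blast+
  moreover have "b n k = (LBINT x=- real n..real n. exp (- \<i> * complex_of_real (k * x)) * u x)" for n k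
    unfolding b_def ift_def un_def interval_lebesgue_integral_def set_lebesgue_integral_def
    by (auto simp: einterval_eq mult_ac intro!: Bochner_Integration.integral_cong)
  ultimately show ?thesis
    unfolding FT2_def using u2 a2 L2_scale[OF a2, of "2 * pi"] by (simp add: u_def)
qed

subsection \<open>Comparison of the semigroup with an approximate solution\<close>

locale generated_semigroup =
  fixes T :: "real \<Rightarrow> (real \<Rightarrow> complex) \<Rightarrow> real \<Rightarrow> complex" and \<alpha> :: complex and p :: nat
    and V :: "real \<Rightarrow> complex"
  assumes T: "C0_generated T \<alpha> p V"
begin

lemma T_L2 [simp, intro]: "0 \<le> s \<Longrightarrow> L2 u \<Longrightarrow> L2 (T s u)"
  using T by (simp add: C0_generated_def)

lemma T_lincomb: "0 \<le> s \<Longrightarrow> L2 u \<Longrightarrow> L2 w \<Longrightarrow> AE x in lborel. T s (\<lambda>y. a * u y + b * w y) x = a * T s u x + b * T s w x"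
  using T by (simp add: C0_generated_def)

lemma T_bound: "0 \<le> s \<Longrightarrow> \<exists>C. \<forall>u. L2 u \<longrightarrow> L2norm (T s u) \<le> C * L2norm u"
  using T by (simp add: C0_generated_def)

lemma T_zero: "L2 u \<Longrightarrow> AE x in lborel. T 0 u x = u x"
  using T by (simp add: C0_generated_def)

lemma T_plus: "0 \<le> s \<Longrightarrow> 0 \<le> r \<Longrightarrow> L2 u \<Longrightarrow> AE x in lborel. T (s + r) u x = T s (T r u) x"
  using T by (simp add: C0_generated_def)

lemma T_continuous: "L2 u \<Longrightarrow> ((\<lambda>h. L2norm (\<lambda>x. T h u x - u x)) \<longlongrightarrow> 0) (at_right 0)"
  using T by (simp add: C0_generated_def)

lemma T_generator: "A_rel \<alpha> p u v \<Longrightarrow>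
    ((\<lambda>h. L2norm (\<lambda>x. (T h u x - u x) / complex_of_real h - (v x + V x * u x))) \<longlongrightarrow> 0) (at_right 0)"
  using T by (simp add: C0_generated_def)

text \<open>The algebraic laws of \<open>T\<close> hold only almost everywhere. This lemma and the
  next two transfer them to norms, where the choice of representative is invisible.\<close>

lemma L2norm_T_diff:
  assumes "0 \<le> s" "L2 u" "L2 w"
  shows "L2norm (\<lambda>x. T s u x - T s w x) = L2norm (T s (\<lambda>x. u x - w x))"
  using assms T_lincomb[OF assms, of 1 "-1"] by (intro L2norm_cong_AE) (auto simp: L2_diff)

lemma L2norm_T_scale:
  assumes "0 \<le> s" "L2 u"
  shows "L2norm (T s (\<lambda>x. c * u x)) = cmod c * L2norm (T s u)"
proof -
  have "L2norm (T s (\<lambda>x. c * u x)) = L2norm (\<lambda>x. c * T s u x)"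
    using T_lincomb[OF assms assms(2), of c 0] assms by (intro L2norm_cong_AE) (auto simp: L2_scale)
  then show ?thesis by (simp add: L2norm_scale)
qed

lemma L2norm_T_plus:
  assumes "0 \<le> s" "0 \<le> r" "L2 u"
  shows "L2norm (T (s + r) u) = L2norm (T s (T r u))"
  using assms T_plus[OF assms] by (intro L2norm_cong_AE) auto

text \<open>Each single \<open>T s\<close> is bounded, so its operator norm \<open>S\<close> is
  finite and some \<open>f\<close> in the unit ball attains more than 2/3 of it. From then on the
  norm of \<open>T s f\<close> can stand in for the operator norm, at the cost of the factor
  3/2.\<close>

lemma T_near_maximiser:
  assumes s: "0 \<le> s" and u: "L2 u" "L2norm (T s u) > K * L2norm u" and K: "K > 0"
  shows "\<exists>f. L2 f \<and> L2norm f \<le> 1 \<and> L2norm (T s f) \<ge> 2 / 3 * K \<and>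
    (\<forall>g. L2 g \<longrightarrow> L2norm (T s g) \<le> 3 / 2 * L2norm (T s f) * L2norm g)"
proof -
  obtain C where C: "\<And>u. L2 u \<Longrightarrow> L2norm (T s u) \<le> C * L2norm u" using T_bound[OF s] by auto
  define S where "S = (SUP f\<in>{f. L2 f \<and> L2norm f \<le> 1}. L2norm (T s f))"
  have bdd: "bdd_above ((\<lambda>f. L2norm (T s f)) ` {f. L2 f \<and> L2norm f \<le> 1})"
  proof (rule bdd_aboveI2)
    fix f assume "f \<in> {f. L2 f \<and> L2norm f \<le> 1}"
    then have "L2norm (T s f) \<le> C * L2norm f" "L2norm f \<le> 1" using C by auto
    then show "L2norm (T s f) \<le> \<bar>C\<bar>"
      using L2norm_nonneg[of f] by (metis abs_ge_self abs_ge_zero mult_left_le mult_right_mono order_trans)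
  qed
  have le_S: "L2norm (T s g) \<le> S * L2norm g" if g: "L2 g" for g
  proof (cases "L2norm g = 0")
    case True then show ?thesis using C[OF g] by simp
  next
    case False
    define c where "c = complex_of_real (1 / L2norm g)"
    have c: "cmod c = 1 / L2norm g" by (simp add: c_def norm_divide)
    have "L2norm (T s (\<lambda>x. c * g x)) \<le> S"
      unfolding S_def by (rule cSUP_upper[OF _ bdd]) (use False g c in \<open>auto simp: L2_scale L2norm_scale\<close>)
    then show ?thesis
      using False c by (simp add: L2norm_T_scale[OF s g] field_simps less_le)
  qed
  have KS: "K < S"
  proof -
    have "K * L2norm u < S * L2norm u" using le_S[OF u(1)] u(2) by simp
    then show ?thesis using L2norm_nonneg[of u] by (simp add: mult_less_cancel_right)
  qed
  have "2 / 3 * S < S" using KS K by simp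
  then obtain f where f: "L2 f" "L2norm f \<le> 1" "2 / 3 * S < L2norm (T s f)"
    unfolding S_def using less_cSUP_iff[OF _ bdd] L2_0 L2norm_0 by (metis (mono_tags, lifting) empty_iff mem_Collect_eq zero_le_one)
  show ?thesis
  proof (intro exI[of _ f] conjI allI impI)
    show "L2norm (T s f) \<ge> 2 / 3 * K" using f(3) KS by simp
    fix g assume g: "L2 g"
    have "S * L2norm g \<le> 3 / 2 * L2norm (T s f) * L2norm g"
      using f(3) by (intro mult_right_mono) auto
    then show "L2norm (T s g) \<le> 3 / 2 * L2norm (T s f) * L2norm g"
      using le_S[OF g] by simp
  qed (use f in auto)
qed

text \<open>Uniform boundedness near \<open>0\<close>, by Sokal's gliding-sum argument: adding or subtracting
  \<open>3\<^sup>-\<^sup>n f\<^sub>n\<close> one can keep \<open>\<parallel>T (s n) x\<parallel>\<close> comparable to \<open>3\<^sup>-\<^sup>n \<parallel>T (s n)\<parallel>\<close>.\<close>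

lemma T_bounded_near_0:
  "\<exists>\<delta>>0. \<exists>K. \<forall>s\<in>{0..\<delta>}. \<forall>u. L2 u \<longrightarrow> L2norm (T s u) \<le> K * L2norm u"
proof (rule ccontr)
  assume "\<not> ?thesis"
  then have neg: "\<exists>s\<in>{0..\<delta>}. \<exists>u. L2 u \<and> L2norm (T s u) > K * L2norm u" if "\<delta> > 0" for \<delta> K
    using that by (meson not_le)
  \<comment> \<open>The threshold 6 * 4^n is chosen so that one quarter of 3^-n times two thirds of
    it equals (4/3)^n, the growth obtained in \<open>grow\<close>.\<close>
  have "\<exists>s f. s \<in> {0..1 / real (Suc n)} \<and> L2 f \<and> L2norm f \<le> 1 \<and> L2norm (T s f) \<ge> 2 / 3 * (6 * 4 ^ n) \<and>
    (\<forall>g. L2 g \<longrightarrow> L2norm (T s g) \<le> 3 / 2 * L2norm (T s f) * L2norm g)" for n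
  proof -
    obtain s u where s: "s \<in> {0..1 / real (Suc n)}" and u: "L2 u" "L2norm (T s u) > (6 * 4 ^ n) * L2norm u"
      using neg[of "1 / real (Suc n)" "6 * 4 ^ n"] by auto
    then show ?thesis using T_near_maximiser[of s u "6 * 4 ^ n"] by auto
  qed
  then obtain s f where s: "\<And>n. s n \<in> {0..1 / real (Suc n)}" and f: "\<And>n. L2 (f n)" "\<And>n. L2norm (f n) \<le> 1"
    and A: "\<And>n. L2norm (T (s n) (f n)) \<ge> 2 / 3 * (6 * 4 ^ n)"
    and max: "\<And>n g. L2 g \<Longrightarrow> L2norm (T (s n) g) \<le> 3 / 2 * L2norm (T (s n) (f n)) * L2norm g"
    by metis
  define e where "e n = (\<lambda>y. complex_of_real ((1/3) ^ n) * f n y)" for n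
  have e: "L2 (e n)" "L2norm (e n) \<le> (1/3) ^ n" "L2norm (T (s n) (e n)) = (1/3) ^ n * L2norm (T (s n) (f n))" for n
    using f(1)[of n] f(2)[of n] s[of n] unfolding e_def
    by (auto simp: L2_scale L2norm_scale L2norm_T_scale norm_power norm_divide mult_left_le)
  define x where "x = rec_nat (\<lambda>_. 0) (\<lambda>n xn. if L2norm (T (s n) (\<lambda>y. xn y + e n y)) \<ge> L2norm (T (s n) (e n))
     then (\<lambda>y. xn y + e n y) else (\<lambda>y. xn y - e n y))"
  have x0: "x 0 = (\<lambda>_. 0)" by (simp add: x_def)
  have xS: "x (Suc n) = (if L2norm (T (s n) (\<lambda>y. x n y + e n y)) \<ge> L2norm (T (s n) (e n))
     then (\<lambda>y. x n y + e n y) else (\<lambda>y. x n y - e n y))" for n by (simp add: x_def)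
  have xL: "L2 (x n)" for n by (induction n) (auto simp: x0 xS e L2_add L2_diff)
  \<comment> \<open>Twice \<open>e n\<close> is the difference of the two candidates
    \<open>x n + e n\<close> and \<open>x n - e n\<close>, so if the first has a smaller image than
    \<open>e n\<close>, the second has a larger one.\<close>
  have big: "L2norm (T (s n) (x (Suc n))) \<ge> L2norm (T (s n) (e n))" for n
  proof (cases "L2norm (T (s n) (\<lambda>y. x n y + e n y)) \<ge> L2norm (T (s n) (e n))")
    case False
    have s0: "0 \<le> s n" using s[of n] by auto
    have "2 * L2norm (T (s n) (e n)) = L2norm (T (s n) (\<lambda>y. 2 * e n y))"
      using L2norm_T_scale[OF s0 e(1), of 2] by simp
    also have "\<dots> = L2norm (\<lambda>y. T (s n) (\<lambda>y. x n y + e n y) y - T (s n) (\<lambda>y. x n y - e n y) y)"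
      by (subst L2norm_T_diff) (auto simp: s0 xL e L2_add L2_diff)
    also have "\<dots> \<le> L2norm (T (s n) (\<lambda>y. x n y + e n y)) + L2norm (T (s n) (\<lambda>y. x n y - e n y))"
      by (rule L2norm_triangle_diff) (auto simp: s0 xL e L2_add L2_diff)
    finally show ?thesis using False by (simp add: xS)
  qed (simp add: xS)
  define d where "d n y = x (Suc n) y - x n y" for n y
  have dL: "L2 (d n)" for n unfolding d_def by (intro L2_diff xL)
  have dn: "L2norm (d n) \<le> (1/3) ^ n" for n
    using e(2)[of n] L2norm_scale[of "-1" "e n"] unfolding d_def xS by (auto split: if_splits)
  have sumd: "summable (\<lambda>n. L2norm (d n))"
    by (rule summable_comparison_test'[OF summable_geometric[of "1/3::real"]]) (use dn in auto)
  obtain X where X: "L2 X" "\<And>N. L2norm (\<lambda>y. X y - (\<Sum>n<N. d n y)) \<le> (\<Sum>n. L2norm (d (n + N)))"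
    using L2_series[OF dL sumd] by blast
  have tele: "(\<Sum>n<N. d n y) = x N y" for N y
    unfolding d_def by (induction N) (auto simp: x0)
  have close: "L2norm (\<lambda>y. X y - x N y) \<le> 3 / 2 * (1/3) ^ N" for N
  proof -
    have "(\<Sum>n. L2norm (d (n + N))) \<le> (\<Sum>n. (1/3::real) ^ N * (1/3) ^ n)"
    proof (rule suminf_le)
      show "L2norm (d (n + N)) \<le> (1/3::real) ^ N * (1/3) ^ n" for n using dn[of "n + N"] by (simp add: power_add mult.commute)
      show "summable (\<lambda>n. L2norm (d (n + N)))" using sumd by (subst summable_iff_shift)
    qed (intro summable_mult summable_geometric, simp)
    also have "\<dots> = (1/3) ^ N * (3 / 2)"
      by (subst suminf_mult) (auto simp: suminf_geometric intro!: summable_geometric)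
    finally show ?thesis using X(2)[of N] by (simp add: tele)
  qed
  \<comment> \<open>The corrections after step n have total norm at most 3^-n / 2. By
    \<open>max\<close> they change the image by at most 3/4 of 3^-n times \<open>?A\<close>, so one
    quarter of the lower bound from \<open>big\<close> survives.\<close>
  have grow: "(4/3) ^ n \<le> L2norm (T (s n) X)" for n
  proof -
    have s0: "0 \<le> s n" using s[of n] by auto
    let ?A = "L2norm (T (s n) (f n))"
    have "L2norm (T (s n) (x (Suc n))) - L2norm (T (s n) X) \<le> L2norm (\<lambda>y. T (s n) (x (Suc n)) y - T (s n) X y)"
      by (rule L2norm_diff_ge) (auto simp: s0 xL X)
    also have "\<dots> = L2norm (T (s n) (\<lambda>y. x (Suc n) y - X y))"
      by (rule L2norm_T_diff) (auto simp: s0 xL X)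
    also have "\<dots> \<le> 3 / 2 * ?A * L2norm (\<lambda>y. x (Suc n) y - X y)"
      by (rule max) (auto simp: xL X L2_diff)
    also have "\<dots> \<le> 3 / 2 * ?A * (3 / 2 * (1/3) ^ Suc n)"
      using close[of "Suc n"] by (intro mult_left_mono) (auto simp: L2norm_minus_commute[of X])
    also have "\<dots> = 3 / 4 * ?A * (1/3) ^ n" by simp
    finally have "(1/3) ^ n * ?A - 3 / 4 * ?A * (1/3) ^ n \<le> L2norm (T (s n) X)"
      using big[of n] e(3)[of n] by linarith
    moreover have "(1/3) ^ n * ?A - 3 / 4 * ?A * (1/3) ^ n = 1 / 4 * (1/3) ^ n * ?A" by simp
    moreover have "1 / 4 * (1/3) ^ n * (2 / 3 * (6 * 4 ^ n)) \<le> 1 / 4 * (1/3) ^ n * ?A"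
      by (intro mult_left_mono A) auto
    moreover have "1 / 4 * (1/3) ^ n * (2 / 3 * (6 * 4 ^ n)) = (4/3::real) ^ n"
      by (simp add: power_divide)
    ultimately show ?thesis by linarith
  qed
  \<comment> \<open>Strong continuity at 0 bounds the norm of \<open>T h X\<close> for small
    \<open>h\<close>; since \<open>s n\<close> tends to 0, this contradicts
    \<open>grow\<close>.\<close>
  have "\<forall>\<^sub>F h in at_right 0. L2norm (\<lambda>y. T h X y - X y) < 1"
    using T_continuous[OF X(1)] by (rule order_tendstoD) simp
  then obtain b where b: "b > 0" "\<And>h. 0 < h \<Longrightarrow> h < b \<Longrightarrow> L2norm (\<lambda>y. T h X y - X y) < 1"
    unfolding eventually_at_right_field by auto
  have bnd: "L2norm (T h X) \<le> L2norm X + 1" if "0 \<le> h" "h < b" for h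
  proof (cases "h = 0")
    case True
    have "L2norm (T 0 X) = L2norm X" by (intro L2norm_cong_AE T_zero X T_L2) auto
    then show ?thesis using True by simp
  next
    case False
    then have "L2norm (T h X) - L2norm X \<le> L2norm (\<lambda>y. T h X y - X y)"
      using that by (intro L2norm_diff_ge X T_L2) auto
    then show ?thesis using b(2)[of h] False that by simp
  qed
  obtain n1 where n1: "1 / real (Suc n1) < b" using b(1) nat_approx_posE by blast
  obtain n2 where n2: "L2norm X + 1 < (4/3) ^ n2" using real_arch_pow[of "4/3" "L2norm X + 1"] by auto
  define n where "n = max n1 n2"
  have "s n \<le> 1 / real (Suc n)" "0 \<le> s n" using s[of n] by auto
  moreover have "1 / real (Suc n) \<le> 1 / real (Suc n1)" by (intro divide_left_mono) (auto simp: n_def)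
  ultimately have "L2norm (T (s n) X) \<le> L2norm X + 1" using n1 by (intro bnd) auto
  moreover have "(4/3::real) ^ n2 \<le> (4/3) ^ n" by (intro power_increasing) (auto simp: n_def)
  ultimately show False using grow[of n] n2 by linarith
qed

lemma T_bounded_on:
  "\<exists>M\<ge>0. \<forall>s\<in>{0..t}. \<forall>u. L2 u \<longrightarrow> L2norm (T s u) \<le> M * L2norm u"
proof -
  obtain \<delta> K0 where \<delta>: "\<delta> > 0" and K0: "\<And>s u. s \<in> {0..\<delta>} \<Longrightarrow> L2 u \<Longrightarrow> L2norm (T s u) \<le> K0 * L2norm u"
    using T_bounded_near_0 by blast
  define K where "K = max 1 K0"
  have K: "L2norm (T s u) \<le> K * L2norm u" if "s \<in> {0..\<delta>}" "L2 u" for s u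
    using K0[OF that] L2norm_nonneg[of u] unfolding K_def
    by (meson max.cobounded2 mult_right_mono order_trans)
  have K1: "1 \<le> K" by (simp add: K_def)
  have step: "\<forall>s\<in>{0..real n * \<delta>}. \<forall>u. L2 u \<longrightarrow> L2norm (T s u) \<le> K ^ Suc n * L2norm u" for n
  proof (induction n)
    case 0
    then show ?case using K[of 0] \<delta> by auto
  next
    case (Suc n)
    show ?case
    proof (intro ballI allI impI)
      fix s u assume s: "s \<in> {0..real (Suc n) * \<delta>}" and u: "L2 u"
      show "L2norm (T s u) \<le> K ^ Suc (Suc n) * L2norm u"
      proof (cases "s \<le> \<delta>")
        case True
        then have "L2norm (T s u) \<le> K * L2norm u" using K s u by auto
        also have "\<dots> \<le> K ^ Suc (Suc n) * L2norm u"
          using K1 by (intro mult_right_mono self_le_power) auto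
        finally show ?thesis .
      next
        case False
        have "L2norm (T s u) = L2norm (T (\<delta> + (s - \<delta>)) u)" by simp
        also have "\<dots> = L2norm (T \<delta> (T (s - \<delta>) u))" using False \<delta> u by (intro L2norm_T_plus) auto
        also have "\<dots> \<le> K * L2norm (T (s - \<delta>) u)" using \<delta> u False by (intro K) auto
        also have "\<dots> \<le> K * (K ^ Suc n * L2norm u)"
          using Suc s u False K1 by (intro mult_left_mono) (auto simp: algebra_simps)
        finally show ?thesis by simp
      qed
    qed
  qed
  obtain n where n: "t / \<delta> \<le> real n" using real_arch_simple by blast
  then have "t \<le> real n * \<delta>" using \<delta> by (simp add: field_simps)
  then show ?thesis using step[of n] K1 by (intro exI[of _ "K ^ Suc n"]) auto
qed

text \<open>If \<open>u\<close> solves \<open>u' = A u + W u\<close> classically then \<open>s \<mapsto> T (t - s) (u s)\<close> is Lipschitz with constant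
  \<open>M sup \<parallel>(W - V) u s\<parallel>\<close>; the bisection principle \<open>Bolzano\<close> passes from local to global estimates.\<close>

lemma perturbation_estimate:
  fixes u v :: "real \<Rightarrow> real \<Rightarrow> complex"
  assumes t: "0 < t"
    and M: "0 \<le> M" "\<And>s u. s \<in> {0..t} \<Longrightarrow> L2 u \<Longrightarrow> L2norm (T s u) \<le> M * L2norm u"
    and A: "\<And>s. s \<in> {0..t} \<Longrightarrow> A_rel \<alpha> p (u s) (v s)"
    and V: "V \<in> borel_measurable lborel" "\<And>x. cmod (V x) \<le> B"
    and W: "W \<in> borel_measurable lborel" "\<And>x. cmod (W x) \<le> B"
    and deriv: "\<And>s. s \<in> {0..t} \<Longrightarrow>
      ((\<lambda>r. L2norm (\<lambda>x. (u r x - u s x) / complex_of_real (r - s) - (v s x + W x * u s x))) \<longlongrightarrow> 0) (at s within {0..t})"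
    and K: "\<And>s. s \<in> {0..t} \<Longrightarrow> L2norm (\<lambda>x. W x * u s x - V x * u s x) \<le> K"
  shows "L2norm (\<lambda>x. T t (u 0) x - u t x) \<le> M * K * t"
proof -
  have uL: "L2 (u s)" and vL: "L2 (v s)" if "s \<in> {0..t}" for s using A[OF that] by (auto simp: A_rel_def)
  have VL: "L2 (\<lambda>x. V x * u s x)" and WL: "L2 (\<lambda>x. W x * u s x)" if "s \<in> {0..t}" for s
    by (rule L2_bounded_mult[OF uL[OF that]], rule V W, rule V W)+
  define \<Psi> where "\<Psi> s = T (t - s) (u s)" for s
  have \<Psi>L: "L2 (\<Psi> s)" if "s \<in> {0..t}" for s unfolding \<Psi>_def using that uL by auto
  \<comment> \<open>Both values of \<open>\<Psi>\<close> are images under the same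
    \<open>T (t - b)\<close>, so the uniform bound \<open>M\<close> reduces the increment to
    comparing \<open>u\<close> with the semigroup over one short interval.\<close>
  have step: "L2norm (\<lambda>x. \<Psi> b x - \<Psi> a x) \<le> M * L2norm (\<lambda>x. u b x - T (b - a) (u a) x)"
    if ab: "0 \<le> a" "a \<le> b" "b \<le> t" for a b
  proof -
    have [simp]: "L2 (u a)" "L2 (u b)" using ab uL by auto
    have "AE x in lborel. T ((t - b) + (b - a)) (u a) x = T (t - b) (T (b - a) (u a)) x"
      using ab by (intro T_plus) auto
    then have "L2norm (\<lambda>x. \<Psi> b x - \<Psi> a x) = L2norm (\<lambda>x. T (t - b) (u b) x - T (t - b) (T (b - a) (u a)) x)"
      using ab unfolding \<Psi>_def by (intro L2norm_cong_AE) (auto intro!: L2_diff)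
    also have "\<dots> = L2norm (T (t - b) (\<lambda>x. u b x - T (b - a) (u a) x))"
      using ab by (intro L2norm_T_diff) auto
    also have "\<dots> \<le> M * L2norm (\<lambda>x. u b x - T (b - a) (u a) x)"
      using ab by (intro M) (auto intro!: L2_diff)
    finally show ?thesis .
  qed
  have right: "\<exists>d>0. \<forall>b. x \<le> b \<and> b - x < d \<and> b \<le> t \<longrightarrow> L2norm (\<lambda>y. \<Psi> b y - \<Psi> x y) \<le> (M * K + \<epsilon>) * (b - x)"
    and left: "\<exists>d>0. \<forall>a. a \<le> x \<and> x - a < d \<and> 0 \<le> a \<longrightarrow> L2norm (\<lambda>y. \<Psi> x y - \<Psi> a y) \<le> (M * K + \<epsilon>) * (x - a)"
    if x: "x \<in> {0..t}" and \<epsilon>: "\<epsilon> > 0" for x \<epsilon>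
  proof -
    \<comment> \<open>Tolerance for all remainders at once: the left-hand estimate is the more
      expensive one and produces \<open>M * (2 * \<eta> + M * \<eta>)\<close>, which this choice
      keeps below \<open>\<epsilon>\<close>.\<close>
    define \<eta> where "\<eta> = \<epsilon> / ((M + 1) * (M + 2))"
    have \<eta>: "\<eta> > 0" using \<epsilon> M(1) by (simp add: \<eta>_def)
    have M\<eta>: "M * (2 * \<eta> + M * \<eta>) \<le> \<epsilon>"
    proof -
      have "M * (2 * \<eta> + M * \<eta>) = M * (M + 2) * \<eta>" by (simp add: algebra_simps)
      also have "\<dots> \<le> (M + 1) * (M + 2) * \<eta>" using M(1) \<eta> by (intro mult_right_mono) auto
      also have "\<dots> = \<epsilon>" using M(1) by (simp add: \<eta>_def)
      finally show ?thesis .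
    qed
    define u' where "u' y = v x y + W y * u x y" for y
    have u'L: "L2 u'" unfolding u'_def using x by (intro L2_add vL WL)
    define D1 where "D1 r y = (u r y - u x y) / complex_of_real (r - x) - u' y" for r y
    define D2 where "D2 h y = (T h (u x) y - u x y) / complex_of_real h - (v x y + V y * u x y)" for h y
    have D1L: "L2 (D1 r)" if "r \<in> {0..t}" for r
    proof -
      have "L2 (\<lambda>y. inverse (complex_of_real (r - x)) * (u r y - u x y))"
        using that x by (intro L2_scale L2_diff uL)
      then show ?thesis unfolding D1_def by (intro L2_diff u'L) (simp only: divide_inverse mult.commute)
    qed
    have D2L: "L2 (D2 h)" if "0 \<le> h" for h
    proof -
      have "L2 (\<lambda>y. inverse (complex_of_real h) * (T h (u x) y - u x y))"
        using that x by (intro L2_scale L2_diff uL T_L2)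
      then show ?thesis unfolding D2_def using x by (intro L2_diff L2_add vL VL) (simp_all only: divide_inverse mult.commute)
    qed
    have "\<forall>\<^sub>F r in at x within {0..t}. L2norm (D1 r) < \<eta>"
      using deriv[OF x] unfolding D1_def u'_def by (rule order_tendstoD) (rule \<eta>)
    then obtain d1 where d1: "d1 > 0" "\<And>r. r \<in> {0..t} \<Longrightarrow> r \<noteq> x \<Longrightarrow> dist r x < d1 \<Longrightarrow> L2norm (D1 r) < \<eta>"
      unfolding eventually_at by blast
    have "\<forall>\<^sub>F h in at_right 0. L2norm (D2 h) < \<eta>"
      using T_generator[OF A[OF x]] unfolding D2_def by (rule order_tendstoD) (rule \<eta>)
    then obtain d2 where d2: "d2 > 0" "\<And>h. 0 < h \<Longrightarrow> h < d2 \<Longrightarrow> L2norm (D2 h) < \<eta>"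
      unfolding eventually_at_right_field by auto
    have "\<forall>\<^sub>F h in at_right 0. L2norm (\<lambda>y. T h u' y - u' y) < \<eta>"
      using T_continuous[OF u'L] by (rule order_tendstoD) (rule \<eta>)
    then obtain d3 where d3: "d3 > 0" "\<And>h. 0 < h \<Longrightarrow> h < d3 \<Longrightarrow> L2norm (\<lambda>y. T h u' y - u' y) < \<eta>"
      unfolding eventually_at_right_field by auto
    have KL: "L2norm (\<lambda>y. V y * u x y - W y * u x y) \<le> K" using K[OF x] by (subst L2norm_minus_commute)
    show "\<exists>d>0. \<forall>b. x \<le> b \<and> b - x < d \<and> b \<le> t \<longrightarrow> L2norm (\<lambda>y. \<Psi> b y - \<Psi> x y) \<le> (M * K + \<epsilon>) * (b - x)"
    proof (intro exI[of _ "min d1 d2"] conjI allI impI)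
      fix b assume b: "x \<le> b \<and> b - x < min d1 d2 \<and> b \<le> t"
      show "L2norm (\<lambda>y. \<Psi> b y - \<Psi> x y) \<le> (M * K + \<epsilon>) * (b - x)"
      proof (cases "b = x")
        case False
        define h where "h = b - x"
        have h: "0 < h" "h < d1" "h < d2" using b False by (auto simp: h_def)
        have bt: "b \<in> {0..t}" using b x by auto
        have eq: "u b y - T h (u x) y = complex_of_real h * ((D1 b y + (W y * u x y - V y * u x y)) - D2 h y)" for y
        proof -
          have "complex_of_real h * D1 b y = u b y - u x y - complex_of_real h * (v x y + W y * u x y)"
            unfolding D1_def u'_def h_def[symmetric] by (subst right_diff_distrib) (use h in simp)
          moreover have "complex_of_real h * D2 h y = T h (u x) y - u x y - complex_of_real h * (v x y + V y * u x y)"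
            unfolding D2_def by (subst right_diff_distrib) (use h in simp)
          ultimately show ?thesis by algebra
        qed
        have "L2norm (\<lambda>y. u b y - T h (u x) y) = h * L2norm (\<lambda>y. (D1 b y + (W y * u x y - V y * u x y)) - D2 h y)"
          unfolding eq L2norm_scale using h by simp
        also have "\<dots> \<le> h * (\<eta> + K + \<eta>)"
        proof (intro mult_left_mono)
          have "L2norm (\<lambda>y. (D1 b y + (W y * u x y - V y * u x y)) - D2 h y)
            \<le> L2norm (\<lambda>y. D1 b y + (W y * u x y - V y * u x y)) + L2norm (D2 h)"
            using h bt x by (intro L2norm_triangle_diff L2_add L2_diff D1L D2L VL WL) auto
          also have "L2norm (\<lambda>y. D1 b y + (W y * u x y - V y * u x y)) \<le> L2norm (D1 b) + L2norm (\<lambda>y. W y * u x y - V y * u x y)"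
            using bt x by (intro L2norm_triangle L2_diff D1L VL WL) auto
          finally show "L2norm (\<lambda>y. (D1 b y + (W y * u x y - V y * u x y)) - D2 h y) \<le> \<eta> + K + \<eta>"
            using d1(2)[OF bt False] d2(2)[of h] K[OF x] h by (simp add: dist_real_def h_def)
        qed (use h in auto)
        finally have le: "L2norm (\<lambda>y. u b y - T (b - x) (u x) y) \<le> h * (\<eta> + K + \<eta>)" unfolding h_def .
        have "L2norm (\<lambda>y. \<Psi> b y - \<Psi> x y) \<le> M * (h * (\<eta> + K + \<eta>))"
          using step[of x b] x b mult_left_mono[OF le M(1)] by auto
        also have "\<dots> = (M * K + M * (2 * \<eta>)) * h" by (simp add: algebra_simps)
        also have "\<dots> \<le> (M * K + \<epsilon>) * h"
        proof -
          have "M * (2 * \<eta>) \<le> M * (2 * \<eta> + M * \<eta>)" using M(1) \<eta> by (intro mult_left_mono) auto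
          then show ?thesis using M\<eta> h by (intro mult_right_mono) auto
        qed
        finally show ?thesis by (simp add: h_def)
      qed simp
    qed (use d1 d2 in auto)
    show "\<exists>d>0. \<forall>a. a \<le> x \<and> x - a < d \<and> 0 \<le> a \<longrightarrow> L2norm (\<lambda>y. \<Psi> x y - \<Psi> a y) \<le> (M * K + \<epsilon>) * (x - a)"
    proof (intro exI[of _ "min d1 (min d2 d3)"] conjI allI impI)
      fix a assume a: "a \<le> x \<and> x - a < min d1 (min d2 d3) \<and> 0 \<le> a"
      show "L2norm (\<lambda>y. \<Psi> x y - \<Psi> a y) \<le> (M * K + \<epsilon>) * (x - a)"
      proof (cases "a = x")
        case False
        define h where "h = x - a"
        have h: "0 < h" "h < d1" "h < d2" "h < d3" "h \<in> {0..t}" using a False x by (auto simp: h_def)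
        have at: "a \<in> {0..t}" using a x by auto
        \<comment> \<open>From the left the generator must still be used at \<open>u x\<close>,
          where its quotient is controlled. So \<open>u a\<close> is expanded about
          \<open>x\<close>; \<open>T h\<close> then also acts on the derivative and on the
          remainder, which costs \<open>T h u' - u'\<close>, small by strong continuity, and the
          extra term \<open>M * \<eta>\<close>.\<close>
        have ua: "u a = (\<lambda>y. 1 * u x y + (- complex_of_real h) * (u' y + D1 a y))"
        proof
          fix y
          have "complex_of_real (a - x) * (u' y + D1 a y) = u a y - u x y"
            using False unfolding D1_def by simp
          moreover have "complex_of_real (a - x) = - complex_of_real h" by (simp add: h_def)
          ultimately show "u a y = 1 * u x y + (- complex_of_real h) * (u' y + D1 a y)" by simp
        qed
        have "AE y in lborel. T h (u a) y = 1 * T h (u x) y + (- complex_of_real h) * T h (\<lambda>y. u' y + D1 a y) y"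
          by (subst ua, rule T_lincomb) (use h x at in \<open>auto intro!: L2_add u'L D1L uL\<close>)
        moreover have "AE y in lborel. T h (\<lambda>y. 1 * u' y + 1 * D1 a y) y = 1 * T h u' y + 1 * T h (D1 a) y"
          by (rule T_lincomb) (use h x at in \<open>auto intro!: u'L D1L\<close>)
        ultimately have eq: "AE y in lborel. u x y - T h (u a) y
          = complex_of_real h * ((((T h u' y - u' y) + T h (D1 a) y) - (V y * u x y - W y * u x y)) - D2 h y)"
        proof eventually_elim
          case (elim y)
          have "complex_of_real h * D2 h y = T h (u x) y - u x y - complex_of_real h * (v x y + V y * u x y)"
            unfolding D2_def by (subst right_diff_distrib) (use h in simp)
          moreover have "T h (\<lambda>y. u' y + D1 a y) y = T h u' y + T h (D1 a) y" using elim(2) by simp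
          ultimately show ?case using elim(1) u'_def[of y] by algebra
        qed
        let ?G = "\<lambda>y. (((T h u' y - u' y) + T h (D1 a) y) - (V y * u x y - W y * u x y)) - D2 h y"
        have GL: "L2 ?G" using h x at by (intro L2_diff L2_add T_L2 u'L D1L D2L VL WL) auto
        have "L2norm (\<lambda>y. u x y - T h (u a) y) = L2norm (\<lambda>y. complex_of_real h * ?G y)"
          using h x at by (intro L2norm_cong_AE eq L2_scale GL L2_diff uL T_L2) auto
        also have "\<dots> = h * L2norm ?G" unfolding L2norm_scale using h by simp
        also have "\<dots> \<le> h * (\<eta> + M * \<eta> + K + \<eta>)"
        proof (intro mult_left_mono)
          have "L2norm ?G \<le> L2norm (\<lambda>y. ((T h u' y - u' y) + T h (D1 a) y) - (V y * u x y - W y * u x y)) + L2norm (D2 h)"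
            using h x at by (intro L2norm_triangle_diff L2_diff L2_add T_L2 u'L D1L D2L VL WL) auto
          also have "L2norm (\<lambda>y. ((T h u' y - u' y) + T h (D1 a) y) - (V y * u x y - W y * u x y))
             \<le> L2norm (\<lambda>y. (T h u' y - u' y) + T h (D1 a) y) + L2norm (\<lambda>y. V y * u x y - W y * u x y)"
            using h x at by (intro L2norm_triangle_diff L2_diff L2_add T_L2 u'L D1L VL WL) auto
          also have "L2norm (\<lambda>y. (T h u' y - u' y) + T h (D1 a) y) \<le> L2norm (\<lambda>y. T h u' y - u' y) + L2norm (T h (D1 a))"
            using h x at by (intro L2norm_triangle L2_diff T_L2 u'L D1L) auto
          also have "L2norm (T h (D1 a)) \<le> M * L2norm (D1 a)" using h at by (intro M D1L) auto
          also have "M * L2norm (D1 a) \<le> M * \<eta>"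
            using d1(2)[OF at False] h M(1) by (intro mult_left_mono) (auto simp: dist_real_def h_def)
          finally show "L2norm ?G \<le> \<eta> + M * \<eta> + K + \<eta>"
            using d2(2)[of h] d3(2)[of h] KL h by simp
        qed (use h in auto)
        finally have le: "L2norm (\<lambda>y. u x y - T (x - a) (u a) y) \<le> h * (\<eta> + M * \<eta> + K + \<eta>)" unfolding h_def .
        have "L2norm (\<lambda>y. \<Psi> x y - \<Psi> a y) \<le> M * (h * (\<eta> + M * \<eta> + K + \<eta>))"
          using step[of a x] x a mult_left_mono[OF le M(1)] by auto
        also have "\<dots> = (M * K + M * (2 * \<eta> + M * \<eta>)) * h" by (simp add: algebra_simps)
        also have "\<dots> \<le> (M * K + \<epsilon>) * h" using M\<eta> h by (intro mult_right_mono) auto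
        finally show ?thesis by (simp add: h_def)
      qed simp
    qed (use d1 d2 d3 in auto)
  qed
  have bound: "L2norm (\<lambda>x. \<Psi> t x - \<Psi> 0 x) \<le> (M * K + \<epsilon>) * t" if \<epsilon>: "\<epsilon> > 0" for \<epsilon>
  proof -
    \<comment> \<open>The guard is needed because the bisection principle also asks for intervals
      around \<open>x\<close> that stick out of [0, t].\<close>
    define P where "P a b \<longleftrightarrow> (0 \<le> a \<and> b \<le> t \<longrightarrow> L2norm (\<lambda>x. \<Psi> b x - \<Psi> a x) \<le> (M * K + \<epsilon>) * (b - a))" for a b
    have tr: "L2norm (\<lambda>x. \<Psi> c x - \<Psi> a x) \<le> (M * K + \<epsilon>) * (c - a)"
      if "0 \<le> a" "a \<le> b" "b \<le> c" "c \<le> t"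
        "L2norm (\<lambda>x. \<Psi> b x - \<Psi> a x) \<le> (M * K + \<epsilon>) * (b - a)" "L2norm (\<lambda>x. \<Psi> c x - \<Psi> b x) \<le> (M * K + \<epsilon>) * (c - b)" for a b c
      using L2norm_triangle3[of "\<Psi> c" "\<Psi> b" "\<Psi> a"] \<Psi>L[of a] \<Psi>L[of b] \<Psi>L[of c] that by (auto simp: algebra_simps)
    have "P 0 t"
    proof (rule Bolzano)
      show "0 \<le> t" using t by simp
      show "P a c" if "P a b" "P b c" "a \<le> b" "b \<le> c" for a b c
        unfolding P_def using that tr[of a b c] by (auto simp: P_def)
      fix x assume x: "0 \<le> x" "x \<le> t"
      obtain d1 where d1: "d1 > 0" "\<And>b. x \<le> b \<and> b - x < d1 \<and> b \<le> t \<Longrightarrow> L2norm (\<lambda>y. \<Psi> b y - \<Psi> x y) \<le> (M * K + \<epsilon>) * (b - x)"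
        using right[of x \<epsilon>] x \<epsilon> by auto
      obtain d2 where d2: "d2 > 0" "\<And>a. a \<le> x \<and> x - a < d2 \<and> 0 \<le> a \<Longrightarrow> L2norm (\<lambda>y. \<Psi> x y - \<Psi> a y) \<le> (M * K + \<epsilon>) * (x - a)"
        using left[of x \<epsilon>] x \<epsilon> by auto
      show "\<exists>d>0. \<forall>a b. a \<le> x \<and> x \<le> b \<and> b - a < d \<longrightarrow> P a b"
      proof (intro exI[of _ "min d1 d2"] conjI allI impI)
        fix a b assume ab: "a \<le> x \<and> x \<le> b \<and> b - a < min d1 d2"
        show "P a b"
          unfolding P_def
        proof
          assume r: "0 \<le> a \<and> b \<le> t"
          show "L2norm (\<lambda>x. \<Psi> b x - \<Psi> a x) \<le> (M * K + \<epsilon>) * (b - a)"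
            by (rule tr[of a x b]) (use ab r d1(2)[of b] d2(2)[of a] in simp_all)
        qed
      qed (use d1(1) d2(1) in simp)
    qed
    then show ?thesis using t by (simp add: P_def)
  qed
  have "L2norm (\<lambda>x. T t (u 0) x - u t x) = L2norm (\<lambda>x. \<Psi> 0 x - \<Psi> t x)"
    unfolding \<Psi>_def using T_zero[OF uL[of t]] t uL
    by (intro L2norm_cong_AE) (auto intro!: L2_diff)
  also have "\<dots> = L2norm (\<lambda>x. \<Psi> t x - \<Psi> 0 x)" by (rule L2norm_minus_commute)
  also have "\<dots> \<le> M * K * t"
  proof (rule field_le_epsilon)
    fix e :: real assume "e > 0"
    then show "L2norm (\<lambda>x. \<Psi> t x - \<Psi> 0 x) \<le> M * K * t + e"
      using bound[of "e / t"] t by (simp add: algebra_simps)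
  qed
  finally show ?thesis .
qed

end

subsection \<open>Averages over uniform partitions\<close>

text \<open>Half-open cells, so that they partition {0<..t} exactly and integrals over them simply
  add up.\<close>

definition pt_cell :: "real \<Rightarrow> nat \<Rightarrow> nat \<Rightarrow> real set" where
  "pt_cell t n j = {real j * t / real n <.. real (Suc j) * t / real n}"

text \<open>Averages rather than point values, because an average is a multiple of a pairing with
  the path whose derivative is the indicator of the cell (\<open>cell_avg_eq_Bpair\<close>), and
  pairings are all that \<open>f\<close> gives access to.\<close>

definition cell_avg :: "real \<Rightarrow> nat \<Rightarrow> (real \<Rightarrow> real) \<Rightarrow> nat \<Rightarrow> real" where
  "cell_avg t n g j = real n / t * (LINT x:pt_cell t n j|lborel. g x)"

lemma pt_cell_sets [measurable]: "pt_cell t n j \<in> sets borel"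
  by (simp add: pt_cell_def)

lemma emeasure_pt_cell: "0 < t \<Longrightarrow> 0 < n \<Longrightarrow> measure lborel (pt_cell t n j) = t / real n"
  by (simp add: pt_cell_def divide_right_mono mult_right_mono field_simps)

lemma Union_pt_cell:
  assumes "0 < t" "0 < n"
  shows "(\<Union>j\<in>{..<n}. pt_cell t n j) = {0<..t}"
proof -
  have "(\<Union>j\<in>{..<m}. pt_cell t n j) = {0<..real m * t / real n}" for m
  proof (induction m)
    case (Suc m)
    have "0 \<le> real m * t / real n" "real m * t / real n \<le> real (Suc m) * t / real n"
      using assms by (auto simp: field_simps)
    then show ?case unfolding lessThan_Suc using Suc by (auto simp: pt_cell_def)
  qed simp
  from this[of n] show ?thesis using assms by simp
qed

lemma disjoint_pt_cell:
  assumes "0 < t" "0 < n"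
  shows "disjoint_family_on (pt_cell t n) A"
proof -
  have "pt_cell t n i \<inter> pt_cell t n j = {}" if "i < j" for i j
  proof -
    have "real (Suc i) * t / real n \<le> real j * t / real n"
      using that assms by (intro divide_right_mono mult_right_mono) auto
    then show ?thesis by (auto simp: pt_cell_def)
  qed
  then show ?thesis unfolding disjoint_family_on_def by (metis Int_commute linorder_neqE_nat)
qed

lemma pt_cell_subset:
  assumes "0 < t" "j < n"
  shows "pt_cell t n j \<subseteq> {0<..t}"
  using Union_pt_cell[of t n] assms by auto

lemma set_integrable_pt_cell:
  fixes f :: "real \<Rightarrow> real"
  assumes "set_integrable lborel {0<..t} f" "0 < t" "j < n"
  shows "set_integrable lborel (pt_cell t n j) f"
  by (rule set_integrable_subset[OF assms(1) _ pt_cell_subset[OF assms(2,3)]]) simp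

lemma set_integrable_const_Ioc [simp]:
  fixes a b c :: real
  shows "set_integrable lborel {a<..b} (\<lambda>_. c)"
proof -
  have "emeasure lborel {a<..b} < \<infinity>" by (rule emeasure_bounded_finite[OF bounded_subset[OF bounded_closed_interval[of a b]]]) auto
  then have "integrable lborel (indicat_real {a<..b})" by (intro integrable_real_indicator) auto
  then show ?thesis unfolding set_integrable_def by (rule integrable_scaleR_left)
qed

lemma set_integrable_const_Icc [simp]:
  fixes a b c :: real
  shows "set_integrable lborel {a..b} (\<lambda>_. c)"
proof -
  have "integrable lborel (indicat_real {a..b})"
    by (intro integrable_real_indicator emeasure_bounded_finite) auto
  then show ?thesis unfolding set_integrable_def by (rule integrable_scaleR_left)
qed

lemma set_integral_eq_sum_pt_cell:
  fixes f :: "real \<Rightarrow> real"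
  assumes "0 < t" "0 < n" "set_integrable lborel {0<..t} f"
  shows "(LINT x:{0<..t}|lborel. f x) = (\<Sum>j<n. LINT x:pt_cell t n j|lborel. f x)"
  unfolding Union_pt_cell[OF assms(1,2), symmetric]
  using assms by (intro set_integral_finite_Union disjoint_pt_cell set_integrable_pt_cell) auto

lemma set_integrable_const_pt_cell [simp]: 
  assumes "0 < t" "0 < n" shows "set_integrable lborel (pt_cell t n j) (\<lambda>_. c::real)"
  unfolding pt_cell_def by simp

lemma set_integral_const_pt_cell:
  assumes "0 < t" "0 < n" shows "(LINT x:pt_cell t n j|lborel. c) = t / real n * (c::real)"
  using emeasure_pt_cell[OF assms, of j] by (simp add: set_lebesgue_integral_def)

text \<open>Bernoulli's inequality at (x - A) / A. Integrated over a cell with A the mean value, the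
  linear term disappears and Jensen's inequality remains.\<close>

lemma power_above_tangent:
  fixes x A :: real
  assumes "0 \<le> x" "0 \<le> A" "1 \<le> p"
  shows "A ^ p + real p * A ^ (p - 1) * (x - A) \<le> x ^ p"
proof (cases "A = 0")
  case True
  then show ?thesis using assms by (cases "p = 1") (auto simp: power_0_left)
next
  case False
  then have A: "0 < A" using assms by simp
  have "1 + real p * ((x - A) / A) \<le> (1 + (x - A) / A) ^ p"
    using A assms by (intro Bernoulli_inequality) (auto simp: field_simps)
  also have "1 + (x - A) / A = x / A" using A by (simp add: field_simps)
  finally have "A ^ p * (1 + real p * ((x - A) / A)) \<le> A ^ p * (x / A) ^ p"
    using A by (intro mult_left_mono) auto
  moreover have "A ^ p * (x / A) ^ p = x ^ p" using A by (simp add: power_divide)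
  moreover have "A ^ p * (1 + real p * ((x - A) / A)) = A ^ p + real p * A ^ (p - 1) * (x - A)"
  proof -
    have "A ^ p = A ^ (p - 1) * A" using assms by (metis One_nat_def Suc_le_eq power_minus_mult)
    then have "A ^ p * (real p * ((x - A) / A)) = real p * A ^ (p - 1) * (x - A)" using A by simp
    then show ?thesis by (simp add: distrib_left)
  qed
  ultimately show ?thesis by simp
qed

text \<open>Jensen's inequality: the tangent of x^p is taken at \<open>A\<close>, the cell mean of
  the absolute value, which dominates the absolute value of the cell mean.\<close>

lemma cell_avg_power_le:
  assumes t: "0 < t" and n: "0 < n" and p: "1 \<le> p"
    and g: "set_integrable lborel (pt_cell t n j) g" "set_integrable lborel (pt_cell t n j) (\<lambda>x. \<bar>g x\<bar> ^ p)"
  shows "t / real n * \<bar>cell_avg t n g j\<bar> ^ p \<le> (LINT x:pt_cell t n j|lborel. \<bar>g x\<bar> ^ p)"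
proof -
  let ?I = "pt_cell t n j"
  define A where "A = real n / t * (LINT x:?I|lborel. \<bar>g x\<bar>)"
  have ag: "set_integrable lborel ?I (\<lambda>x. \<bar>g x\<bar>)" using g(1) by (rule set_integrable_abs)
  have nn: "0 \<le> (LINT x:?I|lborel. \<bar>g x\<bar>)" unfolding set_lebesgue_integral_def by (intro integral_nonneg_AE) auto
  have A0: "0 \<le> A" unfolding A_def using t nn by simp
  have "\<bar>LINT x:?I|lborel. g x\<bar> \<le> (LINT x:?I|lborel. \<bar>g x\<bar>)"
    using integral_abs_bound[of lborel "\<lambda>x. indicator ?I x *\<^sub>R g x"] unfolding set_lebesgue_integral_def by (simp add: abs_mult)
  then have le: "\<bar>cell_avg t n g j\<bar> \<le> A"
    unfolding cell_avg_def A_def using t by (simp add: abs_mult divide_right_mono mult_left_mono)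
  have int: "set_integrable lborel ?I (\<lambda>x. real p * A ^ (p - 1) * (\<bar>g x\<bar> - A))"
    by (intro set_integrable_mult_right set_integral_diff ag set_integrable_const_pt_cell t n)
  have "t / real n * A ^ p = (LINT x:?I|lborel. A ^ p) + real p * A ^ (p - 1) * ((LINT x:?I|lborel. \<bar>g x\<bar>) - (LINT x:?I|lborel. A))"
    unfolding set_integral_const_pt_cell[OF t n] A_def using t n by simp
  also have "\<dots> = (LINT x:?I|lborel. A ^ p + real p * A ^ (p - 1) * (\<bar>g x\<bar> - A))"
    using ag set_integrable_const_pt_cell[OF t n] int by simp
  also have "\<dots> \<le> (LINT x:?I|lborel. \<bar>g x\<bar> ^ p)"
    by (intro set_integral_mono set_integral_add g int set_integrable_const_pt_cell t n power_above_tangent p A0) auto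
  finally have "t / real n * A ^ p \<le> (LINT x:?I|lborel. \<bar>g x\<bar> ^ p)" .
  moreover have "t / real n * \<bar>cell_avg t n g j\<bar> ^ p \<le> t / real n * A ^ p"
    using t le by (intro mult_left_mono power_mono) auto
  ultimately show ?thesis by linarith
qed

lemma sum_cell_avg_power_le:
  assumes t: "0 < t" and n: "0 < n" and p: "1 \<le> p"
    and g: "set_integrable lborel {0<..t} g" "set_integrable lborel {0<..t} (\<lambda>x. \<bar>g x\<bar> ^ p)"
  shows "(\<Sum>j<n. t / real n * \<bar>cell_avg t n g j\<bar> ^ p) \<le> (LINT x:{0<..t}|lborel. \<bar>g x\<bar> ^ p)"
  unfolding set_integral_eq_sum_pt_cell[OF t n g(2)] using g
  by (intro sum_mono cell_avg_power_le t n p set_integrable_pt_cell) auto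

text \<open>Two regimes. If the difference is small relative to \<open>b\<close>, continuity of (1 +
  x)^p at 0 gives the relative error \<open>\<eta>\<close>; otherwise both \<open>a\<close> and
  \<open>b\<close> are at most multiples of the difference. This yields continuity of the integrated
  p-th power with respect to L^p distance.\<close>

lemma power_diff_bound:
  fixes \<eta> :: real
  assumes "0 < \<eta>" "1 \<le> p"
  obtains C where "0 \<le> C" "\<And>a b::real. \<bar>a ^ p - b ^ p\<bar> \<le> \<eta> * \<bar>b\<bar> ^ p + C * \<bar>a - b\<bar> ^ p"
proof -
  have "(\<lambda>x::real. (1 + x) ^ p) \<midarrow>0\<rightarrow> (1 + 0) ^ p" by (intro tendsto_intros)
  from LIM_D[OF this assms(1)] obtain \<delta> where \<delta>: "\<delta> > 0" "\<And>x. x \<noteq> 0 \<Longrightarrow> \<bar>x\<bar> < \<delta> \<Longrightarrow> \<bar>(1 + x) ^ p - 1\<bar> < \<eta>" by auto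
  define C where "C = (1 + 1 / \<delta>) ^ p + (1 / \<delta>) ^ p"
  show thesis
  proof (rule that)
    show "0 \<le> C" using \<delta> by (simp add: C_def)
    fix a b :: real
    define x where "x = a - b"
    show "\<bar>a ^ p - b ^ p\<bar> \<le> \<eta> * \<bar>b\<bar> ^ p + C * \<bar>a - b\<bar> ^ p"
    proof (cases "\<bar>x\<bar> < \<delta> * \<bar>b\<bar>")
      case True
      then have b: "b \<noteq> 0" using \<delta> by auto
      have "\<bar>(1 + x / b) ^ p - 1\<bar> \<le> \<eta>"
      proof (cases "x = 0")
        case False
        have "\<bar>x / b\<bar> < \<delta>" using True b by (simp add: field_simps)
        then show ?thesis using \<delta>(2)[of "x / b"] False b by simp
      qed (use assms in auto)
      moreover have "a ^ p - b ^ p = b ^ p * ((1 + x / b) ^ p - 1)"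
      proof -
        have "b * (1 + x / b) = a" using b by (simp add: x_def field_simps)
        then have "b ^ p * (1 + x / b) ^ p = a ^ p" by (metis power_mult_distrib)
        then show ?thesis by (simp add: right_diff_distrib)
      qed
      ultimately have "\<bar>a ^ p - b ^ p\<bar> \<le> \<bar>b\<bar> ^ p * \<eta>"
        by (simp add: abs_mult power_abs mult_left_mono)
      moreover have "0 \<le> C * \<bar>a - b\<bar> ^ p" using \<open>0 \<le> C\<close> by simp
      ultimately show ?thesis by (simp add: mult.commute)
    next
      case False
      then have b: "\<bar>b\<bar> \<le> \<bar>x\<bar> / \<delta>" using \<delta> by (simp add: field_simps)
      have "\<bar>a\<bar> \<le> \<bar>x\<bar> + \<bar>b\<bar>" by (simp add: x_def)
      also have "\<dots> \<le> (1 + 1 / \<delta>) * \<bar>x\<bar>" using b by (simp add: algebra_simps)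
      finally have "\<bar>a\<bar> ^ p \<le> ((1 + 1 / \<delta>) * \<bar>x\<bar>) ^ p" by (intro power_mono) auto
      moreover have "\<bar>b\<bar> ^ p \<le> (\<bar>x\<bar> / \<delta>) ^ p" using b by (intro power_mono) auto
      moreover have "(\<bar>x\<bar> / \<delta>) ^ p = (1 / \<delta>) ^ p * \<bar>x\<bar> ^ p" by (simp add: power_divide)
      moreover have "\<bar>a ^ p - b ^ p\<bar> \<le> \<bar>a\<bar> ^ p + \<bar>b\<bar> ^ p" by (metis abs_triangle_ineq4 power_abs)
      moreover have "((1 + 1 / \<delta>) * \<bar>x\<bar>) ^ p = (1 + 1 / \<delta>) ^ p * \<bar>x\<bar> ^ p" by (rule power_mult_distrib)
      moreover have "C * \<bar>x\<bar> ^ p = (1 + 1 / \<delta>) ^ p * \<bar>x\<bar> ^ p + (1 / \<delta>) ^ p * \<bar>x\<bar> ^ p"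
        unfolding C_def by (rule distrib_right)
      ultimately have "\<bar>a ^ p - b ^ p\<bar> \<le> C * \<bar>x\<bar> ^ p" by linarith
      moreover have "0 \<le> \<eta> * \<bar>b\<bar> ^ p" using assms by simp
      ultimately show ?thesis by (simp add: x_def)
    qed
  qed
qed

text \<open>Density of bounded continuous functions in L^p. Clipping comes first, so that on a
  bounded interval the second limit has a constant majorant. Since (x + y)^p \<le> 2^p (x^p + y^p),
  each of the two errors is made smaller than \<epsilon> / 2^(p+1).\<close>

lemma continuous_approx_Lp:
  fixes g :: "real \<Rightarrow> real"
  assumes t: "0 < t" and p: "1 \<le> p" and g[measurable]: "g \<in> borel_measurable borel"
    and gp: "set_integrable lborel {0<..t} (\<lambda>x. \<bar>g x\<bar> ^ p)" and \<epsilon>: "\<epsilon> > 0"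
  obtains c K where "continuous_on UNIV c" "\<And>x. \<bar>c x\<bar> \<le> K"
    "set_integrable lborel {0<..t} (\<lambda>x. \<bar>g x - c x\<bar> ^ p)" "(LINT x:{0<..t}|lborel. \<bar>g x - c x\<bar> ^ p) < \<epsilon>"
proof -
  define clip where "clip K x = max (- K) (min K x)" for K x :: real
  have clip_le: "\<bar>clip K x\<bar> \<le> K" if "0 \<le> K" for K x using that by (auto simp: clip_def)
  have clip_diff: "\<bar>g x - clip K (g x)\<bar> \<le> \<bar>g x\<bar>" if "0 \<le> K" for K x using that by (auto simp: clip_def)
  have [measurable]: "clip K \<in> borel_measurable borel" for K unfolding clip_def by measurable
  have "(\<lambda>n. LINT x:{0<..t}|lborel. \<bar>g x - clip (real n) (g x)\<bar> ^ p) \<longlonglongrightarrow> (LINT x:{0<..t}|lborel. 0)"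
    unfolding set_lebesgue_integral_def
  proof (rule integral_dominated_convergence[where w="\<lambda>x. indicator {0<..t} x *\<^sub>R \<bar>g x\<bar> ^ p"])
    show "integrable lborel (\<lambda>x. indicator {0<..t} x *\<^sub>R \<bar>g x\<bar> ^ p)" using gp by (simp add: set_integrable_def)
    show "AE x in lborel. (\<lambda>n. indicator {0<..t} x *\<^sub>R \<bar>g x - clip (real n) (g x)\<bar> ^ p) \<longlonglongrightarrow> indicator {0<..t} x *\<^sub>R 0"
    proof (intro AE_I2 tendsto_eventually)
      fix x
      obtain m where "\<bar>g x\<bar> \<le> real m" using real_arch_simple by blast
      then show "\<forall>\<^sub>F n in sequentially. indicator {0<..t} x *\<^sub>R \<bar>g x - clip (real n) (g x)\<bar> ^ p = indicator {0<..t} x *\<^sub>R 0"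
        using p by (intro eventually_sequentiallyI[of m]) (auto simp: clip_def power_0_left)
    qed
    show "AE x in lborel. norm (indicator {0<..t} x *\<^sub>R \<bar>g x - clip (real n) (g x)\<bar> ^ p) \<le> indicator {0<..t} x *\<^sub>R \<bar>g x\<bar> ^ p" for n
      using clip_diff[of "real n"] by (intro AE_I2) (auto simp: indicator_def intro!: power_mono)
  qed measurable
  then have "\<forall>\<^sub>F n in sequentially. (LINT x:{0<..t}|lborel. \<bar>g x - clip (real n) (g x)\<bar> ^ p) < \<epsilon> / 2 ^ (p + 1)"
    using \<epsilon> by (intro order_tendstoD) (auto simp: set_lebesgue_integral_def)
  then obtain n where n: "(LINT x:{0<..t}|lborel. \<bar>g x - clip (real n) (g x)\<bar> ^ p) < \<epsilon> / 2 ^ (p + 1)"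
    by (auto simp: eventually_sequentially)
  define K where "K = real n"
  have K0: "0 \<le> K" by (simp add: K_def)
  \<comment> \<open>A measurable function is almost everywhere a limit of continuous functions
    \<open>c n\<close>; clipping them keeps continuity and makes them uniformly bounded.\<close>
  have "g \<in> borel_measurable lebesgue" by (rule measurable_completion) (use g in simp)
  then have "g measurable_on UNIV" by (intro lebesgue_measurable_imp_measurable_on) auto
  then obtain N c where N: "negligible N" and c: "\<And>n. continuous_on UNIV (c n)" "\<And>x. x \<notin> N \<Longrightarrow> (\<lambda>n. c n x) \<longlonglongrightarrow> g x"
    by (auto simp: measurable_on_def)
  have [measurable]: "c n \<in> borel_measurable borel" for n by (rule borel_measurable_continuous_onI[OF c(1)])
  have ccont: "continuous_on UNIV (\<lambda>x. clip K (c n x))" for n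
    unfolding clip_def by (intro continuous_intros c)
  have AEN: "AE x in lborel. x \<notin> N"
  proof -
    have "AE x in lebesgue. x \<notin> N" using N by (simp add: AE_not_in negligible_iff_null_sets)
    then show ?thesis by (simp add: AE_completion_iff)
  qed
  have "(\<lambda>n. LINT x:{0<..t}|lborel. \<bar>clip K (g x) - clip K (c n x)\<bar> ^ p) \<longlonglongrightarrow> (LINT x:{0<..t}|lborel. \<bar>clip K (g x) - clip K (g x)\<bar> ^ p)"
    unfolding set_lebesgue_integral_def
  proof (rule integral_dominated_convergence[where w="\<lambda>x. indicator {0<..t} x *\<^sub>R (2 * K) ^ p"])
    show "integrable lborel (\<lambda>x. indicator {0<..t} x *\<^sub>R (2 * K) ^ p)"
      using set_integrable_const_Ioc[of 0 t "(2 * K) ^ p"] unfolding set_integrable_def by simp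
    show "AE x in lborel. (\<lambda>n. indicator {0<..t} x *\<^sub>R \<bar>clip K (g x) - clip K (c n x)\<bar> ^ p) \<longlonglongrightarrow> indicator {0<..t} x *\<^sub>R \<bar>clip K (g x) - clip K (g x)\<bar> ^ p"
      using AEN
    proof eventually_elim
      case (elim x)
      show ?case unfolding clip_def by (intro tendsto_intros c(2) elim)
    qed
    show "AE x in lborel. norm (indicator {0<..t} x *\<^sub>R \<bar>clip K (g x) - clip K (c n x)\<bar> ^ p) \<le> indicator {0<..t} x *\<^sub>R (2 * K) ^ p" for n
    proof (intro AE_I2)
      fix x
      have "\<bar>clip K (g x) - clip K (c n x)\<bar> \<le> 2 * K" using clip_le[OF K0, of "g x"] clip_le[OF K0, of "c n x"] by linarith
      then have "\<bar>clip K (g x) - clip K (c n x)\<bar> ^ p \<le> (2 * K) ^ p" by (intro power_mono) auto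
      then show "norm (indicator {0<..t} x *\<^sub>R \<bar>clip K (g x) - clip K (c n x)\<bar> ^ p) \<le> indicator {0<..t} x *\<^sub>R (2 * K) ^ p"
        by (auto simp: indicator_def)
    qed
  qed measurable
  then have "\<forall>\<^sub>F n in sequentially. (LINT x:{0<..t}|lborel. \<bar>clip K (g x) - clip K (c n x)\<bar> ^ p) < \<epsilon> / 2 ^ (p + 1)"
    using \<epsilon> p by (intro order_tendstoD(2)) (auto simp: set_lebesgue_integral_def power_0_left)
  then obtain m where m: "(LINT x:{0<..t}|lborel. \<bar>clip K (g x) - clip K (c m x)\<bar> ^ p) < \<epsilon> / 2 ^ (p + 1)"
    by (auto simp: eventually_sequentially)
  define c' where "c' x = clip K (c m x)" for x
  have [measurable]: "c' \<in> borel_measurable borel" unfolding c'_def by measurable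
  have i1: "set_integrable lborel {0<..t} (\<lambda>x. \<bar>g x - clip K (g x)\<bar> ^ p)"
    by (rule set_integrable_bound[OF gp])
       (auto simp: set_borel_measurable_def intro!: power_mono clip_diff K0)
  have i2: "set_integrable lborel {0<..t} (\<lambda>x. \<bar>clip K (g x) - c' x\<bar> ^ p)"
  proof (rule set_integrable_bound[where f="\<lambda>x. (2 * K) ^ p"])
    show "set_integrable lborel {0<..t} (\<lambda>x. (2 * K) ^ p)" by simp
    have "\<bar>clip K (g x) - c' x\<bar> \<le> 2 * K" for x using clip_le[OF K0, of "g x"] clip_le[OF K0, of "c m x"] unfolding c'_def by linarith
    then show "AE x in lborel. x \<in> {0<..t} \<longrightarrow> norm (\<bar>clip K (g x) - c' x\<bar> ^ p) \<le> norm ((2 * K) ^ p)"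
      using power_mono[OF _ abs_ge_zero, of _ "2 * K" p] K0 by auto
  qed (auto simp: set_borel_measurable_def)
  have pw: "\<bar>g x - c' x\<bar> ^ p \<le> 2 ^ p * \<bar>g x - clip K (g x)\<bar> ^ p + 2 ^ p * \<bar>clip K (g x) - c' x\<bar> ^ p" for x
  proof -
    let ?m = "max \<bar>g x - clip K (g x)\<bar> \<bar>clip K (g x) - c' x\<bar>"
    have "\<bar>g x - c' x\<bar> \<le> \<bar>g x - clip K (g x)\<bar> + \<bar>clip K (g x) - c' x\<bar>" by linarith
    also have "\<dots> \<le> 2 * ?m" by (simp add: max_def)
    finally have "\<bar>g x - c' x\<bar> \<le> 2 * ?m" .
    then have "\<bar>g x - c' x\<bar> ^ p \<le> (2 * ?m) ^ p" by (intro power_mono) auto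
    also have "\<dots> = 2 ^ p * ?m ^ p" by (simp add: power_mult_distrib)
    also have "\<dots> \<le> 2 ^ p * \<bar>g x - clip K (g x)\<bar> ^ p + 2 ^ p * \<bar>clip K (g x) - c' x\<bar> ^ p"
      by (auto simp: max_def)
    finally show ?thesis .
  qed
  have i12: "set_integrable lborel {0<..t} (\<lambda>x. 2 ^ p * \<bar>g x - clip K (g x)\<bar> ^ p + 2 ^ p * \<bar>clip K (g x) - c' x\<bar> ^ p)"
    by (intro set_integral_add set_integrable_mult_right i1 i2)
  have i3: "set_integrable lborel {0<..t} (\<lambda>x. \<bar>g x - c' x\<bar> ^ p)"
    by (rule set_integrable_bound[OF i12])
       (auto simp: set_borel_measurable_def pw)
  have "(LINT x:{0<..t}|lborel. \<bar>g x - c' x\<bar> ^ p) \<le> (LINT x:{0<..t}|lborel. 2 ^ p * \<bar>g x - clip K (g x)\<bar> ^ p + 2 ^ p * \<bar>clip K (g x) - c' x\<bar> ^ p)"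
    by (intro set_integral_mono i12 i3 pw)
  also have "\<dots> = 2 ^ p * (LINT x:{0<..t}|lborel. \<bar>g x - clip K (g x)\<bar> ^ p) + 2 ^ p * (LINT x:{0<..t}|lborel. \<bar>clip K (g x) - c' x\<bar> ^ p)"
    using i1 i2 by (subst set_integral_add(2)) auto
  also have "\<dots> < 2 ^ p * (\<epsilon> / 2 ^ (p + 1)) + 2 ^ p * (\<epsilon> / 2 ^ (p + 1))"
    using n m unfolding K_def[symmetric] c'_def by (intro add_strict_mono mult_strict_left_mono) auto
  also have "\<dots> = \<epsilon>" by (simp add: field_simps)
  finally show thesis
    using that[of c' K] ccont[of m] clip_le[OF K0] i3 unfolding c'_def by blast
qed

lemma cell_avg_near:
  assumes t: "0 < t" and n: "0 < n" and c: "set_integrable lborel (pt_cell t n j) c"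
    and e: "\<And>y. y \<in> pt_cell t n j \<Longrightarrow> \<bar>c y - a\<bar> \<le> e"
  shows "\<bar>cell_avg t n c j - a\<bar> \<le> e"
proof -
  let ?I = "pt_cell t n j"
  have "\<bar>LINT x:?I|lborel. c x - a\<bar> \<le> (LINT x:?I|lborel. \<bar>c x - a\<bar>)"
    using integral_abs_bound[of lborel "\<lambda>x. indicator ?I x *\<^sub>R (c x - a)"] unfolding set_lebesgue_integral_def by (simp add: abs_mult)
  also have "\<dots> \<le> (LINT x:?I|lborel. e)"
    by (intro set_integral_mono set_integrable_abs set_integral_diff c set_integrable_const_pt_cell t n e)
  also have "\<dots> = t / real n * e" by (rule set_integral_const_pt_cell[OF t n])
  finally have "\<bar>LINT x:?I|lborel. c x - a\<bar> \<le> t / real n * e" .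
  moreover have "cell_avg t n c j - a = real n / t * (LINT x:?I|lborel. c x - a)"
    using c set_integrable_const_pt_cell[OF t n, of j a] set_integral_const_pt_cell[OF t n, of j a] t n
    by (simp add: cell_avg_def field_simps)
  moreover have "real n / t * \<bar>LINT x:?I|lborel. c x - a\<bar> \<le> real n / t * (t / real n * e)"
    using calculation(1) t by (intro mult_left_mono) auto
  ultimately show ?thesis using t n by (simp add: abs_mult)
qed

text \<open>The sum is the integral of the step function \<open>s n\<close>. At x its value is a
  power of the mean of \<open>c\<close> over a cell of length t / n containing x, so it converges by
  continuity of \<open>c\<close> at x, dominated by \<open>K ^ p\<close>.\<close>

lemma cell_avg_power_continuous:
  assumes t: "0 < t" and cont: "continuous_on UNIV c" and K: "\<And>x. \<bar>c x\<bar> \<le> K"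
  shows "(\<lambda>n. \<Sum>j<n. t / real n * cell_avg t n c j ^ p) \<longlonglongrightarrow> (LINT x:{0<..t}|lborel. c x ^ p)"
proof -
  have [measurable]: "c \<in> borel_measurable borel" by (rule borel_measurable_continuous_onI[OF cont])
  have K0: "0 \<le> K" using K[of 0] by linarith
  have cint: "set_integrable lborel A c" if "A \<in> sets borel" "A \<subseteq> {0<..t}" for A
  proof -
    have "set_integrable lborel {0<..t} c"
      by (rule set_integrable_bound[where f="\<lambda>x. K"])
        (use K K0 in \<open>auto simp: set_borel_measurable_def\<close>)
    then show ?thesis using that by (intro set_integrable_subset[OF _ _ that(2)]) auto
  qed
  define s where "s n x = (\<Sum>j<n. indicator (pt_cell t n j) x * cell_avg t n c j ^ p)" for n x
  have [measurable]: "s n \<in> borel_measurable borel" for n unfolding s_def by measurable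
  have s_eq: "s n x = cell_avg t n c j ^ p" if "x \<in> pt_cell t n j" "j < n" for n x j
  proof -
    have "indicator (pt_cell t n i) x = (if i = j then 1 else (0::real))" for i
      using disjoint_pt_cell[OF t, of n UNIV] that unfolding disjoint_family_on_def by (auto simp: indicator_def)
    then have "s n x = (\<Sum>i<n. if i = j then cell_avg t n c i ^ p else 0)"
      unfolding s_def by (intro sum.cong) auto
    then show ?thesis using that(2) by simp
  qed
  have avg_le: "\<bar>cell_avg t n c j\<bar> \<le> K" if "j < n" for n j
    using cell_avg_near[OF t _ cint[OF _ pt_cell_subset[OF t that]], of 0 K] that K by auto
  have "(\<lambda>n. LINT x:{0<..t}|lborel. s n x) \<longlonglongrightarrow> (LINT x:{0<..t}|lborel. c x ^ p)"
    unfolding set_lebesgue_integral_def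
  proof (rule integral_dominated_convergence[where w="\<lambda>x. indicator {0<..t} x *\<^sub>R K ^ p"])
    show "AE x in lborel. (\<lambda>n. indicator {0<..t} x *\<^sub>R s n x) \<longlonglongrightarrow> indicator {0<..t} x *\<^sub>R c x ^ p"
    proof (intro AE_I2)
      fix x
      show "(\<lambda>n. indicator {0<..t} x *\<^sub>R s n x) \<longlonglongrightarrow> indicator {0<..t} x *\<^sub>R c x ^ p"
      proof (cases "x \<in> {0<..t}")
        case True
        have "\<exists>j<n. x \<in> pt_cell t n j" if "0 < n" for n using Union_pt_cell[OF t that] True by blast
        then obtain j where j: "\<And>n. 0 < n \<Longrightarrow> j n < n" "\<And>n. 0 < n \<Longrightarrow> x \<in> pt_cell t n (j n)" by metis
        have "(\<lambda>n. cell_avg t n c (j n)) \<longlonglongrightarrow> c x"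
        proof (rule LIMSEQ_I)
          fix r :: real assume r: "0 < r"
          have "isCont c x" using cont by (simp add: continuous_on_eq_continuous_at)
          from LIM_D[OF this[unfolded isCont_def], of "r / 2"] obtain d where d: "d > 0" "\<And>y. y \<noteq> x \<Longrightarrow> \<bar>y - x\<bar> < d \<Longrightarrow> \<bar>c y - c x\<bar> < r / 2"
            using r by auto
          obtain m where m: "t / d < real m" using reals_Archimedean2 by blast
          show "\<exists>no. \<forall>n\<ge>no. norm (cell_avg t n c (j n) - c x) < r"
          proof (intro exI[of _ "Suc m"] allI impI)
            fix n assume n: "Suc m \<le> n"
            then have n0: "0 < n" by simp
            have "t / real n < d"
            proof -
              have "t < real m * d" using m d by (simp add: field_simps)
              also have "\<dots> \<le> real n * d" using n d by (intro mult_right_mono) auto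
              finally show ?thesis using n0 by (simp add: field_simps)
            qed
            moreover have "\<bar>y - x\<bar> \<le> t / real n" if "y \<in> pt_cell t n (j n)" for y
              using that j(2)[OF n0] unfolding pt_cell_def by (auto simp: add_divide_distrib distrib_right)
            ultimately have "\<bar>y - x\<bar> < d" if "y \<in> pt_cell t n (j n)" for y using that by fastforce
            then have "\<bar>c y - c x\<bar> \<le> r / 2" if "y \<in> pt_cell t n (j n)" for y
              using d(2)[of y] that r by (cases "y = x") (auto intro: less_imp_le)
            then have "\<bar>cell_avg t n c (j n) - c x\<bar> \<le> r / 2"
              by (intro cell_avg_near[OF t n0 cint[OF _ pt_cell_subset[OF t j(1)[OF n0]]]]) auto
            then show "norm (cell_avg t n c (j n) - c x) < r" using r by simp
          qed
        qed
        then have "(\<lambda>n. cell_avg t n c (j n) ^ p) \<longlonglongrightarrow> c x ^ p" by (intro tendsto_intros)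
        moreover have "\<forall>\<^sub>F n in sequentially. cell_avg t n c (j n) ^ p = s n x"
        proof (rule eventually_sequentiallyI[of 1])
          fix n :: nat assume "1 \<le> n"
          then show "cell_avg t n c (j n) ^ p = s n x" using s_eq[OF j(2) j(1), of n] by simp
        qed
        ultimately have "(\<lambda>n. s n x) \<longlonglongrightarrow> c x ^ p" by (rule Lim_transform_eventually)
        then show ?thesis using True by simp
      qed simp
    qed
    show "AE x in lborel. norm (indicator {0<..t} x *\<^sub>R s n x) \<le> indicator {0<..t} x *\<^sub>R K ^ p" for n
    proof (intro AE_I2)
      fix x
      show "norm (indicator {0<..t} x *\<^sub>R s n x) \<le> indicator {0<..t} x *\<^sub>R K ^ p"
      proof (cases "x \<in> {0<..t} \<and> 0 < n")
        case True
        then obtain j where "j < n" "x \<in> pt_cell t n j" using Union_pt_cell[OF t, of n] by blast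
        then show ?thesis using s_eq[of x n j] power_mono[OF avg_le[of j n], of p] by (simp add: power_abs indicator_def)
      qed (use K0 in \<open>auto simp: indicator_def s_def\<close>)
    qed
    show "integrable lborel (\<lambda>x. indicator {0<..t} x *\<^sub>R K ^ p)"
      using set_integrable_const_Ioc[of 0 t "K ^ p"] unfolding set_integrable_def .
  qed measurable
  moreover have "(LINT x:{0<..t}|lborel. s n x) = (\<Sum>j<n. t / real n * cell_avg t n c j ^ p)" if n: "0 < n" for n
  proof -
    have "set_integrable lborel {0<..t} (s n)"
      unfolding s_def set_integrable_def scaleR_sum_right
    proof (intro Bochner_Integration.integrable_sum)
      fix j assume "j \<in> {..<n}"
      then have "pt_cell t n j \<subseteq> {0<..t}" using pt_cell_subset[OF t] by simp
      then have "(\<lambda>x. indicator {0<..t} x *\<^sub>R (indicator (pt_cell t n j) x * cell_avg t n c j ^ p))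
        = (\<lambda>x. indicator (pt_cell t n j) x *\<^sub>R cell_avg t n c j ^ p)"
        by (auto simp: indicator_def fun_eq_iff)
      then show "integrable lborel (\<lambda>x. indicator {0<..t} x *\<^sub>R (indicator (pt_cell t n j) x * cell_avg t n c j ^ p))"
        using set_integrable_const_pt_cell[OF t n, of j "cell_avg t n c j ^ p"] unfolding set_integrable_def by simp
    qed
    then have "(LINT x:{0<..t}|lborel. s n x) = (\<Sum>j<n. LINT x:pt_cell t n j|lborel. s n x)"
      by (rule set_integral_eq_sum_pt_cell[OF t n])
    also have "\<dots> = (\<Sum>j<n. LINT x:pt_cell t n j|lborel. cell_avg t n c j ^ p)"
      by (intro sum.cong set_lebesgue_integral_cong) (auto simp: s_eq)
    finally show ?thesis using set_integral_const_pt_cell[OF t n] by simp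
  qed
  ultimately show ?thesis
    by (rule Lim_transform_eventually[OF _ eventually_sequentiallyI[of 1]]) auto
qed

text \<open>The claim holds for continuous functions, and \<open>g\<close> is approximated by one in
  L^p. By Jensen the same L^p errors control the sums of powers of averages, uniformly in the number
  of cells, so the limits may be exchanged.\<close>

theorem cell_avg_power_tendsto:
  fixes g :: "real \<Rightarrow> real"
  assumes t: "0 < t" and p: "1 \<le> p" and g[measurable]: "g \<in> borel_measurable borel"
    and gi: "set_integrable lborel {0<..t} g"
    and gp: "set_integrable lborel {0<..t} (\<lambda>x. \<bar>g x\<bar> ^ p)"
  shows "(\<lambda>n. \<Sum>j<n. t / real n * cell_avg t n g j ^ p) \<longlonglongrightarrow> (LINT x:{0<..t}|lborel. g x ^ p)"
proof (rule LIMSEQ_I)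
  fix r :: real assume r: "0 < r"
  define G where "G = (LINT x:{0<..t}|lborel. \<bar>g x\<bar> ^ p)"
  have G: "0 \<le> G" unfolding G_def set_lebesgue_integral_def by (intro integral_nonneg_AE) auto
  \<comment> \<open>One sixth of \<open>r\<close> for each of the two terms of
    \<open>power_diff_bound\<close>, so that \<open>E1\<close> and \<open>E2\<close> cost a third
    each; the summand 1 in the denominators of \<open>\<eta>\<close> and \<open>\<epsilon>\<close>
    guards against dividing by zero.\<close>
  define \<eta> where "\<eta> = r / (6 * (G + 1))"
  have \<eta>: "0 < \<eta>" "\<eta> * G \<le> r / 6" using r G by (auto simp: \<eta>_def field_simps)
  obtain C where C: "0 \<le> C" "\<And>a b::real. \<bar>a ^ p - b ^ p\<bar> \<le> \<eta> * \<bar>b\<bar> ^ p + C * \<bar>a - b\<bar> ^ p"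
    using power_diff_bound[OF \<eta>(1) p] by blast
  define \<epsilon> where "\<epsilon> = r / (6 * (C + 1))"
  have \<epsilon>: "0 < \<epsilon>" "C * \<epsilon> \<le> r / 6" using r C by (auto simp: \<epsilon>_def field_simps)
  obtain c K where cont: "continuous_on UNIV c" and K: "\<And>x. \<bar>c x\<bar> \<le> K"
    and di: "set_integrable lborel {0<..t} (\<lambda>x. \<bar>g x - c x\<bar> ^ p)" and d: "(LINT x:{0<..t}|lborel. \<bar>g x - c x\<bar> ^ p) < \<epsilon>"
    using continuous_approx_Lp[OF t p g gp \<epsilon>(1)] by blast
  have [measurable]: "c \<in> borel_measurable borel" by (rule borel_measurable_continuous_onI[OF cont])
  have K0: "0 \<le> K" using K[of 0] by linarith
  have ci: "set_integrable lborel {0<..t} c"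
    by (rule set_integrable_bound[where f="\<lambda>x. K"])
        (use K K0 in \<open>auto simp: set_borel_measurable_def\<close>)
  have cp: "set_integrable lborel {0<..t} (\<lambda>x. c x ^ p)"
    by (rule set_integrable_bound[where f="\<lambda>x. K ^ p"])
        (use K K0 in \<open>auto simp: set_borel_measurable_def power_abs intro!: power_mono\<close>)
  have gp': "set_integrable lborel {0<..t} (\<lambda>x. g x ^ p)"
    by (rule set_integrable_bound[OF gp]) (auto simp: set_borel_measurable_def power_abs)
  have cg: "set_integrable lborel {0<..t} (\<lambda>x. c x - g x)" using ci gi by auto
  have di': "set_integrable lborel {0<..t} (\<lambda>x. \<bar>c x - g x\<bar> ^ p)" using di by (simp add: abs_minus_commute)
  have dd: "(LINT x:{0<..t}|lborel. \<bar>c x - g x\<bar> ^ p) < \<epsilon>" using d by (simp add: abs_minus_commute)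
  have E1: "\<bar>(LINT x:{0<..t}|lborel. c x ^ p) - (LINT x:{0<..t}|lborel. g x ^ p)\<bar> \<le> r / 3"
  proof -
    have "\<bar>(LINT x:{0<..t}|lborel. c x ^ p) - (LINT x:{0<..t}|lborel. g x ^ p)\<bar> = \<bar>LINT x:{0<..t}|lborel. c x ^ p - g x ^ p\<bar>"
      using cp gp' by simp
    also have "\<dots> \<le> (LINT x:{0<..t}|lborel. \<bar>c x ^ p - g x ^ p\<bar>)"
      using integral_abs_bound[of lborel "\<lambda>x. indicator {0<..t} x *\<^sub>R (c x ^ p - g x ^ p)"] unfolding set_lebesgue_integral_def by (simp add: abs_mult)
    also have "\<dots> \<le> (LINT x:{0<..t}|lborel. \<eta> * \<bar>g x\<bar> ^ p + C * \<bar>c x - g x\<bar> ^ p)"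
      by (intro set_integral_mono set_integrable_abs set_integral_diff set_integral_add set_integrable_mult_right cp gp' gp di' C)
    also have "\<dots> = \<eta> * G + C * (LINT x:{0<..t}|lborel. \<bar>c x - g x\<bar> ^ p)"
      unfolding G_def using gp di' by (subst set_integral_add(2)) auto
    also have "\<dots> \<le> r / 6 + C * \<epsilon>" using \<eta> dd C by (intro add_mono mult_left_mono) auto
    finally show ?thesis using \<epsilon> by simp
  qed
  have E2: "\<bar>(\<Sum>j<n. t / real n * cell_avg t n c j ^ p) - (\<Sum>j<n. t / real n * cell_avg t n g j ^ p)\<bar> \<le> r / 3" if n: "0 < n" for n
  proof -
    have lin: "cell_avg t n c j - cell_avg t n g j = cell_avg t n (\<lambda>x. c x - g x) j" if "j < n" for j
      unfolding cell_avg_def using set_integrable_pt_cell[OF ci t that] set_integrable_pt_cell[OF gi t that] by (simp add: right_diff_distrib)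
    have "\<bar>(\<Sum>j<n. t / real n * cell_avg t n c j ^ p) - (\<Sum>j<n. t / real n * cell_avg t n g j ^ p)\<bar>
       = \<bar>\<Sum>j<n. t / real n * (cell_avg t n c j ^ p - cell_avg t n g j ^ p)\<bar>"
      by (simp add: sum_subtractf right_diff_distrib)
    also have "\<dots> \<le> (\<Sum>j<n. \<bar>t / real n * (cell_avg t n c j ^ p - cell_avg t n g j ^ p)\<bar>)" by (rule sum_abs)
    also have "\<dots> \<le> (\<Sum>j<n. t / real n * (\<eta> * \<bar>cell_avg t n g j\<bar> ^ p + C * \<bar>cell_avg t n (\<lambda>x. c x - g x) j\<bar> ^ p))"
      using t C(2) by (intro sum_mono) (auto simp: abs_mult lin[symmetric] intro!: mult_left_mono divide_right_mono)
    also have "\<dots> = \<eta> * (\<Sum>j<n. t / real n * \<bar>cell_avg t n g j\<bar> ^ p) + C * (\<Sum>j<n. t / real n * \<bar>cell_avg t n (\<lambda>x. c x - g x) j\<bar> ^ p)"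
      by (simp add: sum_distrib_left sum.distrib distrib_left mult_ac)
    also have "\<dots> \<le> \<eta> * G + C * (LINT x:{0<..t}|lborel. \<bar>c x - g x\<bar> ^ p)"
      unfolding G_def using \<eta>(1) C(1)
      by (intro add_mono mult_left_mono sum_cell_avg_power_le t n p gi gp cg di') auto
    also have "\<dots> \<le> r / 6 + C * \<epsilon>" using \<eta> dd C by (intro add_mono mult_left_mono) auto
    finally show ?thesis using \<epsilon> by simp
  qed
  from LIMSEQ_D[OF cell_avg_power_continuous[OF t cont K, of p], of "r / 3"] r
  obtain no where no: "\<And>n. no \<le> n \<Longrightarrow> \<bar>(\<Sum>j<n. t / real n * cell_avg t n c j ^ p) - (LINT x:{0<..t}|lborel. c x ^ p)\<bar> < r / 3"
    by auto
  show "\<exists>no. \<forall>n\<ge>no. norm ((\<Sum>j<n. t / real n * cell_avg t n g j ^ p) - (LINT x:{0<..t}|lborel. g x ^ p)) < r"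
  proof (intro exI[of _ "max no 1"] allI impI)
    fix n assume n: "max no 1 \<le> n"
    show "norm ((\<Sum>j<n. t / real n * cell_avg t n g j ^ p) - (LINT x:{0<..t}|lborel. g x ^ p)) < r"
      using E1 E2[of n] no[of n] n unfolding real_norm_def by linarith
  qed
qed

subsection \<open>The spaces \<open>B\<^sub>r\<close>\<close>

text \<open>A Dynkin argument: rays form an intersection-stable generator of the Borel sets, and the
  sets with vanishing integral are stable under complements because the total integral, a limit over
  growing rays, vanishes too. A density whose integrals all vanish is zero almost
  everywhere.\<close>

lemma AE_zero_if_integrals_zero:
  fixes D :: "real \<Rightarrow> real"
  assumes D: "integrable lborel D" and 0: "\<And>a. (LINT x:{a<..}|lborel. D x) = 0"
  shows "AE x in lborel. D x = 0"
proof (rule density_unique_real)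
  show "integrable lborel D" "integrable lborel (\<lambda>_. 0::real)" using D by auto
  have intD: "set_integrable lborel A D" if "A \<in> sets borel" for A
    using that D unfolding set_integrable_def by (intro integrable_mult_indicator) auto
  have total: "(LINT x:UNIV|lborel. D x) = 0"
  proof -
    have "(\<lambda>n. LINT x:{- real n<..}|lborel. D x) \<longlonglongrightarrow> (LINT x:UNIV|lborel. D x)"
      unfolding set_lebesgue_integral_def
    proof (rule integral_dominated_convergence[where w="\<lambda>x. \<bar>D x\<bar>"])
      show "AE x in lborel. (\<lambda>n. indicator {- real n<..} x *\<^sub>R D x) \<longlonglongrightarrow> indicator UNIV x *\<^sub>R D x"
      proof (intro AE_I2 tendsto_eventually)
        fix x :: real
        obtain m where "- x < real m" using reals_Archimedean2 by blast
        then show "\<forall>\<^sub>F n in sequentially. indicator {- real n<..} x *\<^sub>R D x = indicator UNIV x *\<^sub>R D x"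
          by (intro eventually_sequentiallyI[of m]) (auto simp: indicator_def)
      qed
    qed (use D in \<open>auto simp: indicator_def\<close>)
    then show ?thesis using 0 by (simp add: LIMSEQ_const_iff)
  qed
  fix A :: "real set" assume "A \<in> sets lborel"
  then have A: "A \<in> sigma_sets UNIV (range (\<lambda>a::real. {a<..}))"
    by (simp add: borel_Ioi)
  have "{a<..} \<inter> {b<..} = {max a b<..}" for a b :: real by auto
  then have "Int_stable (range (\<lambda>a::real. {a<..}))" by (auto simp: Int_stable_def)
  moreover have "range (\<lambda>a::real. {a<..}) \<subseteq> Pow UNIV" by simp
  ultimately show "(LINT x:A|lborel. D x) = (LINT x:A|lborel. 0)"
    using A
  proof (induction rule: sigma_sets_induct_disjoint)
    case (basic A)
    then show ?case using 0 by auto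
  next
    case (compl A)
    have A: "A \<in> sets borel" using compl(1) by (simp add: borel_Ioi)
    have "(LINT x:UNIV|lborel. D x) = (LINT x:A \<union> (UNIV - A)|lborel. D x)" by (simp add: Un_absorb1)
    also have "\<dots> = (LINT x:A|lborel. D x) + (LINT x:UNIV - A|lborel. D x)"
      using A by (intro set_integral_Un intD) auto
    finally show ?case using compl total by simp
  next
    case (union A)
    have A: "A i \<in> sets lborel" for i using union(2) by (auto simp: borel_Ioi)
    have "(LINT x:(\<Union>i. A i)|lborel. D x) = (\<Sum>i. LINT x:A i|lborel. D x)"
      using union(1) A by (intro lebesgue_integral_countable_add intD) (auto simp: disjoint_family_on_def)
    then show ?case using union(3) by simp
  qed (auto simp: set_lebesgue_integral_def)
qed

text \<open>The predicate under \<open>SOME\<close> in \<open>Bdot\<close>. Naming it lets any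
  explicit derivative of a path replace the chosen one, up to a null set
  (\<open>Bdot_eq\<close>).\<close>

definition brep :: "real \<Rightarrow> (real \<Rightarrow> real) \<Rightarrow> (real \<Rightarrow> real) \<Rightarrow> bool" where
  "brep t \<gamma> g \<longleftrightarrow> g \<in> borel_measurable lborel \<and> set_integrable lborel {0..t} g
      \<and> (\<forall>s\<in>{0..t}. \<gamma> s = - (LBINT \<tau>=s..t. g \<tau>))"

lemma brep_unique:
  assumes g: "brep t \<gamma> g1" "brep t \<gamma> g2" and t: "0 < t"
  shows "AE x in lborel. x \<in> {0..t} \<longrightarrow> g1 x = g2 x"
proof -
  define D where "D x = indicator {0..t} x *\<^sub>R (g1 x - g2 x)" for x
  have int: "set_integrable lborel {0..t} g1" "set_integrable lborel {0..t} g2" using g by (auto simp: brep_def)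
  then have D: "integrable lborel D" unfolding D_def using set_integral_diff(1)[OF int] by (simp add: set_integrable_def)
  have "(LINT x:{a<..}|lborel. D x) = 0" for a
  proof (cases "a < t")
    case True
    define s where "s = max 0 a"
    have s: "s \<in> {0..t}" using True t by (auto simp: s_def)
    have sub: "set_integrable lborel {s<..t} g1" "set_integrable lborel {s<..t} g2"
      by (rule set_integrable_subset[OF int(1)], use s in auto, rule set_integrable_subset[OF int(2)], use s in auto)
    have "(LINT x:{a<..}|lborel. D x) = (LINT x:{s<..t}|lborel. g1 x - g2 x)"
      unfolding set_lebesgue_integral_def
    proof (rule integral_cong_AE)
      have "AE x in lborel. x \<noteq> (0::real)" by (rule AE_lborel_singleton)
      then show "AE x in lborel. indicator {a<..} x *\<^sub>R D x = indicator {s<..t} x *\<^sub>R (g1 x - g2 x)"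
        by eventually_elim (auto simp: D_def s_def indicator_def)
    qed (use g D in \<open>auto simp: brep_def\<close>)
    also have "\<dots> = (LINT x:{s<..t}|lborel. g1 x) - (LINT x:{s<..t}|lborel. g2 x)"
      using sub by (rule set_integral_diff)
    also have "\<dots> = 0"
      using g s interval_integral_Ioc[of s t g1] interval_integral_Ioc[of s t g2] by (auto simp: brep_def)
    finally show ?thesis .
  next
    case False
    have "(LINT x:{a<..}|lborel. D x) = (LINT (x::real)|lborel. 0)"
      unfolding set_lebesgue_integral_def
      by (rule Bochner_Integration.integral_cong[OF refl]) (use False in \<open>auto simp: D_def indicator_def\<close>)
    then show ?thesis by simp
  qed
  from AE_zero_if_integrals_zero[OF D this] show ?thesis
    by eventually_elim (auto simp: D_def)
qed

lemma brep_Bdot: "brep t \<gamma> g \<Longrightarrow> brep t \<gamma> (Bdot t \<gamma>)"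
proof -
  assume "brep t \<gamma> g"
  then have "brep t \<gamma> (SOME g. brep t \<gamma> g)" by (rule someI[of "brep t \<gamma>"])
  moreover have "Bdot t \<gamma> = (SOME g. brep t \<gamma> g)" unfolding Bdot_def brep_def ..
  ultimately show ?thesis by simp
qed

lemma Bdot_eq: "brep t \<gamma> g \<Longrightarrow> 0 < t \<Longrightarrow> AE x in lborel. x \<in> {0..t} \<longrightarrow> Bdot t \<gamma> x = g x"
  by (rule brep_unique[OF brep_Bdot])

lemma LBINT_eq_Icc: "0 < t \<Longrightarrow> (LBINT s=0..t. f s) = (LINT s:{0..t}|lborel. f s)"
  for f :: "real \<Rightarrow> 'a::{banach, second_countable_topology}"
  using interval_integral_Icc[of 0 t f] by (simp add: zero_ereal_def)

lemma set_integral_cong_AE':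
  fixes f g :: "real \<Rightarrow> real"
  assumes "f \<in> borel_measurable lborel" "g \<in> borel_measurable lborel" "AE x in lborel. x \<in> {0..t} \<longrightarrow> f x = g x"
  shows "(LINT x:{0..t}|lborel. f x) = (LINT x:{0..t}|lborel. g x)"
  using assms by (intro set_lebesgue_integral_cong_AE) auto

lemma brep_measurable [measurable_dest]: "brep t \<gamma> g \<Longrightarrow> g \<in> borel_measurable borel"
  by (simp add: brep_def)

lemma Bpair_eq:
  assumes a: "brep t \<eta> a" and b: "brep t \<gamma> b" and t: "0 < t"
  shows "Bpair t \<eta> \<gamma> = (LINT x:{0..t}|lborel. a x * b x)"
  unfolding Bpair_def LBINT_eq_Icc[OF t]
proof (rule set_integral_cong_AE')
  show "AE x in lborel. x \<in> {0..t} \<longrightarrow> Bdot t \<eta> x * Bdot t \<gamma> x = a x * b x"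
    using Bdot_eq[OF a t] Bdot_eq[OF b t] by eventually_elim auto
qed (use brep_measurable[OF a] brep_measurable[OF b] brep_measurable[OF brep_Bdot[OF a]] brep_measurable[OF brep_Bdot[OF b]] in auto)

lemma integral_Bdot_power:
  assumes b: "brep t \<gamma> b" and t: "0 < t"
  shows "(LBINT s=0..t. Bdot t \<gamma> s ^ p) = (LINT x:{0..t}|lborel. b x ^ p)"
  unfolding LBINT_eq_Icc[OF t]
proof (rule set_integral_cong_AE')
  show "AE x in lborel. x \<in> {0..t} \<longrightarrow> Bdot t \<gamma> x ^ p = b x ^ p"
    using Bdot_eq[OF b t] by eventually_elim auto
qed (use brep_measurable[OF b] brep_measurable[OF brep_Bdot[OF b]] in auto)

lemma Bnorm_eq:
  assumes b: "brep t \<gamma> b" and t: "0 < t"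
  shows "Bnorm r t \<gamma> = (LINT x:{0..t}|lborel. \<bar>b x\<bar> powr r) powr (1 / r)"
  unfolding Bnorm_def LBINT_eq_Icc[OF t]
proof (intro arg_cong2[where f="(powr)"] refl set_integral_cong_AE')
  show "AE x in lborel. x \<in> {0..t} \<longrightarrow> \<bar>Bdot t \<gamma> x\<bar> powr r = \<bar>b x\<bar> powr r"
    using Bdot_eq[OF b t] by eventually_elim auto
qed (use brep_measurable[OF b] brep_measurable[OF brep_Bdot[OF b]] in auto)

lemma Bsp_eq:
  "Bsp r t = {\<gamma>. \<exists>g. brep t \<gamma> g \<and> set_integrable lborel {0..t} (\<lambda>s. \<bar>g s\<bar> powr r) \<and> (\<forall>s. s \<notin> {0..t} \<longrightarrow> \<gamma> s = 0)}"
  unfolding Bsp_def brep_def by auto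

lemma Bsp_Bdot:
  assumes \<gamma>: "\<gamma> \<in> Bsp r t" and t: "0 < t"
  shows "brep t \<gamma> (Bdot t \<gamma>)" "set_integrable lborel {0..t} (\<lambda>s. \<bar>Bdot t \<gamma> s\<bar> powr r)"
proof -
  obtain g where g: "brep t \<gamma> g" "set_integrable lborel {0..t} (\<lambda>s. \<bar>g s\<bar> powr r)"
    using \<gamma> by (auto simp: Bsp_eq)
  show b: "brep t \<gamma> (Bdot t \<gamma>)" by (rule brep_Bdot[OF g(1)])
  have "set_integrable lborel {0..t} (\<lambda>s. \<bar>Bdot t \<gamma> s\<bar> powr r) = set_integrable lborel {0..t} (\<lambda>s. \<bar>g s\<bar> powr r)"
    using brep_measurable[OF b] brep_measurable[OF g(1)] Bdot_eq[OF g(1) t]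
    by (intro set_integrable_cong_AE) auto
  then show "set_integrable lborel {0..t} (\<lambda>s. \<bar>Bdot t \<gamma> s\<bar> powr r)" using g by simp
qed

lemma brep_diff:
  assumes "brep t \<gamma> g" "brep t \<delta> d"
  shows "brep t (\<delta> - \<gamma>) (\<lambda>x. d x - g x)"
proof -
  have int: "interval_lebesgue_integrable lborel (ereal s) (ereal t) f" if "set_integrable lborel {0..t} f" "s \<in> {0..t}" for f :: "real \<Rightarrow> real" and s
    unfolding interval_lebesgue_integrable_def using that
    by (auto intro!: set_integrable_subset[OF that(1)] simp: einterval_iff)
  show ?thesis
    using assms interval_lebesgue_integral_diff(2)[OF int int] unfolding brep_def by (auto simp: fun_diff_def)
qed

text \<open>A right inverse of differentiation. The value 0 outside [0, t] is what
  \<open>Bsp\<close> prescribes, so that a path is determined by its values on the interval.\<close>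

definition bpath :: "real \<Rightarrow> (real \<Rightarrow> real) \<Rightarrow> real \<Rightarrow> real" where
  "bpath t g = (\<lambda>s. if s \<in> {0..t} then - (LBINT \<tau>=s..t. g \<tau>) else 0)"

lemma brep_bpath: "g \<in> borel_measurable borel \<Longrightarrow> set_integrable lborel {0..t} g \<Longrightarrow> brep t (bpath t g) g"
  by (auto simp: brep_def bpath_def)

lemma set_integrable_bounded_Icc:
  fixes g :: "real \<Rightarrow> 'a::{banach, second_countable_topology}"
  assumes "g \<in> borel_measurable borel" "\<And>x. norm (g x) \<le> B"
  shows "set_integrable lborel {0..t} g"
proof (rule set_integrable_bound[where f="\<lambda>_. B"])
  show "set_integrable lborel {0..t} (\<lambda>_. B)" by simp
  show "AE x in lborel. x \<in> {0..t} \<longrightarrow> norm (g x) \<le> norm B"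
    using order_trans[OF assms(2) abs_ge_self] by auto
qed (use assms in \<open>auto simp: set_borel_measurable_def\<close>)

lemma bpath_in_Bsp:
  assumes g[measurable]: "g \<in> borel_measurable borel" and b: "\<And>x. \<bar>g x\<bar> \<le> B" and r: "0 \<le> r"
  shows "bpath t g \<in> Bsp r t"
  unfolding Bsp_eq mem_Collect_eq
proof (intro exI[of _ g] conjI)
  show "brep t (bpath t g) g"
    by (intro brep_bpath set_integrable_bounded_Icc[where B=B]) (use b in auto)
  show "set_integrable lborel {0..t} (\<lambda>s. \<bar>g s\<bar> powr r)"
    by (rule set_integrable_bounded_Icc[where B="B powr r"]) (use b r in \<open>auto intro!: powr_mono2\<close>)
qed (auto simp: bpath_def)

text \<open>Rescaling the two factors by l and 1 / l before Young's inequality allows either term to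
  be made small at the expense of the other. This takes the place of Hoelder's inequality in
  \<open>Bpair_measurable\<close>.\<close>

lemma young_scaled:
  fixes a b l p q :: real
  assumes p: "1 < p" "1 < q" "1 / p + 1 / q = 1" and l: "0 < l"
  shows "\<bar>a * b\<bar> \<le> l powr p * \<bar>b\<bar> powr p + (1 / l) powr q * \<bar>a\<bar> powr q"
proof -
  have "\<bar>a * b\<bar> = (l * \<bar>b\<bar>) * (1 / l * \<bar>a\<bar>)" using l by (simp add: abs_mult)
  also have "\<dots> \<le> (l * \<bar>b\<bar>) powr p / p + (1 / l * \<bar>a\<bar>) powr q / q"
    using l by (intro Youngs_inequality p) auto
  also have "\<dots> \<le> (l * \<bar>b\<bar>) powr p + (1 / l * \<bar>a\<bar>) powr q"
  proof -
    have "x / c \<le> x" if "0 \<le> x" "1 < c" for x c :: real using divide_left_mono[of 1 c x] that by simp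
    then show ?thesis using p by (intro add_mono) auto
  qed
  also have "(l * \<bar>b\<bar>) powr p = l powr p * \<bar>b\<bar> powr p" by (rule powr_mult)
  also have "(1 / l * \<bar>a\<bar>) powr q = (1 / l) powr q * \<bar>a\<bar> powr q" by (rule powr_mult)
  finally show ?thesis .
qed

lemma set_integrable_mult_conjugate:
  fixes a b :: "real \<Rightarrow> real"
  assumes p: "1 < p" "1 < q" "1 / p + 1 / q = 1"
    and [measurable]: "a \<in> borel_measurable borel" "b \<in> borel_measurable borel"
    and ab: "set_integrable lborel {0..t} (\<lambda>x. \<bar>a x\<bar> powr q)" "set_integrable lborel {0..t} (\<lambda>x. \<bar>b x\<bar> powr p)"
  shows "set_integrable lborel {0..t} (\<lambda>x. a x * b x)"
proof (rule set_integrable_bound)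
  show "set_integrable lborel {0..t} (\<lambda>x. \<bar>b x\<bar> powr p + \<bar>a x\<bar> powr q)" using ab by auto
  show "AE x in lborel. x \<in> {0..t} \<longrightarrow> norm (a x * b x) \<le> norm (\<bar>b x\<bar> powr p + \<bar>a x\<bar> powr q)"
    using young_scaled[OF p, of 1] by (auto intro!: order_trans[OF _ abs_ge_self])
qed (auto simp: set_borel_measurable_def)

lemma powr_abs_diff_le:
  fixes x y r :: real
  assumes "0 \<le> r"
  shows "\<bar>x - y\<bar> powr r \<le> 2 powr r * (\<bar>x\<bar> powr r + \<bar>y\<bar> powr r)"
proof -
  have "\<bar>x - y\<bar> powr r \<le> (2 * max \<bar>x\<bar> \<bar>y\<bar>) powr r" using assms by (intro powr_mono2) auto
  also have "\<dots> = 2 powr r * (max \<bar>x\<bar> \<bar>y\<bar>) powr r" by (simp add: powr_mult)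
  also have "\<dots> \<le> 2 powr r * (\<bar>x\<bar> powr r + \<bar>y\<bar> powr r)" by (intro mult_left_mono) (auto simp: max_def)
  finally show ?thesis .
qed

lemma space_Bborel: "space (Bborel r t) = Bsp r t"
  and sets_Bborel: "sets (Bborel r t) = sigma_sets (Bsp r t) (Bopen r t)"
proof -
  have *: "Bopen r t \<subseteq> Pow (Bsp r t)" by (auto simp: Bopen_def)
  show "space (Bborel r t) = Bsp r t" "sets (Bborel r t) = sigma_sets (Bsp r t) (Bopen r t)"
    unfolding Bborel_def using space_measure_of[OF *] sets_measure_of[OF *] by auto
qed

text \<open>Pairing with a fixed path is continuous for \<open>Bnorm\<close>, so preimages of open
  sets belong to the generator \<open>Bopen\<close>.\<close>

lemma Bpair_measurable [measurable]:
  assumes p: "1 < p" "1 < q" "1 / p + 1 / q = 1" and t: "0 < t" and \<eta>: "\<eta> \<in> Bsp q t"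
  shows "Bpair t \<eta> \<in> borel_measurable (Bborel p t)"
proof (rule borel_measurableI)
  fix O' :: "real set" assume O': "open O'"
  let ?a = "Bdot t \<eta>"
  note a = Bsp_Bdot[OF \<eta> t]
  have [measurable]: "?a \<in> borel_measurable borel" using a by (auto simp: brep_def)
  define A where "A = (LINT x:{0..t}|lborel. \<bar>?a x\<bar> powr q)"
  have A: "0 \<le> A" unfolding A_def set_lebesgue_integral_def by (intro integral_nonneg_AE) auto
  have "Bpair t \<eta> -` O' \<inter> Bsp p t \<in> Bopen p t"
    unfolding Bopen_def mem_Collect_eq
  proof (intro conjI ballI)
    fix \<gamma> assume "\<gamma> \<in> Bpair t \<eta> -` O' \<inter> Bsp p t"
    then have \<gamma>: "\<gamma> \<in> Bsp p t" "Bpair t \<eta> \<gamma> \<in> O'" by auto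
    obtain e0 where e0: "e0 > 0" "\<And>y. \<bar>y - Bpair t \<eta> \<gamma>\<bar> < e0 \<Longrightarrow> y \<in> O'"
      using O' \<gamma>(2) unfolding open_real by blast
    \<comment> \<open>First \<open>l\<close> is chosen so that the part of Young's bound coming from
      \<open>\<eta>\<close> is below e0 / 2; then the radius \<open>e\<close> keeps the part coming
      from \<open>\<delta> - \<gamma>\<close> below e0 / 2. The summand 1 covers A = 0.\<close>
    define m where "m = ((e0 / 2) / (A + 1)) powr (1 / q)"
    define l where "l = 1 / m"
    have m: "0 < m" "m powr q = (e0 / 2) / (A + 1)" using e0 A p by (auto simp: m_def powr_powr)
    have l: "0 < l" "(1 / l) powr q * A < e0 / 2"
    proof -
      show "0 < l" using m by (simp add: l_def)
      have "(1 / l) powr q * A = (e0 / 2) / (A + 1) * A" using m by (simp add: l_def)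
      also have "\<dots> < e0 / 2" using e0 A by (simp add: field_simps)
      finally show "(1 / l) powr q * A < e0 / 2" .
    qed
    define e where "e = ((e0 / 2) powr (1 / p)) / l"
    have e: "0 < e" "l powr p * e powr p = e0 / 2"
    proof -
      show "0 < e" using l e0 by (simp add: e_def)
      have "l powr p * e powr p = (l * e) powr p" by (rule powr_mult[symmetric])
      also have "l * e = (e0 / 2) powr (1 / p)" using l by (simp add: e_def)
      also have "\<dots> powr p = e0 / 2" using e0 p by (simp add: powr_powr)
      finally show "l powr p * e powr p = e0 / 2" .
    qed
    show "\<exists>e>0. {\<delta> \<in> Bsp p t. Bnorm p t (\<delta> - \<gamma>) < e} \<subseteq> Bpair t \<eta> -` O' \<inter> Bsp p t"
    proof (intro exI[of _ e] conjI subsetI)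
      fix \<delta> assume "\<delta> \<in> {\<delta> \<in> Bsp p t. Bnorm p t (\<delta> - \<gamma>) < e}"
      then have \<delta>: "\<delta> \<in> Bsp p t" "Bnorm p t (\<delta> - \<gamma>) < e" by auto
      note g = Bsp_Bdot[OF \<gamma>(1) t] and d = Bsp_Bdot[OF \<delta>(1) t]
      let ?b = "\<lambda>x. Bdot t \<delta> x - Bdot t \<gamma> x"
      have [measurable]: "Bdot t \<gamma> \<in> borel_measurable borel" "Bdot t \<delta> \<in> borel_measurable borel"
        using g d by (auto simp: brep_def)
      have bp: "set_integrable lborel {0..t} (\<lambda>x. \<bar>?b x\<bar> powr p)"
      proof (rule set_integrable_bound)
        show "set_integrable lborel {0..t} (\<lambda>x. 2 powr p * (\<bar>Bdot t \<delta> x\<bar> powr p + \<bar>Bdot t \<gamma> x\<bar> powr p))"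
          by (intro set_integrable_mult_right set_integral_add g d)
        show "AE x in lborel. x \<in> {0..t} \<longrightarrow> norm (\<bar>?b x\<bar> powr p) \<le> norm (2 powr p * (\<bar>Bdot t \<delta> x\<bar> powr p + \<bar>Bdot t \<gamma> x\<bar> powr p))"
          using powr_abs_diff_le[of p] p by auto
      qed (auto simp: set_borel_measurable_def)
      define I where "I = (LINT x:{0..t}|lborel. \<bar>?b x\<bar> powr p)"
      have I: "0 \<le> I" unfolding I_def set_lebesgue_integral_def by (intro integral_nonneg_AE) auto
      have "I powr (1 / p) < e" using \<delta>(2) Bnorm_eq[OF brep_diff[OF g(1) d(1)] t] unfolding I_def by simp
      then have "(I powr (1 / p)) powr p < e powr p" using p by (intro powr_less_mono2) auto
      then have Ie: "I < e powr p" using I p by (simp add: powr_powr)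
      have ad: "set_integrable lborel {0..t} (\<lambda>x. ?a x * Bdot t \<delta> x)" "set_integrable lborel {0..t} (\<lambda>x. ?a x * Bdot t \<gamma> x)"
          "set_integrable lborel {0..t} (\<lambda>x. ?a x * ?b x)"
        by (rule set_integrable_mult_conjugate[OF p]; use a g d bp in simp)+
      have "\<bar>Bpair t \<eta> \<delta> - Bpair t \<eta> \<gamma>\<bar> = \<bar>LINT x:{0..t}|lborel. ?a x * ?b x\<bar>"
        unfolding Bpair_eq[OF a(1) g(1) t] Bpair_eq[OF a(1) d(1) t] set_integral_diff(2)[OF ad(1,2), symmetric]
        by (simp add: right_diff_distrib)
      also have "\<dots> \<le> (LINT x:{0..t}|lborel. \<bar>?a x * ?b x\<bar>)"
        using integral_abs_bound[of lborel "\<lambda>x. indicator {0..t} x *\<^sub>R (?a x * ?b x)"] unfolding set_lebesgue_integral_def by (simp add: abs_mult)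
      also have "\<dots> \<le> (LINT x:{0..t}|lborel. l powr p * \<bar>?b x\<bar> powr p + (1 / l) powr q * \<bar>?a x\<bar> powr q)"
        by (intro set_integral_mono set_integrable_abs set_integral_add set_integrable_mult_right ad bp a young_scaled p l)
      also have "\<dots> = l powr p * I + (1 / l) powr q * A"
        unfolding I_def A_def using bp a by (subst set_integral_add(2)) auto
      also have "\<dots> < e0 / 2 + e0 / 2"
      proof (intro add_strict_mono l)
        have "l powr p * I < l powr p * e powr p" using Ie l by (intro mult_strict_left_mono) auto
        then show "l powr p * I < e0 / 2" unfolding e(2) .
      qed
      finally have "Bpair t \<eta> \<delta> \<in> O'" by (intro e0(2)) simp
      then show "\<delta> \<in> Bpair t \<eta> -` O' \<inter> Bsp p t" using \<delta>(1) by simp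
    qed (rule e(1))
  qed auto
  then show "Bpair t \<eta> -` O' \<inter> space (Bborel p t) \<in> sets (Bborel p t)"
    unfolding space_Bborel sets_Bborel by (rule sigma_sets.Basic)
qed

subsection \<open>Complex measures represented by densities\<close>

text \<open>The image of the smaller weight \<open>v\<close> is dominated setwise by
  \<open>M\<close>, the image of the modulus of \<open>w\<close>, hence absolutely continuous;
  \<open>D\<close> is its Radon-Nikodym density.\<close>

lemma pushforward_density_part:
  fixes w :: "'a \<Rightarrow> complex" and v :: "'a \<Rightarrow> real"
  assumes w: "integrable P w" and \<Gamma>[measurable]: "\<Gamma> \<in> measurable P K"
    and v[measurable]: "v \<in> borel_measurable P" and vw: "\<And>x. 0 \<le> v x" "\<And>x. v x \<le> cmod (w x)"
    and M: "M = distr (density P (\<lambda>x. ennreal (cmod (w x)))) K \<Gamma>" and fin: "finite_measure M"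
  obtains D where "integrable M D" "\<And>\<phi> :: 'b \<Rightarrow> complex. \<phi> \<in> borel_measurable K \<Longrightarrow>
    (LINT x|M. \<phi> x * complex_of_real (D x)) = (LINT x|P. \<phi> (\<Gamma> x) * complex_of_real (v x))"
proof -
  have [measurable]: "w \<in> borel_measurable P" using w by auto
  define N where "N = distr (density P (\<lambda>x. ennreal (v x))) K \<Gamma>"
  have sM [measurable_cong]: "sets M = sets K" by (simp add: M)
  have sN [measurable_cong]: "sets N = sets K" by (simp add: N_def)
  interpret M: finite_measure M by fact
  have N_le: "emeasure N A \<le> emeasure M A" if A: "A \<in> sets K" for A
  proof -
    have [measurable]: "A \<in> sets K" by fact
    have "emeasure N A = (\<integral>\<^sup>+x. ennreal (v x) * indicator (\<Gamma> -` A \<inter> space P) x \<partial>P)"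
      unfolding N_def by (subst emeasure_distr) (auto simp: emeasure_density)
    also have "\<dots> \<le> (\<integral>\<^sup>+x. ennreal (cmod (w x)) * indicator (\<Gamma> -` A \<inter> space P) x \<partial>P)"
      by (intro nn_integral_mono mult_right_mono ennreal_leI vw) simp
    also have "\<dots> = emeasure M A"
      unfolding M by (subst emeasure_distr) (auto simp: emeasure_density)
    finally show ?thesis .
  qed
  have finN: "finite_measure N"
  proof
    have "emeasure N (space N) \<le> emeasure M (space M)"
      using N_le[of "space K"] sets_eq_imp_space_eq[OF sM] sets_eq_imp_space_eq[OF sN] by simp
    then show "emeasure N (space N) \<noteq> \<infinity>" using M.emeasure_finite[of "space M"] by (auto simp: top_unique)
  qed
  have ac: "absolutely_continuous M N"
    unfolding absolutely_continuous_def
  proof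
    fix A assume "A \<in> null_sets M"
    then show "A \<in> null_sets N"
      using N_le[of A] sM sN by (auto simp: null_sets_def)
  qed
  have sNM: "sets N = sets M" by (simp add: sM sN)
  obtain D where D[measurable]: "D \<in> borel_measurable M" and DAE: "AE x in M. RN_deriv M N x = ennreal (D x)"
    and D0: "\<And>x. 0 \<le> D x"
    using M.real_RN_deriv[OF finN ac sNM] by metis
  have dens: "N = density M (\<lambda>x. ennreal (D x))"
  proof -
    have "density M (RN_deriv M N) = density M (\<lambda>x. ennreal (D x))"
      using DAE by (intro density_cong) auto
    then show ?thesis using M.density_RN_deriv[OF ac sNM] by simp
  qed
  show thesis
  proof (rule that)
    interpret N: finite_measure N by fact
    have "integrable N (\<lambda>_. 1::real)" by simp
    then show "integrable M D"
      unfolding dens by (subst (asm) integrable_density) (use D0 in auto)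
    fix \<phi> :: "'b \<Rightarrow> complex" assume [measurable]: "\<phi> \<in> borel_measurable K"
    have "(LINT x|M. \<phi> x * complex_of_real (D x)) = (LINT x|N. \<phi> x)"
      unfolding dens by (subst integral_density) (use D0 in \<open>auto simp: scaleR_conv_of_real mult.commute\<close>)
    also have "\<dots> = (LINT x|P. \<phi> (\<Gamma> x) * complex_of_real (v x))"
      unfolding N_def using vw
      by (subst integral_distr, simp, simp, subst integral_density) (auto simp: scaleR_conv_of_real mult.commute)
    finally show "(LINT x|M. \<phi> x * complex_of_real (D x)) = (LINT x|P. \<phi> (\<Gamma> x) * complex_of_real (v x))" .
  qed
qed

text \<open>\<open>FB_rep\<close> wants a complex measure as a positive finite measure with an
  integrable density. For the image of a complex-weighted measure the modulus of the weight supplies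
  the positive measure, and the complex density is assembled from real ones. Testing against bounded
  functions is enough for both \<open>f\<close> and \<open>I_Phi\<close>.\<close>

lemma pushforward_density:
  fixes w :: "'a \<Rightarrow> complex"
  assumes w: "integrable P w" and \<Gamma>[measurable]: "\<Gamma> \<in> measurable P K"
  obtains M and h :: "'b \<Rightarrow> complex" where "sets M = sets K" "finite_measure M" "integrable M h"
    "\<And>\<phi> B. \<phi> \<in> borel_measurable K \<Longrightarrow> (\<And>x. cmod (\<phi> x) \<le> B) \<Longrightarrow>
      (LINT x|M. \<phi> x * h x) = (LINT x|P. \<phi> (\<Gamma> x) * w x)"
proof -
  have [measurable]: "w \<in> borel_measurable P" using w by auto
  define M where "M = distr (density P (\<lambda>x. ennreal (cmod (w x)))) K \<Gamma>"
  have sM [measurable_cong]: "sets M = sets K" by (simp add: M_def)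
  have fin: "finite_measure M"
  proof
    have "emeasure M (space M) = (\<integral>\<^sup>+x. ennreal (cmod (w x)) * indicator (\<Gamma> -` space K \<inter> space P) x \<partial>P)"
      unfolding M_def by (subst emeasure_distr) (auto simp: emeasure_density)
    also have "\<dots> \<le> (\<integral>\<^sup>+x. ennreal (cmod (w x)) \<partial>P)"
      by (intro nn_integral_mono) (auto simp: indicator_def)
    also have "\<dots> < \<infinity>" using w by (auto simp: integrable_iff_bounded)
    finally show "emeasure M (space M) \<noteq> \<infinity>" by simp
  qed
  interpret M: finite_measure M by fact
  note part = pushforward_density_part[OF w \<Gamma> _ _ _ M_def fin]
  \<comment> \<open>Positive and negative parts of the real and imaginary parts: four nonnegative
    weights, each at most the modulus of \<open>w\<close>.\<close>
  define v where "v i x = (if i = (0::nat) then max 0 (Re (w x)) else if i = 1 then max 0 (- Re (w x))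
     else if i = 2 then max 0 (Im (w x)) else max 0 (- Im (w x)))" for i x
  have [measurable]: "v i \<in> borel_measurable P" for i unfolding v_def by measurable
  have v: "0 \<le> v i x" "v i x \<le> cmod (w x)" for i x
    using abs_Re_le_cmod[of "w x"] abs_Im_le_cmod[of "w x"] by (auto simp: v_def)
  have "\<exists>D. integrable M D \<and> (\<forall>\<phi> :: 'b \<Rightarrow> complex. \<phi> \<in> borel_measurable K \<longrightarrow>
    (LINT x|M. \<phi> x * complex_of_real (D x)) = (LINT x|P. \<phi> (\<Gamma> x) * complex_of_real (v i x)))" for i
    by (rule part[of "v i"]) (use v in auto)
  then obtain D where D: "\<And>i. integrable M (D i)" and Dint: "\<And>i \<phi>. \<phi> \<in> borel_measurable K \<Longrightarrow>
    (LINT x|M. \<phi> x * complex_of_real (D i x)) = (LINT x|P. \<phi> (\<Gamma> x) * complex_of_real (v i x))"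
    by metis
  define h where "h x = complex_of_real (D 0 x) - complex_of_real (D 1 x) + \<i> * complex_of_real (D 2 x) - \<i> * complex_of_real (D 3 x)" for x
  have w_eq: "w x = complex_of_real (v 0 x) - complex_of_real (v 1 x) + \<i> * complex_of_real (v 2 x) - \<i> * complex_of_real (v 3 x)" for x
    by (auto simp: v_def complex_eq_iff)
  have vint: "integrable P (\<lambda>x. complex_of_real (v i x))" for i
    by (rule Bochner_Integration.integrable_bound[OF w]) (use v in auto)
  show thesis
  proof (rule that)
    show "integrable M h" unfolding h_def using D by auto
    fix \<phi> :: "'b \<Rightarrow> complex" and B assume \<phi>[measurable]: "\<phi> \<in> borel_measurable K" and B: "\<And>x. cmod (\<phi> x) \<le> B"
    have i1: "integrable M (\<lambda>x. \<phi> x * complex_of_real (D i x))" for i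
      by (rule integrable_bounded_mult[where B=B]) (use D B in auto)
    have i2: "integrable P (\<lambda>x. \<phi> (\<Gamma> x) * complex_of_real (v i x))" for i
      by (rule integrable_bounded_mult[where B=B]) (use vint B in auto)
    have "(LINT x|M. \<phi> x * h x) = (LINT x|M. \<phi> x * complex_of_real (D 0 x) - \<phi> x * complex_of_real (D 1 x)
      + \<i> * (\<phi> x * complex_of_real (D 2 x)) - \<i> * (\<phi> x * complex_of_real (D 3 x)))"
      unfolding h_def by (intro Bochner_Integration.integral_cong refl) (simp add: algebra_simps)
    also have "\<dots> = (LINT x|P. \<phi> (\<Gamma> x) * complex_of_real (v 0 x)) - (LINT x|P. \<phi> (\<Gamma> x) * complex_of_real (v 1 x))
      + \<i> * (LINT x|P. \<phi> (\<Gamma> x) * complex_of_real (v 2 x)) - \<i> * (LINT x|P. \<phi> (\<Gamma> x) * complex_of_real (v 3 x))"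
      using i1 by (simp add: Dint)
    also have "\<dots> = (LINT x|P. \<phi> (\<Gamma> x) * complex_of_real (v 0 x) - \<phi> (\<Gamma> x) * complex_of_real (v 1 x)
      + \<i> * (\<phi> (\<Gamma> x) * complex_of_real (v 2 x)) - \<i> * (\<phi> (\<Gamma> x) * complex_of_real (v 3 x)))"
      using i2 by simp
    also have "\<dots> = (LINT x|P. \<phi> (\<Gamma> x) * w x)"
      by (intro Bochner_Integration.integral_cong refl) (simp add: w_eq algebra_simps)
    finally show "(LINT x|M. \<phi> x * h x) = (LINT x|P. \<phi> (\<Gamma> x) * w x)" .
  qed (use sM fin in auto)
qed

text \<open>Polar decomposition: the modulus of \<open>h\<close>, normalised by the total variation
  \<open>c\<close>, moves into the measure, and only a multiple of the sign of \<open>h\<close>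
  stays as density. A probability measure permits i.i.d. jumps, and the bound \<open>c\<close>
  controls every factor of the Dyson series.\<close>

lemma bounded_prob_density:
  fixes N :: "real measure" and h :: "real \<Rightarrow> complex"
  assumes sN: "sets N = sets borel" and h: "integrable N h"
  obtains N' and h' :: "real \<Rightarrow> complex" and c where "prob_space N'" "sets N' = sets borel" "h' \<in> borel_measurable borel"
    "0 \<le> c" "\<And>y. cmod (h' y) \<le> c"
    "\<And>\<phi>. \<phi> \<in> borel_measurable borel \<Longrightarrow> (LINT y|N. \<phi> y * h y) = (LINT y|N'. \<phi> y * h' y)"
proof -
  have hN[measurable]: "h \<in> borel_measurable N" using h by auto
  then have [measurable]: "h \<in> borel_measurable borel" using sN by (simp cong: measurable_cong_sets)
  have sN' [measurable_cong]: "sets N = sets borel" by fact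
  define c where "c = (LINT y|N. cmod (h y))"
  have c0: "0 \<le> c" unfolding c_def by simp
  show thesis
  proof (cases "c = 0")
    \<comment> \<open>If the total variation is 0 there is nothing to normalise; any probability
      measure with density 0 represents the zero functional.\<close>
    case True
    have "AE y in N. cmod (h y) = 0"
      using True h integral_nonneg_eq_0_iff_AE[of N "\<lambda>y. cmod (h y)"] by (simp add: c_def)
    then have "(LINT y|N. \<phi> y * h y) = 0" for \<phi> :: "real \<Rightarrow> complex"
      by (intro integral_eq_zero_AE) auto
    then show thesis
      by (intro that[of "return borel 0" "\<lambda>_. 0" 0]) (auto intro: prob_space_return)
  next
    case False
    then have c: "0 < c" using c0 by simp
    define N' where "N' = density N (\<lambda>y. ennreal (cmod (h y) / c))"
    define h' where "h' y = complex_of_real c * sgn (h y)" for y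
    have [measurable]: "h' \<in> borel_measurable borel"
      unfolding h'_def sgn_div_norm by measurable
    have "emeasure N' (space N') = (\<integral>\<^sup>+y. ennreal (cmod (h y) / c) \<partial>N)"
      unfolding N'_def by (subst emeasure_density) (auto intro!: nn_integral_cong)
    also have "\<dots> = ennreal (LINT y|N. cmod (h y) / c)"
      using h c by (intro nn_integral_eq_integral) auto
    also have "(LINT y|N. cmod (h y) / c) = 1" using c by (simp add: c_def)
    finally have "prob_space N'" by (intro prob_spaceI) simp
    moreover have "(LINT y|N. \<phi> y * h y) = (LINT y|N'. \<phi> y * h' y)" if [measurable]: "\<phi> \<in> borel_measurable borel" for \<phi>
    proof -
      have "(LINT y|N'. \<phi> y * h' y) = (LINT y|N. (cmod (h y) / c) *\<^sub>R (\<phi> y * h' y))"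
        unfolding N'_def using c by (intro integral_density) (auto cong: measurable_cong_sets)
      also have "\<dots> = (LINT y|N. \<phi> y * h y)"
        using c by (intro Bochner_Integration.integral_cong refl)
          (auto simp: h'_def sgn_div_norm scaleR_conv_of_real field_simps)
      finally show ?thesis by simp
    qed
    ultimately show thesis
      using c by (intro that[of N' h' c]) (auto simp: N'_def sN h'_def norm_mult norm_sgn)
  qed
qed

subsection \<open>The functional \<open>I_Phi\<close> depends on \<open>f\<close> only\<close>

locale two_densities =
  fixes K M M' :: "'a measure" and h h' :: "'a \<Rightarrow> complex"
  assumes sets_M: "sets M = sets K" and sets_M': "sets M' = sets K"
    and int_h: "integrable M h" and int_h': "integrable M' h'"
begin

lemmas [measurable_cong] = sets_M sets_M'

text \<open>These functions form a vector space closed under bounded pointwise limits: a functional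
  monotone class argument, which starts from exponentials of pairings and ends at the exponential of
  the action. Boundedness is included so that products with \<open>h\<close> and \<open>h'\<close>
  are integrable.\<close>

definition agree :: "('a \<Rightarrow> complex) \<Rightarrow> bool" where
  "agree \<phi> \<longleftrightarrow> \<phi> \<in> borel_measurable K \<and> (\<exists>B. \<forall>x. cmod (\<phi> x) \<le> B) \<and>
    (LINT x|M. \<phi> x * h x) = (LINT x|M'. \<phi> x * h' x)"

lemma agree_integrable:
  assumes "agree \<phi>"
  shows "integrable M (\<lambda>x. \<phi> x * h x)" "integrable M' (\<lambda>x. \<phi> x * h' x)"
proof -
  obtain B where B: "\<And>x. cmod (\<phi> x) \<le> B" and [measurable]: "\<phi> \<in> borel_measurable K" using assms by (auto simp: agree_def)
  show "integrable M (\<lambda>x. \<phi> x * h x)" "integrable M' (\<lambda>x. \<phi> x * h' x)"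
    by (rule integrable_bounded_mult[OF int_h _ B] integrable_bounded_mult[OF int_h' _ B], measurable)+
qed

lemma agree_lincomb:
  assumes "agree \<phi>" "agree \<psi>"
  shows "agree (\<lambda>x. a * \<phi> x + b * \<psi> x)"
proof -
  obtain B C where B: "\<And>x. cmod (\<phi> x) \<le> B" and C: "\<And>x. cmod (\<psi> x) \<le> C" using assms by (auto simp: agree_def)
  have "cmod (a * \<phi> x + b * \<psi> x) \<le> cmod a * B + cmod b * C" for x
    by (rule order_trans[OF norm_triangle_ineq]) (auto simp: norm_mult intro!: add_mono mult_left_mono B C)
  moreover have "(LINT x|M. (a * \<phi> x + b * \<psi> x) * h x) = a * (LINT x|M. \<phi> x * h x) + b * (LINT x|M. \<psi> x * h x)"
    using agree_integrable[OF assms(1)] agree_integrable[OF assms(2)] by (simp add: distrib_right mult.assoc)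
  moreover have "(LINT x|M'. (a * \<phi> x + b * \<psi> x) * h' x) = a * (LINT x|M'. \<phi> x * h' x) + b * (LINT x|M'. \<psi> x * h' x)"
    using agree_integrable[OF assms(1)] agree_integrable[OF assms(2)] by (simp add: distrib_right mult.assoc)
  ultimately show ?thesis using assms unfolding agree_def by (auto intro!: exI[of _ "cmod a * B + cmod b * C"])
qed

lemma agree_0: "agree (\<lambda>_. 0)"
  by (auto simp: agree_def)

lemma agree_sum: "(\<And>i. i \<in> A \<Longrightarrow> agree (\<phi> i)) \<Longrightarrow> agree (\<lambda>x. \<Sum>i\<in>A. a i * \<phi> i x)"
proof (induction A rule: infinite_finite_induct)
  case (insert i A)
  then show ?case using agree_lincomb[of "\<phi> i" "\<lambda>x. \<Sum>i\<in>A. a i * \<phi> i x" "a i" 1] by simp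
qed (auto simp: agree_0)

lemma agree_limit:
  assumes \<phi>: "\<And>n. agree (\<phi> n)" and B: "\<And>n x. cmod (\<phi> n x) \<le> B" and B': "\<And>x. cmod (\<psi> x) \<le> B"
    and lim: "\<And>x. x \<in> space K \<Longrightarrow> (\<lambda>n. \<phi> n x) \<longlonglongrightarrow> \<psi> x"
  shows "agree \<psi>"
  unfolding agree_def
proof (intro conjI exI allI)
  have [measurable]: "\<phi> n \<in> borel_measurable K" for n using \<phi> by (auto simp: agree_def)
  show \<psi>[measurable]: "\<psi> \<in> borel_measurable K"
    by (rule borel_measurable_LIMSEQ_metric[OF _ lim]) auto
  show "cmod (\<psi> x) \<le> B" for x by fact
  have sp: "space M = space K" "space M' = space K" using sets_M sets_M' by (auto dest: sets_eq_imp_space_eq)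
  have 1: "(\<lambda>n. LINT x|M. \<phi> n x * h x) \<longlonglongrightarrow> (LINT x|M. \<psi> x * h x)"
  proof (rule integral_dominated_convergence[where w="\<lambda>x. B * cmod (h x)"])
    show "AE x in M. (\<lambda>n. \<phi> n x * h x) \<longlonglongrightarrow> \<psi> x * h x" by (intro AE_I2 tendsto_intros lim) (simp add: sp)
    show "AE x in M. norm (\<phi> n x * h x) \<le> B * cmod (h x)" for n
      by (auto simp: norm_mult intro!: mult_right_mono B)
  qed (use int_h in auto)
  have 2: "(\<lambda>n. LINT x|M'. \<phi> n x * h' x) \<longlonglongrightarrow> (LINT x|M'. \<psi> x * h' x)"
  proof (rule integral_dominated_convergence[where w="\<lambda>x. B * cmod (h' x)"])
    show "AE x in M'. (\<lambda>n. \<phi> n x * h' x) \<longlonglongrightarrow> \<psi> x * h' x" by (intro AE_I2 tendsto_intros lim) (simp add: sp)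
    show "AE x in M'. norm (\<phi> n x * h' x) \<le> B * cmod (h' x)" for n
      by (auto simp: norm_mult intro!: mult_right_mono B)
  qed (use int_h' in auto)
  have "(LINT x|M. \<phi> n x * h x) = (LINT x|M'. \<phi> n x * h' x)" for n using \<phi> by (auto simp: agree_def)
  then show "(LINT x|M. \<psi> x * h x) = (LINT x|M'. \<psi> x * h' x)"
    using 1 2 LIMSEQ_unique by simp
qed

text \<open>A bounded continuous \<open>\<psi>\<close> is the bounded pointwise limit of the trigonometric polynomials
  \<open>P\<^sub>m (m sin (x / m))\<close>, with \<open>P\<^sub>m\<close> a polynomial close to \<open>\<psi>\<close> on \<open>[-m, m]\<close>.\<close>

lemma agree_sin_power:
  fixes X :: "'a \<Rightarrow> real"
  assumes "\<And>b. agree (\<lambda>x. G x * exp (\<i> * complex_of_real (b * X x)))"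
  shows "agree (\<lambda>x. G x * complex_of_real (sin (d * X x) ^ l) * exp (\<i> * complex_of_real (b * X x)))"
proof (induction l arbitrary: b)
  case 0
  then show ?case using assms by simp
next
  case (Suc l)
  have s: "complex_of_real (sin y) = (exp (\<i> * complex_of_real y) - exp (- (\<i> * complex_of_real y))) / (2 * \<i>)" for y
    using sin_exp_eq[of "complex_of_real y"] by (simp add: sin_of_real)
  have "G x * complex_of_real (sin (d * X x) ^ Suc l) * exp (\<i> * complex_of_real (b * X x))
    = (1 / (2 * \<i>)) * (G x * complex_of_real (sin (d * X x) ^ l) * exp (\<i> * complex_of_real ((b + d) * X x)))
    + (- 1 / (2 * \<i>)) * (G x * complex_of_real (sin (d * X x) ^ l) * exp (\<i> * complex_of_real ((b - d) * X x)))" for x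
  proof -
    have e: "exp (\<i> * complex_of_real ((b + d) * X x)) = exp (\<i> * complex_of_real (d * X x)) * exp (\<i> * complex_of_real (b * X x))"
      "exp (\<i> * complex_of_real ((b - d) * X x)) = exp (- (\<i> * complex_of_real (d * X x))) * exp (\<i> * complex_of_real (b * X x))"
      by (simp_all add: exp_add[symmetric] algebra_simps)
    have sl: "complex_of_real (sin (d * X x) ^ Suc l) = complex_of_real (sin (d * X x) ^ l) * ((exp (\<i> * complex_of_real (d * X x)) - exp (- (\<i> * complex_of_real (d * X x)))) / (2 * \<i>))"
      unfolding s[symmetric] by simp
    have aux: "g * (S * ((P - Q) / (2 * \<i>))) * E = 1 / (2 * \<i>) * (g * S * (P * E)) + - 1 / (2 * \<i>) * (g * S * (Q * E))"
      for g S P Q E :: complex by (simp add: field_simps)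
    show ?thesis by (simp only: sl e aux)
  qed
  then show ?case using agree_lincomb[OF Suc[of "b + d"] Suc[of "b - d"], of "1 / (2 * \<i>)" "- 1 / (2 * \<i>)"] by simp
qed

lemma tendsto_mult_sin_divide: "(\<lambda>n. real (Suc n) * sin (x / real (Suc n))) \<longlonglongrightarrow> x"
proof -
  have "((\<lambda>h. sin (x * h)) has_real_derivative cos (x * 0) * x) (at 0)"
    by (auto intro!: derivative_eq_intros)
  then have "((\<lambda>h. sin (x * h) / h) \<longlongrightarrow> x) (at 0)" by (simp add: DERIV_def)
  moreover have "filterlim (\<lambda>n. 1 / real (Suc n)) (at 0) sequentially"
    unfolding filterlim_at using LIMSEQ_Suc[OF lim_1_over_n] by auto
  ultimately have "(\<lambda>n. sin (x * (1 / real (Suc n))) / (1 / real (Suc n))) \<longlonglongrightarrow> x"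
    by (rule filterlim_compose)
  then show ?thesis by (simp add: mult.commute)
qed

text \<open>The factor \<open>G\<close> is carried along so that one coordinate can be treated while
  others are held fixed; \<open>psi\<close> is real because polynomial approximation is applied to
  real functions. Uniform closeness within 1 on the range of m sin (x / m) supplies the common bound
  B + 1.\<close>

lemma agree_real_continuous:
  fixes X :: "'a \<Rightarrow> real" and \<psi> :: "real \<Rightarrow> real"
  assumes G: "\<And>x. cmod (G x) \<le> C" and ag: "\<And>b. agree (\<lambda>x. G x * exp (\<i> * complex_of_real (b * X x)))"
    and \<psi>: "continuous_on UNIV \<psi>" "\<And>y. \<bar>\<psi> y\<bar> \<le> B"
  shows "agree (\<lambda>x. G x * complex_of_real (\<psi> (X x)))"
proof -
  have C0: "0 \<le> C" using G order_trans[OF norm_ge_zero] by blast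
  have "\<exists>P. real_polynomial_function P \<and> (\<forall>y\<in>{- real (Suc m)..real (Suc m)}. \<bar>\<psi> y - P y\<bar> < 1 / real (Suc m))" for m
    using Stone_Weierstrass_real_polynomial_function[of "{- real (Suc m)..real (Suc m)}" \<psi> "1 / real (Suc m)"] continuous_on_subset[OF \<psi>(1)]
    by (metis compact_Icc divide_pos_pos of_nat_0_less_iff subset_UNIV zero_less_Suc zero_less_one)
  then obtain P where P: "\<And>m. real_polynomial_function (P m)"
    and Pc: "\<And>m y. y \<in> {- real (Suc m)..real (Suc m)} \<Longrightarrow> \<bar>\<psi> y - P m y\<bar> < 1 / real (Suc m)" by metis
  define s where "s m x = real (Suc m) * sin (x / real (Suc m))" for m x
  have s_in: "s m x \<in> {- real (Suc m)..real (Suc m)}" for m x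
  proof -
    have "\<bar>s m x\<bar> \<le> real (Suc m) * 1"
      unfolding s_def abs_mult by (intro mult_mono) auto
    then show ?thesis by auto
  qed
  have bnd: "\<bar>P m (s m x)\<bar> \<le> B + 1" for m x
  proof -
    have "\<bar>\<psi> (s m x) - P m (s m x)\<bar> < 1 / real (Suc m)" by (rule Pc[OF s_in])
    also have "\<dots> \<le> 1" by simp
    finally show ?thesis using \<psi>(2)[of "s m x"] by linarith
  qed
  show ?thesis
  proof (rule agree_limit[where \<phi>="\<lambda>m x. G x * complex_of_real (P m (s m (X x)))" and B="C * (B + 1)"])
    fix m
    obtain a n where a: "P m = (\<lambda>x. \<Sum>i\<le>n. a i * x ^ i)"
      using P[of m] by (auto simp: real_polynomial_function_iff_sum)
    have "G x * complex_of_real (P m (s m (X x))) =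
      (\<Sum>i\<le>n. complex_of_real (a i * real (Suc m) ^ i) * (G x * complex_of_real (sin (1 / real (Suc m) * X x) ^ i) * exp (\<i> * complex_of_real (0 * X x))))" for x
      unfolding a s_def by (simp add: sum_distrib_left power_mult_distrib mult_ac)
    then show "agree (\<lambda>x. G x * complex_of_real (P m (s m (X x))))"
      by (simp only:) (intro agree_sum agree_sin_power ag)
    show "cmod (G x * complex_of_real (P m (s m (X x)))) \<le> C * (B + 1)" for x
      unfolding norm_mult norm_of_real by (intro mult_mono G bnd C0) auto
  next
    fix x
    have "\<bar>\<psi> (X x)\<bar> \<le> B + 1" using \<psi>(2)[of "X x"] by simp
    then show "cmod (G x * complex_of_real (\<psi> (X x))) \<le> C * (B + 1)"
      unfolding norm_mult norm_of_real by (intro mult_mono G C0) auto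
    have 1: "(\<lambda>m. \<psi> (s m (X x))) \<longlonglongrightarrow> \<psi> (X x)"
      using \<psi>(1) tendsto_mult_sin_divide[of "X x"] unfolding s_def
      by (auto simp: continuous_on_eq_continuous_at intro: isCont_tendsto_compose)
    have 2: "(\<lambda>m. \<psi> (s m (X x)) - P m (s m (X x))) \<longlonglongrightarrow> 0"
    proof (rule Lim_null_comparison)
      show "\<forall>\<^sub>F m in sequentially. norm (\<psi> (s m (X x)) - P m (s m (X x))) \<le> 1 / real (Suc m)"
        using Pc[OF s_in] by (auto intro!: always_eventually less_imp_le)
      show "(\<lambda>m. 1 / real (Suc m)) \<longlonglongrightarrow> 0" by (rule LIMSEQ_Suc[OF lim_1_over_n])
    qed
    have "(\<lambda>m. P m (s m (X x))) \<longlonglongrightarrow> \<psi> (X x)" using tendsto_diff[OF 1 2] by simp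
    then show "(\<lambda>m. G x * complex_of_real (P m (s m (X x)))) \<longlonglongrightarrow> G x * complex_of_real (\<psi> (X x))"
      by (intro tendsto_intros)
  qed
qed

lemma agree_continuous:
  fixes X :: "'a \<Rightarrow> real" and \<psi> :: "real \<Rightarrow> complex"
  assumes G: "\<And>x. cmod (G x) \<le> C" and ag: "\<And>b. agree (\<lambda>x. G x * exp (\<i> * complex_of_real (b * X x)))"
    and \<psi>: "continuous_on UNIV \<psi>" "\<And>y. cmod (\<psi> y) \<le> B"
  shows "agree (\<lambda>x. G x * \<psi> (X x))"
proof -
  have "agree (\<lambda>x. G x * complex_of_real (Re (\<psi> (X x))))"
    by (rule agree_real_continuous[OF G ag, where B=B])
       (auto intro!: continuous_intros \<psi> order_trans[OF abs_Re_le_cmod])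
  moreover have "agree (\<lambda>x. G x * complex_of_real (Im (\<psi> (X x))))"
    by (rule agree_real_continuous[OF G ag, where B=B])
       (auto intro!: continuous_intros \<psi> order_trans[OF abs_Im_le_cmod])
  ultimately have "agree (\<lambda>x. 1 * (G x * complex_of_real (Re (\<psi> (X x)))) + \<i> * (G x * complex_of_real (Im (\<psi> (X x)))))"
    by (rule agree_lincomb)
  moreover have "1 * (G x * complex_of_real (Re (\<psi> (X x)))) + \<i> * (G x * complex_of_real (Im (\<psi> (X x)))) = G x * \<psi> (X x)" for x
  proof -
    have "1 * (G x * complex_of_real (Re (\<psi> (X x)))) + \<i> * (G x * complex_of_real (Im (\<psi> (X x))))
      = G x * (complex_of_real (Re (\<psi> (X x))) + \<i> * complex_of_real (Im (\<psi> (X x))))" by (simp add: distrib_left mult_ac)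
    then show ?thesis by (simp only: complex_eq[symmetric])
  qed
  ultimately show ?thesis by simp
qed

text \<open>The coordinates are exchanged one at a time. After \<open>j\<close> steps the first
  \<open>j\<close> carry \<open>\<psi>\<close> and the others are still exponentials with free
  coefficients, so the frequency \<open>b\<close> demanded for coordinate \<open>j\<close> is
  absorbed by changing \<open>c\<close> at \<open>j\<close>.\<close>

lemma agree_prod_continuous:
  fixes X :: "nat \<Rightarrow> 'a \<Rightarrow> real" and \<psi> :: "real \<Rightarrow> complex"
  assumes ag: "\<And>c. agree (\<lambda>x. exp (\<i> * complex_of_real (\<Sum>i<n. c i * X i x)))"
    and \<psi>: "continuous_on UNIV \<psi>" "\<And>y. cmod (\<psi> y) \<le> 1"
  shows "agree (\<lambda>x. \<Prod>i<n. \<psi> (X i x))"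
proof -
  have "agree (\<lambda>x. (\<Prod>i<j. \<psi> (X i x)) * exp (\<i> * complex_of_real (\<Sum>i\<in>{j..<n}. c i * X i x)))" if "j \<le> n" for j c
    using that
  proof (induction j arbitrary: c)
    case 0
    then show ?case using ag[of c] by (simp add: lessThan_atLeast0)
  next
    case (Suc j)
    let ?G = "\<lambda>x. (\<Prod>i<j. \<psi> (X i x)) * exp (\<i> * complex_of_real (\<Sum>i\<in>{Suc j..<n}. c i * X i x))"
    have "agree (\<lambda>x. ?G x * \<psi> (X j x))"
    proof (rule agree_continuous[OF _ _ \<psi>, where C=1])
      show "cmod (?G x) \<le> 1" for x
        using \<psi>(2) by (auto simp: norm_mult prod_norm[symmetric] intro!: prod_le_1)
      fix b
      have "?G x * exp (\<i> * complex_of_real (b * X j x)) = (\<Prod>i<j. \<psi> (X i x)) * exp (\<i> * complex_of_real (\<Sum>i\<in>{j..<n}. (c(j := b)) i * X i x))" for x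
      proof -
        have "{j..<n} = insert j {Suc j..<n}" using Suc.prems by auto
        then have "(\<Sum>i\<in>{j..<n}. (c(j := b)) i * X i x) = b * X j x + (\<Sum>i\<in>{Suc j..<n}. c i * X i x)"
          by (simp add: sum.insert)
        moreover have "exp (\<i> * complex_of_real (y + z)) = exp (\<i> * complex_of_real z) * exp (\<i> * complex_of_real y)" for y z
          by (simp add: exp_add distrib_left mult.commute)
        ultimately show ?thesis by (simp only: mult.assoc)
      qed
      then show "agree (\<lambda>x. ?G x * exp (\<i> * complex_of_real (b * X j x)))"
        using Suc.IH[of "c(j := b)"] Suc.prems by (simp only: Suc_leD)
    qed
    then show ?case by (simp add: mult_ac)
  qed
  from this[of n] show ?thesis by simp
qed

end

lemma cell_avg_eq_Bpair:
  assumes t: "0 < t" and j: "j < n" and \<gamma>: "brep t \<gamma> g"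
  shows "cell_avg t n g j = real n / t * Bpair t (bpath t (indicator (pt_cell t n j))) \<gamma>"
proof -
  have "brep t (bpath t (indicator (pt_cell t n j))) (indicator (pt_cell t n j))"
    by (intro brep_bpath set_integrable_bounded_Icc[where B=1]) (auto simp: indicator_def)
  then have "Bpair t (bpath t (indicator (pt_cell t n j))) \<gamma> = (LINT x:{0..t}|lborel. indicator (pt_cell t n j) x * g x)"
    by (rule Bpair_eq[OF _ \<gamma> t])
  also have "\<dots> = (LINT x:pt_cell t n j|lborel. g x)"
    unfolding set_lebesgue_integral_def using pt_cell_subset[OF t j]
    by (intro Bochner_Integration.integral_cong refl) (auto simp: indicator_def)
  finally show ?thesis by (simp add: cell_avg_def)
qed

text \<open>Cell averages are pairings, and their p-th powers sum to the action in the limit, so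
  \<open>agree_limit\<close> reaches the exponential of the action. The second sign condition is
  stated for arbitrary \<open>g\<close> because \<open>agree\<close> asks for a bound on the whole
  function type, not only on the space of paths.\<close>

theorem FB_rep_action_unique:
  fixes p :: nat and \<beta> :: complex and f :: "(real \<Rightarrow> real) \<Rightarrow> complex"
  assumes t: "0 < t" and p: "2 \<le> p" and q: "q = real p / (real p - 1)"
    and \<beta>: "\<And>y :: real. Re (\<beta> * complex_of_real (y ^ p)) \<le> 0" 
      "\<And>g :: real \<Rightarrow> real. Re (\<beta> * complex_of_real (LBINT s=0..t. g s ^ p)) \<le> 0"
    and rep: "FB_rep (real p) q t f M h" "FB_rep (real p) q t f M' h'"
  shows "(\<lambda>\<gamma>. exp (\<beta> * complex_of_real (LBINT s=0..t. Bdot t \<gamma> s ^ p))) \<in> borel_measurable (Bborel (real p) t)"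
    "(LINT \<gamma>|M. exp (\<beta> * complex_of_real (LBINT s=0..t. Bdot t \<gamma> s ^ p)) * h \<gamma>)
    = (LINT \<gamma>|M'. exp (\<beta> * complex_of_real (LBINT s=0..t. Bdot t \<gamma> s ^ p)) * h' \<gamma>)"
proof -
  have pq: "1 < real p" "1 < q" "1 / real p + 1 / q = 1" using p by (auto simp: q field_simps)
  let ?K = "Bborel (real p) t"
  interpret two_densities ?K M M' h h'
    using rep by unfold_locales (auto simp: FB_rep_def)
  let ?\<Delta> = "\<lambda>n j \<gamma>. cell_avg t n (Bdot t \<gamma>) j"
  let ?F = "\<lambda>\<gamma>. exp (\<beta> * complex_of_real (LBINT s=0..t. Bdot t \<gamma> s ^ p))"
  have Bsp_brep: "brep t \<gamma> (Bdot t \<gamma>)" if "\<gamma> \<in> Bsp (real p) t" for \<gamma> by (rule Bsp_Bdot[OF that t])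
  \<comment> \<open>A linear combination of pairings with cell paths is a single pairing with the
    path \<open>?\<eta>\<close> whose derivative is the corresponding step function. There both
    representations return the same value \<open>f ?\<eta>\<close>.\<close>
  have exp_agree: "agree (\<lambda>\<gamma>. exp (\<i> * complex_of_real (\<Sum>j<n. c j * Bpair t (bpath t (indicator (pt_cell t n j))) \<gamma>)))" for n and c :: "nat \<Rightarrow> real"
  proof -
    let ?a = "\<lambda>x. \<Sum>j<n. c j * indicator (pt_cell t n j) x"
    let ?\<eta> = "bpath t ?a"
    let ?S = "\<lambda>\<gamma>. \<Sum>j<n. c j * Bpair t (bpath t (indicator (pt_cell t n j))) \<gamma>"
    have ind: "bpath t (indicator (pt_cell t n j)) \<in> Bsp q t" for j
      by (rule bpath_in_Bsp[where B=1]) (use pq in \<open>auto simp: indicator_def\<close>)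
    have [measurable]: "?a \<in> borel_measurable borel" by measurable
    have bnd: "\<bar>?a x\<bar> \<le> (\<Sum>j<n. \<bar>c j\<bar>)" for x
      by (rule order_trans[OF sum_abs]) (auto intro!: sum_mono simp: indicator_def)
    have \<eta>: "?\<eta> \<in> Bsp q t"
      by (rule bpath_in_Bsp[OF _ bnd]) (measurable, use pq in simp)
    have \<eta>rep: "brep t ?\<eta> ?a"
      by (intro brep_bpath set_integrable_bounded_Icc[where B="\<Sum>j<n. \<bar>c j\<bar>"]) (measurable, simp only: real_norm_def bnd)
    have eq: "?S \<gamma> = Bpair t ?\<eta> \<gamma>" if \<gamma>: "\<gamma> \<in> Bsp (real p) t" for \<gamma>
    proof -
      note g = Bsp_brep[OF \<gamma>]
      have jrep: "brep t (bpath t (indicator (pt_cell t n j))) (indicator (pt_cell t n j))" for j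
        by (intro brep_bpath set_integrable_bounded_Icc[where B=1]) (auto simp: indicator_def)
      have jint: "set_integrable lborel {0..t} (\<lambda>x. indicator (pt_cell t n j) x * Bdot t \<gamma> x)" for j
        by (rule set_integrable_bound[where f="Bdot t \<gamma>"])
           (use g in \<open>auto simp: brep_def set_borel_measurable_def indicator_def\<close>)
      have "Bpair t ?\<eta> \<gamma> = (LINT x:{0..t}|lborel. \<Sum>j<n. c j * (indicator (pt_cell t n j) x * Bdot t \<gamma> x))"
        unfolding Bpair_eq[OF \<eta>rep g t] by (simp only: sum_distrib_right mult.assoc)
      also have "\<dots> = (\<Sum>j<n. LINT x:{0..t}|lborel. c j * (indicator (pt_cell t n j) x * Bdot t \<gamma> x))"
        unfolding set_lebesgue_integral_def scaleR_sum_right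
        by (intro Bochner_Integration.integral_sum) (use set_integrable_mult_right[OF jint] in \<open>auto simp: set_integrable_def\<close>)
      also have "\<dots> = ?S \<gamma>"
        by (simp add: Bpair_eq[OF jrep g t])
      finally show ?thesis by simp
    qed
    have sp: "space M = Bsp (real p) t" "space M' = Bsp (real p) t"
      using sets_M sets_M' by (auto dest: sets_eq_imp_space_eq simp: space_Bborel)
    have "(LINT \<gamma>|M. exp (\<i> * complex_of_real (?S \<gamma>)) * h \<gamma>) = f ?\<eta>"
    proof -
      have "(LINT \<gamma>|M. exp (\<i> * complex_of_real (?S \<gamma>)) * h \<gamma>) = (LINT \<gamma>|M. exp (\<i> * complex_of_real (Bpair t ?\<eta> \<gamma>)) * h \<gamma>)"
        by (rule Bochner_Integration.integral_cong[OF refl]) (simp only: sp eq)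
      moreover have "\<forall>\<eta>\<in>Bsp q t. f \<eta> = (LINT \<gamma>|M. exp (\<i> * complex_of_real (Bpair t \<eta> \<gamma>)) * h \<gamma>)"
        using rep(1) unfolding FB_rep_def by blast
      from bspec[OF this \<eta>] have "f ?\<eta> = (LINT \<gamma>|M. exp (\<i> * complex_of_real (Bpair t ?\<eta> \<gamma>)) * h \<gamma>)" .
      ultimately show ?thesis by (simp only:)
    qed
    moreover have "(LINT \<gamma>|M'. exp (\<i> * complex_of_real (?S \<gamma>)) * h' \<gamma>) = f ?\<eta>"
    proof -
      have "(LINT \<gamma>|M'. exp (\<i> * complex_of_real (?S \<gamma>)) * h' \<gamma>) = (LINT \<gamma>|M'. exp (\<i> * complex_of_real (Bpair t ?\<eta> \<gamma>)) * h' \<gamma>)"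
        by (rule Bochner_Integration.integral_cong[OF refl]) (simp only: sp eq)
      moreover have "\<forall>\<eta>\<in>Bsp q t. f \<eta> = (LINT \<gamma>|M'. exp (\<i> * complex_of_real (Bpair t \<eta> \<gamma>)) * h' \<gamma>)"
        using rep(2) unfolding FB_rep_def by blast
      from bspec[OF this \<eta>] have "f ?\<eta> = (LINT \<gamma>|M'. exp (\<i> * complex_of_real (Bpair t ?\<eta> \<gamma>)) * h' \<gamma>)" .
      ultimately show ?thesis by (simp only:)
    qed
    moreover have "(\<lambda>\<gamma>. exp (\<i> * complex_of_real (?S \<gamma>))) \<in> borel_measurable ?K"
      using Bpair_measurable[OF pq t ind] by measurable
    moreover have "\<forall>\<gamma>. cmod (exp (\<i> * complex_of_real (?S \<gamma>))) \<le> 1" by (intro allI) (simp only: norm_exp_ii_times order_refl)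
    ultimately show ?thesis unfolding agree_def by (intro conjI exI[of _ 1]) (assumption | simp only:)+
  qed
  have Re1: "cmod (exp z) \<le> 1" if "Re z \<le> 0" for z using that by simp
  \<comment> \<open>The factor for a cell is the exponential of the action of a path moving there
    with the average speed. As Re (\<beta> y^p) \<le> 0, all factors lie in the unit disc, which
    bounds the product independently of \<open>n\<close>.\<close>
  define G where "G n \<gamma> = (\<Prod>j<n. exp (\<beta> * complex_of_real ((t / real n) * (real n / t * Bpair t (bpath t (indicator (pt_cell t n j))) \<gamma>) ^ p)))" for n \<gamma>
  have G_agree: "agree (G n)" for n
    unfolding G_def
  proof (rule agree_prod_continuous[OF exp_agree, where \<psi>="\<lambda>y. exp (\<beta> * complex_of_real ((t / real n) * (real n / t * y) ^ p))"])
    show "cmod (exp (\<beta> * complex_of_real ((t / real n) * (real n / t * y) ^ p))) \<le> 1" for y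
    proof (rule Re1)
      have "Re (\<beta> * complex_of_real ((t / real n) * (real n / t * y) ^ p)) = t / real n * Re (\<beta> * complex_of_real ((real n / t * y) ^ p))"
        by (simp add: algebra_simps)
      also have "\<dots> \<le> 0" using \<beta>(1)[of "real n / t * y"] t by (intro mult_nonneg_nonpos) auto
      finally show "Re (\<beta> * complex_of_real ((t / real n) * (real n / t * y) ^ p)) \<le> 0" .
    qed
  qed (intro continuous_intros)
  have agF: "agree ?F"
  proof (rule agree_limit[OF G_agree, where B=1])
    show "cmod (G n \<gamma>) \<le> 1" for n \<gamma>
      unfolding G_def prod_norm[symmetric]
    proof (intro prod_le_1 conjI Re1)
      fix j
      have "Re (\<beta> * complex_of_real ((t / real n) * (real n / t * Bpair t (bpath t (indicator (pt_cell t n j))) \<gamma>) ^ p))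
        = t / real n * Re (\<beta> * complex_of_real ((real n / t * Bpair t (bpath t (indicator (pt_cell t n j))) \<gamma>) ^ p))"
        by (simp add: algebra_simps)
      also have "\<dots> \<le> 0" using \<beta>(1) t by (intro mult_nonneg_nonpos) auto
      finally show "Re (\<beta> * complex_of_real ((t / real n) * (real n / t * Bpair t (bpath t (indicator (pt_cell t n j))) \<gamma>) ^ p)) \<le> 0" .
    qed simp
    show "cmod (?F \<gamma>) \<le> 1" for \<gamma> by (rule Re1) (rule \<beta>(2))
    fix \<gamma> assume "\<gamma> \<in> space ?K"
    then have \<gamma>: "\<gamma> \<in> Bsp (real p) t" by (simp add: space_Bborel)
    note g = Bsp_Bdot[OF \<gamma> t]
    have gp: "set_integrable lborel {0<..t} (\<lambda>x. \<bar>Bdot t \<gamma> x\<bar> ^ p)"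
    proof -
      have "\<bar>y\<bar> powr real p = \<bar>y\<bar> ^ p" for y :: real using p by (cases "y = 0") (auto simp: powr_realpow)
      then have "set_integrable lborel {0..t} (\<lambda>x. \<bar>Bdot t \<gamma> x\<bar> ^ p)" using g(2) by simp
      then show ?thesis by (rule set_integrable_subset) auto
    qed
    have gi: "set_integrable lborel {0<..t} (Bdot t \<gamma>)"
      by (rule set_integrable_subset[where A="{0..t}"]) (use g(1) in \<open>auto simp: brep_def\<close>)
    have "(\<lambda>n. \<Sum>j<n. t / real n * ?\<Delta> n j \<gamma> ^ p) \<longlonglongrightarrow> (LINT x:{0<..t}|lborel. Bdot t \<gamma> x ^ p)"
      by (rule cell_avg_power_tendsto[OF t _ _ gi gp]) (use g p in \<open>auto simp: brep_def\<close>)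
    also have "(LINT x:{0<..t}|lborel. Bdot t \<gamma> x ^ p) = (LBINT s=0..t. Bdot t \<gamma> s ^ p)"
      using interval_integral_Ioc[of 0 t "\<lambda>s. Bdot t \<gamma> s ^ p"] t by (simp add: zero_ereal_def)
    finally have "(\<lambda>n. exp (\<beta> * complex_of_real (\<Sum>j<n. t / real n * ?\<Delta> n j \<gamma> ^ p))) \<longlonglongrightarrow> ?F \<gamma>"
      by (intro tendsto_intros)
    moreover have "exp (\<beta> * complex_of_real (\<Sum>j<n. t / real n * ?\<Delta> n j \<gamma> ^ p)) = G n \<gamma>" for n
      unfolding G_def using cell_avg_eq_Bpair[OF t _ g(1)] by (simp add: exp_sum sum_distrib_left)
    ultimately show "(\<lambda>n. G n \<gamma>) \<longlonglongrightarrow> ?F \<gamma>" by simp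
  qed
  then show "?F \<in> borel_measurable ?K" "(LINT \<gamma>|M. ?F \<gamma> * h \<gamma>) = (LINT \<gamma>|M'. ?F \<gamma> * h' \<gamma>)"
    by (auto simp: agree_def)
qed

subsection \<open>Random kicks\<close>

text \<open>The uniform variables live on the whole real line with a density supported in [0, 1].
  Clamping makes the order and the range of the kick times hold for every sample point instead of
  almost every one.\<close>

definition unit_clamp :: "real \<Rightarrow> real" where
  "unit_clamp x = max 0 (min 1 x)"

text \<open>Stick breaking: given one kick time, the next earlier one is uniform on the interval
  from 0 to it.\<close>

definition kick_time :: "real \<Rightarrow> (nat \<Rightarrow> real \<times> real) \<Rightarrow> nat \<Rightarrow> real" where
  "kick_time t \<omega> j = t * (\<Prod>i<j. unit_clamp (fst (\<omega> i)))"

definition kick_sum :: "(nat \<Rightarrow> real \<times> real) \<Rightarrow> nat \<Rightarrow> real" where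
  "kick_sum \<omega> n = (\<Sum>j<n. snd (\<omega> j))"

text \<open>The factor \<open>kick_time t \<omega> j\<close> is the reciprocal of the density of the
  uniform law of \<open>kick_time t \<omega> (Suc j)\<close>. The expectation is therefore an
  iterated Lebesgue integral over ordered times, as in a Dyson series.\<close>

definition kick_weight :: "(real \<Rightarrow> real \<Rightarrow> complex) \<Rightarrow> nat \<Rightarrow> real \<Rightarrow> (nat \<Rightarrow> real \<times> real) \<Rightarrow> complex" where
  "kick_weight \<psi> n t \<omega> = (\<Prod>j<n. complex_of_real (kick_time t \<omega> j) * \<psi> (kick_time t \<omega> (Suc j)) (snd (\<omega> j)))"

text \<open>The kicks are numbered backwards in time, \<open>t = kick_time 0 \<ge> kick_time 1 \<ge> \<dots>\<close>, and \<open>k\<close> is the final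
  frequency: the frequency is \<open>k - kick_sum \<omega> j\<close> between \<open>kick_time (j + 1)\<close> and \<open>kick_time j\<close>.\<close>

definition kick_action :: "nat \<Rightarrow> nat \<Rightarrow> real \<Rightarrow> real \<Rightarrow> (nat \<Rightarrow> real \<times> real) \<Rightarrow> real" where
  "kick_action p n t k \<omega> = (\<Sum>j<n. (kick_time t \<omega> j - kick_time t \<omega> (Suc j)) * (k - kick_sum \<omega> j) ^ p)
     + kick_time t \<omega> n * (k - kick_sum \<omega> n) ^ p"

lemma unit_clamp_bounds [simp]: "0 \<le> unit_clamp x" "unit_clamp x \<le> 1"
  by (auto simp: unit_clamp_def)

lemma kick_time_0 [simp]: "kick_time t \<omega> 0 = t"
  by (simp add: kick_time_def)

lemma kick_time_case_nat [simp]: "kick_time t (case_nat d \<omega>) (Suc j) = kick_time (t * unit_clamp (fst d)) \<omega> j"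
  unfolding kick_time_def by (subst prod.lessThan_Suc_shift) simp

lemma kick_time_nonneg: "0 \<le> t \<Longrightarrow> 0 \<le> kick_time t \<omega> j"
  unfolding kick_time_def by (intro mult_nonneg_nonneg prod_nonneg) auto

lemma kick_time_Suc_le: "0 \<le> t \<Longrightarrow> kick_time t \<omega> (Suc j) \<le> kick_time t \<omega> j"
  using mult_left_le[OF unit_clamp_bounds(2) kick_time_nonneg[of t \<omega> j], of "fst (\<omega> j)"]
  by (simp add: kick_time_def mult_ac)

lemma kick_time_le: "0 \<le> t \<Longrightarrow> kick_time t \<omega> j \<le> t"
  by (induction j) (auto intro: order_trans[OF kick_time_Suc_le])

lemma kick_time_mono: "0 \<le> s \<Longrightarrow> s \<le> t \<Longrightarrow> kick_time s \<omega> j \<le> kick_time t \<omega> j"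
  unfolding kick_time_def by (intro mult_right_mono prod_nonneg) auto

lemma kick_sum_0 [simp]: "kick_sum \<omega> 0 = 0"
  by (simp add: kick_sum_def)

lemma kick_sum_case_nat [simp]: "kick_sum (case_nat d \<omega>) (Suc n) = snd d + kick_sum \<omega> n"
  unfolding kick_sum_def by (subst sum.lessThan_Suc_shift) simp

lemma kick_weight_0 [simp]: "kick_weight \<psi> 0 t \<omega> = 1"
  by (simp add: kick_weight_def)

lemma kick_weight_case_nat [simp]: "kick_weight \<psi> (Suc n) t (case_nat d \<omega>) =
    complex_of_real t * (\<psi> (t * unit_clamp (fst d)) (snd d) * kick_weight \<psi> n (t * unit_clamp (fst d)) \<omega>)"
  unfolding kick_weight_def by (subst prod.lessThan_Suc_shift) (simp add: mult_ac)

lemma kick_action_0 [simp]: "kick_action p 0 t k \<omega> = t * k ^ p"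
  by (simp add: kick_action_def)

lemma kick_action_case_nat [simp]: "kick_action p (Suc n) t k (case_nat d \<omega>) =
    (t - t * unit_clamp (fst d)) * k ^ p + kick_action p n (t * unit_clamp (fst d)) (k - snd d) \<omega>"
  unfolding kick_action_def by (subst sum.lessThan_Suc_shift) (simp add: diff_diff_eq)

lemma Re_kick_action_le:
  assumes "0 \<le> t" and \<alpha>: "\<And>y::real. Re (\<alpha> * complex_of_real (y ^ p)) \<le> 0"
  shows "Re (\<alpha> * complex_of_real (kick_action p n t k \<omega>)) \<le> 0"
proof -
  have "Re (\<alpha> * complex_of_real (kick_action p n t k \<omega>)) =
    (\<Sum>j<n. (kick_time t \<omega> j - kick_time t \<omega> (Suc j)) * Re (\<alpha> * complex_of_real ((k - kick_sum \<omega> j) ^ p)))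
     + kick_time t \<omega> n * Re (\<alpha> * complex_of_real ((k - kick_sum \<omega> n) ^ p))"
    unfolding kick_action_def by (simp add: sum_distrib_left distrib_left mult_ac)
  also have "\<dots> \<le> 0"
    using assms kick_time_Suc_le[OF assms(1)] kick_time_nonneg[OF assms(1)]
    by (intro add_nonpos_nonpos sum_nonpos mult_nonneg_nonpos) auto
  finally show ?thesis .
qed

lemma norm_exp_kick_action_le:
  assumes "0 \<le> t" and \<alpha>: "\<And>y::real. Re (\<alpha> * complex_of_real (y ^ p)) \<le> 0"
  shows "cmod (exp (\<alpha> * complex_of_real (kick_action p n t k \<omega>))) \<le> 1"
  using Re_kick_action_le[OF assms] by simp

text \<open>The weight for a constant jump amplitude \<open>b\<close>. Its expectations (t b)^n / n!
  sum to exp (t b), which makes it the common majorant of all Dyson series below.\<close>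

definition dominant :: "real \<Rightarrow> real \<Rightarrow> nat \<Rightarrow> (nat \<Rightarrow> real \<times> real) \<Rightarrow> real" where
  "dominant b t n \<omega> = (\<Prod>j<n. kick_time t \<omega> j * b)"

lemma dominant_nonneg: "0 \<le> t \<Longrightarrow> 0 \<le> b \<Longrightarrow> 0 \<le> dominant b t n \<omega>"
  unfolding dominant_def by (intro prod_nonneg mult_nonneg_nonneg kick_time_nonneg) auto

lemma norm_kick_weight_le:
  assumes "0 \<le> s" "s \<le> t" "\<And>r y. cmod (\<psi> r y) \<le> b"
  shows "cmod (kick_weight \<psi> n s \<omega>) \<le> dominant b t n \<omega>"
  unfolding kick_weight_def dominant_def prod_norm[symmetric]
proof (intro prod_mono conjI)
  fix j
  have "0 \<le> kick_time s \<omega> j" "kick_time s \<omega> j \<le> kick_time t \<omega> j"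
    using kick_time_nonneg[OF assms(1)] kick_time_mono[OF assms(1,2)] by auto
  then show "cmod (complex_of_real (kick_time s \<omega> j) * \<psi> (kick_time s \<omega> (Suc j)) (snd (\<omega> j))) \<le> kick_time t \<omega> j * b"
    unfolding norm_mult using assms(3) by (intro mult_mono) auto
qed simp

lemma dominant_eq_kick_weight: "complex_of_real (dominant b t n \<omega>) = kick_weight (\<lambda>_ _. complex_of_real b) n t \<omega>"
  by (simp add: dominant_def kick_weight_def)

lemma dominant_le: "0 \<le> t \<Longrightarrow> 0 \<le> b \<Longrightarrow> dominant b t n \<omega> \<le> (t * b) ^ n"
proof -
  assume *: "0 \<le> t" "0 \<le> b"
  have "dominant b t n \<omega> \<le> (\<Prod>j<n. t * b)"
    unfolding dominant_def using * kick_time_le[OF *(1)] kick_time_nonneg[OF *(1)]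
    by (intro prod_mono conjI mult_nonneg_nonneg mult_right_mono) auto
  then show ?thesis by simp
qed

definition kick_measure :: "real measure \<Rightarrow> (nat \<Rightarrow> real \<times> real) measure" where
  "kick_measure N = PiM UNIV (\<lambda>_. density lborel (\<lambda>x. ennreal (indicator {0..1} x)) \<Otimes>\<^sub>M N)"

locale kicks = prob_space N for N :: "real measure" +
  assumes sets_N [measurable_cong]: "sets N = sets borel"
begin

abbreviation "U \<equiv> density lborel (\<lambda>x::real. ennreal (indicator {0..1} x))"
abbreviation "S \<equiv> kick_measure N"

lemma prob_space_U: "prob_space U"
  by (rule prob_spaceI) (simp add: emeasure_density ennreal_indicator)

sublocale U: prob_space U by (rule prob_space_U)
sublocale UN: pair_prob_space U N ..
sublocale S: sequence_space "U \<Otimes>\<^sub>M N" ..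

lemma prob_space_S: "prob_space S"
  unfolding kick_measure_def by (rule S.P.prob_space_axioms)

sublocale SP: prob_space S by (rule prob_space_S)

lemma sets_S [measurable_cong]: "sets S = sets (borel :: (nat \<Rightarrow> real \<times> real) measure)"
proof -
  have "sets (U \<Otimes>\<^sub>M N) = sets (borel \<Otimes>\<^sub>M borel)"
    by (rule sets_pair_measure_cong) (auto simp: sets_N)
  also have "\<dots> = sets (borel :: (real \<times> real) measure)" using borel_prod by metis
  finally have "sets (U \<Otimes>\<^sub>M N) = sets (borel :: (real \<times> real) measure)" .
  then have "sets S = sets (PiM UNIV (\<lambda>_. borel :: (real \<times> real) measure))"
    unfolding kick_measure_def by (intro sets_PiM_cong) auto
  then show ?thesis by (simp add: sets_PiM_equal_borel)
qed

lemma space_S [simp]: "space S = UNIV"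
  using sets_eq_imp_space_eq[OF sets_S] by simp

lemma space_N [simp]: "space N = UNIV"
  using sets_eq_imp_space_eq[OF sets_N] by simp

text \<open>An i.i.d. sequence is its first element followed by an independent copy of the sequence,
  and s = t r turns t times the uniform law into Lebesgue measure on [0, t]. Index 0 is the last
  kick in time, so this is the step by which every recursion below lowers the number of
  kicks.\<close>

lemma integral_last_kick:
  fixes F :: "real \<Rightarrow> real \<Rightarrow> (nat \<Rightarrow> real \<times> real) \<Rightarrow> complex"
  assumes t: "0 \<le> t" and f[measurable]: "f \<in> borel_measurable borel"
    and F[measurable]: "(\<lambda>(s, y, \<omega>). F s y \<omega>) \<in> borel_measurable (borel \<Otimes>\<^sub>M borel \<Otimes>\<^sub>M borel)"
    and B: "\<And>s y \<omega>. s \<in> {0..t} \<Longrightarrow> cmod (F s y \<omega>) \<le> B"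
    and fF: "\<And>d \<omega>. f (case_nat d \<omega>) = complex_of_real t * F (t * unit_clamp (fst d)) (snd d) \<omega>"
  shows "(LINT \<omega>|S. f \<omega>) = (LINT s:{0..t}|lborel. LINT y|N. LINT \<omega>|S. F s y \<omega>)"
proof -
  have F'[measurable (raw)]: "(\<lambda>x. F (a x) (b x) (c x)) \<in> borel_measurable M"
    if "a \<in> borel_measurable M" "b \<in> borel_measurable M" "c \<in> borel_measurable M" for a b c and M :: "'x measure"
    using measurable_compose[OF measurable_Pair[OF that(1) measurable_Pair[OF that(2,3)]] F] by simp
  have shift: "(\<lambda>(d, \<omega>). case_nat d \<omega>) \<in> measurable ((U \<Otimes>\<^sub>M N) \<Otimes>\<^sub>M S) S"
    unfolding kick_measure_def by measurable
  have FI[measurable]: "(\<lambda>s. LINT y|N. LINT \<omega>|S. F s y \<omega>) \<in> borel_measurable borel"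
    by measurable
  interpret US: pair_prob_space "U \<Otimes>\<^sub>M N" S ..
  define G where "G = (\<lambda>(d, \<omega>). complex_of_real t * F (t * unit_clamp (fst d)) (snd d) \<omega>)"
  have Gm[measurable]: "G \<in> borel_measurable ((U \<Otimes>\<^sub>M N) \<Otimes>\<^sub>M S)"
    unfolding G_def unit_clamp_def by measurable
  have tc: "t * unit_clamp x \<in> {0..t}" for x using t mult_left_le[of "unit_clamp x" t] by auto
  have Gb: "norm (G z) \<le> t * B" for z
    using t B[OF tc] by (auto simp: G_def norm_mult split: prod.split intro!: mult_left_mono)
  have Gi: "integrable ((U \<Otimes>\<^sub>M N) \<Otimes>\<^sub>M S) G"
    by (rule US.P.integrable_const_bound[where B="t * B"]) (use Gb in auto)
  have "(LINT \<omega>|S. f \<omega>) = (LINT \<omega>|distr ((U \<Otimes>\<^sub>M N) \<Otimes>\<^sub>M S) S (\<lambda>(d, \<omega>). case_nat d \<omega>). f \<omega>)"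
    using S.PiM_iter by (simp add: kick_measure_def)
  also have "\<dots> = (LINT z|((U \<Otimes>\<^sub>M N) \<Otimes>\<^sub>M S). f (case z of (d, \<omega>) \<Rightarrow> case_nat d \<omega>))"
    by (rule integral_distr[OF shift]) measurable
  also have "\<dots> = (LINT z|((U \<Otimes>\<^sub>M N) \<Otimes>\<^sub>M S). G z)"
    by (intro Bochner_Integration.integral_cong refl) (auto simp: G_def fF split: prod.split)
  also have "\<dots> = (LINT d|(U \<Otimes>\<^sub>M N). LINT \<omega>|S. G (d, \<omega>))"
    by (rule US.integral_fst'[symmetric, OF Gi])
  also have "\<dots> = (LINT r|U. LINT y|N. LINT \<omega>|S. G ((r, y), \<omega>))"
    by (rule UN.integral_fst'[symmetric]) (use US.integrable_fst'[OF Gi] in simp)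
  also have "\<dots> = (LINT r|U. complex_of_real t * (LINT y|N. LINT \<omega>|S. F (t * unit_clamp r) y \<omega>))"
    by (simp add: G_def)
  also have "\<dots> = (LINT r|lborel. indicator {0..1} r *\<^sub>R (complex_of_real t * (LINT y|N. LINT \<omega>|S. F (t * r) y \<omega>)))"
    by (subst integral_density)
       (auto intro!: Bochner_Integration.integral_cong measurable_compose[OF _ FI] simp: indicator_def unit_clamp_def)
  also have "\<dots> = (LINT s:{0..t}|lborel. LINT y|N. LINT \<omega>|S. F s y \<omega>)"
  \<comment> \<open>The substitution s = t r requires t nonzero; at t = 0 both sides vanish.\<close>
  proof (cases "t = 0")
    case True
    have "AE s in lborel. s \<noteq> (0::real)" by (rule AE_lborel_singleton)
    then have "(LINT s:{0..t}|lborel. LINT y|N. LINT \<omega>|S. F s y \<omega>) = 0"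
      unfolding set_lebesgue_integral_def by (intro integral_eq_zero_AE, eventually_elim) (auto simp: True indicator_def)
    then show ?thesis by (simp add: True)
  next
    case False
    then have t0: "0 < t" using t by simp
    let ?H = "\<lambda>s. LINT y|N. LINT \<omega>|S. F s y \<omega>"
    have ind: "indicator {0..t} (0 + t * r) = (indicator {0..1} r :: real)" for r
      using t0 by (auto simp: indicator_def zero_le_mult_iff)
    have "(LINT s:{0..t}|lborel. ?H s) = \<bar>t\<bar> *\<^sub>R (LINT r|lborel. indicator {0..t} (0 + t * r) *\<^sub>R ?H (0 + t * r))"
      unfolding set_lebesgue_integral_def by (rule lborel_integral_real_affine) (use t0 in simp)
    also have "\<dots> = \<bar>t\<bar> *\<^sub>R (LINT r|lborel. indicator {0..1} r *\<^sub>R ?H (t * r))"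
      unfolding ind by simp
    also have "\<dots> = (LINT r|lborel. \<bar>t\<bar> *\<^sub>R (indicator {0..1} r *\<^sub>R ?H (t * r)))"
      by (rule integral_scaleR_right[symmetric])
    also have "\<dots> = (LINT r|lborel. indicator {0..1} r *\<^sub>R (complex_of_real t * ?H (t * r)))"
      using t0 by (intro Bochner_Integration.integral_cong refl) (simp add: scaleR_conv_of_real mult_ac)
    finally show ?thesis by simp
  qed
  finally show ?thesis .
qed

lemma measurable_component_fst [measurable (raw)]:
  "f \<in> measurable M borel \<Longrightarrow> (\<lambda>x. fst ((f x :: nat \<Rightarrow> real \<times> real) i)) \<in> borel_measurable M"
  by (rule measurable_compose[of f M borel]) (auto intro!: borel_measurable_continuous_onI continuous_on_fst continuous_on_product_coordinates)

lemma measurable_component_snd [measurable (raw)]: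
  "f \<in> measurable M borel \<Longrightarrow> (\<lambda>x. snd ((f x :: nat \<Rightarrow> real \<times> real) i)) \<in> borel_measurable M"
  by (rule measurable_compose[of f M borel]) (auto intro!: borel_measurable_continuous_onI continuous_on_snd continuous_on_product_coordinates)

lemma measurable_kick_time [measurable (raw)]:
  assumes [measurable]: "a \<in> borel_measurable M" "b \<in> measurable M borel"
  shows "(\<lambda>x. kick_time (a x) (b x) j) \<in> borel_measurable M"
  unfolding kick_time_def unit_clamp_def
  by (intro borel_measurable_times borel_measurable_prod borel_measurable_max borel_measurable_min measurable_component_fst)
    measurable

lemma measurable_kick_sum [measurable (raw)]:
  assumes [measurable]: "b \<in> measurable M borel"
  shows "(\<lambda>x. kick_sum (b x) j) \<in> borel_measurable M"
  unfolding kick_sum_def by (intro borel_measurable_sum measurable_component_snd) measurable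

lemma measurable_kick_action [measurable (raw)]:
  assumes [measurable]: "a \<in> borel_measurable M" "k \<in> borel_measurable M" "b \<in> measurable M borel"
  shows "(\<lambda>x. kick_action p n (a x) (k x) (b x)) \<in> borel_measurable M"
  unfolding kick_action_def by measurable

lemma measurable_kick_weight [measurable (raw)]:
  assumes \<psi>: "(\<lambda>(s, y). \<psi> s y) \<in> borel_measurable (borel \<Otimes>\<^sub>M borel)"
    and [measurable]: "a \<in> borel_measurable M" "b \<in> measurable M borel"
  shows "(\<lambda>x. kick_weight \<psi> n (a x) (b x)) \<in> borel_measurable M"
proof -
  have [measurable (raw)]: "(\<lambda>x. \<psi> (f x) (g x)) \<in> borel_measurable M'"
    if "f \<in> borel_measurable M'" "g \<in> borel_measurable M'" for f g and M' :: "'x measure"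
    using measurable_compose[OF measurable_Pair[OF that] \<psi>] by simp
  show ?thesis unfolding kick_weight_def by measurable
qed

text \<open>The integral of a product over ordered times is a power of the single integral divided
  by n!. By induction on the last kick the integrand is the derivative of P^(n+1) / (n+1)!, where
  \<open>P\<close> is the antiderivative of the integral of \<open>\<psi>\<close> over the
  jumps.\<close>

lemma integral_kick_weight:
  assumes \<psi>[measurable]: "(\<lambda>(s, y). \<psi> s y) \<in> borel_measurable (borel \<Otimes>\<^sub>M borel)"
    and b: "\<And>s y. cmod (\<psi> s y) \<le> b"
    and cont: "continuous_on {0..t} (\<lambda>s. LINT y|N. \<psi> s y)"
    and s: "s \<in> {0..t}"
  shows "(LINT \<omega>|S. kick_weight \<psi> n s \<omega>) = (LINT r:{0..s}|lborel. LINT y|N. \<psi> r y) ^ n / fact n"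
  using s
proof (induction n arbitrary: s)
  case 0
  then show ?case using SP.prob_space by simp
next
  case (Suc n)
  then have s: "0 \<le> s" "s \<le> t" by auto
  let ?\<Psi> = "\<lambda>r. LINT y|N. \<psi> r y"
  define P where "P s = (LINT r:{0..s}|lborel. ?\<Psi> r)" for s
  have b0: "0 \<le> b" using b[of 0 0] order_trans[OF norm_ge_zero] by blast
  have [measurable (raw)]: "(\<lambda>x. \<psi> (f x) (g x)) \<in> borel_measurable M'"
    if "f \<in> borel_measurable M'" "g \<in> borel_measurable M'" for f g and M' :: "'x measure"
    using measurable_compose[OF measurable_Pair[OF that] \<psi>] by simp
  have bound: "cmod (kick_weight \<psi> n r \<omega>) \<le> (s * b) ^ n" if "r \<in> {0..s}" for r \<omega>
  proof -
    have "cmod (kick_weight \<psi> n r \<omega>) \<le> dominant b s n \<omega>" using that by (intro norm_kick_weight_le b) auto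
    also have "\<dots> \<le> (s * b) ^ n" by (intro dominant_le s b0)
    finally show ?thesis .
  qed
  have "(LINT \<omega>|S. kick_weight \<psi> (Suc n) s \<omega>) = (LINT r:{0..s}|lborel. LINT y|N. LINT \<omega>|S. \<psi> r y * kick_weight \<psi> n r \<omega>)"
  proof (rule integral_last_kick[OF s(1), where B="b * (s * b) ^ n"])
    show "cmod (\<psi> r y * kick_weight \<psi> n r \<omega>) \<le> b * (s * b) ^ n" if "r \<in> {0..s}" for r y \<omega>
      unfolding norm_mult using bound[OF that] b0 by (intro mult_mono b) auto
  qed auto
  also have "\<dots> = (LINT r:{0..s}|lborel. ?\<Psi> r * (P r ^ n / fact n))"
  proof (rule set_lebesgue_integral_cong)
    show "\<forall>r. r \<in> {0..s} \<longrightarrow> (LINT y|N. LINT \<omega>|S. \<psi> r y * kick_weight \<psi> n r \<omega>) = ?\<Psi> r * (P r ^ n / fact n)"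
      using Suc.IH s by (auto simp: P_def)
  qed simp
  also have "\<dots> = P s ^ Suc n / fact (Suc n) - P 0 ^ Suc n / fact (Suc n)"
  proof -
    have cs: "continuous_on {0..s} ?\<Psi>" using cont by (rule continuous_on_subset) (use s in auto)
    have Pint: "P r = integral {0..r} ?\<Psi>" if "r \<in> {0..s}" for r
      unfolding P_def using that
      by (intro set_borel_integral_eq_integral(2)[of "{0..r}"] borel_integrable_atLeastAtMost')
         (rule continuous_on_subset[OF cs], auto)
    have dP: "(P has_vector_derivative ?\<Psi> r) (at r within {0..s})" if "r \<in> {0..s}" for r
    proof (rule has_vector_derivative_transform[OF that])
      show "((\<lambda>r. integral {0..r} ?\<Psi>) has_vector_derivative ?\<Psi> r) (at r within {0..s})"
        by (rule integral_has_vector_derivative[OF cs that])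
    qed (simp add: Pint)
    have cP: "continuous_on {0..s} P"
      unfolding continuous_on_eq_continuous_within using has_vector_derivative_continuous dP by blast
    have "has_bochner_integral lborel (\<lambda>x. indicator {0..s} x *\<^sub>R (?\<Psi> x * (P x ^ n / fact n)))
        (P s ^ Suc n / fact (Suc n) - P 0 ^ Suc n / fact (Suc n))"
    proof (rule has_bochner_integral_FTC_Icc[OF s(1)])
      fix r assume "0 \<le> r" "r \<le> s"
      then have r: "r \<in> {0..s}" by simp
      have "((\<lambda>r. P r ^ Suc n / fact (Suc n)) has_vector_derivative (?\<Psi> r * (of_nat (Suc n) * P r ^ n / fact (Suc n)))) (at r within {0..s})"
      proof -
        have "((\<lambda>z. z ^ Suc n / fact (Suc n)) has_field_derivative ((1 + of_nat n) * (1 * P r ^ n) / fact (Suc n))) (at (P r) within P ` {0..s})"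
          by (rule DERIV_cdivide[OF DERIV_power_Suc[OF DERIV_ident]])
        from field_vector_diff_chain_within[OF dP[OF r] this] show ?thesis by (simp add: o_def)
      qed
      moreover have "of_nat (Suc n) * P r ^ n / fact (Suc n) = P r ^ n / fact n"
        unfolding fact_Suc by (rule mult_divide_mult_cancel_left[OF of_nat_neq_0])
      ultimately show "((\<lambda>r. P r ^ Suc n / fact (Suc n)) has_vector_derivative (?\<Psi> r * (P r ^ n / fact n))) (at r within {0..s})"
        by (simp only:)
    qed (intro continuous_intros cs cP, simp)
    then show ?thesis unfolding set_lebesgue_integral_def by (rule has_bochner_integral_integral_eq)
  qed
  also have "P 0 = 0"
  proof -
    have "AE s in lborel. s \<noteq> (0::real)" by (rule AE_lborel_singleton)
    then show ?thesis
      unfolding P_def set_lebesgue_integral_def by (intro integral_eq_zero_AE, eventually_elim) (auto simp: indicator_def)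
  qed
  finally show ?case by (simp add: P_def)
qed

lemma integral_dominant:
  assumes "0 \<le> t" "0 \<le> b"
  shows "(LINT \<omega>|S. dominant b t n \<omega>) = (t * b) ^ n / fact n"
proof -
  have "complex_of_real (LINT \<omega>|S. dominant b t n \<omega>) = (LINT \<omega>|S. kick_weight (\<lambda>_ _. complex_of_real b) n t \<omega>)"
    unfolding dominant_eq_kick_weight[symmetric] by simp
  also have "\<dots> = (LINT r:{0..t}|lborel. LINT y|N. complex_of_real b) ^ n / fact n"
    by (rule integral_kick_weight[where b=b]) (use assms in auto)
  also have "(LINT r:{0..t}|lborel. LINT y|N. complex_of_real b) = complex_of_real (t * b)"
    using assms prob_space by (simp add: set_lebesgue_integral_def scaleR_conv_of_real)
  finally have "complex_of_real (LINT \<omega>|S. dominant b t n \<omega>) = complex_of_real ((t * b) ^ n / fact n)" by simp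
  then show ?thesis by (simp only: of_real_eq_iff)
qed

lemma integrable_dominant:
  assumes "0 \<le> t" "0 \<le> b"
  shows "integrable S (dominant b t n)"
proof (rule SP.integrable_const_bound)
  show "AE \<omega> in S. norm (dominant b t n \<omega>) \<le> (t * b) ^ n"
    using dominant_le[OF assms] dominant_nonneg[OF assms] by auto
  show "dominant b t n \<in> borel_measurable S" unfolding dominant_def by measurable
qed

end

subsection \<open>The Dyson series\<close>

lemma pair_count_space_measurable:
  assumes "\<And>n::nat. (\<lambda>\<omega>. f n \<omega>) \<in> borel_measurable M"
  shows "(\<lambda>(n, \<omega>). f n \<omega>) \<in> borel_measurable (count_space UNIV \<Otimes>\<^sub>M M)"
  by (rule measurable_pair_measure_countable1) (use assms in auto)

lemma pair_pair_count_space_measurable: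
  assumes f: "\<And>n::nat. (\<lambda>z. f n (fst z) (snd z)) \<in> borel_measurable (M \<Otimes>\<^sub>M M')"
  shows "(\<lambda>((n, \<omega>), x). f n \<omega> x) \<in> borel_measurable ((count_space UNIV \<Otimes>\<^sub>M M) \<Otimes>\<^sub>M M')"
proof -
  have "(\<lambda>z. f (fst (fst z)) (snd (fst z)) (snd z)) \<in> borel_measurable ((count_space UNIV \<Otimes>\<^sub>M M) \<Otimes>\<^sub>M M')"
  proof (rule measurable_compose_countable[where g="\<lambda>z. fst (fst z)" and f="\<lambda>n z. f n (snd (fst z)) (snd z)"])
    fix n
    have "(\<lambda>z. (snd (fst z), snd z)) \<in> measurable ((count_space (UNIV :: nat set) \<Otimes>\<^sub>M M) \<Otimes>\<^sub>M M') (M \<Otimes>\<^sub>M M')"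
      by measurable
    from measurable_compose[OF this f[of n]]
    show "(\<lambda>z. f n (snd (fst z)) (snd z)) \<in> borel_measurable ((count_space (UNIV :: nat set) \<Otimes>\<^sub>M M) \<Otimes>\<^sub>M M')" by simp
  qed measurable
  then show ?thesis by (simp add: case_prod_unfold)
qed

text \<open>The sum over the number of kicks is itself written as an integral, against counting
  measure, so that Fubini and dominated convergence handle series and expectation in one
  stroke.\<close>

locale sum_prob = prob_space P for P :: "'a measure"
begin

abbreviation "Q \<equiv> count_space (UNIV :: nat set) \<Otimes>\<^sub>M P"

lemma sigma_finite_nat: "sigma_finite_measure (count_space (UNIV :: nat set))"
  by (rule sigma_finite_measure_count_space_countable) simp

sublocale C: sigma_finite_measure "count_space (UNIV :: nat set)" by (rule sigma_finite_nat)
sublocale CP: pair_sigma_finite "count_space (UNIV :: nat set)" P ..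

lemma sigma_finite_Q: "sigma_finite_measure Q"
  by (rule CP.sigma_finite_measure_axioms)

lemma integral_Q_sums:
  fixes f :: "nat \<Rightarrow> 'a \<Rightarrow> 'b::{banach, second_countable_topology}"
  assumes f: "integrable Q (\<lambda>(n, \<omega>). f n \<omega>)"
  shows "(\<lambda>n. LINT \<omega>|P. f n \<omega>) sums (LINT z|Q. (\<lambda>(n, \<omega>). f n \<omega>) z)"
proof -
  have "integrable (count_space UNIV) (\<lambda>n. LINT \<omega>|P. f n \<omega>)"
    using CP.integrable_fst'[OF f] by simp
  then have "(\<lambda>n. LINT \<omega>|P. f n \<omega>) sums (LINT n|count_space UNIV. LINT \<omega>|P. f n \<omega>)"
    by (rule sums_integral_count_space_nat)
  then show ?thesis using CP.integral_fst'[OF f] by simp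
qed

lemma integrable_Q:
  fixes f :: "nat \<Rightarrow> 'a \<Rightarrow> 'b::{banach, second_countable_topology}"
  assumes f: "\<And>n. integrable P (f n)" and s: "summable (\<lambda>n. LINT \<omega>|P. norm (f n \<omega>))"
  shows "integrable Q (\<lambda>(n, \<omega>). f n \<omega>)"
proof (rule CP.Fubini_integrable)
  show "(\<lambda>(n, \<omega>). f n \<omega>) \<in> borel_measurable Q"
    by (rule measurable_pair_measure_countable1) (use f in auto)
  show "integrable (count_space UNIV) (\<lambda>n. LINT \<omega>|P. norm (case (n, \<omega>) of (n, \<omega>) \<Rightarrow> f n \<omega>))"
    using s by (simp add: integrable_count_space_nat_iff)
qed (use f in auto)

end

locale dyson = kicks N for N :: "real measure" +
  fixes h :: "real \<Rightarrow> complex" and c :: real and \<alpha> :: complex and p :: nat and t :: real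
  assumes h_measurable [measurable]: "h \<in> borel_measurable borel"
    and h_le: "\<And>y. cmod (h y) \<le> c"
    and alpha: "\<And>y::real. Re (\<alpha> * complex_of_real (y ^ p)) \<le> 0"
    and t_nonneg: "0 \<le> t"
begin

sublocale sum_prob S ..

abbreviation "W n s \<omega> \<equiv> kick_weight (\<lambda>_. h) n s \<omega>"

lemma c_nonneg: "0 \<le> c" using h_le order_trans[OF norm_ge_zero] by blast

lemma integrable_dominant_Q:
  assumes b: "0 \<le> b"
  shows "integrable Q (\<lambda>(n, \<omega>). dominant b t n \<omega>)" "(LINT z|Q. (\<lambda>(n, \<omega>). dominant b t n \<omega>) z) = exp (t * b)"
proof -
  show i: "integrable Q (\<lambda>(n, \<omega>). dominant b t n \<omega>)"
  proof (rule integrable_Q)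
    have "(LINT \<omega>|S. norm (dominant b t n \<omega>)) = (t * b) ^ n / fact n" for n
      using integral_dominant[OF t_nonneg b] dominant_nonneg[OF t_nonneg b] by simp
    moreover have "summable (\<lambda>n. (t * b) ^ n / fact n)"
      using summable_exp[of "t * b"] by (simp add: field_simps)
    ultimately show "summable (\<lambda>n. LINT \<omega>|S. norm (dominant b t n \<omega>))" by simp
  qed (rule integrable_dominant[OF t_nonneg b])
  have "(\<lambda>n. (t * b) ^ n / fact n) sums (LINT z|Q. (\<lambda>(n, \<omega>). dominant b t n \<omega>) z)"
    using integral_Q_sums[OF i] integral_dominant[OF t_nonneg b] by simp
  moreover have "(\<lambda>n. (t * b) ^ n / fact n) sums exp (t * b)"
    using exp_converges[of "t * b"] by (simp add: field_simps scaleR_conv_of_real)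
  ultimately show "(LINT z|Q. (\<lambda>(n, \<omega>). dominant b t n \<omega>) z) = exp (t * b)"
    by (rule sums_unique2)
qed

lemma integrable_Q_dominated:
  fixes f :: "nat \<Rightarrow> (nat \<Rightarrow> real \<times> real) \<Rightarrow> complex"
  assumes b: "0 \<le> b" and f: "\<And>n. f n \<in> borel_measurable borel" and le: "\<And>n \<omega>. cmod (f n \<omega>) \<le> C * dominant b t n \<omega>"
  shows "integrable Q (\<lambda>(n, \<omega>). f n \<omega>)" "cmod (LINT z|Q. (\<lambda>(n, \<omega>). f n \<omega>) z) \<le> C * exp (t * b)"
proof -
  have d: "integrable Q (\<lambda>z. C * (\<lambda>(n, \<omega>). dominant b t n \<omega>) z)"
    using integrable_dominant_Q(1)[OF b] by (rule integrable_mult_right)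
  show i: "integrable Q (\<lambda>(n, \<omega>). f n \<omega>)"
  proof (rule Bochner_Integration.integrable_bound[OF d])
    show "(\<lambda>(n, \<omega>). f n \<omega>) \<in> borel_measurable Q"
      by (rule pair_count_space_measurable) (use f in measurable)
    show "AE z in Q. norm ((\<lambda>(n, \<omega>). f n \<omega>) z) \<le> norm (C * (\<lambda>(n, \<omega>). dominant b t n \<omega>) z)"
      by (intro AE_I2) (auto split: prod.split intro: order_trans[OF le abs_ge_self])
  qed
  have "cmod (LINT z|Q. (\<lambda>(n, \<omega>). f n \<omega>) z) \<le> (LINT z|Q. cmod ((\<lambda>(n, \<omega>). f n \<omega>) z))"
    by (rule integral_norm_bound)
  also have "\<dots> \<le> (LINT z|Q. C * (\<lambda>(n, \<omega>). dominant b t n \<omega>) z)"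
    by (intro integral_mono integrable_norm i d) (auto split: prod.split intro: le)
  also have "\<dots> = C * exp (t * b)" using integrable_dominant_Q(2)[OF b] by simp
  finally show "cmod (LINT z|Q. (\<lambda>(n, \<omega>). f n \<omega>) z) \<le> C * exp (t * b)" .
qed

text \<open>The solution with initial value \<open>exp (\<i> k \<cdot>)\<close>, evaluated at \<open>(t, x)\<close>.\<close>

definition wave :: "real \<Rightarrow> real \<Rightarrow> complex" where
  "wave x k = (LINT z|Q. (\<lambda>(n, \<omega>). W n t \<omega> * (exp (\<i> * complex_of_real (x * (k + kick_sum \<omega> n)))
      * exp (\<alpha> * complex_of_real (kick_action p n t (k + kick_sum \<omega> n) \<omega>)))) z)"

lemma norm_W_mult_le:
  assumes "s \<in> {0..t}" "cmod x \<le> 1"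
  shows "cmod (W n s \<omega> * x) \<le> dominant c t n \<omega>"
proof -
  have "cmod (W n s \<omega>) \<le> dominant c t n \<omega>" using assms by (intro norm_kick_weight_le h_le) auto
  then show ?thesis using assms(2) by (simp add: norm_mult mult_left_le order_trans[OF mult_left_le])
qed

lemma norm_phase_le:
  "s \<in> {0..t} \<Longrightarrow> cmod (exp (\<i> * complex_of_real y) * exp (\<alpha> * complex_of_real (kick_action p n s k \<omega>))) \<le> 1"
  using norm_exp_kick_action_le[OF _ alpha, of s n k \<omega>] unfolding norm_mult norm_exp_ii_times by simp

lemma wave_integrable:
  "integrable Q (\<lambda>(n, \<omega>). W n t \<omega> * (exp (\<i> * complex_of_real (x * (k + kick_sum \<omega> n)))
      * exp (\<alpha> * complex_of_real (kick_action p n t (k + kick_sum \<omega> n) \<omega>))))"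
  and norm_wave_le: "cmod (wave x k) \<le> exp (t * c)"
proof -
  note * = integrable_Q_dominated[OF c_nonneg, where C=1 and f="\<lambda>n \<omega>. W n t \<omega> * (exp (\<i> * complex_of_real (x * (k + kick_sum \<omega> n)))
      * exp (\<alpha> * complex_of_real (kick_action p n t (k + kick_sum \<omega> n) \<omega>)))"]
  have m: "(\<lambda>\<omega>. W n t \<omega> * (exp (\<i> * complex_of_real (x * (k + kick_sum \<omega> n)))
      * exp (\<alpha> * complex_of_real (kick_action p n t (k + kick_sum \<omega> n) \<omega>)))) \<in> borel_measurable borel" for n
    by measurable
  have l: "cmod (W n t \<omega> * (exp (\<i> * complex_of_real (x * (k + kick_sum \<omega> n)))
      * exp (\<alpha> * complex_of_real (kick_action p n t (k + kick_sum \<omega> n) \<omega>)))) \<le> 1 * dominant c t n \<omega>" for n \<omega>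
    unfolding mult_1 by (intro norm_W_mult_le norm_phase_le) (simp_all add: t_nonneg)
  show "integrable Q (\<lambda>(n, \<omega>). W n t \<omega> * (exp (\<i> * complex_of_real (x * (k + kick_sum \<omega> n)))
      * exp (\<alpha> * complex_of_real (kick_action p n t (k + kick_sum \<omega> n) \<omega>))))" by (rule *(1)[OF m l])
  show "cmod (wave x k) \<le> exp (t * c)" using *(2)[OF m l] by (simp add: wave_def)
qed

text \<open>The Dyson series on the Fourier side. Here \<open>k\<close> is the final frequency, so
  the initial density is evaluated at \<open>k - kick_sum \<omega> n\<close>; in \<open>wave\<close>
  the parameter is the initial frequency instead.\<close>

definition fsol :: "(real \<Rightarrow> complex) \<Rightarrow> real \<Rightarrow> real \<Rightarrow> complex" where
  "fsol w0 s k = (LINT z|Q. (\<lambda>(n, \<omega>). W n s \<omega> * (w0 (k - kick_sum \<omega> n)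
      * exp (\<alpha> * complex_of_real (kick_action p n s k \<omega>)))) z)"

text \<open>The parameter \<open>a\<close> covers both frequency conventions: -1 when
  \<open>k\<close> is the final frequency, 0 when it is the initial one. Translation invariance
  makes the integral over \<open>k\<close> independent of the jumps, leaving
  \<open>dominant\<close>.\<close>

lemma integrable_Q_lborel:
  fixes g :: "nat \<Rightarrow> (nat \<Rightarrow> real \<times> real) \<Rightarrow> real \<Rightarrow> complex"
  assumes w0: "integrable lborel w0" and s: "s \<in> {0..t}"
    and g: "\<And>n. (\<lambda>z. g n (fst z) (snd z)) \<in> borel_measurable (borel \<Otimes>\<^sub>M borel)" "\<And>n \<omega> k. cmod (g n \<omega> k) \<le> 1"
  shows "integrable (Q \<Otimes>\<^sub>M lborel) (\<lambda>((n, \<omega>), k). W n s \<omega> * (w0 (k + a * kick_sum \<omega> n) * g n \<omega> k))"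
proof -
  have w0m[measurable]: "w0 \<in> borel_measurable borel" using w0 by auto
  have gm[measurable (raw)]: "(\<lambda>x. g n (b x) (k x)) \<in> borel_measurable M"
    if "b \<in> measurable M borel" "k \<in> borel_measurable M" for b k n and M :: "'x measure"
    using measurable_compose[OF measurable_Pair[OF that] g(1)[of n]] by simp
  interpret Qs: sigma_finite_measure Q by (rule sigma_finite_Q)
  interpret QL: pair_sigma_finite Q lborel ..
  have shift: "integrable lborel (\<lambda>k. w0 (k + y))" "(LINT k|lborel. cmod (w0 (k + y))) = (LINT k|lborel. cmod (w0 k))" for y
    using lborel_integrable_real_affine_iff[of 1 w0 y] w0 lborel_integral_real_affine[of 1 "\<lambda>k. cmod (w0 k)" y]
    by (simp_all add: add.commute)
  have int: "integrable lborel (\<lambda>k. W n s \<omega> * (w0 (k + a * kick_sum \<omega> n) * g n \<omega> k))" for n \<omega>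
    by (intro integrable_mult_right, subst mult.commute, rule integrable_bounded_mult[OF shift(1)]) (use g(2) in measurable)
  let ?I = "\<lambda>n \<omega>. LINT k|lborel. norm (W n s \<omega> * (w0 (k + a * kick_sum \<omega> n) * g n \<omega> k))"
  have I_le: "?I n \<omega> \<le> dominant c t n \<omega> * (LINT k|lborel. cmod (w0 k))" for n \<omega>
  proof -
    have "?I n \<omega> \<le> (LINT k|lborel. dominant c t n \<omega> * cmod (w0 (k + a * kick_sum \<omega> n)))"
    proof (rule integral_mono)
      show "integrable lborel (\<lambda>k. dominant c t n \<omega> * cmod (w0 (k + a * kick_sum \<omega> n)))" using shift(1) by auto
      fix k
      have "cmod (W n s \<omega>) \<le> dominant c t n \<omega>" using s by (intro norm_kick_weight_le h_le) auto
      then show "norm (W n s \<omega> * (w0 (k + a * kick_sum \<omega> n) * g n \<omega> k)) \<le> dominant c t n \<omega> * cmod (w0 (k + a * kick_sum \<omega> n))"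
        unfolding norm_mult using g(2) dominant_nonneg[OF t_nonneg c_nonneg] by (intro mult_mono) (auto simp: mult_left_le)
    qed (use int in auto)
    then show ?thesis using shift(2) by simp
  qed
  show ?thesis
  proof (rule QL.Fubini_integrable)
    show "(\<lambda>((n, \<omega>), k). W n s \<omega> * (w0 (k + a * kick_sum \<omega> n) * g n \<omega> k)) \<in> borel_measurable (Q \<Otimes>\<^sub>M lborel)"
      by (rule pair_pair_count_space_measurable[where f="\<lambda>n \<omega> k. W n s \<omega> * (w0 (k + a * kick_sum \<omega> n) * g n \<omega> k)"]) measurable
    have "integrable Q (\<lambda>z. complex_of_real ((\<lambda>(n, \<omega>). ?I n \<omega>) z))"
    proof -
      have "integrable Q (\<lambda>(n, \<omega>). complex_of_real (?I n \<omega>))"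
      proof (rule integrable_Q_dominated(1)[OF c_nonneg])
        show "(\<lambda>\<omega>. complex_of_real (?I n \<omega>)) \<in> borel_measurable borel" for n by measurable
        have "0 \<le> ?I n \<omega>" for n \<omega> by simp
        then show "cmod (complex_of_real (?I n \<omega>)) \<le> (LINT k|lborel. cmod (w0 k)) * dominant c t n \<omega>" for n \<omega>
          using I_le[of n \<omega>] by (simp add: mult.commute)
      qed
      then show ?thesis by (simp add: case_prod_unfold)
    qed
    then have "integrable Q (\<lambda>z. (\<lambda>(n, \<omega>). ?I n \<omega>) z)"
      by (simp only: complex_of_real_integrable_eq)
    then show "integrable Q (\<lambda>z. LINT k|lborel. norm ((\<lambda>((n, \<omega>), k). W n s \<omega> * (w0 (k + a * kick_sum \<omega> n) * g n \<omega> k)) (z, k)))"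
      by (simp add: case_prod_unfold)
  qed (use int in auto)
qed

text \<open>The shift of \<open>k\<close> by \<open>kick_sum\<close> between two applications of
  Fubini trades the final frequency for the initial one.\<close>

lemma ift_fsol:
  assumes w0: "integrable lborel w0"
  shows "ift (fsol w0 t) x = (LINT k|lborel. w0 k * wave x k)"
proof -
  have w0m[measurable]: "w0 \<in> borel_measurable borel" using w0 by auto
  interpret Qs: sigma_finite_measure Q by (rule sigma_finite_Q)
  interpret QL: pair_sigma_finite Q lborel ..
  have t: "t \<in> {0..t}" using t_nonneg by simp
  let ?g = "\<lambda>n \<omega> k. exp (\<i> * complex_of_real (x * k)) * exp (\<alpha> * complex_of_real (kick_action p n t k \<omega>))"
  let ?f1 = "\<lambda>z k. (case z of (n, \<omega>) \<Rightarrow> W n t \<omega> * (w0 (k - kick_sum \<omega> n) * ?g n \<omega> k))"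
  let ?f2 = "\<lambda>z k. (case z of (n, \<omega>) \<Rightarrow> W n t \<omega> * (w0 k * ?g n \<omega> (k + kick_sum \<omega> n)))"
  have i1: "integrable (Q \<Otimes>\<^sub>M lborel) (case_prod ?f1)"
  proof -
    have "integrable (Q \<Otimes>\<^sub>M lborel) (\<lambda>((n, \<omega>), k). W n t \<omega> * (w0 (k + (- 1) * kick_sum \<omega> n) * ?g n \<omega> k))"
      by (rule integrable_Q_lborel[OF w0 t _ norm_phase_le[OF t]]) measurable
    then show ?thesis by (simp add: case_prod_unfold)
  qed
  have i2: "integrable (Q \<Otimes>\<^sub>M lborel) (case_prod ?f2)"
  proof -
    have "integrable (Q \<Otimes>\<^sub>M lborel) (\<lambda>((n, \<omega>), k). W n t \<omega> * (w0 (k + 0 * kick_sum \<omega> n) * ?g n \<omega> (k + kick_sum \<omega> n)))"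
      by (rule integrable_Q_lborel[OF w0 t _ norm_phase_le[OF t]]) measurable
    then show ?thesis by (simp add: case_prod_unfold)
  qed
  have "ift (fsol w0 t) x = (LINT k|lborel. LINT z|Q. ?f1 z k)"
    unfolding ift_def fsol_def integral_mult_right_zero[symmetric]
    by (intro Bochner_Integration.integral_cong refl) (auto split: prod.split simp: mult_ac)
  also have "\<dots> = (LINT z|Q. LINT k|lborel. ?f1 z k)"
    by (rule QL.Fubini_integral[OF i1])
  also have "\<dots> = (LINT z|Q. LINT k|lborel. ?f2 z k)"
  proof (rule Bochner_Integration.integral_cong[OF refl])
    fix z :: "nat \<times> (nat \<Rightarrow> real \<times> real)"
    obtain n \<omega> where z: "z = (n, \<omega>)" by (cases z)
    show "(LINT k|lborel. ?f1 z k) = (LINT k|lborel. ?f2 z k)"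
      unfolding z by (subst lborel_integral_real_affine[where c=1 and t="kick_sum \<omega> n"]) (auto simp: add.commute)
  qed
  also have "\<dots> = (LINT k|lborel. LINT z|Q. ?f2 z k)"
    by (rule QL.Fubini_integral[OF i2, symmetric])
  also have "\<dots> = (LINT k|lborel. w0 k * wave x k)"
    unfolding wave_def integral_mult_right_zero[symmetric]
    by (intro Bochner_Integration.integral_cong refl) (auto split: prod.split simp: mult_ac)
  finally show ?thesis .
qed

text \<open>These constants involve only the bound \<open>c\<close> on \<open>h\<close>, not its
  support. The exponentially weighted bounds of \<open>evolution\<close> deteriorate as the support
  grows, so the uniform estimate of the L^2 norm in \<open>approximation\<close> has to rest on
  these.\<close>

lemma fsol_bounds:
  assumes w0: "integrable lborel w0" and B: "\<And>k. cmod (w0 k) \<le> B" and s: "s \<in> {0..t}"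
  shows "cmod (fsol w0 s k) \<le> B * exp (t * c)" "integrable lborel (fsol w0 s)"
    "(LINT k|lborel. cmod (fsol w0 s k)) \<le> exp (t * c) * (LINT k|lborel. cmod (w0 k))"
proof -
  have w0m[measurable]: "w0 \<in> borel_measurable borel" using w0 by auto
  have B0: "0 \<le> B" using B order_trans[OF norm_ge_zero] by blast
  let ?g = "\<lambda>n \<omega> k. exp (\<i> * complex_of_real 0) * exp (\<alpha> * complex_of_real (kick_action p n s k \<omega>))"
  let ?f = "\<lambda>z k. (case z of (n, \<omega>) \<Rightarrow> W n s \<omega> * (w0 (k - kick_sum \<omega> n) * exp (\<alpha> * complex_of_real (kick_action p n s k \<omega>))))"
  have le: "cmod (W n s \<omega> * (w0 (k - kick_sum \<omega> n) * exp (\<alpha> * complex_of_real (kick_action p n s k \<omega>)))) \<le> cmod (w0 (k - kick_sum \<omega> n)) * dominant c t n \<omega>" for n \<omega> k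
  proof -
    have "cmod (W n s \<omega> * exp (\<alpha> * complex_of_real (kick_action p n s k \<omega>))) \<le> dominant c t n \<omega>"
      using s norm_exp_kick_action_le[OF _ alpha] by (intro norm_W_mult_le) auto
    then have "cmod (w0 (k - kick_sum \<omega> n)) * cmod (W n s \<omega> * exp (\<alpha> * complex_of_real (kick_action p n s k \<omega>))) \<le> cmod (w0 (k - kick_sum \<omega> n)) * dominant c t n \<omega>"
      by (rule mult_left_mono) simp
    then show ?thesis unfolding norm_mult by (simp only: mult_ac)
  qed
  show "cmod (fsol w0 s k) \<le> B * exp (t * c)"
    unfolding fsol_def
  proof (rule integrable_Q_dominated(2)[OF c_nonneg])
    show "cmod (W n s \<omega> * (w0 (k - kick_sum \<omega> n) * exp (\<alpha> * complex_of_real (kick_action p n s k \<omega>)))) \<le> B * dominant c t n \<omega>" for n \<omega>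
      by (rule order_trans[OF le]) (intro mult_right_mono B dominant_nonneg t_nonneg c_nonneg)
  qed measurable
  interpret Qs: sigma_finite_measure Q by (rule sigma_finite_Q)
  interpret QL: pair_sigma_finite Q lborel ..
  have i: "integrable (Q \<Otimes>\<^sub>M lborel) (case_prod ?f)"
  proof -
    have "integrable (Q \<Otimes>\<^sub>M lborel) (\<lambda>((n, \<omega>), k). W n s \<omega> * (w0 (k + (- 1) * kick_sum \<omega> n) * ?g n \<omega> k))"
      by (rule integrable_Q_lborel[OF w0 s _ norm_phase_le[OF s]]) measurable
    then show ?thesis by (simp add: case_prod_unfold)
  qed
  show fi: "integrable lborel (fsol w0 s)"
    using QL.integrable_snd[OF i] by (simp add: fsol_def[abs_def] case_prod_unfold)
  have "(LINT k|lborel. cmod (fsol w0 s k)) \<le> (LINT k|lborel. LINT z|Q. cmod (?f z k))"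
  proof (rule integral_mono)
    show "integrable lborel (\<lambda>k. cmod (fsol w0 s k))" using fi by auto
    have "integrable (Q \<Otimes>\<^sub>M lborel) (case_prod (\<lambda>z k. cmod (?f z k)))"
      using integrable_norm[OF i] by (simp add: case_prod_unfold)
    from QL.integrable_snd[OF this] show "integrable lborel (\<lambda>k. LINT z|Q. cmod (?f z k))" .
    show "cmod (fsol w0 s k) \<le> (LINT z|Q. cmod (?f z k))" for k
      unfolding fsol_def by (rule integral_norm_bound)
  qed
  also have "\<dots> = (LINT z|Q. LINT k|lborel. cmod (?f z k))"
    using integrable_norm[OF i] by (intro QL.Fubini_integral) (simp add: case_prod_unfold)
  also have "\<dots> \<le> (LINT z|Q. (LINT k|lborel. cmod (w0 k)) * (\<lambda>(n, \<omega>). dominant c t n \<omega>) z)"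
  proof (rule integral_mono)
    have "integrable (Q \<Otimes>\<^sub>M lborel) (\<lambda>(z, k). cmod (?f z k))"
      using integrable_norm[OF i] by (simp add: case_prod_unfold)
    from QL.integrable_fst[OF this] show "integrable Q (\<lambda>z. LINT k|lborel. cmod (?f z k))" .
    show "integrable Q (\<lambda>z. (LINT k|lborel. cmod (w0 k)) * (\<lambda>(n, \<omega>). dominant c t n \<omega>) z)"
      by (intro integrable_mult_right integrable_dominant_Q c_nonneg)
    fix z :: "nat \<times> (nat \<Rightarrow> real \<times> real)"
    obtain n \<omega> where z: "z = (n, \<omega>)" by (cases z)
    have shift: "integrable lborel (\<lambda>k. cmod (w0 (k - y)))" "(LINT k|lborel. cmod (w0 (k - y))) = (LINT k|lborel. cmod (w0 k))" for y
      using lborel_integrable_real_affine_iff[of 1 "\<lambda>k. cmod (w0 k)" "- y"] w0 lborel_integral_real_affine[of 1 "\<lambda>k. cmod (w0 k)" "- y"]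
      by simp_all
    have "(LINT k|lborel. cmod (?f z k)) \<le> (LINT k|lborel. cmod (w0 (k - kick_sum \<omega> n)) * dominant c t n \<omega>)"
    proof (rule integral_mono_AE')
      show "integrable lborel (\<lambda>k. cmod (w0 (k - kick_sum \<omega> n)) * dominant c t n \<omega>)" using shift(1) by auto
      show "AE k in lborel. cmod (?f z k) \<le> cmod (w0 (k - kick_sum \<omega> n)) * dominant c t n \<omega>" unfolding z using le by simp
      show "AE k in lborel. 0 \<le> cmod (w0 (k - kick_sum \<omega> n)) * dominant c t n \<omega>" using dominant_nonneg[OF t_nonneg c_nonneg] by simp
    qed
    then show "(LINT k|lborel. cmod (?f z k)) \<le> (LINT k|lborel. cmod (w0 k)) * (\<lambda>(n, \<omega>). dominant c t n \<omega>) z"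
      using shift(2) by (simp add: z)
  qed
  also have "\<dots> = exp (t * c) * (LINT k|lborel. cmod (w0 k))"
    using integrable_dominant_Q(2)[OF c_nonneg] by simp
  finally show "(LINT k|lborel. cmod (fsol w0 s k)) \<le> exp (t * c) * (LINT k|lborel. cmod (w0 k))" .
qed

end

subsection \<open>Classical solutions\<close>

lemma integrable_power_exp_abs: "integrable lborel (\<lambda>k::real. \<bar>k\<bar> ^ m * exp (- \<bar>k\<bar>))"
proof (rule integrableI_bounded)
  have "(\<integral>\<^sup>+k. ennreal (norm (\<bar>k::real\<bar> ^ m * exp (- \<bar>k\<bar>))) \<partial>lborel)
    \<le> (\<integral>\<^sup>+k. ennreal (k ^ m * exp (- k)) * indicator {0..} k + ennreal ((- k) ^ m * exp (- (- k))) * indicator {0..} (- k) \<partial>lborel)"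
    by (intro nn_integral_mono) (auto simp: indicator_def abs_if)
  also have "\<dots> = (\<integral>\<^sup>+k. ennreal (k ^ m * exp (- k)) * indicator {0..} k \<partial>lborel)
      + (\<integral>\<^sup>+k. ennreal ((- k) ^ m * exp (- (- k))) * indicator {0..} (- k) \<partial>lborel)"
    by (intro nn_integral_add) auto
  also have "(\<integral>\<^sup>+k. ennreal ((- k) ^ m * exp (- (- k))) * indicator {0..} (- k) \<partial>lborel)
      = (\<integral>\<^sup>+k. ennreal (k ^ m * exp (- k)) * indicator {0..} k \<partial>lborel)"
    using nn_integral_real_affine[of "\<lambda>k. ennreal (k ^ m * exp (- k)) * indicator {0..} k" "-1" 0] by simp
  also have "(\<integral>\<^sup>+k. ennreal (k ^ m * exp (- k)) * indicator {0..} k \<partial>lborel)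
      + (\<integral>\<^sup>+k. ennreal (k ^ m * exp (- k)) * indicator {0..} k \<partial>lborel) < \<infinity>"
    unfolding nn_intergal_power_times_exp_Ici by simp
  finally show "(\<integral>\<^sup>+k. ennreal (norm (\<bar>k::real\<bar> ^ m * exp (- \<bar>k\<bar>))) \<partial>lborel) < \<infinity>" .
qed measurable

lemma set_integrable_bounded_on:
  fixes f :: "real \<Rightarrow> complex"
  assumes "f \<in> borel_measurable borel" "\<And>x. x \<in> {a..b} \<Longrightarrow> cmod (f x) \<le> B"
  shows "set_integrable lborel {a..b} f"
proof (rule set_integrable_bound[where f="\<lambda>_. B"])
  show "AE x in lborel. x \<in> {a..b} \<longrightarrow> norm (f x) \<le> norm B"
    using order_trans[OF assms(2) abs_ge_self] by auto
qed (use assms in \<open>auto simp: set_borel_measurable_def\<close>)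

lemma ift_lincomb:
  assumes "integrable lborel a" "integrable lborel b"
  shows "ift (\<lambda>k. c * a k + d * b k) x = c * ift a x + d * ift b x"
proof -
  have i: "integrable lborel (\<lambda>k. exp (\<i> * complex_of_real (x * k)) * a k)" "integrable lborel (\<lambda>k. exp (\<i> * complex_of_real (x * k)) * b k)"
    by (intro integrable_cexp_mult assms, measurable)+
  have "ift (\<lambda>k. c * a k + d * b k) x = (LINT k|lborel. c * (exp (\<i> * complex_of_real (x * k)) * a k) + d * (exp (\<i> * complex_of_real (x * k)) * b k))"
    unfolding ift_def by (intro Bochner_Integration.integral_cong refl) (simp add: algebra_simps)
  also have "\<dots> = c * ift a x + d * ift b x"
    unfolding ift_def using i by simp
  finally show ?thesis .
qed

lemma difference_quotient_tendsto:
  fixes f :: "real \<Rightarrow> complex"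
  assumes f: "(f has_vector_derivative D) (at s within A)" and X: "\<And>i. X i \<in> A - {s}" "X \<longlonglongrightarrow> s"
  shows "(\<lambda>i. (f (X i) - f s) / complex_of_real (X i - s) - D) \<longlonglongrightarrow> 0"
proof -
  have "((\<lambda>y. (f y - f s - (y - s) *\<^sub>R D) /\<^sub>R norm (y - s)) \<longlongrightarrow> 0) (at s within A)"
    using f by (simp add: has_vector_derivative_def has_derivative_at_within)
  then have "(\<lambda>i. (f (X i) - f s - (X i - s) *\<^sub>R D) /\<^sub>R norm (X i - s)) \<longlonglongrightarrow> 0"
    using X by (auto simp: tendsto_at_iff_sequentially o_def)
  then have "(\<lambda>i. norm ((f (X i) - f s - (X i - s) *\<^sub>R D) /\<^sub>R norm (X i - s))) \<longlonglongrightarrow> 0"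
    by (rule tendsto_norm_zero)
  moreover have "norm ((f (X i) - f s - (X i - s) *\<^sub>R D) /\<^sub>R norm (X i - s)) = norm ((f (X i) - f s) / complex_of_real (X i - s) - D)" for i
  proof -
    have "X i \<noteq> s" using X(1)[of i] by auto
    then have "(f (X i) - f s) / complex_of_real (X i - s) - D = (f (X i) - f s - (X i - s) *\<^sub>R D) / complex_of_real (X i - s)"
      by (simp add: scaleR_conv_of_real diff_divide_distrib)
    then show ?thesis by (simp add: norm_mult norm_inverse divide_inverse_commute del: of_real_diff)
  qed
  ultimately show ?thesis by (simp add: tendsto_norm_zero_iff)
qed

context dyson
begin

definition pot :: "real \<Rightarrow> complex" where
  "pot x = (LINT y|N. exp (\<i> * complex_of_real (x * y)) * h y)"

end

text \<open>Bounded jumps preserve exponential decay: |k| \<le> |k - y| + |y| costs a factor exp |y|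
  per kick, so \<open>c\<close> is replaced by \<open>c * exp R\<close> in the majorant. The decay
  keeps k^p times the solution integrable and bounded, hence the solution in the domain of
  A.\<close>

locale evolution = dyson +
  fixes w0 :: "real \<Rightarrow> complex" and R C0 :: real
  assumes w0_cont: "continuous_on UNIV w0" and w0_le: "\<And>k. cmod (w0 k) \<le> C0 * exp (- \<bar>k\<bar>)"
    and R_nonneg: "0 \<le> R" and h_supp: "\<And>y. R < \<bar>y\<bar> \<Longrightarrow> h y = 0"
begin

definition b where "b = c * exp R"

lemma b_nonneg: "0 \<le> b" using c_nonneg by (simp add: b_def)

lemma C0_nonneg: "0 \<le> C0" using w0_le[of 0] norm_ge_zero[of "w0 0"] by (simp del: norm_ge_zero)

lemma w0_measurable [measurable]: "w0 \<in> borel_measurable borel"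
  by (rule borel_measurable_continuous_onI[OF w0_cont])

lemma w0_le': "cmod (w0 k) \<le> C0"
  by (rule order_trans[OF w0_le]) (use C0_nonneg in \<open>auto intro: mult_left_le\<close>)

lemma integrable_w0: "integrable lborel w0"
  by (rule Bochner_Integration.integrable_bound[where f="\<lambda>k. C0 * (\<bar>k\<bar> ^ 0 * exp (- \<bar>k\<bar>))"])
    (use integrable_power_exp_abs[of 0] w0_le in \<open>auto intro: order_trans[OF _ abs_ge_self]\<close>)

lemma norm_h_exp_le: "cmod (h y) * exp \<bar>y\<bar> \<le> b"
  unfolding b_def using h_le[of y] h_supp[of y] c_nonneg by (cases "\<bar>y\<bar> \<le> R") (auto intro!: mult_mono)

lemma norm_W_exp_le:
  assumes s: "s \<in> {0..t}"
  shows "cmod (W n s \<omega>) * exp \<bar>kick_sum \<omega> n\<bar> \<le> dominant b t n \<omega>"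
proof -
  have s0: "0 \<le> s" "s \<le> t" using s by auto
  have "exp \<bar>kick_sum \<omega> n\<bar> \<le> exp (\<Sum>j<n. \<bar>snd (\<omega> j)\<bar>)" unfolding kick_sum_def by (simp add: sum_abs)
  then have "cmod (W n s \<omega>) * exp \<bar>kick_sum \<omega> n\<bar> \<le> cmod (W n s \<omega>) * (\<Prod>j<n. exp \<bar>snd (\<omega> j)\<bar>)"
    by (intro mult_left_mono) (auto simp: exp_sum)
  also have "\<dots> = (\<Prod>j<n. kick_time s \<omega> j * (cmod (h (snd (\<omega> j))) * exp \<bar>snd (\<omega> j)\<bar>))"
    using kick_time_nonneg[OF s0(1)] unfolding kick_weight_def by (simp add: prod_norm[symmetric] norm_mult prod.distrib mult_ac)
  also have "\<dots> \<le> dominant b t n \<omega>"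
    unfolding dominant_def using kick_time_nonneg[OF s0(1)] kick_time_mono[OF s0] kick_time_nonneg[OF t_nonneg] norm_h_exp_le
    by (intro prod_mono conjI mult_mono mult_nonneg_nonneg) auto
  finally show ?thesis .
qed

definition fterm where
  "fterm n s k \<omega> = W n s \<omega> * (w0 (k - kick_sum \<omega> n) * exp (\<alpha> * complex_of_real (kick_action p n s k \<omega>)))"

lemma fsol_fterm: "fsol w0 s k = (LINT z|Q. (\<lambda>(n, \<omega>). fterm n s k \<omega>) z)"
  unfolding fsol_def fterm_def ..

lemma fterm_measurable [measurable (raw)]:
  assumes [measurable]: "s \<in> borel_measurable M" "k \<in> borel_measurable M" "\<omega> \<in> measurable M borel"
  shows "(\<lambda>x. fterm n (s x) (k x) (\<omega> x)) \<in> borel_measurable M"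
  unfolding fterm_def by measurable

lemma norm_fterm_le:
  assumes s: "s \<in> {0..t}"
  shows "cmod (fterm n s k \<omega>) \<le> (C0 * exp (- \<bar>k\<bar>)) * dominant b t n \<omega>"
proof -
  have "\<bar>k\<bar> \<le> \<bar>k - kick_sum \<omega> n\<bar> + \<bar>kick_sum \<omega> n\<bar>" by linarith
  then have "exp (- \<bar>k - kick_sum \<omega> n\<bar>) \<le> exp (- \<bar>k\<bar>) * exp \<bar>kick_sum \<omega> n\<bar>"
    by (simp add: exp_add[symmetric])
  then have "cmod (w0 (k - kick_sum \<omega> n)) \<le> C0 * (exp (- \<bar>k\<bar>) * exp \<bar>kick_sum \<omega> n\<bar>)"
    using C0_nonneg by (intro order_trans[OF w0_le] mult_left_mono)
  moreover have "cmod (exp (\<alpha> * complex_of_real (kick_action p n s k \<omega>))) \<le> 1"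
    using s by (intro norm_exp_kick_action_le alpha) auto
  ultimately have "cmod (w0 (k - kick_sum \<omega> n) * exp (\<alpha> * complex_of_real (kick_action p n s k \<omega>))) \<le> C0 * (exp (- \<bar>k\<bar>) * exp \<bar>kick_sum \<omega> n\<bar>) * 1"
    unfolding norm_mult using C0_nonneg by (intro mult_mono) auto
  then have "cmod (fterm n s k \<omega>) \<le> cmod (W n s \<omega>) * (C0 * (exp (- \<bar>k\<bar>) * exp \<bar>kick_sum \<omega> n\<bar>))"
    unfolding fterm_def norm_mult[of "W n s \<omega>"] by (intro mult_left_mono) auto
  also have "\<dots> = (C0 * exp (- \<bar>k\<bar>)) * (cmod (W n s \<omega>) * exp \<bar>kick_sum \<omega> n\<bar>)" by (simp only: mult_ac)
  also have "\<dots> \<le> (C0 * exp (- \<bar>k\<bar>)) * dominant b t n \<omega>"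
    using C0_nonneg by (intro mult_left_mono norm_W_exp_le[OF s]) auto
  finally show ?thesis .
qed

lemma norm_fterm_le':
  assumes s: "s \<in> {0..t}"
  shows "cmod (fterm n s k \<omega>) \<le> C0 * dominant b t n \<omega>"
proof -
  have "(C0 * exp (- \<bar>k\<bar>)) * dominant b t n \<omega> \<le> (C0 * 1) * dominant b t n \<omega>"
    using C0_nonneg dominant_nonneg[OF t_nonneg b_nonneg] by (intro mult_right_mono mult_left_mono) auto
  then show ?thesis using norm_fterm_le[OF s, of n k \<omega>] by simp
qed

definition C1 where "C1 = C0 * exp (t * b)"

lemma C1_nonneg: "0 \<le> C1" using C0_nonneg by (simp add: C1_def)

lemma norm_fsol_le:
  assumes s: "s \<in> {0..t}"
  shows "cmod (fsol w0 s k) \<le> C1 * exp (- \<bar>k\<bar>)"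
proof -
  have "cmod (fsol w0 s k) \<le> (C0 * exp (- \<bar>k\<bar>)) * exp (t * b)"
    unfolding fsol_fterm by (rule integrable_Q_dominated(2)[OF b_nonneg _ norm_fterm_le[OF s]]) measurable
  then show ?thesis by (simp add: C1_def mult_ac)
qed

lemma norm_fsol_le': "s \<in> {0..t} \<Longrightarrow> cmod (fsol w0 s k) \<le> C1"
  by (rule order_trans[OF norm_fsol_le]) (use C1_nonneg in \<open>auto intro: mult_left_le\<close>)

lemma fterm_tendsto:
  assumes "sm \<longlonglongrightarrow> s" "km \<longlonglongrightarrow> k"
  shows "(\<lambda>m. fterm n (sm m) (km m) \<omega>) \<longlonglongrightarrow> fterm n s k \<omega>"
proof -
  have "(\<lambda>m. w0 (km m - kick_sum \<omega> n)) \<longlonglongrightarrow> w0 (k - kick_sum \<omega> n)"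
  proof (rule isCont_tendsto_compose[where g=w0])
    show "isCont w0 (k - kick_sum \<omega> n)" using w0_cont by (simp add: continuous_on_eq_continuous_at)
  qed (intro tendsto_intros assms)
  then show ?thesis
    unfolding fterm_def kick_weight_def kick_action_def kick_time_def by (intro tendsto_intros assms)
qed

lemma fsol_tendsto:
  assumes sm: "\<And>m. sm m \<in> {0..t}" and lim: "sm \<longlonglongrightarrow> s" "km \<longlonglongrightarrow> k"
  shows "(\<lambda>m. fsol w0 (sm m) (km m)) \<longlonglongrightarrow> fsol w0 s k"
  unfolding fsol_fterm
proof (rule integral_dominated_convergence[where w="\<lambda>z. C0 * (\<lambda>(n, \<omega>). dominant b t n \<omega>) z"])
  show "integrable Q (\<lambda>z. C0 * (\<lambda>(n, \<omega>). dominant b t n \<omega>) z)"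
    by (intro integrable_mult_right integrable_dominant_Q b_nonneg)
  show "(\<lambda>(n, \<omega>). fterm n s k \<omega>) \<in> borel_measurable Q"
    "(\<lambda>(n, \<omega>). fterm n (sm m) (km m) \<omega>) \<in> borel_measurable Q" for m
    by (rule pair_count_space_measurable, measurable)+
  show "AE z in Q. (\<lambda>m. (\<lambda>(n, \<omega>). fterm n (sm m) (km m) \<omega>) z) \<longlonglongrightarrow> (\<lambda>(n, \<omega>). fterm n s k \<omega>) z"
    using fterm_tendsto[OF lim] by (auto split: prod.split)
  show "AE z in Q. norm ((\<lambda>(n, \<omega>). fterm n (sm m) (km m) \<omega>) z) \<le> C0 * (\<lambda>(n, \<omega>). dominant b t n \<omega>) z" for m
    using norm_fterm_le'[OF sm] by (auto split: prod.split)
qed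

lemma fsol_continuous: "s \<in> {0..t} \<Longrightarrow> continuous_on UNIV (fsol w0 s)"
  unfolding continuous_on_eq_continuous_at[OF open_UNIV]
  using fsol_tendsto[of "\<lambda>_. s" s] by (auto intro!: continuous_at_sequentiallyI)

lemma fsol_measurable: "s \<in> {0..t} \<Longrightarrow> fsol w0 s \<in> borel_measurable borel"
  by (rule borel_measurable_continuous_onI[OF fsol_continuous])

text \<open>The convolution of the solution with the complex measure of the potential, that is, the
  Fourier side of multiplication by \<open>pot\<close> (\<open>ift_G\<close>).\<close>

definition G where "G s k = (LINT y|N. h y * fsol w0 s (k - y))"

lemma norm_h_fsol_le:
  assumes s: "s \<in> {0..t}"
  shows "cmod (h y * fsol w0 s (k - y)) \<le> b * C1 * exp (- \<bar>k\<bar>)"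
proof -
  have "exp (- \<bar>k - y\<bar>) \<le> exp (- \<bar>k\<bar>) * exp \<bar>y\<bar>" by (simp add: exp_add[symmetric])
  then have "cmod (fsol w0 s (k - y)) \<le> C1 * (exp (- \<bar>k\<bar>) * exp \<bar>y\<bar>)"
    using C1_nonneg by (intro order_trans[OF norm_fsol_le[OF s]] mult_left_mono)
  then have "cmod (h y * fsol w0 s (k - y)) \<le> cmod (h y) * (C1 * (exp (- \<bar>k\<bar>) * exp \<bar>y\<bar>))"
    unfolding norm_mult by (rule mult_left_mono) simp
  also have "\<dots> = C1 * exp (- \<bar>k\<bar>) * (cmod (h y) * exp \<bar>y\<bar>)" by (simp only: mult_ac)
  also have "\<dots> \<le> C1 * exp (- \<bar>k\<bar>) * b"
    using C1_nonneg by (intro mult_left_mono norm_h_exp_le) auto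
  finally show ?thesis by (simp only: mult_ac)
qed

lemma norm_h_fsol_le': "s \<in> {0..t} \<Longrightarrow> cmod (h y * fsol w0 s (k - y)) \<le> c * C1"
  unfolding norm_mult using c_nonneg by (intro mult_mono h_le norm_fsol_le') auto

lemma h_fsol_measurable: "s \<in> {0..t} \<Longrightarrow> (\<lambda>y. h y * fsol w0 s (k - y)) \<in> borel_measurable N"
  using fsol_measurable[of s] by measurable

lemma h_fsol_integrable: "s \<in> {0..t} \<Longrightarrow> integrable N (\<lambda>y. h y * fsol w0 s (k - y))"
  by (rule integrable_const_bound[OF AE_I2[OF norm_h_fsol_le'] h_fsol_measurable])

lemma norm_G_le:
  assumes s: "s \<in> {0..t}"
  shows "cmod (G s k) \<le> b * C1 * exp (- \<bar>k\<bar>)"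
proof -
  have "cmod (G s k) \<le> (LINT y|N. cmod (h y * fsol w0 s (k - y)))" unfolding G_def by (rule integral_norm_bound)
  also have "\<dots> \<le> b * C1 * exp (- \<bar>k\<bar>)"
    by (intro integral_le_const integrable_norm h_fsol_integrable[OF s]) (auto intro: norm_h_fsol_le[OF s])
  finally show ?thesis .
qed

lemma G_tendsto:
  assumes sm: "\<And>m. sm m \<in> {0..t}" "s \<in> {0..t}" and lim: "sm \<longlonglongrightarrow> s" "km \<longlonglongrightarrow> k"
  shows "(\<lambda>m. G (sm m) (km m)) \<longlonglongrightarrow> G s k"
  unfolding G_def
proof (rule integral_dominated_convergence[where w="\<lambda>_. c * C1"])
  show "AE y in N. (\<lambda>m. h y * fsol w0 (sm m) (km m - y)) \<longlonglongrightarrow> h y * fsol w0 s (k - y)"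
    by (intro AE_I2 tendsto_intros fsol_tendsto sm lim)
qed (use norm_h_fsol_le'[OF sm(1)] h_fsol_measurable sm in auto)

lemma G_continuous: "s \<in> {0..t} \<Longrightarrow> continuous_on UNIV (G s)"
  unfolding continuous_on_eq_continuous_at[OF open_UNIV]
  using G_tendsto[of "\<lambda>_. s" s] by (auto intro!: continuous_at_sequentiallyI)

lemma G_continuous_time: "continuous_on {0..t} (\<lambda>s. G s k)"
proof (rule continuous_on_sequentiallyI)
  fix u a assume "\<forall>n. u n \<in> {0..t}" "a \<in> {0..t}" "u \<longlonglongrightarrow> a"
  then show "(\<lambda>n. G (u n) k) \<longlonglongrightarrow> G a k" by (intro G_tendsto) auto
qed

section \<open>Duhamel's formula from the recursion in the number of kicks\<close>

definition wn where "wn n s k = (LINT \<omega>|S. fterm n s k \<omega>)"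

lemma wn_measurable [measurable (raw)]:
  assumes [measurable]: "s \<in> borel_measurable M" "k \<in> borel_measurable M"
  shows "(\<lambda>x. wn n (s x) (k x)) \<in> borel_measurable M"
  unfolding wn_def by measurable

lemma fterm_integrable:
  assumes s: "s \<in> {0..t}"
  shows "integrable S (fterm n s k)"
proof (rule Bochner_Integration.integrable_bound)
  show "integrable S (\<lambda>\<omega>. C0 * dominant b t n \<omega>)"
    by (intro integrable_mult_right integrable_dominant t_nonneg b_nonneg)
  show "AE \<omega> in S. norm (fterm n s k \<omega>) \<le> norm (C0 * dominant b t n \<omega>)"
    using order_trans[OF norm_fterm_le'[OF s] abs_ge_self] by (intro AE_I2) simp
qed measurable

lemma norm_wn_le:
  assumes s: "s \<in> {0..t}"
  shows "cmod (wn n s k) \<le> C0 * ((t * b) ^ n / fact n)"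
proof -
  have "cmod (wn n s k) \<le> (LINT \<omega>|S. cmod (fterm n s k \<omega>))" unfolding wn_def by (rule integral_norm_bound)
  also have "\<dots> \<le> (LINT \<omega>|S. C0 * dominant b t n \<omega>)"
    by (intro integral_mono integrable_norm fterm_integrable s integrable_mult_right integrable_dominant t_nonneg b_nonneg norm_fterm_le')
  also have "\<dots> = C0 * ((t * b) ^ n / fact n)" by (simp add: integral_dominant[OF t_nonneg b_nonneg])
  finally show ?thesis .
qed

lemma summable_wn_bound: "summable (\<lambda>n. C0 * ((t * b) ^ n / fact n))"
  using summable_exp[of "t * b"] by (intro summable_mult) (simp add: field_simps)

lemma wn_sums: "s \<in> {0..t} \<Longrightarrow> (\<lambda>n. wn n s k) sums fsol w0 s k"
  unfolding wn_def fsol_fterm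
  by (rule integral_Q_sums, rule integrable_Q_dominated(1)[OF b_nonneg _ norm_fterm_le'], measurable)

definition gn where "gn n r k = (LINT y|N. h y * wn n r (k - y))"

lemma gn_measurable [measurable]: "(\<lambda>r. gn n r k) \<in> borel_measurable borel"
  unfolding gn_def by measurable

lemma norm_h_wn_le: "r \<in> {0..t} \<Longrightarrow> cmod (h y * wn n r (k - y)) \<le> c * (C0 * ((t * b) ^ n / fact n))"
  unfolding norm_mult using c_nonneg by (intro mult_mono h_le norm_wn_le) auto

lemma h_wn_integrable: "r \<in> {0..t} \<Longrightarrow> integrable N (\<lambda>y. h y * wn n r (k - y))"
  by (rule integrable_const_bound[OF AE_I2[OF norm_h_wn_le]]) measurable

lemma norm_gn_le:
  assumes r: "r \<in> {0..t}"
  shows "cmod (gn n r k) \<le> c * (C0 * ((t * b) ^ n / fact n))"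
proof -
  have "cmod (gn n r k) \<le> (LINT y|N. cmod (h y * wn n r (k - y)))" unfolding gn_def by (rule integral_norm_bound)
  also have "\<dots> \<le> c * (C0 * ((t * b) ^ n / fact n))"
    by (rule integral_le_const[OF integrable_norm[OF h_wn_integrable[OF r]] AE_I2[OF norm_h_wn_le[OF r]]])
  finally show ?thesis .
qed

lemma gn_sums:
  assumes r: "r \<in> {0..t}"
  shows "(\<lambda>n. gn n r k) sums G r k"
proof -
  have bnd: "norm (LINT y|N. norm (h y * wn n r (k - y))) \<le> c * (C0 * ((t * b) ^ n / fact n))" for n
  proof -
    have "(LINT y|N. norm (h y * wn n r (k - y))) \<le> c * (C0 * ((t * b) ^ n / fact n))"
      by (rule integral_le_const[OF integrable_norm[OF h_wn_integrable[OF r]] AE_I2[OF norm_h_wn_le[OF r]]])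
    then show ?thesis by simp
  qed
  have "(\<lambda>n. gn n r k) sums (LINT y|N. (\<Sum>n. h y * wn n r (k - y)))"
    unfolding gn_def
  proof (rule sums_integral[OF h_wn_integrable[OF r]])
    show "AE y in N. summable (\<lambda>n. norm (h y * wn n r (k - y)))"
      by (intro AE_I2 summable_comparison_test'[OF summable_mult[OF summable_wn_bound, of c]])
        (use norm_h_wn_le[OF r] in auto)
    show "summable (\<lambda>n. LINT y|N. norm (h y * wn n r (k - y)))"
      by (rule summable_comparison_test'[OF summable_mult[OF summable_wn_bound, of c]]) (rule bnd)
  qed
  also have "(LINT y|N. (\<Sum>n. h y * wn n r (k - y))) = G r k"
    unfolding G_def
    by (intro Bochner_Integration.integral_cong refl sums_unique[symmetric] sums_mult wn_sums[OF r])
  finally show ?thesis .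
qed

definition free where "free s k = exp (\<alpha> * complex_of_real (s * k ^ p))"

lemma norm_free_le: "0 \<le> s \<Longrightarrow> cmod (free s k) \<le> 1"
proof -
  assume s: "0 \<le> s"
  have "Re (\<alpha> * complex_of_real (s * k ^ p)) = s * Re (\<alpha> * complex_of_real (k ^ p))" by (simp add: algebra_simps)
  also have "\<dots> \<le> 0" using s alpha[of k] by (intro mult_nonneg_nonpos)
  finally show ?thesis by (simp add: free_def)
qed

lemma free_measurable [measurable]: "(\<lambda>r. free (s - r) k) \<in> borel_measurable borel"
  unfolding free_def by measurable

lemma wn_0: "wn 0 s k = free s k * w0 k"
  unfolding wn_def fterm_def free_def using SP.prob_space by simp

text \<open>The last kick happens at time \<open>r\<close> with jump \<open>y\<close>. After it the
  frequency is \<open>k\<close>, which gives the free factor over \<open>s - r\<close>; before it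
  there are \<open>n\<close> kicks ending at frequency \<open>k - y\<close>.\<close>

lemma wn_Suc:
  assumes s: "s \<in> {0..t}"
  shows "wn (Suc n) s k = (LINT r:{0..s}|lborel. free (s - r) k * gn n r k)"
proof -
  have s0: "0 \<le> s" using s by auto
  have fb: "cmod (fterm n r k' \<omega>) \<le> C0 * (t * b) ^ n" if "r \<in> {0..s}" for r k' \<omega>
  proof -
    have "cmod (fterm n r k' \<omega>) \<le> C0 * dominant b t n \<omega>" using that s by (intro norm_fterm_le') auto
    also have "\<dots> \<le> C0 * (t * b) ^ n" by (intro mult_left_mono dominant_le C0_nonneg t_nonneg b_nonneg)
    finally show ?thesis .
  qed
  have "wn (Suc n) s k = (LINT r:{0..s}|lborel. LINT y|N. LINT \<omega>|S. free (s - r) k * (h y * fterm n r (k - y) \<omega>))"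
    unfolding wn_def
  proof (rule integral_last_kick[OF s0, where B="1 * (c * (C0 * (t * b) ^ n))"])
    show "(\<lambda>(r, y, \<omega>). free (s - r) k * (h y * fterm n r (k - y) \<omega>)) \<in> borel_measurable (borel \<Otimes>\<^sub>M borel \<Otimes>\<^sub>M borel)"
      unfolding free_def by measurable
    show "cmod (free (s - r) k * (h y * fterm n r (k - y) \<omega>)) \<le> 1 * (c * (C0 * (t * b) ^ n))" if "r \<in> {0..s}" for r y \<omega>
      unfolding norm_mult using that c_nonneg by (intro mult_mono norm_free_le h_le fb) auto
    show "fterm (Suc n) s k (case_nat d \<omega>) = complex_of_real s *
       (free (s - s * unit_clamp (fst d)) k * (h (snd d) * fterm n (s * unit_clamp (fst d)) (k - snd d) \<omega>))" for d \<omega>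
      unfolding fterm_def free_def by (simp add: exp_add distrib_left diff_diff_eq mult_ac)
  qed measurable
  also have "\<dots> = (LINT r:{0..s}|lborel. free (s - r) k * gn n r k)"
    by (simp add: gn_def wn_def)
  finally show ?thesis .
qed

text \<open>Summing \<open>wn_Suc\<close> over the number of kicks. The factorial bounds on
  \<open>gn\<close> allow the sum to enter the time integral.\<close>

lemma fsol_mild:
  assumes s: "s \<in> {0..t}"
  shows "fsol w0 s k = free s k * w0 k + (LINT r:{0..s}|lborel. free (s - r) k * G r k)"
proof -
  let ?f = "\<lambda>n r. free (s - r) k * gn n r k"
  have fle: "cmod (?f n r) \<le> c * (C0 * ((t * b) ^ n / fact n))" if "r \<in> {0..s}" for n r
  proof -
    have "cmod (?f n r) \<le> 1 * (c * (C0 * ((t * b) ^ n / fact n)))"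
      unfolding norm_mult using that s by (intro mult_mono norm_free_le norm_gn_le) auto
    then show ?thesis by simp
  qed
  have fi: "integrable lborel (\<lambda>r. indicator {0..s} r *\<^sub>R ?f n r)" for n
  proof -
    have "set_integrable lborel {0..s} (?f n)" by (rule set_integrable_bounded_on[OF _ fle]) measurable
    then show ?thesis unfolding set_integrable_def .
  qed
  have B0: "0 \<le> c * (C0 * ((t * b) ^ n / fact n))" for n
    using c_nonneg C0_nonneg t_nonneg b_nonneg by simp
  have nle: "norm (indicator {0..s} r *\<^sub>R ?f n r) \<le> c * (C0 * ((t * b) ^ n / fact n)) * indicator {0..s} r" for n r
    using fle by (auto simp: indicator_def)
  have "(\<lambda>n. wn (Suc n) s k) sums (LINT r|lborel. (\<Sum>n. indicator {0..s} r *\<^sub>R ?f n r))"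
    unfolding wn_Suc[OF s] set_lebesgue_integral_def
  proof (rule sums_integral[OF fi])
    have sm: "summable (\<lambda>n. c * (C0 * ((t * b) ^ n / fact n)) * x)" for x
      by (intro summable_mult2 summable_mult summable_wn_bound)
    show "AE r in lborel. summable (\<lambda>n. norm (indicator {0..s} r *\<^sub>R ?f n r))"
      by (intro AE_I2 summable_comparison_test'[OF sm]) (use nle in auto)
    show "summable (\<lambda>n. LINT r|lborel. norm (indicator {0..s} r *\<^sub>R ?f n r))"
    proof (rule summable_comparison_test'[OF sm])
      fix n
      have "(LINT r|lborel. norm (indicator {0..s} r *\<^sub>R ?f n r)) \<le> (LINT r|lborel. c * (C0 * ((t * b) ^ n / fact n)) * indicator {0..s} r)"
      proof (rule integral_mono[OF integrable_norm[OF fi] _ nle])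
        show "integrable lborel (\<lambda>r. c * (C0 * ((t * b) ^ n / fact n)) * indicator {0..s} r)"
          by (intro integrable_mult_right integrable_real_indicator) (use s in auto)
      qed
      also have "\<dots> = c * (C0 * ((t * b) ^ n / fact n)) * s" using s by simp
      finally show "norm (LINT r|lborel. norm (indicator {0..s} r *\<^sub>R ?f n r)) \<le> c * (C0 * ((t * b) ^ n / fact n)) * s" by simp
    qed
  qed
  also have "(LINT r|lborel. (\<Sum>n. indicator {0..s} r *\<^sub>R ?f n r)) = (LINT r:{0..s}|lborel. free (s - r) k * G r k)"
    unfolding set_lebesgue_integral_def
  proof (rule Bochner_Integration.integral_cong[OF refl])
    fix r
    show "(\<Sum>n. indicator {0..s} r *\<^sub>R ?f n r) = indicator {0..s} r *\<^sub>R (free (s - r) k * G r k)"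
    proof (cases "r \<in> {0..s}")
      case True
      then have "r \<in> {0..t}" using s by auto
      then have "(\<lambda>n. ?f n r) sums (free (s - r) k * G r k)" by (intro sums_mult gn_sums)
      then show ?thesis using True by (simp add: sums_iff)
    qed simp
  qed
  finally have "(\<lambda>n. wn (Suc n) s k) sums (LINT r:{0..s}|lborel. free (s - r) k * G r k)" .
  from sums_Suc[OF this] have "(\<lambda>n. wn n s k) sums ((LINT r:{0..s}|lborel. free (s - r) k * G r k) + wn 0 s k)" .
  from sums_unique2[OF wn_sums[OF s] this] show ?thesis by (simp add: wn_0)
qed

lemma fsol_0: "fsol w0 0 k = w0 k"
proof -
  have "AE s in lborel. s \<noteq> (0::real)" by (rule AE_lborel_singleton)
  then have "(LINT r:{0..0}|lborel. free (0 - r) k * G r k) = 0"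
    unfolding set_lebesgue_integral_def by (intro integral_eq_zero_AE, eventually_elim) (auto simp: indicator_def)
  then show ?thesis using fsol_mild[of 0 k] t_nonneg by (simp add: free_def)
qed

definition D where "D s k = \<alpha> * complex_of_real k ^ p * fsol w0 s k + G s k"

text \<open>For a fixed frequency the free factor over s - r splits as exp (s \<lambda>) exp (- r
  \<lambda>) with \<lambda> = \<alpha> k^p. The second factor may grow without bound in
  \<open>k\<close>, but pointwise in \<open>k\<close> the claim is just the product rule and the
  fundamental theorem of calculus.\<close>

lemma fsol_deriv:
  assumes s: "s \<in> {0..t}"
  shows "((\<lambda>s. fsol w0 s k) has_vector_derivative D s k) (at s within {0..t})"
proof -
  let ?e = "\<lambda>s. exp (complex_of_real s * (\<alpha> * complex_of_real (k ^ p)))"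
  let ?g = "\<lambda>r. ?e (- r) * G r k"
  have free_e: "free s k = ?e s" for s by (simp add: free_def mult_ac)
  have cg: "continuous_on {0..t} ?g" by (intro continuous_intros G_continuous_time)
  have eq: "fsol w0 r k = ?e r * (w0 k + integral {0..r} ?g)" if r: "r \<in> {0..t}" for r
  proof -
    have "(LINT q:{0..r}|lborel. free (r - q) k * G q k) = (LINT q:{0..r}|lborel. ?e r * ?g q)"
      unfolding free_e by (intro set_lebesgue_integral_cong) (auto simp: exp_add[symmetric] algebra_simps mult_exp_exp)
    also have "\<dots> = ?e r * (LINT q:{0..r}|lborel. ?g q)" by (rule set_integral_mult_right)
    also have "(LINT q:{0..r}|lborel. ?g q) = integral {0..r} ?g"
      by (intro set_borel_integral_eq_integral(2)[of "{0..r}"] borel_integrable_atLeastAtMost')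
        (rule continuous_on_subset[OF cg], use r in auto)
    finally show ?thesis unfolding fsol_mild[OF r] free_e by (simp only: distrib_left)
  qed
  have de: "(?e has_vector_derivative (\<alpha> * complex_of_real (k ^ p)) * ?e s) (at s within {0..t})"
    by (rule has_vector_derivative_at_within) (auto intro!: derivative_eq_intros has_vector_derivative_real_field simp: mult_ac)
  have dz: "((\<lambda>r. w0 k + integral {0..r} ?g) has_vector_derivative (0 + ?g s)) (at s within {0..t})"
    by (intro has_vector_derivative_add has_vector_derivative_const integral_has_vector_derivative[OF cg s])
  have "((\<lambda>r. ?e r * (w0 k + integral {0..r} ?g)) has_vector_derivative
      (?e s * (0 + ?g s) + (\<alpha> * complex_of_real (k ^ p)) * ?e s * (w0 k + integral {0..s} ?g))) (at s within {0..t})"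
    by (rule has_vector_derivative_mult[OF de dz])
  moreover have "?e s * (0 + ?g s) + (\<alpha> * complex_of_real (k ^ p)) * ?e s * (w0 k + integral {0..s} ?g) = D s k"
  proof -
    have "?e s * ?e (- s) = 1" by (simp add: exp_add[symmetric])
    then have "?e s * (0 + ?g s) = G s k" by (metis add_0 mult.assoc mult_1)
    then show ?thesis unfolding D_def eq[OF s] by (simp add: mult.assoc)
  qed
  ultimately have "((\<lambda>r. ?e r * (w0 k + integral {0..r} ?g)) has_vector_derivative D s k) (at s within {0..t})" by simp
  then show ?thesis
    by (rule has_vector_derivative_transform[OF s, rotated]) (simp add: eq)
qed

text \<open>One majorant, in L^1 and in L^2, for both terms of the time derivative. By the mean
  value inequality it also dominates the difference quotients.\<close>

definition dbound where "dbound k = (cmod \<alpha> * \<bar>k\<bar> ^ p + b) * (C1 * exp (- \<bar>k\<bar>))"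

lemma dbound_ge:
  "cmod \<alpha> * \<bar>k\<bar> ^ p * (C1 * exp (- \<bar>k\<bar>)) \<le> dbound k" "b * C1 * exp (- \<bar>k\<bar>) \<le> dbound k"
proof -
  have "0 \<le> cmod \<alpha> * \<bar>k\<bar> ^ p * (C1 * exp (- \<bar>k\<bar>))" "0 \<le> b * (C1 * exp (- \<bar>k\<bar>))"
    using C1_nonneg b_nonneg by simp_all
  then show "cmod \<alpha> * \<bar>k\<bar> ^ p * (C1 * exp (- \<bar>k\<bar>)) \<le> dbound k" "b * C1 * exp (- \<bar>k\<bar>) \<le> dbound k"
    unfolding dbound_def distrib_right mult.assoc by linarith+
qed

lemma norm_power_fsol_le:
  "s \<in> {0..t} \<Longrightarrow> cmod (\<alpha> * complex_of_real k ^ p * fsol w0 s k) \<le> cmod \<alpha> * \<bar>k\<bar> ^ p * (C1 * exp (- \<bar>k\<bar>))"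
  unfolding norm_mult norm_power norm_of_real by (intro mult_left_mono norm_fsol_le) auto

lemma norm_D_le:
  assumes s: "s \<in> {0..t}"
  shows "cmod (D s k) \<le> dbound k"
proof -
  have "cmod (D s k) \<le> cmod (\<alpha> * complex_of_real k ^ p * fsol w0 s k) + cmod (G s k)"
    unfolding D_def by (rule norm_triangle_ineq)
  also have "\<dots> \<le> cmod \<alpha> * \<bar>k\<bar> ^ p * (C1 * exp (- \<bar>k\<bar>)) + b * C1 * exp (- \<bar>k\<bar>)"
    by (intro add_mono norm_power_fsol_le norm_G_le s)
  finally show ?thesis by (simp add: dbound_def algebra_simps)
qed

lemma integrable_dbound: "integrable lborel dbound"
proof -
  have "integrable lborel (\<lambda>k. cmod \<alpha> * C1 * (\<bar>k\<bar> ^ p * exp (- \<bar>k\<bar>)) + b * C1 * (\<bar>k\<bar> ^ 0 * exp (- \<bar>k\<bar>)))"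
    by (intro Bochner_Integration.integrable_add integrable_mult_right integrable_power_exp_abs)
  then show ?thesis by (simp add: dbound_def[abs_def] algebra_simps)
qed

lemma integrable_dbound_square: "integrable lborel (\<lambda>k. (dbound k)\<^sup>2)"
proof (rule Bochner_Integration.integrable_bound)
  show "integrable lborel (\<lambda>k. 2 * C1\<^sup>2 * ((cmod \<alpha>)\<^sup>2 * (\<bar>k\<bar> ^ (2 * p) * exp (- \<bar>k\<bar>)) + b\<^sup>2 * (\<bar>k\<bar> ^ 0 * exp (- \<bar>k\<bar>))))"
    by (intro Bochner_Integration.integrable_add integrable_mult_right integrable_power_exp_abs)
  show "(\<lambda>k. (dbound k)\<^sup>2) \<in> borel_measurable lborel" unfolding dbound_def by measurable
  show "AE k in lborel. norm ((dbound k)\<^sup>2) \<le> norm (2 * C1\<^sup>2 * ((cmod \<alpha>)\<^sup>2 * (\<bar>k\<bar> ^ (2 * p) * exp (- \<bar>k\<bar>)) + b\<^sup>2 * (\<bar>k\<bar> ^ 0 * exp (- \<bar>k\<bar>))))"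
  proof (intro AE_I2)
    fix k :: real
    let ?x = "cmod \<alpha> * \<bar>k\<bar> ^ p"
    have "(?x + b)\<^sup>2 \<le> 2 * (?x\<^sup>2 + b\<^sup>2)"
      using zero_le_power2[of "?x - b"] by (simp add: power2_sum power2_diff)
    moreover have "(exp (- \<bar>k\<bar>))\<^sup>2 \<le> exp (- \<bar>k\<bar>)" by (simp add: power2_eq_square mult_left_le)
    ultimately have "(?x + b)\<^sup>2 * (exp (- \<bar>k\<bar>))\<^sup>2 \<le> 2 * (?x\<^sup>2 + b\<^sup>2) * exp (- \<bar>k\<bar>)"
      by (intro mult_mono) auto
    then have "C1\<^sup>2 * ((?x + b)\<^sup>2 * (exp (- \<bar>k\<bar>))\<^sup>2) \<le> C1\<^sup>2 * (2 * (?x\<^sup>2 + b\<^sup>2) * exp (- \<bar>k\<bar>))"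
      by (rule mult_left_mono) simp
    moreover have "?x\<^sup>2 = (cmod \<alpha>)\<^sup>2 * \<bar>k\<bar> ^ (2 * p)" by (simp add: power_mult_distrib power_mult[symmetric] mult.commute)
    ultimately have "(dbound k)\<^sup>2 \<le> 2 * C1\<^sup>2 * ((cmod \<alpha>)\<^sup>2 * (\<bar>k\<bar> ^ (2 * p) * exp (- \<bar>k\<bar>)) + b\<^sup>2 * (\<bar>k\<bar> ^ 0 * exp (- \<bar>k\<bar>)))"
      unfolding dbound_def power_mult_distrib by (simp add: algebra_simps)
    then show "norm ((dbound k)\<^sup>2) \<le> norm (2 * C1\<^sup>2 * ((cmod \<alpha>)\<^sup>2 * (\<bar>k\<bar> ^ (2 * p) * exp (- \<bar>k\<bar>)) + b\<^sup>2 * (\<bar>k\<bar> ^ 0 * exp (- \<bar>k\<bar>))))"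
      unfolding real_norm_def abs_power2 by (rule order_trans[OF _ abs_ge_self])
  qed
qed

lemma fsol_lipschitz:
  assumes "r \<in> {0..t}" "s \<in> {0..t}"
  shows "cmod (fsol w0 r k - fsol w0 s k) \<le> dbound k * \<bar>r - s\<bar>"
proof -
  have "norm (fsol w0 r k - fsol w0 s k) \<le> dbound k * norm (r - s)"
  proof (rule differentiable_bound[where S="{0..t}" and f="\<lambda>s. fsol w0 s k" and f'="\<lambda>s h. h *\<^sub>R D s k"])
    show "((\<lambda>s. fsol w0 s k) has_derivative (\<lambda>h. h *\<^sub>R D x k)) (at x within {0..t})" if "x \<in> {0..t}" for x
      using fsol_deriv[OF that] by (simp add: has_vector_derivative_def)
    show "onorm (\<lambda>h. h *\<^sub>R D x k) \<le> dbound k" if "x \<in> {0..t}" for x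
      by (rule onorm_le) (use norm_D_le[OF that, of k] in \<open>simp add: mult.commute mult_left_mono\<close>)
  qed (use assms in auto)
  then show ?thesis by simp
qed

lemma D_continuous: "s \<in> {0..t} \<Longrightarrow> continuous_on UNIV (D s)"
  unfolding D_def[abs_def] by (intro continuous_intros fsol_continuous G_continuous)

lemma D_measurable: "s \<in> {0..t} \<Longrightarrow> D s \<in> borel_measurable borel"
  by (rule borel_measurable_continuous_onI[OF D_continuous])

lemma integrable_le_dbound:
  assumes "f \<in> borel_measurable borel" "\<And>k. cmod (f k) \<le> C * dbound k"
  shows "integrable lborel f" "L2 f"
proof -
  show "integrable lborel f"
    by (rule Bochner_Integration.integrable_bound[OF integrable_mult_right[OF integrable_dbound, of C]])
      (use assms in \<open>auto intro: order_trans[OF _ abs_ge_self]\<close>)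
  have "integrable lborel (\<lambda>k. (cmod (f k))\<^sup>2)"
  proof (rule Bochner_Integration.integrable_bound[OF integrable_mult_right[OF integrable_dbound_square, of "C\<^sup>2"]])
    show "AE k in lborel. norm ((cmod (f k))\<^sup>2) \<le> norm (C\<^sup>2 * (dbound k)\<^sup>2)"
    proof (intro AE_I2)
      fix k
      have "(cmod (f k))\<^sup>2 \<le> (C * dbound k)\<^sup>2" by (intro power_mono assms) simp
      then show "norm ((cmod (f k))\<^sup>2) \<le> norm (C\<^sup>2 * (dbound k)\<^sup>2)" by (simp add: power_mult_distrib)
    qed
  qed (use assms in auto)
  then show "L2 f" using assms by (simp add: L2_def)
qed

lemma D_integrable: "s \<in> {0..t} \<Longrightarrow> integrable lborel (D s)" "s \<in> {0..t} \<Longrightarrow> L2 (D s)"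
  using integrable_le_dbound[of "D s" 1] D_measurable norm_D_le by auto

lemma fsol_integrable: "s \<in> {0..t} \<Longrightarrow> integrable lborel (fsol w0 s)"
  by (rule fsol_bounds(2)[OF integrable_w0 w0_le'])

lemma power_fsol_integrable:
  assumes s: "s \<in> {0..t}"
  shows "integrable lborel (\<lambda>k. \<alpha> * complex_of_real k ^ p * fsol w0 s k)"
proof (rule integrable_le_dbound(1)[where C=1])
  show "(\<lambda>k. \<alpha> * complex_of_real k ^ p * fsol w0 s k) \<in> borel_measurable borel"
    using fsol_measurable[OF s] by measurable
  show "cmod (\<alpha> * complex_of_real k ^ p * fsol w0 s k) \<le> 1 * dbound k" for k
    using order_trans[OF norm_power_fsol_le[OF s] dbound_ge(1)] by simp
qed

lemma G_integrable:
  assumes s: "s \<in> {0..t}"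
  shows "integrable lborel (G s)"
proof (rule integrable_le_dbound(1)[where C=1])
  show "G s \<in> borel_measurable borel" by (rule borel_measurable_continuous_onI[OF G_continuous[OF s]])
  show "cmod (G s k) \<le> 1 * dbound k" for k
    using order_trans[OF norm_G_le[OF s] dbound_ge(2)] by simp
qed

lemma ift_G:
  assumes s: "s \<in> {0..t}"
  shows "ift (G s) x = pot x * ift (fsol w0 s) x"
proof -
  have fm[measurable]: "fsol w0 s \<in> borel_measurable borel" by (rule fsol_measurable[OF s])
  interpret NL: pair_sigma_finite N lborel ..
  let ?f = "\<lambda>y k. exp (\<i> * complex_of_real (x * k)) * (h y * fsol w0 s (k - y))"
  have shift: "integrable lborel (\<lambda>k. fsol w0 s (k - y))" "(LINT k|lborel. cmod (fsol w0 s (k - y))) = (LINT k|lborel. cmod (fsol w0 s k))" for y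
    using lborel_integrable_real_affine_iff[of 1 "fsol w0 s" "- y"] fsol_integrable[OF s] lborel_integral_real_affine[of 1 "\<lambda>k. cmod (fsol w0 s k)" "- y"]
    by simp_all
  have int: "integrable (N \<Otimes>\<^sub>M lborel) (\<lambda>(y, k). ?f y k)"
  proof (rule NL.Fubini_integrable)
    show "integrable N (\<lambda>y. LINT k|lborel. norm ((\<lambda>(y, k). ?f y k) (y, k)))"
    proof -
      have "integrable N (\<lambda>y. cmod (h y) * (LINT k|lborel. cmod (fsol w0 s k)))"
        by (intro integrable_mult_left integrable_const_bound[where B=c]) (auto intro: h_le)
      then show ?thesis by (simp add: norm_mult shift(2))
    qed
    show "AE y in N. integrable lborel (\<lambda>k. (\<lambda>(y, k). ?f y k) (y, k))"
    proof (rule AE_I2)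
      fix y
      have "integrable lborel (\<lambda>k. h y * fsol w0 s (k - y))" by (rule integrable_mult_right[OF shift(1)])
      then have "integrable lborel (?f y)" by (rule integrable_cexp_mult) measurable
      then show "integrable lborel (\<lambda>k. (\<lambda>(y, k). ?f y k) (y, k))" by simp
    qed
  qed measurable
  have "ift (G s) x = (LINT k|lborel. LINT y|N. ?f y k)"
    unfolding ift_def G_def by simp
  also have "\<dots> = (LINT y|N. LINT k|lborel. ?f y k)" by (rule NL.Fubini_integral[OF int])
  also have "\<dots> = (LINT y|N. (exp (\<i> * complex_of_real (x * y)) * h y) * ift (fsol w0 s) x)"
  proof (rule Bochner_Integration.integral_cong[OF refl])
    fix y
    have "(LINT k|lborel. ?f y k) = (LINT k|lborel. ?f y (y + 1 * k))"
      by (subst lborel_integral_real_affine[where c=1 and t=y]) auto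
    also have "\<dots> = (LINT k|lborel. (exp (\<i> * complex_of_real (x * y)) * h y) * (exp (\<i> * complex_of_real (x * k)) * fsol w0 s k))"
      by (intro Bochner_Integration.integral_cong refl) (simp add: exp_add distrib_left mult_ac)
    also have "\<dots> = (exp (\<i> * complex_of_real (x * y)) * h y) * ift (fsol w0 s) x"
      unfolding ift_def by (rule integral_mult_right_zero)
    finally show "(LINT k|lborel. ?f y k) = (exp (\<i> * complex_of_real (x * y)) * h y) * ift (fsol w0 s) x" .
  qed
  also have "\<dots> = pot x * ift (fsol w0 s) x" unfolding pot_def by (rule integral_mult_left_zero)
  finally show ?thesis .
qed

lemma power_le_fact_exp:
  fixes x :: real
  assumes "0 \<le> x"
  shows "x ^ n * exp (- x) \<le> fact n"
proof -
  have "(\<Sum>i\<in>{n}. x ^ i /\<^sub>R fact i) \<le> (\<Sum>i. x ^ i /\<^sub>R fact i)"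
    using assms by (intro sum_le_suminf summable_exp_generic) auto
  then have "x ^ n / fact n \<le> exp x" by (simp add: exp_def divide_inverse_commute)
  then have "x ^ n \<le> fact n * exp x" by (simp add: field_simps)
  then have "x ^ n * exp (- x) \<le> fact n * exp x * exp (- x)" by (intro mult_right_mono) auto
  also have "\<dots> = fact n" by (simp add: mult.assoc exp_add[symmetric])
  finally show ?thesis .
qed

lemma A_rel_fsol:
  assumes s: "s \<in> {0..t}"
  shows "A_rel \<alpha> p (ift (fsol w0 s)) (ift (\<lambda>k. \<alpha> * complex_of_real k ^ p * fsol w0 s k))"
proof -
  have 1: "FT2 (ift (fsol w0 s)) (\<lambda>k. 2 * pi * fsol w0 s k)"
    by (rule FT2_ift[OF fsol_integrable[OF s] fsol_continuous[OF s] norm_fsol_le'[OF s]])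
  have "cmod (\<alpha> * complex_of_real k ^ p * fsol w0 s k) \<le> cmod \<alpha> * C1 * fact p" for k
  proof -
    have "cmod (\<alpha> * complex_of_real k ^ p * fsol w0 s k) \<le> cmod \<alpha> * C1 * (\<bar>k\<bar> ^ p * exp (- \<bar>k\<bar>))"
      using norm_power_fsol_le[OF s, of k] by (simp add: mult_ac)
    also have "\<dots> \<le> cmod \<alpha> * C1 * fact p"
      using C1_nonneg by (intro mult_left_mono power_le_fact_exp) auto
    finally show ?thesis .
  qed
  then have "FT2 (ift (\<lambda>k. \<alpha> * complex_of_real k ^ p * fsol w0 s k)) (\<lambda>k. 2 * pi * (\<alpha> * complex_of_real k ^ p * fsol w0 s k))"
    by (intro FT2_ift power_fsol_integrable s continuous_intros fsol_continuous)
  moreover have "(\<lambda>k. 2 * pi * (\<alpha> * complex_of_real k ^ p * fsol w0 s k)) = (\<lambda>k. \<alpha> * complex_of_real k ^ p * (2 * pi * fsol w0 s k))"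
    by (simp add: mult_ac)
  ultimately have 2: "FT2 (ift (\<lambda>k. \<alpha> * complex_of_real k ^ p * fsol w0 s k)) (\<lambda>k. \<alpha> * complex_of_real k ^ p * (2 * pi * fsol w0 s k))"
    by (simp only:)
  have "L2 (ift (fsol w0 s))" "L2 (ift (\<lambda>k. \<alpha> * complex_of_real k ^ p * fsol w0 s k))"
    using 1 2 unfolding FT2_def by blast+
  then show ?thesis unfolding A_rel_def using 1 2 by blast
qed

text \<open>On the Fourier side the remainders \<open>q i\<close> tend to 0 pointwise and are
  dominated by twice \<open>dbound\<close>, hence in L^2; the Plancherel bound carries this over to
  x. So the pointwise differential equation in \<open>k\<close> becomes one in L^2, as
  \<open>perturbation_estimate\<close> demands.\<close>

lemma ift_fsol_deriv:
  assumes s: "s \<in> {0..t}"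
  shows "((\<lambda>r. L2norm (\<lambda>x. (ift (fsol w0 r) x - ift (fsol w0 s) x) / complex_of_real (r - s)
    - (ift (\<lambda>k. \<alpha> * complex_of_real k ^ p * fsol w0 s k) x + pot x * ift (fsol w0 s) x))) \<longlongrightarrow> 0) (at s within {0..t})"
  unfolding tendsto_at_iff_sequentially o_def
proof (intro allI impI)
  fix X :: "nat \<Rightarrow> real" assume X: "\<forall>i. X i \<in> {0..t} - {s}" "X \<longlonglongrightarrow> s"
  have Xi: "X i \<in> {0..t}" "X i \<noteq> s" for i using X(1) by auto
  define q where "q i k = (fsol w0 (X i) k - fsol w0 s k) / complex_of_real (X i - s) - D s k" for i k
  have qm: "q i \<in> borel_measurable borel" for i
    unfolding q_def using fsol_measurable[OF Xi(1)] fsol_measurable[OF s] D_measurable[OF s] by measurable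
  have qle: "cmod (q i k) \<le> 2 * dbound k" for i k
  proof -
    have "cmod ((fsol w0 (X i) k - fsol w0 s k) / complex_of_real (X i - s)) \<le> dbound k"
      using fsol_lipschitz[OF Xi(1) s, of i k] Xi(2)[of i] by (simp add: norm_divide divide_le_eq del: of_real_diff)
    then show ?thesis using norm_triangle_ineq4[of "(fsol w0 (X i) k - fsol w0 s k) / complex_of_real (X i - s)" "D s k"] norm_D_le[OF s, of k]
      unfolding q_def by linarith
  qed
  note qi = integrable_le_dbound[OF qm qle]
  have ift_D: "ift (D s) x = ift (\<lambda>k. \<alpha> * complex_of_real k ^ p * fsol w0 s k) x + pot x * ift (fsol w0 s) x" for x
    using ift_lincomb[OF power_fsol_integrable[OF s] G_integrable[OF s], of 1 1 x] unfolding D_def[abs_def] by (simp add: ift_G[OF s])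
  have eq: "(ift (fsol w0 (X i)) x - ift (fsol w0 s) x) / complex_of_real (X i - s) - ift (D s) x = ift (q i) x" for i x
  proof -
    let ?c = "1 / complex_of_real (X i - s)"
    have i1: "integrable lborel (\<lambda>k. ?c * fsol w0 (X i) k + (- ?c) * fsol w0 s k)"
      by (intro Bochner_Integration.integrable_add integrable_mult_right fsol_integrable Xi s)
    have "ift (\<lambda>k. 1 * (?c * fsol w0 (X i) k + (- ?c) * fsol w0 s k) + (-1) * D s k) x
      = 1 * (?c * ift (fsol w0 (X i)) x + (- ?c) * ift (fsol w0 s) x) + (-1) * ift (D s) x"
      unfolding ift_lincomb[OF i1 D_integrable(1)[OF s]] ift_lincomb[OF fsol_integrable[OF Xi(1)] fsol_integrable[OF s]] ..
    moreover have "(\<lambda>k. 1 * (?c * fsol w0 (X i) k + (- ?c) * fsol w0 s k) + (-1) * D s k) = q i"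
      by (auto simp: q_def diff_divide_distrib)
    ultimately show ?thesis by (simp add: diff_divide_distrib)
  qed
  have "(\<lambda>i. LINT k|lborel. (cmod (q i k))\<^sup>2) \<longlonglongrightarrow> (LINT (k::real)|lborel. 0)"
  proof (rule integral_dominated_convergence[where w="\<lambda>k. 4 * (dbound k)\<^sup>2"])
    show "AE k in lborel. (\<lambda>i. (cmod (q i k))\<^sup>2) \<longlonglongrightarrow> 0"
    proof (intro AE_I2)
      fix k
      have "(\<lambda>i. q i k) \<longlonglongrightarrow> 0"
        unfolding q_def by (rule difference_quotient_tendsto[OF fsol_deriv[OF s]]) (use X in auto)
      from tendsto_power[OF tendsto_norm[OF this], of 2] show "(\<lambda>i. (cmod (q i k))\<^sup>2) \<longlonglongrightarrow> 0" by simp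
    qed
    show "AE k in lborel. norm ((cmod (q i k))\<^sup>2) \<le> 4 * (dbound k)\<^sup>2" for i
      using power_mono[OF qle norm_ge_zero, of i _ 2] by (auto simp: power_mult_distrib)
    show "(\<lambda>k. (cmod (q i k))\<^sup>2) \<in> borel_measurable lborel" for i using qm by measurable
  qed (use integrable_dbound_square in auto)
  then have "(\<lambda>i. sqrt (LINT k|lborel. (cmod (q i k))\<^sup>2)) \<longlonglongrightarrow> 0"
    using tendsto_real_sqrt by fastforce
  then have "(\<lambda>i. sqrt (2 * pi) * L2norm (q i)) \<longlonglongrightarrow> 0"
    unfolding L2norm_def by (rule tendsto_mult_right_zero)
  then have "(\<lambda>i. L2norm (ift (q i))) \<longlonglongrightarrow> 0"
    by (rule tendsto_sandwich[OF always_eventually always_eventually tendsto_const, rotated 2])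
      (auto intro: L2norm_ift_le qi)
  then show "(\<lambda>i. L2norm (\<lambda>x. (ift (fsol w0 (X i)) x - ift (fsol w0 s) x) / complex_of_real (X i - s)
    - (ift (\<lambda>k. \<alpha> * complex_of_real k ^ p * fsol w0 s k) x + pot x * ift (fsol w0 s) x))) \<longlonglongrightarrow> 0"
    unfolding ift_D[symmetric] eq .
qed

lemma L2norm_ift_fsol_le:
  assumes s: "s \<in> {0..t}"
  shows "L2norm (ift (fsol w0 s)) \<le> sqrt (2 * pi * (C0 * exp (t * c) * (exp (t * c) * (LINT k|lborel. cmod (w0 k)))))"
proof -
  note fb = fsol_bounds[OF integrable_w0 w0_le' s]
  have "(L2norm (ift (fsol w0 s)))\<^sup>2 \<le> 2 * pi * (L2norm (fsol w0 s))\<^sup>2"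
    by (rule Plancherel_le[OF fb(2) L2_of_bounded_integrable(1)[OF fb(2,1)]])
  also have "\<dots> \<le> 2 * pi * (C0 * exp (t * c) * (LINT k|lborel. cmod (fsol w0 s k)))"
    by (intro mult_left_mono L2_of_bounded_integrable(2) fb) auto
  also have "\<dots> \<le> 2 * pi * (C0 * exp (t * c) * (exp (t * c) * (LINT k|lborel. cmod (w0 k))))"
    using C0_nonneg by (intro mult_left_mono fb(3)) auto
  finally show ?thesis by (rule real_le_rsqrt)
qed

end

subsection \<open>The measure representing \<open>f\<close>\<close>

text \<open>Here \<open>y\<close> is the initial frequency. Jump \<open>j\<close> occurs at index
  \<open>Suc j\<close> because \<open>kick_time t \<omega> 0\<close> is the final time
  \<open>t\<close>, where no kick takes place.\<close>

definition kick_freq :: "nat \<Rightarrow> real \<Rightarrow> real \<Rightarrow> (nat \<Rightarrow> real \<times> real) \<Rightarrow> real \<Rightarrow> real" where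
  "kick_freq n t y \<omega> s = y + (\<Sum>j<n. snd (\<omega> j) * indicator {kick_time t \<omega> (Suc j)..} s)"

text \<open>The minus sign compensates the one in \<eta>(s) = - (integral of the derivative over
  [s, t]), so that pairings produce plain values of \<open>\<eta>\<close>.\<close>

definition kick_path :: "nat \<Rightarrow> real \<Rightarrow> real \<Rightarrow> (nat \<Rightarrow> real \<times> real) \<Rightarrow> real \<Rightarrow> real" where
  "kick_path n t y \<omega> = bpath t (\<lambda>s. - kick_freq n t y \<omega> s)"

lemma kick_freq_measurable [measurable]: "kick_freq n t y \<omega> \<in> borel_measurable borel"
  unfolding kick_freq_def by measurable

lemma abs_kick_freq_le: "\<bar>kick_freq n t y \<omega> s\<bar> \<le> \<bar>y\<bar> + (\<Sum>j<n. \<bar>snd (\<omega> j)\<bar>)"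
proof -
  have "\<bar>\<Sum>j<n. snd (\<omega> j) * indicator {kick_time t \<omega> (Suc j)..} s\<bar> \<le> (\<Sum>j<n. \<bar>snd (\<omega> j)\<bar>)"
    by (rule order_trans[OF sum_abs]) (auto intro!: sum_mono simp: indicator_def)
  then show ?thesis unfolding kick_freq_def using abs_triangle_ineq[of y] by (smt (verit))
qed

lemma brep_kick_path: "brep t (kick_path n t y \<omega>) (\<lambda>s. - kick_freq n t y \<omega> s)"
  unfolding kick_path_def
  by (intro brep_bpath set_integrable_bounded_Icc[where B="\<bar>y\<bar> + (\<Sum>j<n. \<bar>snd (\<omega> j)\<bar>)"])
    (measurable, simp add: abs_kick_freq_le)

lemma kick_path_in_Bsp: "0 \<le> r \<Longrightarrow> kick_path n t y \<omega> \<in> Bsp r t"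
  unfolding kick_path_def
  by (rule bpath_in_Bsp[where B="\<bar>y\<bar> + (\<Sum>j<n. \<bar>snd (\<omega> j)\<bar>)"]) (measurable, simp add: abs_kick_freq_le)

lemma set_integral_const_Icc: "a \<le> b \<Longrightarrow> (LINT x:{a..b}|lborel. c) = (b - a) * (c::real)"
  by (simp add: set_lebesgue_integral_def)

lemma kick_freq_power_integrable: "set_integrable lborel {0..s} (\<lambda>s. kick_freq n t y \<omega> s ^ p)"
proof (rule set_integrable_bounded_Icc)
  show "norm (kick_freq n t y \<omega> s ^ p) \<le> (\<bar>y\<bar> + (\<Sum>j<n. \<bar>snd (\<omega> j)\<bar>)) ^ p" for s
    using power_mono[OF abs_kick_freq_le, of n t y \<omega> s p] by (simp add: power_abs)
qed measurable

text \<open>Induction splitting [0, t] at the last kick time \<open>?r\<close>: afterwards the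
  frequency is constant and equal to the final one, before it there is a path with one kick less on
  [0, ?r]. The convention at \<open>?r\<close> itself affects a single point only.\<close>

lemma integral_kick_freq_power:
  assumes "0 \<le> t"
  shows "(LINT s:{0..t}|lborel. kick_freq n t y \<omega> s ^ p) = kick_action p n t (y + kick_sum \<omega> n) \<omega>"
  using assms
proof (induction n arbitrary: t \<omega>)
  case 0
  then show ?case using set_integral_const_Icc[of 0 t "y ^ p"] by (simp add: kick_freq_def)
next
  case (Suc n)
  define d \<omega>' where "d = \<omega> 0" and "\<omega>' = (\<lambda>j. \<omega> (Suc j))"
  have \<omega>: "\<omega> = case_nat d \<omega>'" by (auto simp: fun_eq_iff d_def \<omega>'_def split: nat.split)
  let ?r = "t * unit_clamp (fst d)"
  have r: "0 \<le> ?r" "?r \<le> t" using Suc.prems mult_left_le[of "unit_clamp (fst d)" t] by auto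
  have split: "kick_freq (Suc n) t y \<omega> s = snd d * indicator {?r..} s + kick_freq n ?r y \<omega>' s" for s
    unfolding kick_freq_def \<omega> by (subst sum.lessThan_Suc_shift) simp
  have late: "kick_freq (Suc n) t y \<omega> s = y + kick_sum \<omega> (Suc n)" if "?r \<le> s" for s
  proof -
    have "indicator {kick_time ?r \<omega>' (Suc j)..} s = (1::real)" for j
      using that kick_time_le[OF r(1), of \<omega>' "Suc j"] by simp
    then show ?thesis using that unfolding split unfolding \<omega> kick_sum_case_nat by (simp add: kick_freq_def kick_sum_def)
  qed
  have "(LINT s:{0..t}|lborel. kick_freq (Suc n) t y \<omega> s ^ p)
    = (LINT s:{0..?r}|lborel. kick_freq (Suc n) t y \<omega> s ^ p) + (LINT s:{?r<..t}|lborel. kick_freq (Suc n) t y \<omega> s ^ p)"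
  proof -
    have "{0..t} = {0..?r} \<union> {?r<..t}" using r by auto
    moreover have "(LINT s:{0..?r} \<union> {?r<..t}|lborel. kick_freq (Suc n) t y \<omega> s ^ p)
      = (LINT s:{0..?r}|lborel. kick_freq (Suc n) t y \<omega> s ^ p) + (LINT s:{?r<..t}|lborel. kick_freq (Suc n) t y \<omega> s ^ p)"
      by (rule set_integral_Un)
        (use r in \<open>auto intro: kick_freq_power_integrable set_integrable_subset[OF kick_freq_power_integrable[of t]]\<close>)
    ultimately show ?thesis by simp
  qed
  also have "(LINT s:{0..?r}|lborel. kick_freq (Suc n) t y \<omega> s ^ p) = (LINT s:{0..?r}|lborel. kick_freq n ?r y \<omega>' s ^ p)"
  proof (rule set_integral_cong_AE')
    have "AE s in lborel. s \<noteq> ?r" by (rule AE_lborel_singleton)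
    then show "AE s in lborel. s \<in> {0..?r} \<longrightarrow> kick_freq (Suc n) t y \<omega> s ^ p = kick_freq n ?r y \<omega>' s ^ p"
      by eventually_elim (auto simp: split)
  qed measurable
  also have "\<dots> = kick_action p n ?r (y + kick_sum \<omega>' n) \<omega>'" by (rule Suc.IH[OF r(1)])
  also have "(LINT s:{?r<..t}|lborel. kick_freq (Suc n) t y \<omega> s ^ p) = (LINT s:{?r<..t}|lborel. (y + kick_sum \<omega> (Suc n)) ^ p)"
    by (rule set_lebesgue_integral_cong) (auto simp: late)
  also have "\<dots> = (t - ?r) * (y + kick_sum \<omega> (Suc n)) ^ p" using r by (simp add: set_lebesgue_integral_def)
  finally show ?case unfolding \<omega> by (simp add: algebra_simps)
qed

section \<open>Pairings of kick paths and their continuous dependence on the sample\<close>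

lemma Bdot_tail_integral:
  assumes \<eta>: "brep t \<eta> g" and s: "s \<in> {0..t}"
  shows "(LINT x:{0..t}|lborel. indicator {s..} x * g x) = - \<eta> s"
proof -
  have "(LINT x:{0..t}|lborel. indicator {s..} x * g x) = (LINT x:{s..t}|lborel. g x)"
    unfolding set_lebesgue_integral_def using s
    by (intro Bochner_Integration.integral_cong refl) (auto simp: indicator_def)
  also have "\<dots> = (LBINT \<tau>=s..t. g \<tau>)" using s interval_integral_Icc[of s t g] by simp
  finally show ?thesis using \<eta> s by (simp add: brep_def)
qed

lemma brep_tail_integrable:
  assumes "brep t \<eta> g"
  shows "set_integrable lborel {0..t} (\<lambda>x. indicator {s..} x * g x)"
  by (rule set_integrable_bound[where f=g])
    (use assms in \<open>auto simp: brep_def set_borel_measurable_def indicator_def\<close>)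

text \<open>The derivative of the path is a combination of indicators of [s, \<infinity>), and
  pairing with each of these reads off a value of \<open>\<eta>\<close>. The initial frequency
  counts as a jump at time 0.\<close>

lemma Bpair_kick_path:
  assumes \<eta>: "brep t \<eta> g" and t: "0 < t"
  shows "Bpair t \<eta> (kick_path n t y \<omega>) = y * \<eta> 0 + (\<Sum>j<n. snd (\<omega> j) * \<eta> (kick_time t \<omega> (Suc j)))"
proof -
  have kt: "kick_time t \<omega> (Suc j) \<in> {0..t}" for j
    using t kick_time_nonneg[of t \<omega> "Suc j"] kick_time_le[of t \<omega> "Suc j"] by auto
  have pull: "(LINT x:{0..t}|lborel. (- a) * (indicator {s..} x * g x)) = a * \<eta> s" if "s \<in> {0..t}" for s a
    unfolding set_integral_mult_right Bdot_tail_integral[OF \<eta> that] by simp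
  have "Bpair t \<eta> (kick_path n t y \<omega>) = (LINT x:{0..t}|lborel. g x * - kick_freq n t y \<omega> x)"
    by (rule Bpair_eq[OF \<eta> brep_kick_path t])
  also have "\<dots> = (LINT x:{0..t}|lborel. (- y) * (indicator {0..} x * g x) + (\<Sum>j<n. (- snd (\<omega> j)) * (indicator {kick_time t \<omega> (Suc j)..} x * g x)))"
  proof (rule set_lebesgue_integral_cong)
    have alg: "gx * - (y + (\<Sum>j<n. a j * i j)) = (- y) * (1 * gx) + (\<Sum>j<n. (- a j) * (i j * gx))" for gx :: real and a i :: "nat \<Rightarrow> real"
      by (simp add: sum_distrib_left sum_negf algebra_simps)
    show "\<forall>x. x \<in> {0..t} \<longrightarrow> g x * - kick_freq n t y \<omega> x = (- y) * (indicator {0..} x * g x) + (\<Sum>j<n. (- snd (\<omega> j)) * (indicator {kick_time t \<omega> (Suc j)..} x * g x))"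
    proof (intro allI impI)
      fix x assume "x \<in> {0..t}"
      then have "indicator {0..} x = (1::real)" by simp
      then show "g x * - kick_freq n t y \<omega> x = (- y) * (indicator {0..} x * g x) + (\<Sum>j<n. (- snd (\<omega> j)) * (indicator {kick_time t \<omega> (Suc j)..} x * g x))"
        unfolding kick_freq_def by (simp only: alg)
    qed
  qed simp
  also have "\<dots> = (LINT x:{0..t}|lborel. (- y) * (indicator {0..} x * g x)) + (LINT x:{0..t}|lborel. (\<Sum>j<n. (- snd (\<omega> j)) * (indicator {kick_time t \<omega> (Suc j)..} x * g x)))"
  proof (rule set_integral_add(2))
    show "set_integrable lborel {0..t} (\<lambda>x. (- y) * (indicator {0..} x * g x))"
      by (intro set_integrable_mult_right brep_tail_integrable[OF \<eta>])
    show "set_integrable lborel {0..t} (\<lambda>x. \<Sum>j<n. (- snd (\<omega> j)) * (indicator {kick_time t \<omega> (Suc j)..} x * g x))"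
      unfolding set_integrable_def scaleR_sum_right
      by (intro Bochner_Integration.integrable_sum) (use set_integrable_mult_right[OF brep_tail_integrable[OF \<eta>]] in \<open>simp only: set_integrable_def\<close>)
  qed
  also have "(LINT x:{0..t}|lborel. (\<Sum>j<n. (- snd (\<omega> j)) * (indicator {kick_time t \<omega> (Suc j)..} x * g x)))
    = (\<Sum>j<n. LINT x:{0..t}|lborel. (- snd (\<omega> j)) * (indicator {kick_time t \<omega> (Suc j)..} x * g x))"
    unfolding set_lebesgue_integral_def scaleR_sum_right
    by (intro Bochner_Integration.integral_sum) (use set_integrable_mult_right[OF brep_tail_integrable[OF \<eta>]] in \<open>simp only: set_integrable_def\<close>)
  also have "(LINT x:{0..t}|lborel. (- y) * (indicator {0..} x * g x)) = y * \<eta> 0"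
    by (rule pull) (use t in simp)
  finally show ?thesis unfolding pull[OF kt] .
qed

lemma coordinate_tendsto:
  fixes X :: "nat \<Rightarrow> nat \<Rightarrow> real \<times> real"
  assumes "X \<longlonglongrightarrow> \<omega>"
  shows "(\<lambda>m. X m j) \<longlonglongrightarrow> \<omega> j"
proof -
  have "continuous_on UNIV (\<lambda>\<omega> :: nat \<Rightarrow> real \<times> real. \<omega> j)"
    by (rule continuous_on_product_coordinates)
  then have "isCont (\<lambda>\<omega> :: nat \<Rightarrow> real \<times> real. \<omega> j) \<omega>"
    unfolding continuous_on_eq_continuous_at[OF open_UNIV] by auto
  from isCont_tendsto_compose[OF this assms] show ?thesis .
qed

text \<open>Kick times and jumps depend continuously on the coordinates, so the derivatives converge
  at every time that is not one of the finitely many limiting kick times. Convergence of the jumps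
  also supplies a uniform bound for dominated convergence.\<close>

lemma Bnorm_kick_path_tendsto:
  fixes X :: "nat \<Rightarrow> (nat \<Rightarrow> real \<times> real) \<times> real"
  assumes X: "X \<longlonglongrightarrow> z" and t: "0 < t" and r: "1 \<le> r"
  shows "(\<lambda>m. Bnorm r t (kick_path n t (snd (X m)) (fst (X m)) - kick_path n t (snd z) (fst z))) \<longlonglongrightarrow> 0"
proof -
  have y: "(\<lambda>m. snd (X m)) \<longlonglongrightarrow> snd z" and \<omega>: "(\<lambda>m. fst (X m) j) \<longlonglongrightarrow> fst z j" for j
    using tendsto_snd[OF X] coordinate_tendsto[OF tendsto_fst[OF X]] by auto
  have kt: "(\<lambda>m. kick_time t (fst (X m)) j) \<longlonglongrightarrow> kick_time t (fst z) j" for j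
    unfolding kick_time_def unit_clamp_def by (intro tendsto_intros \<omega>)
  define g where "g m s = - kick_freq n t (snd (X m)) (fst (X m)) s - (- kick_freq n t (snd z) (fst z) s)" for m s
  have [measurable]: "g m \<in> borel_measurable borel" for m unfolding g_def by measurable
  let ?K = "\<lambda>z :: (nat \<Rightarrow> real \<times> real) \<times> real. \<bar>snd z\<bar> + (\<Sum>j<n. \<bar>snd (fst z j)\<bar>)"
  have "(\<lambda>m. ?K (X m)) \<longlonglongrightarrow> ?K z" by (intro tendsto_intros y \<omega>)
  then have "Bseq (\<lambda>m. ?K (X m))" by (rule convergent_imp_Bseq[OF convergentI])
  then obtain C where C: "\<And>m. \<bar>?K (X m)\<bar> \<le> C" by (auto simp: Bseq_def)
  have gb: "\<bar>g m s\<bar> \<le> C + ?K z" for m s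
    using abs_kick_freq_le[of n t "snd (X m)" "fst (X m)" s] abs_kick_freq_le[of n t "snd z" "fst z" s] C[of m]
    unfolding g_def by linarith
  have "(\<lambda>m. LINT s:{0..t}|lborel. \<bar>g m s\<bar> powr r) \<longlonglongrightarrow> (LINT s:{0..t}|lborel. 0)"
    unfolding set_lebesgue_integral_def
  proof (rule integral_dominated_convergence[where w="\<lambda>s. indicator {0..t} s *\<^sub>R (C + ?K z) powr r"])
    show "integrable lborel (\<lambda>s. indicator {0..t} s *\<^sub>R (C + ?K z) powr r)"
      using set_integrable_const_Icc[of 0 t "(C + ?K z) powr r"] unfolding set_integrable_def .
    have fin: "finite ((\<lambda>j. kick_time t (fst z) (Suc j)) ` {..<n})" by simp
    have "AE s in lborel. s \<notin> (\<lambda>j. kick_time t (fst z) (Suc j)) ` {..<n}"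
      by (rule AE_not_in[OF finite_imp_null_set_lborel[OF fin]])
    then show "AE s in lborel. (\<lambda>m. indicator {0..t} s *\<^sub>R \<bar>g m s\<bar> powr r) \<longlonglongrightarrow> indicator {0..t} s *\<^sub>R 0"
    proof eventually_elim
      case (elim s)
      have ind: "(\<lambda>m. indicator {kick_time t (fst (X m)) (Suc j)..} s :: real) \<longlonglongrightarrow> indicator {kick_time t (fst z) (Suc j)..} s" if "j < n" for j
      proof (rule tendsto_eventually)
        have "s \<noteq> kick_time t (fst z) (Suc j)" using elim that by auto
        then consider "s < kick_time t (fst z) (Suc j)" | "kick_time t (fst z) (Suc j) < s" by linarith
        then show "\<forall>\<^sub>F m in sequentially. indicator {kick_time t (fst (X m)) (Suc j)..} s = (indicator {kick_time t (fst z) (Suc j)..} s :: real)"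
        proof cases
          case 1
          from order_tendstoD(1)[OF kt 1] show ?thesis by eventually_elim (use 1 in auto)
        next
          case 2
          from order_tendstoD(2)[OF kt 2] show ?thesis by eventually_elim (use 2 in auto)
        qed
      qed
      have "(\<lambda>m. kick_freq n t (snd (X m)) (fst (X m)) s) \<longlonglongrightarrow> kick_freq n t (snd z) (fst z) s"
        unfolding kick_freq_def by (intro tendsto_intros y \<omega> ind) auto
      then have "(\<lambda>m. g m s) \<longlonglongrightarrow> - kick_freq n t (snd z) (fst z) s - (- kick_freq n t (snd z) (fst z) s)"
        unfolding g_def by (intro tendsto_intros)
      then have "(\<lambda>m. \<bar>g m s\<bar>) \<longlonglongrightarrow> 0" by (simp add: tendsto_rabs_zero_iff)
      then have "(\<lambda>m. \<bar>g m s\<bar> powr r) \<longlonglongrightarrow> 0"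
        using r by (intro tendsto_zero_powrI[where b=r]) auto
      then show ?case by (intro tendsto_intros)
    qed
    show "AE s in lborel. norm (indicator {0..t} s *\<^sub>R \<bar>g m s\<bar> powr r) \<le> indicator {0..t} s *\<^sub>R (C + ?K z) powr r" for m
      using gb[of m] r by (intro AE_I2) (auto simp: indicator_def intro!: powr_mono2)
  qed measurable
  then have "(\<lambda>m. LINT s:{0..t}|lborel. \<bar>g m s\<bar> powr r) \<longlonglongrightarrow> 0" by simp
  moreover have "0 \<le> (LINT s:{0..t}|lborel. \<bar>g m s\<bar> powr r)" for m
    unfolding set_lebesgue_integral_def by (intro integral_nonneg_AE) auto
  ultimately have "(\<lambda>m. (LINT s:{0..t}|lborel. \<bar>g m s\<bar> powr r) powr (1 / r)) \<longlonglongrightarrow> 0"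
    using r by (intro tendsto_zero_powrI[where b="1 / r"]) auto
  then show ?thesis
    unfolding g_def using Bnorm_eq[OF brep_diff[OF brep_kick_path brep_kick_path] t] by simp
qed

text \<open>For each fixed \<open>n\<close> the map is continuous: the complement of the preimage of
  a set in \<open>Bopen\<close> is sequentially closed, which suffices since the sample space is
  first countable.\<close>

lemma kick_path_measurable:
  assumes t: "0 < t" and r: "1 \<le> r"
  shows "(\<lambda>z. kick_path n t (snd z) (fst z)) \<in> measurable (borel :: ((nat \<Rightarrow> real \<times> real) \<times> real) measure) (Bborel r t)"
  unfolding Bborel_def
proof (rule measurable_measure_of)
  show "Bopen r t \<subseteq> Pow (Bsp r t)" by (auto simp: Bopen_def)
  show "(\<lambda>z. kick_path n t (snd z) (fst z)) \<in> space borel \<rightarrow> Bsp r t"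
    using r by (auto intro!: kick_path_in_Bsp)
  fix A assume A: "A \<in> Bopen r t"
  let ?f = "\<lambda>z :: (nat \<Rightarrow> real \<times> real) \<times> real. kick_path n t (snd z) (fst z)"
  have "closed (- (?f -` A))"
    unfolding closed_sequential_limits
  proof (intro allI impI, elim conjE)
    fix X z assume X: "\<forall>m. X m \<in> - (?f -` A)" "X \<longlonglongrightarrow> z"
    show "z \<in> - (?f -` A)"
    proof (rule ccontr)
      assume "z \<notin> - (?f -` A)"
      then have "?f z \<in> A" by simp
      then obtain e where e: "e > 0" "{\<delta> \<in> Bsp r t. Bnorm r t (\<delta> - ?f z) < e} \<subseteq> A"
        using A unfolding Bopen_def by blast
      have "\<forall>\<^sub>F m in sequentially. Bnorm r t (?f (X m) - ?f z) < e"
        using Bnorm_kick_path_tendsto[OF X(2) t r] e(1) by (rule order_tendstoD)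
      then obtain m where "Bnorm r t (?f (X m) - ?f z) < e" by (auto simp: eventually_sequentially)
      moreover have "?f (X m) \<in> Bsp r t" using r by (intro kick_path_in_Bsp) auto
      ultimately have "?f (X m) \<in> A" using e(2) by blast
      then show False using X(1) by auto
    qed
  qed
  then have "open (?f -` A)" by (simp add: closed_def)
  then show "?f -` A \<inter> space borel \<in> sets borel" by simp
qed

lemma brep_continuous:
  assumes \<eta>: "brep t \<eta> g"
  shows "continuous_on {0..t} \<eta>"
proof (rule continuous_on_sequentiallyI)
  fix u a assume u: "\<forall>n. u n \<in> {0..t}" "a \<in> {0..t}" "u \<longlonglongrightarrow> a"
  have [measurable]: "g \<in> borel_measurable borel" using \<eta> by (simp add: brep_def)
  have "(\<lambda>m. LINT x:{0..t}|lborel. indicator {u m..} x * g x) \<longlonglongrightarrow> (LINT x:{0..t}|lborel. indicator {a..} x * g x)"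
    unfolding set_lebesgue_integral_def
  proof (rule integral_dominated_convergence[where w="\<lambda>x. norm (indicator {0..t} x *\<^sub>R g x)"])
    show "integrable lborel (\<lambda>x. norm (indicator {0..t} x *\<^sub>R g x))"
      using \<eta> by (intro integrable_norm) (simp add: brep_def set_integrable_def)
    have "AE x in lborel. x \<noteq> a" by (rule AE_lborel_singleton)
    then show "AE x in lborel. (\<lambda>m. indicator {0..t} x *\<^sub>R (indicator {u m..} x * g x)) \<longlonglongrightarrow> indicator {0..t} x *\<^sub>R (indicator {a..} x * g x)"
    proof eventually_elim
      case (elim x)
      then consider "x < a" | "a < x" by linarith
      then have "\<forall>\<^sub>F m in sequentially. indicator {u m..} x = (indicator {a..} x :: real)"
      proof cases
        case 1
        from order_tendstoD(1)[OF u(3) 1] show ?thesis by eventually_elim (use 1 in auto)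
      next
        case 2
        from order_tendstoD(2)[OF u(3) 2] show ?thesis by eventually_elim (use 2 in auto)
      qed
      then have "(\<lambda>m. indicator {u m..} x :: real) \<longlonglongrightarrow> indicator {a..} x" by (rule tendsto_eventually)
      then show ?case by (intro tendsto_intros)
    qed
  qed (auto simp: indicator_def)
  then have "(\<lambda>m. - \<eta> (u m)) \<longlonglongrightarrow> - \<eta> a"
    using u by (simp add: Bdot_tail_integral[OF \<eta>])
  from tendsto_minus[OF this] show "(\<lambda>m. \<eta> (u m)) \<longlonglongrightarrow> \<eta> a" by simp
qed

section \<open>The exponential of the potential and the representing measure\<close>

context dyson
begin

lemma pot_continuous: "continuous_on UNIV pot"
  unfolding continuous_on_eq_continuous_at[OF open_UNIV]
proof (intro ballI continuous_at_sequentiallyI)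
  fix x u assume u: "u \<longlonglongrightarrow> (x::real)"
  show "(\<lambda>m. pot (u m)) \<longlonglongrightarrow> pot x"
    unfolding pot_def
  proof (rule integral_dominated_convergence[where w="\<lambda>_. c"])
    show "AE y in N. (\<lambda>m. exp (\<i> * complex_of_real (u m * y)) * h y) \<longlonglongrightarrow> exp (\<i> * complex_of_real (x * y)) * h y"
      by (intro AE_I2 tendsto_intros u)
    show "AE y in N. norm (exp (\<i> * complex_of_real (u m * y)) * h y) \<le> c" for m
      by (intro AE_I2) (simp add: norm_mult h_le del: of_real_mult)
  qed auto
qed

text \<open>The phases along \<open>\<eta>\<close> are absorbed into the jump amplitude
  \<open>\<psi>\<close>, whose integral over the jump is \<open>pot (x + \<eta> s)\<close>. The
  expectation with \<open>n\<close> kicks is then the n-th term of the exponential series.\<close>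

lemma exp_potential:
  assumes \<eta>: "continuous_on {0..t} \<eta>"
  shows "(LINT z|Q. (\<lambda>(n, \<omega>). W n t \<omega> * exp (\<i> * complex_of_real (\<Sum>j<n. (x + \<eta> (kick_time t \<omega> (Suc j))) * snd (\<omega> j)))) z)
    = exp (LINT s:{0..t}|lborel. pot (x + \<eta> s))"
    "integrable Q (\<lambda>(n, \<omega>). W n t \<omega> * exp (\<i> * complex_of_real (\<Sum>j<n. (x + \<eta> (kick_time t \<omega> (Suc j))) * snd (\<omega> j))))"
proof -
  \<comment> \<open>Extension by 0 makes the amplitude measurable on the whole line; all kick times
    lie in [0, t], so nothing changes there.\<close>
  define \<eta>' where "\<eta>' s = indicator {0..t} s *\<^sub>R \<eta> s" for s
  have [measurable]: "\<eta>' \<in> borel_measurable borel"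
    unfolding \<eta>'_def by (rule borel_measurable_continuous_on_indicator[OF _ \<eta>]) simp
  define \<psi> where "\<psi> s y = h y * exp (\<i> * complex_of_real ((x + \<eta>' s) * y))" for s y
  have \<psi>m: "(\<lambda>(s, y). \<psi> s y) \<in> borel_measurable (borel \<Otimes>\<^sub>M borel)" unfolding \<psi>_def by measurable
  have \<psi>b: "cmod (\<psi> s y) \<le> c" for s y using h_le[of y] by (simp add: \<psi>_def norm_mult del: of_real_mult of_real_add)
  have \<psi>N: "(LINT y|N. \<psi> s y) = pot (x + \<eta>' s)" for s by (simp add: pot_def \<psi>_def mult.commute)
  have cont: "continuous_on {0..t} (\<lambda>s. LINT y|N. \<psi> s y)"
  proof -
    have "continuous_on {0..t} (\<lambda>s. pot (x + \<eta> s))"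
      by (rule continuous_on_compose2[OF pot_continuous]) (auto intro!: continuous_intros \<eta>)
    then show ?thesis unfolding \<psi>N by (rule continuous_on_eq) (simp add: \<eta>'_def)
  qed
  have kt: "kick_time t \<omega> j \<in> {0..t}" for \<omega> j using kick_time_nonneg[OF t_nonneg] kick_time_le[OF t_nonneg] by simp
  have weq: "W n t \<omega> * exp (\<i> * complex_of_real (\<Sum>j<n. (x + \<eta> (kick_time t \<omega> (Suc j))) * snd (\<omega> j))) = kick_weight \<psi> n t \<omega>" for n \<omega>
  proof -
    have "\<eta>' (kick_time t \<omega> (Suc j)) = \<eta> (kick_time t \<omega> (Suc j))" for j using kt[of \<omega> "Suc j"] by (simp add: \<eta>'_def)
    then show ?thesis
      unfolding kick_weight_def \<psi>_def by (simp add: exp_sum sum_distrib_left prod.distrib[symmetric] mult_ac)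
  qed
  show i: "integrable Q (\<lambda>(n, \<omega>). W n t \<omega> * exp (\<i> * complex_of_real (\<Sum>j<n. (x + \<eta> (kick_time t \<omega> (Suc j))) * snd (\<omega> j))))"
    unfolding weq
  proof (rule integrable_Q_dominated(1)[OF c_nonneg])
    show "kick_weight \<psi> n t \<in> borel_measurable borel" for n
      using measurable_kick_weight[OF \<psi>m, of "\<lambda>_. t" borel "\<lambda>\<omega>. \<omega>" n] by simp
    show "cmod (kick_weight \<psi> n t \<omega>) \<le> 1 * dominant c t n \<omega>" for n \<omega>
      using norm_kick_weight_le[OF t_nonneg order_refl \<psi>b] by simp
  qed
  have sums: "(\<lambda>n. (LINT s:{0..t}|lborel. LINT y|N. \<psi> s y) ^ n / fact n) sums
     (LINT z|Q. (\<lambda>(n, \<omega>). W n t \<omega> * exp (\<i> * complex_of_real (\<Sum>j<n. (x + \<eta> (kick_time t \<omega> (Suc j))) * snd (\<omega> j)))) z)"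
    using integral_Q_sums[OF i] unfolding weq
    using integral_kick_weight[OF \<psi>m \<psi>b cont, of t] t_nonneg by simp
  have "(\<lambda>n. (LINT s:{0..t}|lborel. LINT y|N. \<psi> s y) ^ n / fact n) sums exp (LINT s:{0..t}|lborel. LINT y|N. \<psi> s y)"
    using exp_converges[of "LINT s:{0..t}|lborel. LINT y|N. \<psi> s y"] by (simp add: scaleR_conv_of_real field_simps)
  from sums_unique2[OF sums this]
  have "(LINT z|Q. (\<lambda>(n, \<omega>). W n t \<omega> * exp (\<i> * complex_of_real (\<Sum>j<n. (x + \<eta> (kick_time t \<omega> (Suc j))) * snd (\<omega> j)))) z)
    = exp (LINT s:{0..t}|lborel. LINT y|N. \<psi> s y)" .
  also have "(LINT s:{0..t}|lborel. LINT y|N. \<psi> s y) = (LINT s:{0..t}|lborel. pot (x + \<eta> s))"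
    unfolding \<psi>N by (rule set_lebesgue_integral_cong) (auto simp: \<eta>'_def)
  finally show "(LINT z|Q. (\<lambda>(n, \<omega>). W n t \<omega> * exp (\<i> * complex_of_real (\<Sum>j<n. (x + \<eta> (kick_time t \<omega> (Suc j))) * snd (\<omega> j)))) z)
    = exp (LINT s:{0..t}|lborel. pot (x + \<eta> s))" .
qed

text \<open>The sample consists of the number of kicks, the kicks and the initial frequency; the
  complex weight contains the phase of the total frequency at \<open>x\<close>, while the path does
  not see \<open>x\<close>. Pairing and phase recombine to (x + \<eta> 0) y plus the sum of (x +
  \<eta> s_j) y_j, so the integral factorises into \<open>u0 (x + \<eta> 0)\<close> and the
  exponential of the potential.\<close>

theorem FB_rep_exists:
  fixes M0 :: "real measure" and h0 u0 :: "real \<Rightarrow> complex" and f :: "(real \<Rightarrow> real) \<Rightarrow> complex"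
  assumes t: "0 < t" and p: "2 \<le> p" and q: "q = real p / (real p - 1)"
    and sM0: "sets M0 = sets borel" and M0: "finite_measure M0" and h0: "integrable M0 h0"
    and u0: "\<And>x. u0 x = (LINT y|M0. exp (\<i> * complex_of_real (x * y)) * h0 y)"
    and f: "\<And>\<eta>. f \<eta> = u0 (x + \<eta> 0) * exp (LBINT s=0..t. pot (x + \<eta> s))"
    and \<beta>: "\<And>g :: real \<Rightarrow> real. Re ((- 1) ^ p * \<alpha> * complex_of_real (LBINT s=0..t. g s ^ p)) \<le> 0"
  obtains M H where "FB_rep (real p) q t f M H" "I_Phi p \<alpha> t M H = (LINT y|M0. wave x y * h0 y)"
proof -
  note [measurable_cong] = sM0
  interpret M0: finite_measure M0 by fact
  have pq: "1 < real p" "1 < q" "1 / real p + 1 / q = 1" using p by (auto simp: q field_simps)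
  have h0m[measurable]: "h0 \<in> borel_measurable borel" 
    using borel_measurable_integrable[OF h0] measurable_cong_sets[OF sM0 refl] by blast
  interpret Qs: sigma_finite_measure Q by (rule sigma_finite_Q)
  interpret QM: pair_sigma_finite Q M0 ..
  let ?\<Gamma> = "\<lambda>z :: (nat \<times> (nat \<Rightarrow> real \<times> real)) \<times> real. kick_path (fst (fst z)) t (snd z) (snd (fst z))"
  let ?w = "\<lambda>((n, \<omega>), y). exp (\<i> * complex_of_real (x * (y + kick_sum \<omega> n))) * (W n t \<omega> * h0 y)"
  have \<Gamma>m: "?\<Gamma> \<in> measurable (Q \<Otimes>\<^sub>M M0) (Bborel (real p) t)"
  proof (rule measurable_compose_countable[where g="\<lambda>z. fst (fst z)" and f="\<lambda>n z. kick_path n t (snd z) (snd (fst z))"])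
    fix n :: nat
    have "(\<lambda>z. (snd (fst z), snd z)) \<in> measurable (Q \<Otimes>\<^sub>M M0) (borel \<Otimes>\<^sub>M borel)" by measurable
    then have "(\<lambda>z. (snd (fst z), snd z)) \<in> measurable (Q \<Otimes>\<^sub>M M0) (borel :: ((nat \<Rightarrow> real \<times> real) \<times> real) measure)"
      by (simp add: borel_prod)
    from measurable_compose[OF this kick_path_measurable[OF t less_imp_le[OF pq(1)]]]
    show "(\<lambda>z. kick_path n t (snd z) (snd (fst z))) \<in> measurable (Q \<Otimes>\<^sub>M M0) (Bborel (real p) t)" by simp
  qed measurable
  have Wi: "integrable Q (\<lambda>(n, \<omega>). W n t \<omega>)"
  proof (rule integrable_Q_dominated(1)[OF c_nonneg])
    show "cmod (W n t \<omega>) \<le> 1 * dominant c t n \<omega>" for n \<omega>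
      using norm_kick_weight_le[OF t_nonneg order_refl, of "\<lambda>_. h" c] h_le by simp
  qed measurable
  have wi: "integrable (Q \<Otimes>\<^sub>M M0) ?w"
  proof -
    have "integrable (Q \<Otimes>\<^sub>M M0) (\<lambda>(z, y). (\<lambda>(n, \<omega>). W n t \<omega>) z * h0 y)"
      by (rule integrable_pair_mult[OF sigma_finite_Q M0.sigma_finite_measure_axioms Wi h0])
    then have "integrable (Q \<Otimes>\<^sub>M M0) (\<lambda>v. exp (\<i> * complex_of_real ((\<lambda>((n, \<omega>), y). x * (y + kick_sum \<omega> n)) v)) * (\<lambda>(z, y). (\<lambda>(n, \<omega>). W n t \<omega>) z * h0 y) v)"
    proof (rule integrable_cexp_mult)
      show "(\<lambda>((n, \<omega>), y). x * (y + kick_sum \<omega> n)) \<in> borel_measurable (Q \<Otimes>\<^sub>M M0)"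
        by (rule pair_pair_count_space_measurable[where f="\<lambda>n \<omega> y. x * (y + kick_sum \<omega> n)"]) measurable
    qed
    then show ?thesis by (simp add: case_prod_unfold)
  qed
  obtain M H where MH: "sets M = sets (Bborel (real p) t)" "finite_measure M" "integrable M H"
    and push: "\<And>\<phi> B. \<phi> \<in> borel_measurable (Bborel (real p) t) \<Longrightarrow> (\<And>x. cmod (\<phi> x) \<le> B) \<Longrightarrow>
      (LINT x|M. \<phi> x * H x) = (LINT x|(Q \<Otimes>\<^sub>M M0). \<phi> (?\<Gamma> x) * ?w x)"
    using pushforward_density[OF wi \<Gamma>m] by blast
  have rep: "FB_rep (real p) q t f M H"
    unfolding FB_rep_def
  proof (intro conjI ballI MH)
    fix \<eta> assume \<eta>: "\<eta> \<in> Bsp q t"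
    note g = Bsp_Bdot(1)[OF \<eta> t]
    note cont = brep_continuous[OF g]
    let ?E = "\<lambda>(n, \<omega>). W n t \<omega> * exp (\<i> * complex_of_real (\<Sum>j<n. (x + \<eta> (kick_time t \<omega> (Suc j))) * snd (\<omega> j)))"
    let ?e = "\<lambda>y. exp (\<i> * complex_of_real ((x + \<eta> 0) * y)) * h0 y"
    have ei: "integrable M0 ?e" by (rule integrable_cexp_mult[OF h0]) measurable
    have "(LINT \<gamma>|M. exp (\<i> * complex_of_real (Bpair t \<eta> \<gamma>)) * H \<gamma>)
      = (LINT v|(Q \<Otimes>\<^sub>M M0). exp (\<i> * complex_of_real (Bpair t \<eta> (?\<Gamma> v))) * ?w v)"
    proof (rule push)
      show "(\<lambda>\<gamma>. exp (\<i> * complex_of_real (Bpair t \<eta> \<gamma>))) \<in> borel_measurable (Bborel (real p) t)"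
        using Bpair_measurable[OF pq t \<eta>] by measurable
      show "cmod (exp (\<i> * complex_of_real (Bpair t \<eta> \<gamma>))) \<le> 1" for \<gamma> by (simp only: norm_exp_ii_times order_refl)
    qed
    also have "\<dots> = (LINT v|(Q \<Otimes>\<^sub>M M0). (\<lambda>(z, y). ?E z * ?e y) v)"
    proof (rule Bochner_Integration.integral_cong[OF refl])
      fix v :: "(nat \<times> (nat \<Rightarrow> real \<times> real)) \<times> real"
      obtain n \<omega> y where v: "v = ((n, \<omega>), y)" by (metis prod.exhaust)
      have "(y * \<eta> 0 + (\<Sum>j<n. snd (\<omega> j) * \<eta> (kick_time t \<omega> (Suc j)))) + x * (y + kick_sum \<omega> n)
        = (\<Sum>j<n. (x + \<eta> (kick_time t \<omega> (Suc j))) * snd (\<omega> j)) + (x + \<eta> 0) * y"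
        by (simp add: kick_sum_def sum_distrib_left sum.distrib[symmetric] algebra_simps)
      then have "exp (\<i> * complex_of_real (Bpair t \<eta> (kick_path n t y \<omega>))) * exp (\<i> * complex_of_real (x * (y + kick_sum \<omega> n)))
        = exp (\<i> * complex_of_real (\<Sum>j<n. (x + \<eta> (kick_time t \<omega> (Suc j))) * snd (\<omega> j))) * exp (\<i> * complex_of_real ((x + \<eta> 0) * y))"
        unfolding Bpair_kick_path[OF g t] exp_add[symmetric] distrib_left[symmetric] of_real_add[symmetric] by (simp only:)
      moreover have "a * (d * (w * r)) = (w * k) * (l * r)" if "a * d = k * l" for a d w r k l :: complex
        using that by algebra
      ultimately show "exp (\<i> * complex_of_real (Bpair t \<eta> (?\<Gamma> v))) * ?w v = (\<lambda>(z, y). ?E z * ?e y) v"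
        unfolding v by (simp only: prod.case fst_conv snd_conv)
    qed
    also have "\<dots> = (LINT z|Q. LINT y|M0. ?E z * ?e y)"
    proof -
      have "integrable (Q \<Otimes>\<^sub>M M0) (\<lambda>(z, y). ?E z * ?e y)"
        by (rule integrable_pair_mult[OF sigma_finite_Q M0.sigma_finite_measure_axioms exp_potential(2)[OF cont] ei])
      from QM.integral_fst'[OF this] show ?thesis by simp
    qed
    also have "\<dots> = (LINT z|Q. ?E z) * (LINT y|M0. ?e y)" by (simp only: integral_mult_right_zero integral_mult_left_zero)
    also have "(LINT z|Q. ?E z) = exp (LINT s:{0..t}|lborel. pot (x + \<eta> s))" by (rule exp_potential(1)[OF cont])
    also have "(LINT y|M0. ?e y) = u0 (x + \<eta> 0)" by (rule u0[symmetric])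
    finally show "f \<eta> = (LINT \<gamma>|M. exp (\<i> * complex_of_real (Bpair t \<eta> \<gamma>)) * H \<gamma>)"
      unfolding f LBINT_eq_Icc[OF t] by (simp only: mult.commute)
  qed
  \<comment> \<open>The condition on \<open>\<alpha>\<close> at - y, since (-1)^p y^p = (-
    y)^p.\<close>
  have \<beta>1: "Re ((- 1) ^ p * \<alpha> * complex_of_real (y ^ p)) \<le> 0" for y :: real
  proof -
    have "complex_of_real ((- y) ^ p) = (- 1) ^ p * complex_of_real (y ^ p)"
      using power_minus[of "complex_of_real y" p] by simp
    then have "(- 1) ^ p * \<alpha> * complex_of_real (y ^ p) = \<alpha> * complex_of_real ((- y) ^ p)"
      by (simp only: mult_ac)
    then show ?thesis using alpha[of "- y"] by (simp only:)
  qed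
  \<comment> \<open>Measurability of the exponential of the action is taken from the uniqueness
    theorem, with the same representation in both places.\<close>
  note um = FB_rep_action_unique(1)[OF t p q \<beta>1 \<beta> rep rep]
  have "I_Phi p \<alpha> t M H = (LINT v|(Q \<Otimes>\<^sub>M M0). exp ((- 1) ^ p * \<alpha> * complex_of_real (LBINT s=0..t. Bdot t (?\<Gamma> v) s ^ p)) * ?w v)"
    unfolding I_Phi_def
  proof (rule push[OF um])
    show "cmod (exp ((- 1) ^ p * \<alpha> * complex_of_real (LBINT s=0..t. Bdot t \<gamma> s ^ p))) \<le> 1" for \<gamma>
      using \<beta>[of "Bdot t \<gamma>"] by (simp only: norm_exp_eq_Re exp_le_one_iff)
  qed
  also have "\<dots> = (LINT v|(Q \<Otimes>\<^sub>M M0). (\<lambda>(z, y). (case z of (n, \<omega>) \<Rightarrow> W n t \<omega> * (exp (\<i> * complex_of_real (x * (y + kick_sum \<omega> n)))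
      * exp (\<alpha> * complex_of_real (kick_action p n t (y + kick_sum \<omega> n) \<omega>)))) * h0 y) v)"
  proof (rule Bochner_Integration.integral_cong[OF refl])
    fix v :: "(nat \<times> (nat \<Rightarrow> real \<times> real)) \<times> real"
    obtain n \<omega> y where v: "v = ((n, \<omega>), y)" by (metis prod.exhaust)
    have "(LBINT s=0..t. Bdot t (kick_path n t y \<omega>) s ^ p) = (LINT s:{0..t}|lborel. (- kick_freq n t y \<omega> s) ^ p)"
      by (rule integral_Bdot_power[OF brep_kick_path t])
    also have "\<dots> = (LINT s:{0..t}|lborel. (- 1) ^ p * kick_freq n t y \<omega> s ^ p)"
      by (intro set_lebesgue_integral_cong) (auto simp: power_minus[of "kick_freq n t y \<omega> _"])
    also have "\<dots> = (- 1) ^ p * kick_action p n t (y + kick_sum \<omega> n) \<omega>"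
      using integral_kick_freq_power[OF t_nonneg, of n y \<omega> p] by simp
    finally have "(- 1) ^ p * \<alpha> * complex_of_real (LBINT s=0..t. Bdot t (kick_path n t y \<omega>) s ^ p) = \<alpha> * complex_of_real (kick_action p n t (y + kick_sum \<omega> n) \<omega>)"
      by (simp add: power_mult_distrib[symmetric] mult_ac)
    then show "exp ((- 1) ^ p * \<alpha> * complex_of_real (LBINT s=0..t. Bdot t (?\<Gamma> v) s ^ p)) * ?w v
      = (\<lambda>(z, y). (case z of (n, \<omega>) \<Rightarrow> W n t \<omega> * (exp (\<i> * complex_of_real (x * (y + kick_sum \<omega> n)))
      * exp (\<alpha> * complex_of_real (kick_action p n t (y + kick_sum \<omega> n) \<omega>)))) * h0 y) v"
      unfolding v by (simp only: prod.case fst_conv snd_conv mult_ac)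
  qed
  also have "\<dots> = (LINT y|M0. LINT z|Q. (case z of (n, \<omega>) \<Rightarrow> W n t \<omega> * (exp (\<i> * complex_of_real (x * (y + kick_sum \<omega> n)))
      * exp (\<alpha> * complex_of_real (kick_action p n t (y + kick_sum \<omega> n) \<omega>)))) * h0 y)"
  proof -
    let ?F = "\<lambda>((n, \<omega>), y). exp (\<alpha> * complex_of_real (kick_action p n t (y + kick_sum \<omega> n) \<omega>))"
    have "integrable (Q \<Otimes>\<^sub>M M0) (\<lambda>v. ?F v * ?w v)"
    proof (rule integrable_bounded_mult[OF wi, where B=1])
      show "?F \<in> borel_measurable (Q \<Otimes>\<^sub>M M0)"
        by (rule pair_pair_count_space_measurable[where f="\<lambda>n \<omega> y. exp (\<alpha> * complex_of_real (kick_action p n t (y + kick_sum \<omega> n) \<omega>))"]) measurable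
      show "cmod (?F v) \<le> 1" for v
        using norm_exp_kick_action_le[OF t_nonneg alpha] by (cases v) (auto split: prod.split)
    qed
    then have "integrable (Q \<Otimes>\<^sub>M M0) (\<lambda>(z, y). (case z of (n, \<omega>) \<Rightarrow> W n t \<omega> * (exp (\<i> * complex_of_real (x * (y + kick_sum \<omega> n)))
      * exp (\<alpha> * complex_of_real (kick_action p n t (y + kick_sum \<omega> n) \<omega>)))) * h0 y)"
      by (simp add: case_prod_unfold mult_ac)
    from QM.integral_snd[OF this] show ?thesis by simp
  qed
  also have "\<dots> = (LINT y|M0. wave x y * h0 y)"
    unfolding wave_def by (simp only: integral_mult_left_zero)
  finally show thesis using rep that by blast
qed

end

subsection \<open>General initial values\<close>

lemma continuous_on_LINT_real:
  fixes F :: "'a \<Rightarrow> real \<Rightarrow> complex"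
  assumes F: "\<And>y. continuous_on UNIV (F y)" and m: "\<And>k. (\<lambda>y. F y k) \<in> borel_measurable M"
    and w: "integrable M w" and le: "\<And>y k. y \<in> space M \<Longrightarrow> cmod (F y k) \<le> w y"
  shows "continuous_on UNIV (\<lambda>k. LINT y|M. F y k)"
  unfolding continuous_on_eq_continuous_at[OF open_UNIV]
proof (intro ballI continuous_at_sequentiallyI)
  fix k u assume u: "u \<longlonglongrightarrow> (k::real)"
  show "(\<lambda>n. LINT y|M. F y (u n)) \<longlonglongrightarrow> (LINT y|M. F y k)"
  proof (rule integral_dominated_convergence[OF m m w])
    show "AE y in M. (\<lambda>n. F y (u n)) \<longlonglongrightarrow> F y k"
    proof (rule AE_I2)
      fix y
      have "isCont (F y) k" using F[of y] by (simp add: continuous_on_eq_continuous_at)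
      then show "(\<lambda>n. F y (u n)) \<longlonglongrightarrow> F y k" using u by (rule isCont_tendsto_compose)
    qed
  qed (use le in auto)
qed

definition gauss :: "real \<Rightarrow> real \<Rightarrow> real" where
  "gauss \<epsilon> z = std_normal_density (z / \<epsilon>) / \<epsilon>"

lemma gauss_nonneg: "0 < \<epsilon> \<Longrightarrow> 0 \<le> gauss \<epsilon> z"
  by (simp add: gauss_def)

lemma gauss_measurable [measurable]: "gauss \<epsilon> \<in> borel_measurable borel"
  unfolding gauss_def by measurable

lemma gauss_continuous: "continuous_on UNIV (\<lambda>k. complex_of_real (gauss \<epsilon> (k - y)))"
  unfolding gauss_def std_normal_density_def by (cases "\<epsilon> = 0") (auto intro!: continuous_intros)

text \<open>Completing the square: (|z| / \<epsilon> - \<epsilon>)^2 \<ge> 0. The Gaussian thus has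
  the exponential decay that \<open>evolution\<close> requires of an initial density.\<close>

lemma gauss_le_exp:
  assumes \<epsilon>: "0 < \<epsilon>"
  shows "gauss \<epsilon> z \<le> exp (\<epsilon>\<^sup>2 / 2) / \<epsilon> * exp (- \<bar>z\<bar>)"
proof -
  have s: "1 / sqrt (2 * pi) \<le> 1"
  proof -
    have "1 \<le> sqrt (2 * pi)" using pi_gt3 by simp
    then show ?thesis by simp
  qed
  have "0 \<le> (\<bar>z\<bar> / \<epsilon> - \<epsilon>)\<^sup>2" by simp
  then have "- (z / \<epsilon>)\<^sup>2 / 2 \<le> \<epsilon>\<^sup>2 / 2 - \<bar>z\<bar>"
    using \<epsilon> by (simp add: power2_diff power_divide)
  then have "exp (- (z / \<epsilon>)\<^sup>2 / 2) \<le> exp (\<epsilon>\<^sup>2 / 2) * exp (- \<bar>z\<bar>)"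
    by (simp add: exp_add[symmetric])
  moreover have "std_normal_density (z / \<epsilon>) \<le> exp (- (z / \<epsilon>)\<^sup>2 / 2)"
    unfolding std_normal_density_def using s by (intro mult_left_le_one_le) auto
  ultimately have "std_normal_density (z / \<epsilon>) \<le> exp (\<epsilon>\<^sup>2 / 2) * exp (- \<bar>z\<bar>)" by linarith
  then show ?thesis unfolding gauss_def using \<epsilon> by (simp add: divide_right_mono)
qed

lemma integral_gauss:
  fixes f :: "real \<Rightarrow> complex"
  assumes \<epsilon>: "0 < \<epsilon>"
  shows "(LINT k|lborel. complex_of_real (gauss \<epsilon> (k - y)) * f k) = (LINT z|lborel. complex_of_real (std_normal_density z) * f (y + \<epsilon> * z))"
proof -
  have "(LINT k|lborel. complex_of_real (gauss \<epsilon> (k - y)) * f k) = \<bar>\<epsilon>\<bar> *\<^sub>R (LINT z|lborel. complex_of_real (gauss \<epsilon> ((y + \<epsilon> * z) - y)) * f (y + \<epsilon> * z))"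
    by (rule lborel_integral_real_affine) (use \<epsilon> in simp)
  also have "\<dots> = (LINT z|lborel. \<bar>\<epsilon>\<bar> *\<^sub>R (complex_of_real (gauss \<epsilon> ((y + \<epsilon> * z) - y)) * f (y + \<epsilon> * z)))"
    by (rule integral_scaleR_right[symmetric])
  also have "\<dots> = (LINT z|lborel. complex_of_real (std_normal_density z) * f (y + \<epsilon> * z))"
    using \<epsilon> by (intro Bochner_Integration.integral_cong refl) (simp add: gauss_def scaleR_conv_of_real)
  finally show ?thesis .
qed

lemma integrable_gauss: "0 < \<epsilon> \<Longrightarrow> integrable lborel (\<lambda>k. complex_of_real (gauss \<epsilon> (k - y)))"
proof -
  assume \<epsilon>: "0 < \<epsilon>"
  have "integrable lborel (\<lambda>k. complex_of_real (std_normal_density (- y / \<epsilon> + (1 / \<epsilon>) * k)))"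
    by (subst lborel_integrable_real_affine_iff) (use \<epsilon> integrable_std_normal in auto)
  then have "integrable lborel (\<lambda>k. complex_of_real (std_normal_density (- y / \<epsilon> + (1 / \<epsilon>) * k)) / complex_of_real \<epsilon>)"
    by (rule integrable_divide)
  moreover have "gauss \<epsilon> (k - y) = std_normal_density (- y / \<epsilon> + (1 / \<epsilon>) * k) / \<epsilon>" for k
    by (simp add: gauss_def diff_divide_distrib)
  ultimately show ?thesis by simp
qed

text \<open>Initial values with continuous, exponentially decaying Fourier transform: truncate the measure
  and mollify it with a Gaussian.\<close>

locale initial_measure = M0: finite_measure M0 for M0 :: "real measure" +
  fixes h0 :: "real \<Rightarrow> complex"
  assumes sets_M0 [measurable_cong]: "sets M0 = sets borel" and h0_int: "integrable M0 h0"
begin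

lemma h0_measurable [measurable]: "h0 \<in> borel_measurable borel"
  using borel_measurable_integrable[OF h0_int] measurable_cong_sets[OF sets_M0 refl] by blast

definition trunc :: "real \<Rightarrow> real \<Rightarrow> complex" where
  "trunc R y = (if \<bar>y\<bar> \<le> R then h0 y else 0)"

lemma trunc_measurable [measurable]: "trunc R \<in> borel_measurable borel"
  unfolding trunc_def by measurable

lemma norm_trunc_le: "cmod (trunc R y) \<le> cmod (h0 y)"
  by (simp add: trunc_def)

lemma trunc_int: "integrable M0 (trunc R)"
  by (rule Bochner_Integration.integrable_bound[OF h0_int]) (auto simp: norm_trunc_le)

definition mollified :: "real \<Rightarrow> real \<Rightarrow> real \<Rightarrow> complex" where
  "mollified \<epsilon> R k = (LINT y|M0. complex_of_real (gauss \<epsilon> (k - y)) * trunc R y)"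

definition charf :: "(real \<Rightarrow> complex) \<Rightarrow> real \<Rightarrow> complex" where
  "charf g x = (LINT y|M0. exp (\<i> * complex_of_real (x * y)) * g y)"

definition mass :: real where "mass = (LINT y|M0. cmod (h0 y))"

text \<open>For |y| \<le> R shifting the Gaussian by \<open>y\<close> costs at most exp R in the
  decay rate exp (- |k|); this is what truncating the measure is for.\<close>

lemma mollified_le:
  assumes \<epsilon>: "0 < \<epsilon>"
  shows "cmod (mollified \<epsilon> R k) \<le> exp (\<epsilon>\<^sup>2 / 2) / \<epsilon> * exp R * mass * exp (- \<bar>k\<bar>)"
proof -
  have le: "cmod (complex_of_real (gauss \<epsilon> (k - y)) * trunc R y) \<le> exp (\<epsilon>\<^sup>2 / 2) / \<epsilon> * exp R * exp (- \<bar>k\<bar>) * cmod (h0 y)" for y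
  proof (cases "\<bar>y\<bar> \<le> R")
    case True
    then have "exp (- \<bar>k - y\<bar>) \<le> exp R * exp (- \<bar>k\<bar>)" by (simp add: exp_add[symmetric])
    then have "exp (\<epsilon>\<^sup>2 / 2) / \<epsilon> * exp (- \<bar>k - y\<bar>) \<le> exp (\<epsilon>\<^sup>2 / 2) / \<epsilon> * (exp R * exp (- \<bar>k\<bar>))"
      using \<epsilon> by (intro mult_left_mono) auto
    then have "gauss \<epsilon> (k - y) \<le> exp (\<epsilon>\<^sup>2 / 2) / \<epsilon> * (exp R * exp (- \<bar>k\<bar>))"
      using gauss_le_exp[OF \<epsilon>, of "k - y"] by linarith
    then have "gauss \<epsilon> (k - y) * cmod (h0 y) \<le> exp (\<epsilon>\<^sup>2 / 2) / \<epsilon> * (exp R * exp (- \<bar>k\<bar>)) * cmod (h0 y)"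
      by (intro mult_right_mono) auto
    then show ?thesis using True gauss_nonneg[OF \<epsilon>, of "k - y"] by (simp add: norm_mult trunc_def mult_ac)
  qed (use \<epsilon> in \<open>simp add: trunc_def\<close>)
  have i: "integrable M0 (\<lambda>y. exp (\<epsilon>\<^sup>2 / 2) / \<epsilon> * exp R * exp (- \<bar>k\<bar>) * cmod (h0 y))" using h0_int by (intro integrable_mult_right integrable_norm)
  have "cmod (mollified \<epsilon> R k) \<le> (LINT y|M0. cmod (complex_of_real (gauss \<epsilon> (k - y)) * trunc R y))"
    unfolding mollified_def by (rule integral_norm_bound)
  also have "\<dots> \<le> (LINT y|M0. exp (\<epsilon>\<^sup>2 / 2) / \<epsilon> * exp R * exp (- \<bar>k\<bar>) * cmod (h0 y))"
    by (rule integral_mono_AE'[OF i]) (use le \<epsilon> in auto)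
  also have "\<dots> = exp (\<epsilon>\<^sup>2 / 2) / \<epsilon> * exp R * exp (- \<bar>k\<bar>) * mass" unfolding mass_def by (rule integral_mult_right_zero)
  finally show ?thesis by (simp only: mult_ac)
qed

lemma mollified_continuous:
  assumes \<epsilon>: "0 < \<epsilon>"
  shows "continuous_on UNIV (mollified \<epsilon> R)"
proof -
  have "continuous_on UNIV (\<lambda>k. LINT y|M0. complex_of_real (gauss \<epsilon> (k - y)) * trunc R y)"
  proof (rule continuous_on_LINT_real)
    show "continuous_on UNIV (\<lambda>k. complex_of_real (gauss \<epsilon> (k - y)) * trunc R y)" for y
      by (intro continuous_intros gauss_continuous)
    show "integrable M0 (\<lambda>y. exp (\<epsilon>\<^sup>2 / 2) / \<epsilon> * cmod (h0 y))" using h0_int by auto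
    show "cmod (complex_of_real (gauss \<epsilon> (k - y)) * trunc R y) \<le> exp (\<epsilon>\<^sup>2 / 2) / \<epsilon> * cmod (h0 y)" for y k
    proof -
      have "exp (\<epsilon>\<^sup>2 / 2) / \<epsilon> * exp (- \<bar>k - y\<bar>) \<le> exp (\<epsilon>\<^sup>2 / 2) / \<epsilon> * 1" using \<epsilon> by (intro mult_left_mono) auto
      then have "gauss \<epsilon> (k - y) \<le> exp (\<epsilon>\<^sup>2 / 2) / \<epsilon>" using gauss_le_exp[OF \<epsilon>, of "k - y"] by linarith
      then show ?thesis unfolding norm_mult using norm_trunc_le gauss_nonneg[OF \<epsilon>, of "k - y"] \<epsilon> by (intro mult_mono) auto
    qed
  qed measurable
  then show ?thesis unfolding mollified_def[abs_def] .
qed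

text \<open>After scaling the Gaussian variable, \<open>\<epsilon>\<close> occurs only in the
  argument of \<open>f\<close>, so \<epsilon> tending to 0 uses continuity of \<open>f\<close>
  alone. With f an exponential this gives the transform of the mollified density, with f =
  \<open>wave\<close> the limit of the solutions.\<close>

lemma integral_mollified_mult:
  assumes \<epsilon>: "0 < \<epsilon>" and f[measurable]: "f \<in> borel_measurable borel" and B: "\<And>k. cmod (f k) \<le> B"
  shows "(LINT k|lborel. mollified \<epsilon> R k * f k) = (LINT y|M0. trunc R y * (LINT z|lborel. complex_of_real (std_normal_density z) * f (y + \<epsilon> * z)))"
proof -
  interpret MK: pair_sigma_finite M0 lborel ..
  let ?F = "\<lambda>y k. complex_of_real (gauss \<epsilon> (k - y)) * trunc R y * f k"
  have gi: "integrable lborel (\<lambda>k. cmod (complex_of_real (gauss \<epsilon> (k - y))))" for y using integrable_gauss[OF \<epsilon>] by (rule integrable_norm)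
  have g1: "(LINT k|lborel. cmod (complex_of_real (gauss \<epsilon> (k - y)))) = 1" for y
  proof -
    have "complex_of_real (LINT k|lborel. gauss \<epsilon> (k - y)) = 1"
      using integral_gauss[OF \<epsilon>, of y "\<lambda>_. 1"] integral_std_normal by simp
    then show ?thesis using gauss_nonneg[OF \<epsilon>] by simp
  qed
  have B0: "0 \<le> B" using B order_trans[OF norm_ge_zero] by blast
  have i1: "integrable lborel (?F y)" for y
  proof -
    have "integrable lborel (\<lambda>k. f k * (complex_of_real (gauss \<epsilon> (k - y)) * trunc R y))"
      by (intro integrable_bounded_mult[OF integrable_mult_left[OF integrable_gauss[OF \<epsilon>]] _ B]) simp
    then show ?thesis by (simp only: mult_ac)
  qed
  have int: "integrable (M0 \<Otimes>\<^sub>M lborel) (\<lambda>(y, k). ?F y k)"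
  proof (rule MK.Fubini_integrable)
    show "integrable M0 (\<lambda>y. LINT k|lborel. norm ((\<lambda>(y, k). ?F y k) (y, k)))"
    proof (rule Bochner_Integration.integrable_bound)
      show "integrable M0 (\<lambda>y. B * cmod (h0 y))" using h0_int by auto
      show "AE y in M0. norm (LINT k|lborel. norm ((\<lambda>(y, k). ?F y k) (y, k))) \<le> norm (B * cmod (h0 y))"
      proof (rule AE_I2)
        fix y
        have "(LINT k|lborel. norm (?F y k)) \<le> (LINT k|lborel. B * cmod (h0 y) * cmod (complex_of_real (gauss \<epsilon> (k - y))))"
        proof (rule integral_mono)
          show "integrable lborel (\<lambda>k. B * cmod (h0 y) * cmod (complex_of_real (gauss \<epsilon> (k - y))))" by (intro integrable_mult_right gi)
          show "norm (?F y k) \<le> B * cmod (h0 y) * cmod (complex_of_real (gauss \<epsilon> (k - y)))" for k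
          proof -
            have "cmod (trunc R y) * cmod (f k) \<le> cmod (h0 y) * B" by (intro mult_mono norm_trunc_le B) auto
            from mult_left_mono[OF this, of "cmod (complex_of_real (gauss \<epsilon> (k - y)))"]
            show ?thesis unfolding norm_mult by (simp only: mult_ac norm_ge_zero simp_thms)
          qed
        qed (intro integrable_norm i1)
        also have "\<dots> = B * cmod (h0 y)" using g1[of y] by simp
        finally have "(LINT k|lborel. norm (?F y k)) \<le> B * cmod (h0 y)" .
        moreover have "0 \<le> (LINT k|lborel. norm (?F y k))" by simp
        ultimately show "norm (LINT k|lborel. norm ((\<lambda>(y, k). ?F y k) (y, k))) \<le> norm (B * cmod (h0 y))"
          using B0 by simp
      qed
    qed measurable
  qed (use i1 in \<open>auto intro!: AE_I2\<close>)
  have "(LINT k|lborel. mollified \<epsilon> R k * f k) = (LINT k|lborel. LINT y|M0. ?F y k)"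
    unfolding mollified_def by (simp only: integral_mult_left_zero)
  also have "\<dots> = (LINT y|M0. LINT k|lborel. ?F y k)" by (rule MK.Fubini_integral[OF int])
  also have "\<dots> = (LINT y|M0. trunc R y * (LINT z|lborel. complex_of_real (std_normal_density z) * f (y + \<epsilon> * z)))"
  proof (rule Bochner_Integration.integral_cong[OF refl])
    fix y
    have "(LINT k|lborel. ?F y k) = (LINT k|lborel. trunc R y * (complex_of_real (gauss \<epsilon> (k - y)) * f k))"
      by (rule Bochner_Integration.integral_cong[OF refl]) (simp only: mult_ac)
    also have "\<dots> = trunc R y * (LINT k|lborel. complex_of_real (gauss \<epsilon> (k - y)) * f k)" by (rule integral_mult_right_zero)
    finally show "(LINT k|lborel. ?F y k) = trunc R y * (LINT z|lborel. complex_of_real (std_normal_density z) * f (y + \<epsilon> * z))"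
      unfolding integral_gauss[OF \<epsilon>] .
  qed
  finally show ?thesis .
qed

lemma ift_mollified:
  assumes \<epsilon>: "0 < \<epsilon>"
  shows "ift (mollified \<epsilon> R) x = complex_of_real (exp (- (\<epsilon> * x)\<^sup>2 / 2)) * charf (trunc R) x"
proof -
  have "ift (mollified \<epsilon> R) x = (LINT k|lborel. mollified \<epsilon> R k * exp (\<i> * complex_of_real (x * k)))"
    unfolding ift_def by (simp only: mult.commute)
  also have "\<dots> = (LINT y|M0. trunc R y * (LINT z|lborel. complex_of_real (std_normal_density z) * exp (\<i> * complex_of_real (x * (y + \<epsilon> * z)))))"
  proof (rule integral_mollified_mult[OF \<epsilon>, where B=1])
    show "(\<lambda>k. exp (\<i> * complex_of_real (x * k))) \<in> borel_measurable borel" by measurable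
    show "cmod (exp (\<i> * complex_of_real (x * k))) \<le> 1" for k by (simp only: norm_exp_ii_times order_refl)
  qed
  also have "\<dots> = (LINT y|M0. complex_of_real (exp (- (\<epsilon> * x)\<^sup>2 / 2)) * (exp (\<i> * complex_of_real (x * y)) * trunc R y))"
  proof (rule Bochner_Integration.integral_cong[OF refl])
    fix y
    have "(LINT z|lborel. complex_of_real (std_normal_density z) * exp (\<i> * complex_of_real (x * (y + \<epsilon> * z))))
      = (LINT z|lborel. exp (\<i> * complex_of_real (x * y)) * (exp (\<i> * complex_of_real ((\<epsilon> * x) * z)) * complex_of_real (std_normal_density z)))"
      by (intro Bochner_Integration.integral_cong refl) (simp add: exp_add distrib_left mult_ac)
    also have "\<dots> = exp (\<i> * complex_of_real (x * y)) * ift (\<lambda>z. complex_of_real (std_normal_density z)) (\<epsilon> * x)"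
      unfolding ift_def by (rule integral_mult_right_zero)
    also have "ift (\<lambda>z. complex_of_real (std_normal_density z)) (\<epsilon> * x) = complex_of_real (exp (- (\<epsilon> * x)\<^sup>2 / 2))"
      unfolding ift_std_normal by (simp add: exp_of_real[symmetric])
    finally show "trunc R y * (LINT z|lborel. complex_of_real (std_normal_density z) * exp (\<i> * complex_of_real (x * (y + \<epsilon> * z))))
      = complex_of_real (exp (- (\<epsilon> * x)\<^sup>2 / 2)) * (exp (\<i> * complex_of_real (x * y)) * trunc R y)" by (simp only: mult_ac)
  qed
  also have "\<dots> = complex_of_real (exp (- (\<epsilon> * x)\<^sup>2 / 2)) * charf (trunc R) x" unfolding charf_def by (rule integral_mult_right_zero)
  finally show ?thesis .
qed

lemma charf_trunc_close:
  "cmod (charf (trunc R) x - charf h0 x) \<le> (LINT y|M0. cmod (trunc R y - h0 y))"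
proof -
  have "charf (trunc R) x - charf h0 x = (LINT y|M0. exp (\<i> * complex_of_real (x * y)) * trunc R y - exp (\<i> * complex_of_real (x * y)) * h0 y)"
    unfolding charf_def by (rule Bochner_Integration.integral_diff[symmetric]; intro integrable_cexp_mult trunc_int h0_int; measurable)
  also have "cmod \<dots> \<le> (LINT y|M0. cmod (exp (\<i> * complex_of_real (x * y)) * trunc R y - exp (\<i> * complex_of_real (x * y)) * h0 y))"
    by (rule integral_norm_bound)
  also have "\<dots> = (LINT y|M0. cmod (trunc R y - h0 y))"
    by (simp only: right_diff_distrib[symmetric] norm_mult norm_exp_ii_times mult_1)
  finally show ?thesis .
qed

lemma trunc_tendsto: "(\<lambda>n. LINT y|M0. cmod (trunc (real n) y - h0 y)) \<longlonglongrightarrow> 0"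
proof -
  have "(\<lambda>n. LINT y|M0. cmod (trunc (real n) y - h0 y)) \<longlonglongrightarrow> (LINT y|M0. 0)"
  proof (rule integral_dominated_convergence[where w="\<lambda>y. cmod (h0 y)"])
    show "AE y in M0. (\<lambda>n. cmod (trunc (real n) y - h0 y)) \<longlonglongrightarrow> 0"
    proof (intro AE_I2 tendsto_eventually)
      fix y :: real
      obtain m where "\<bar>y\<bar> \<le> real m" using real_arch_simple by blast
      then show "\<forall>\<^sub>F n in sequentially. cmod (trunc (real n) y - h0 y) = 0"
        by (intro eventually_sequentiallyI[of m]) (auto simp: trunc_def)
    qed
  qed (use h0_int in \<open>auto simp: trunc_def\<close>)
  then show ?thesis by simp
qed

text \<open>The order of the choices matters. The transform of the truncated measure is only
  uniformly close to \<open>charf h0\<close> and need not be in L^2; the Gaussian factor of the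
  already fixed \<open>\<epsilon>\<close> turns uniform closeness into L^2 closeness. So
  \<open>\<epsilon>\<close> is chosen first and the truncation radius afterwards.\<close>

lemma mollified_approx:
  assumes u0: "L2 (charf h0)" and \<delta>: "0 < \<delta>"
  obtains \<epsilon> R where "0 < \<epsilon>" "\<epsilon> < \<delta>" "1 / \<delta> < R" "L2norm (\<lambda>x. ift (mollified \<epsilon> R) x - charf h0 x) < \<delta>" "L2 (ift (mollified \<epsilon> R))"
proof -
  have [measurable]: "charf g \<in> borel_measurable borel" if [measurable]: "g \<in> borel_measurable borel" for g
    unfolding charf_def by measurable
  let ?e = "\<lambda>\<epsilon> x. complex_of_real (exp (- (\<epsilon> * x)\<^sup>2 / 2))"
  have "(\<lambda>n. LINT x|lborel. (cmod (?e (1 / real (Suc n)) x * charf h0 x - charf h0 x))\<^sup>2) \<longlonglongrightarrow> (LINT (x::real)|lborel. 0)"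
  proof (rule integral_dominated_convergence[where w="\<lambda>x. (cmod (charf h0 x))\<^sup>2"])
    show "AE x in lborel. (\<lambda>n. (cmod (?e (1 / real (Suc n)) x * charf h0 x - charf h0 x))\<^sup>2) \<longlonglongrightarrow> 0"
    proof (rule AE_I2)
      fix x
      have "(\<lambda>n. (cmod (?e (1 / real (Suc n)) x * charf h0 x - charf h0 x))\<^sup>2) \<longlonglongrightarrow> (cmod (?e 0 x * charf h0 x - charf h0 x))\<^sup>2"
        by (intro tendsto_intros LIMSEQ_Suc[OF lim_1_over_n]) auto
      then show "(\<lambda>n. (cmod (?e (1 / real (Suc n)) x * charf h0 x - charf h0 x))\<^sup>2) \<longlonglongrightarrow> 0" by simp
    qed
    show "AE x in lborel. norm ((cmod (?e (1 / real (Suc n)) x * charf h0 x - charf h0 x))\<^sup>2) \<le> (cmod (charf h0 x))\<^sup>2" for n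
    proof (rule AE_I2)
      fix x
      let ?a = "exp (- (1 / real (Suc n) * x)\<^sup>2 / 2)"
      have "?e (1 / real (Suc n)) x * charf h0 x - charf h0 x = complex_of_real (?a - 1) * charf h0 x" by (simp add: left_diff_distrib)
      moreover have "cmod (complex_of_real (?a - 1)) \<le> 1"
      proof -
        have "?a \<le> 1" "0 \<le> ?a" by simp_all
        then show ?thesis unfolding norm_of_real by linarith
      qed
      ultimately have "cmod (?e (1 / real (Suc n)) x * charf h0 x - charf h0 x) \<le> cmod (charf h0 x)"
        by (simp only: norm_mult) (simp only: mult_left_le_one_le norm_ge_zero)
      then show "norm ((cmod (?e (1 / real (Suc n)) x * charf h0 x - charf h0 x))\<^sup>2) \<le> (cmod (charf h0 x))\<^sup>2"
        unfolding real_norm_def abs_power2 by (rule power_mono) simp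
    qed
  qed (use u0 in \<open>auto simp: L2_def\<close>)
  then have "(\<lambda>n. L2norm (\<lambda>x. ?e (1 / real (Suc n)) x * charf h0 x - charf h0 x)) \<longlonglongrightarrow> 0"
    unfolding L2norm_def using tendsto_real_sqrt by fastforce
  then have ev1: "\<forall>\<^sub>F n in sequentially. L2norm (\<lambda>x. ?e (1 / real (Suc n)) x * charf h0 x - charf h0 x) < \<delta> / 2"
    by (rule order_tendstoD) (use \<delta> in simp)
  have ev2: "\<forall>\<^sub>F n in sequentially. 1 / real (Suc n) < \<delta>"
    by (rule order_tendstoD(2)[OF LIMSEQ_Suc[OF lim_1_over_n] \<delta>])
  from eventually_conj[OF ev1 ev2] obtain n where
    n: "L2norm (\<lambda>x. ?e (1 / real (Suc n)) x * charf h0 x - charf h0 x) < \<delta> / 2" "1 / real (Suc n) < \<delta>"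
    by (auto simp: eventually_sequentially)
  define \<epsilon> where "\<epsilon> = 1 / real (Suc n)"
  have \<epsilon>: "0 < \<epsilon>" by (simp add: \<epsilon>_def)
  have eL2: "L2 (?e \<epsilon>)"
  proof (rule L2_of_bounded_integrable[where B=1])
    show "integrable lborel (?e \<epsilon>)"
      using integrable_gauss_scaled[of \<epsilon>] \<epsilon> unfolding gauss_weight by simp
  qed simp
  define E where "E = L2norm (?e \<epsilon>)"
  have "(\<lambda>m. (LINT y|M0. cmod (trunc (real m) y - h0 y)) * E) \<longlonglongrightarrow> 0 * E" by (intro tendsto_intros trunc_tendsto)
  then have ev3: "\<forall>\<^sub>F m in sequentially. (LINT y|M0. cmod (trunc (real m) y - h0 y)) * E < \<delta> / 2"
    by (rule order_tendstoD) (use \<delta> in simp)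
  have ev4: "\<forall>\<^sub>F m in sequentially. 1 / \<delta> < real m"
    using filterlim_real_sequentially by (simp add: filterlim_at_top_dense)
  from eventually_conj[OF ev3 ev4] obtain m where
    m: "(LINT y|M0. cmod (trunc (real m) y - h0 y)) * E < \<delta> / 2" "1 / \<delta> < real m"
    by (auto simp: eventually_sequentially)
  let ?d = "\<lambda>x. charf (trunc (real m)) x - charf h0 x"
  have dm: "?d \<in> borel_measurable lborel" by measurable
  note dL = L2_bounded_mult[OF eL2 dm charf_trunc_close]
  have e0L: "L2 (\<lambda>x. ?e \<epsilon> x * charf h0 x)"
    by (rule L2_bounded_mult(1)[OF u0, where B=1]) auto
  have eq: "ift (mollified \<epsilon> (real m)) x = ?d x * ?e \<epsilon> x + ?e \<epsilon> x * charf h0 x" for x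
    unfolding ift_mollified[OF \<epsilon>] by (simp add: algebra_simps)
  have "L2norm (\<lambda>x. ?d x * ?e \<epsilon> x + (?e \<epsilon> x * charf h0 x - charf h0 x)) \<le> L2norm (\<lambda>x. ?d x * ?e \<epsilon> x) + L2norm (\<lambda>x. ?e \<epsilon> x * charf h0 x - charf h0 x)"
    by (intro L2norm_triangle dL L2_diff e0L u0)
  also have "\<dots> < \<delta>" using dL(2) m(1) n(1) unfolding E_def \<epsilon>_def by linarith
  finally have "L2norm (\<lambda>x. ift (mollified \<epsilon> (real m)) x - charf h0 x) < \<delta>" unfolding eq by (simp only: add_diff_eq)
  moreover have "L2 (ift (mollified \<epsilon> (real m)))" unfolding eq[abs_def] by (intro L2_add dL e0L)
  ultimately show thesis using that[of \<epsilon> "real m"] \<epsilon> n(2) m(2) by (simp add: \<epsilon>_def)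
qed

end

section \<open>Stability of the Dyson series under truncation of the potential\<close>

context dyson
begin

lemma pot_measurable [measurable]: "pot \<in> borel_measurable borel"
  by (rule borel_measurable_continuous_onI[OF pot_continuous])

lemma h_integrable: "integrable N h"
  by (rule integrable_const_bound[where B=c]) (auto simp: h_le)

lemma norm_pot_le: "cmod (pot x) \<le> c"
proof -
  have "cmod (pot x) \<le> (LINT y|N. cmod (exp (\<i> * complex_of_real (x * y)) * h y))"
    unfolding pot_def by (rule integral_norm_bound)
  also have "\<dots> = (LINT y|N. cmod (h y))"
    by (simp only: norm_mult norm_exp_ii_times mult_1)
  also have "\<dots> \<le> (LINT y|N. c)"
    by (intro integral_mono integrable_norm h_integrable h_le) simp
  finally show ?thesis using prob_space by simp
qed

text \<open>All densities share the bound \<open>c\<close>, so \<open>dominant c t\<close> is a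
  common majorant. Varying the density and the frequency together removes truncation and
  mollification in a single limit.\<close>

lemma wave_tendsto:
  assumes hm: "\<And>m. dyson N (hm m) c \<alpha> p t" and lim: "\<And>y. (\<lambda>m. hm m y) \<longlonglongrightarrow> h y" "km \<longlonglongrightarrow> k"
  shows "(\<lambda>m. dyson.wave N (hm m) \<alpha> p t x (km m)) \<longlonglongrightarrow> wave x k"
  unfolding wave_def dyson.wave_def[OF hm]
proof (rule integral_dominated_convergence[where w="\<lambda>z. (\<lambda>(n, \<omega>). dominant c t n \<omega>) z"])
  let ?P = "\<lambda>k n \<omega>. exp (\<i> * complex_of_real (x * (k + kick_sum \<omega> n)))
      * exp (\<alpha> * complex_of_real (kick_action p n t (k + kick_sum \<omega> n) \<omega>))"
  note [measurable] = dyson.h_measurable[OF hm]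
  show "integrable Q (\<lambda>z. (\<lambda>(n, \<omega>). dominant c t n \<omega>) z)" by (rule integrable_dominant_Q[OF c_nonneg])
  show "(\<lambda>(n, \<omega>). W n t \<omega> * ?P k n \<omega>) \<in> borel_measurable Q"
    "(\<lambda>(n, \<omega>). kick_weight (\<lambda>_. hm m) n t \<omega> * ?P (km m) n \<omega>) \<in> borel_measurable Q" for m
    by (rule pair_count_space_measurable, measurable)+
  have "(\<lambda>m. kick_weight (\<lambda>_. hm m) n t \<omega> * ?P (km m) n \<omega>) \<longlonglongrightarrow> W n t \<omega> * ?P k n \<omega>" for n \<omega>
    unfolding kick_weight_def kick_action_def by (intro tendsto_intros lim)
  then show "AE z in Q. (\<lambda>m. (\<lambda>(n, \<omega>). kick_weight (\<lambda>_. hm m) n t \<omega> * ?P (km m) n \<omega>) z) \<longlonglongrightarrow> (\<lambda>(n, \<omega>). W n t \<omega> * ?P k n \<omega>) z"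
    by (intro AE_I2) (auto split: prod.split)
  have "cmod (kick_weight (\<lambda>_. hm m) n t \<omega> * ?P (km m) n \<omega>) \<le> dominant c t n \<omega>" for m n \<omega>
    by (intro dyson.norm_W_mult_le[OF hm] norm_phase_le) (simp_all add: t_nonneg)
  then show "AE z in Q. norm ((\<lambda>(n, \<omega>). kick_weight (\<lambda>_. hm m) n t \<omega> * ?P (km m) n \<omega>) z) \<le> (\<lambda>(n, \<omega>). dominant c t n \<omega>) z" for m
    by (intro AE_I2) (simp only: split: prod.split, blast)
qed

lemma wave_continuous: "continuous_on UNIV (wave x)"
  unfolding continuous_on_eq_continuous_at[OF open_UNIV]
  by (intro ballI continuous_at_sequentiallyI wave_tendsto dyson_axioms tendsto_const)

lemma wave_measurable [measurable]: "wave x \<in> borel_measurable borel"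
  by (rule borel_measurable_continuous_onI[OF wave_continuous])

definition cut :: "real \<Rightarrow> real \<Rightarrow> complex" where
  "cut R y = (if \<bar>y\<bar> \<le> R then h y else 0)"

lemma cut_measurable [measurable]: "cut R \<in> borel_measurable borel"
  unfolding cut_def by measurable

lemma norm_cut_le: "cmod (cut R y) \<le> c"
  using h_le c_nonneg by (simp add: cut_def)

lemma dyson_cut: "dyson N (cut R) c \<alpha> p t"
  by unfold_locales (rule cut_measurable norm_cut_le alpha t_nonneg)+

lemma cut_tendsto:
  assumes R: "\<And>m. real m \<le> R m"
  shows "(\<lambda>m. cut (R m) y) \<longlonglongrightarrow> h y"
proof (rule tendsto_eventually)
  obtain n where "\<bar>y\<bar> \<le> real n" using real_arch_simple by blast
  then have "\<bar>y\<bar> \<le> R m" if "n \<le> m" for m using that R[of m] by linarith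
  then show "\<forall>\<^sub>F m in sequentially. cut (R m) y = h y"
    by (intro eventually_sequentiallyI[of n]) (simp add: cut_def)
qed

lemma cut_integral_tendsto: "(\<lambda>n. LINT y|N. cmod (cut (real n) y - h y)) \<longlonglongrightarrow> 0"
proof -
  have "(\<lambda>n. LINT y|N. cmod (cut (real n) y - h y)) \<longlonglongrightarrow> (LINT y|N. cmod (h y - h y))"
  proof (rule integral_dominated_convergence[where w="\<lambda>_. c"])
    show "AE y in N. (\<lambda>n. cmod (cut (real n) y - h y)) \<longlonglongrightarrow> cmod (h y - h y)"
      by (intro AE_I2 tendsto_intros cut_tendsto) simp
    show "AE y in N. norm (cmod (cut (real n) y - h y)) \<le> c" for n
      using h_le c_nonneg by (intro AE_I2) (simp add: cut_def)
  qed auto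
  then show ?thesis by simp
qed

text \<open>The distance of the potentials is uniform in \<open>x\<close>, which makes the
  truncation a small bounded perturbation of the generator.\<close>

lemma pot_cut_close: "cmod (dyson.pot N (cut R) x - pot x) \<le> (LINT y|N. cmod (cut R y - h y))"
proof -
  interpret C: dyson N "cut R" c \<alpha> p t by (rule dyson_cut)
  have "C.pot x - pot x = (LINT y|N. exp (\<i> * complex_of_real (x * y)) * cut R y - exp (\<i> * complex_of_real (x * y)) * h y)"
    unfolding C.pot_def pot_def
    by (rule Bochner_Integration.integral_diff[symmetric]; intro integrable_cexp_mult C.h_integrable h_integrable; measurable)
  also have "cmod \<dots> \<le> (LINT y|N. cmod (exp (\<i> * complex_of_real (x * y)) * cut R y - exp (\<i> * complex_of_real (x * y)) * h y))"
    by (rule integral_norm_bound)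
  also have "\<dots> = (LINT y|N. cmod (cut R y - h y))"
    by (simp only: right_diff_distrib[symmetric] norm_mult norm_exp_ii_times mult_1)
  finally show ?thesis .
qed

end

section \<open>Identification of the semigroup with the Dyson series\<close>

locale feynman = dyson + generated_semigroup T \<alpha> p pot + initial_measure M0 h0 for T M0 h0 +
  assumes t_pos: "0 < t" and L2_charf: "L2 (charf h0)"
begin

text \<open>Initial data are fixed first. The L^2 bound \<open>B\<close> on the resulting solutions
  does not depend on the cutoff \<open>n\<close>, so \<open>n\<close> can then be taken large enough
  to push the perturbation error below \<open>\<delta>\<close>. Replacing the initial value costs M
  \<delta> and replacing the potential costs \<delta>, whence M + 1.\<close>

lemma approximation:
  assumes M: "0 \<le> M" "\<And>s u. s \<in> {0..t} \<Longrightarrow> L2 u \<Longrightarrow> L2norm (T s u) \<le> M * L2norm u"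
    and \<delta>: "0 < \<delta>"
  obtains \<epsilon> R n where "0 < \<epsilon>" "\<epsilon> < \<delta>" "1 / \<delta> < R" "1 / \<delta> < real n"
    "L2 (\<lambda>x. LINT k|lborel. mollified \<epsilon> R k * dyson.wave N (cut (real n)) \<alpha> p t x k)"
    "L2norm (\<lambda>x. T t (charf h0) x - (LINT k|lborel. mollified \<epsilon> R k * dyson.wave N (cut (real n)) \<alpha> p t x k)) \<le> (M + 1) * \<delta>"
proof -
  obtain \<epsilon> R where \<epsilon>: "0 < \<epsilon>" "\<epsilon> < \<delta>" and R: "1 / \<delta> < R"
    and close: "L2norm (\<lambda>x. ift (mollified \<epsilon> R) x - charf h0 x) < \<delta>" and mL: "L2 (ift (mollified \<epsilon> R))"
    by (rule mollified_approx[OF L2_charf \<delta>])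
  let ?w = "mollified \<epsilon> R"
  define C0 where "C0 = exp (\<epsilon>\<^sup>2 / 2) / \<epsilon> * exp R * mass"
  define B where "B = sqrt (2 * pi * (C0 * exp (t * c) * (exp (t * c) * (LINT k|lborel. cmod (?w k)))))"
  let ?d = "\<lambda>n. LINT y|N. cmod (cut (real n) y - h y)"
  have "(\<lambda>n. M * (?d n * B) * t) \<longlonglongrightarrow> M * (0 * B) * t" by (intro tendsto_intros cut_integral_tendsto)
  then have ev1: "\<forall>\<^sub>F n in sequentially. M * (?d n * B) * t < \<delta>"
    by (rule order_tendstoD) (use \<delta> in simp)
  have ev2: "\<forall>\<^sub>F n in sequentially. 1 / \<delta> < real n"
    using filterlim_real_sequentially by (simp add: filterlim_at_top_dense)
  from eventually_conj[OF ev1 ev2] obtain n where n: "M * (?d n * B) * t < \<delta>" "1 / \<delta> < real n"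
    by (auto simp: eventually_sequentially)
  interpret C: dyson N "cut (real n)" c \<alpha> p t by (rule dyson_cut)
  interpret E: evolution N "cut (real n)" c \<alpha> p t ?w "real n" C0
  proof
    show "continuous_on UNIV ?w" by (rule mollified_continuous[OF \<epsilon>(1)])
    show "cmod (?w k) \<le> C0 * exp (- \<bar>k\<bar>)" for k unfolding C0_def by (rule mollified_le[OF \<epsilon>(1)])
    show "cut (real n) y = 0" if "real n < \<bar>y\<bar>" for y using that by (simp add: cut_def)
  qed simp
  have t: "t \<in> {0..t}" using t_nonneg by simp
  have uL: "L2 (ift (C.fsol ?w s))" if "s \<in> {0..t}" for s
    using E.A_rel_fsol[OF that] by (simp add: A_rel_def)
  have f0: "C.fsol ?w 0 = ?w" by (rule ext) (rule E.fsol_0)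
  have "L2norm (\<lambda>x. T t (ift (C.fsol ?w 0)) x - ift (C.fsol ?w t) x) \<le> M * (?d n * B) * t"
  proof (rule perturbation_estimate[OF t_pos M E.A_rel_fsol _ norm_pot_le _ C.norm_pot_le E.ift_fsol_deriv])
    show "pot \<in> borel_measurable lborel" "C.pot \<in> borel_measurable lborel" by measurable
    fix s assume s: "s \<in> {0..t}"
    have "L2norm (\<lambda>x. (C.pot x - pot x) * ift (C.fsol ?w s) x) \<le> ?d n * L2norm (ift (C.fsol ?w s))"
      by (rule L2_bounded_mult(2)[OF uL[OF s] _ pot_cut_close]) measurable
    also have "\<dots> \<le> ?d n * B"
      unfolding B_def by (intro mult_left_mono E.L2norm_ift_fsol_le s) simp
    finally show "L2norm (\<lambda>x. C.pot x * ift (C.fsol ?w s) x - pot x * ift (C.fsol ?w s) x) \<le> ?d n * B"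
      by (simp only: left_diff_distrib)
  qed
  then have 1: "L2norm (\<lambda>x. T t (ift ?w) x - ift (C.fsol ?w t) x) < \<delta>" unfolding f0 using n(1) by linarith
  have "L2norm (\<lambda>x. T t (charf h0) x - T t (ift ?w) x) \<le> M * L2norm (\<lambda>x. charf h0 x - ift ?w x)"
    unfolding L2norm_T_diff[OF t_nonneg L2_charf mL] by (intro M(2)[OF t] L2_diff L2_charf mL)
  also have "\<dots> \<le> M * \<delta>"
    using close M(1) by (intro mult_left_mono) (simp_all add: L2norm_minus_commute)
  finally have "L2norm (\<lambda>x. T t (charf h0) x - ift (C.fsol ?w t) x) \<le> (M + 1) * \<delta>"
    using L2norm_triangle3[OF T_L2[OF t_nonneg L2_charf] T_L2[OF t_nonneg mL] uL[OF t]] 1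
    unfolding distrib_right mult_1 by linarith
  then show thesis
    using that[OF \<epsilon> R n(2)] uL[OF t] unfolding C.ift_fsol[OF E.integrable_w0, abs_def] by blast
qed

text \<open>The truncated waves are bounded by exp (t c) throughout, and \<open>wave_tendsto\<close>
  covers the moving argument y + \<epsilon> z together with the moving cutoff. Dominated convergence
  is used first in the Gaussian variable, then in \<open>M0\<close>.\<close>

lemma approximants_tendsto:
  assumes \<epsilon>: "\<And>m. 0 < \<epsilon> m" "\<epsilon> \<longlonglongrightarrow> 0" and R: "\<And>m. real m \<le> R m" and R': "\<And>m. real m \<le> R' m"
  shows "(\<lambda>m. LINT k|lborel. mollified (\<epsilon> m) (R m) k * dyson.wave N (cut (R' m)) \<alpha> p t x k) \<longlonglongrightarrow> (LINT y|M0. wave x y * h0 y)"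
proof -
  let ?wave = "\<lambda>m. dyson.wave N (cut (R' m)) \<alpha> p t x"
  note [measurable] = dyson.wave_measurable[OF dyson_cut]
  note le = dyson.norm_wave_le[OF dyson_cut]
  let ?I = "\<lambda>m y. LINT z|lborel. complex_of_real (std_normal_density z) * ?wave m (y + \<epsilon> m * z)"
  have snd1: "(LINT z|lborel. cmod (complex_of_real (std_normal_density z))) = 1"
  proof -
    have "complex_of_real (LINT z|lborel. std_normal_density z) = 1" using integral_std_normal by simp
    then show ?thesis by simp
  qed
  have si: "integrable lborel (\<lambda>z. exp (t * c) * cmod (complex_of_real (std_normal_density z)))"
    using integrable_std_normal by (intro integrable_mult_right integrable_norm)
  have le': "cmod (complex_of_real (std_normal_density z) * ?wave m y) \<le> exp (t * c) * cmod (complex_of_real (std_normal_density z))" for m y z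
    unfolding norm_mult by (subst mult.commute) (intro mult_right_mono le norm_ge_zero)
  have I_le: "cmod (?I m y) \<le> exp (t * c)" for m y
  proof -
    have "cmod (?I m y) \<le> (LINT z|lborel. cmod (complex_of_real (std_normal_density z) * ?wave m (y + \<epsilon> m * z)))"
      by (rule integral_norm_bound)
    also have "\<dots> \<le> (LINT z|lborel. exp (t * c) * cmod (complex_of_real (std_normal_density z)))"
      by (rule integral_mono_AE'[OF si]) (use le' in auto)
    also have "\<dots> = exp (t * c)" using snd1 by simp
    finally show ?thesis .
  qed
  have I_lim: "(\<lambda>m. ?I m y) \<longlonglongrightarrow> wave x y" for y
  proof -
    have "(\<lambda>m. ?I m y) \<longlonglongrightarrow> (LINT z|lborel. complex_of_real (std_normal_density z) * wave x y)"
    proof (rule integral_dominated_convergence[OF _ _ si])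
      have "(\<lambda>m. ?wave m (y + \<epsilon> m * z)) \<longlonglongrightarrow> wave x y" for z
      proof (rule wave_tendsto[OF dyson_cut cut_tendsto[OF R']])
        have "(\<lambda>m. y + \<epsilon> m * z) \<longlonglongrightarrow> y + 0 * z" by (intro tendsto_intros \<epsilon>(2))
        then show "(\<lambda>m. y + \<epsilon> m * z) \<longlonglongrightarrow> y" by simp
      qed
      then show "AE z in lborel. (\<lambda>m. complex_of_real (std_normal_density z) * ?wave m (y + \<epsilon> m * z)) \<longlonglongrightarrow> complex_of_real (std_normal_density z) * wave x y"
        by (intro AE_I2 tendsto_mult tendsto_const)
      show "AE z in lborel. norm (complex_of_real (std_normal_density z) * ?wave m (y + \<epsilon> m * z)) \<le> exp (t * c) * cmod (complex_of_real (std_normal_density z))" for m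
        by (intro AE_I2 le')
    qed measurable
    then show ?thesis using integral_std_normal by (simp only: integral_mult_left_zero mult_1)
  qed
  have "(\<lambda>m. LINT y|M0. trunc (R m) y * ?I m y) \<longlonglongrightarrow> (LINT y|M0. h0 y * wave x y)"
  proof (rule integral_dominated_convergence[where w="\<lambda>y. exp (t * c) * cmod (h0 y)"])
    show "integrable M0 (\<lambda>y. exp (t * c) * cmod (h0 y))" by (intro integrable_mult_right integrable_norm h0_int)
    show "AE y in M0. (\<lambda>m. trunc (R m) y * ?I m y) \<longlonglongrightarrow> h0 y * wave x y"
    proof (intro AE_I2 tendsto_mult I_lim tendsto_eventually)
      fix y
      obtain n where "\<bar>y\<bar> \<le> real n" using real_arch_simple by blast
      then have "\<bar>y\<bar> \<le> R m" if "n \<le> m" for m using that R[of m] by linarith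
      then show "\<forall>\<^sub>F m in sequentially. trunc (R m) y = h0 y"
        by (intro eventually_sequentiallyI[of n]) (simp add: trunc_def)
    qed
    show "AE y in M0. norm (trunc (R m) y * ?I m y) \<le> exp (t * c) * cmod (h0 y)" for m
    proof (rule AE_I2)
      fix y
      have "cmod (trunc (R m) y) * cmod (?I m y) \<le> cmod (h0 y) * exp (t * c)" by (intro mult_mono norm_trunc_le I_le) auto
      then show "norm (trunc (R m) y * ?I m y) \<le> exp (t * c) * cmod (h0 y)" by (simp only: norm_mult mult.commute)
    qed
  qed measurable
  then show ?thesis
    unfolding integral_mollified_mult[OF \<epsilon>(1) dyson.wave_measurable[OF dyson_cut] le] by (simp only: mult.commute)
qed

text \<open>The approximants converge in L^2 to the semigroup and at every point to the Dyson
  series. Applying Fatou's lemma to their difference from the semigroup bounds the norm of the final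
  difference by every positive \<open>e\<close>.\<close>

theorem semigroup_eq_wave: "AE x in lborel. T t (charf h0) x = (LINT y|M0. wave x y * h0 y)"
proof -
  obtain M where M: "0 \<le> M" "\<And>s u. s \<in> {0..t} \<Longrightarrow> L2 u \<Longrightarrow> L2norm (T s u) \<le> M * L2norm u"
    using T_bounded_on[of t] by blast
  define U where "U \<epsilon> R n x = (LINT k|lborel. mollified \<epsilon> R k * dyson.wave N (cut (real n)) \<alpha> p t x k)" for \<epsilon> R n x
  \<comment> \<open>Besides the L^2 error, the radii are forced beyond \<open>m\<close>, so that
    both truncations disappear in the pointwise limit along the chosen sequence.\<close>
  define good where "good m \<epsilon> R n \<longleftrightarrow> 0 < \<epsilon> \<and> \<epsilon> < 1 / real (Suc m) \<and> real m \<le> R \<and> real m \<le> real n \<and> L2 (U \<epsilon> R n)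
      \<and> L2norm (\<lambda>x. T t (charf h0) x - U \<epsilon> R n x) \<le> (M + 1) * (1 / real (Suc m))" for m \<epsilon> R n
  have "\<exists>\<epsilon> R n. good m \<epsilon> R n" for m
  proof -
    show ?thesis
    proof (rule approximation[OF M(1)])
      show "L2norm (T s u) \<le> M * L2norm u" if "s \<in> {0..t}" "L2 u" for s u using M(2) that .
      show "0 < 1 / real (Suc m)" by simp
      fix \<epsilon> R n
      assume *: "0 < \<epsilon>" "\<epsilon> < 1 / real (Suc m)" "1 / (1 / real (Suc m)) < R" "1 / (1 / real (Suc m)) < real n"
        "L2 (\<lambda>x. LINT k|lborel. mollified \<epsilon> R k * dyson.wave N (cut (real n)) \<alpha> p t x k)"
        "L2norm (\<lambda>x. T t (charf h0) x - (LINT k|lborel. mollified \<epsilon> R k * dyson.wave N (cut (real n)) \<alpha> p t x k)) \<le> (M + 1) * (1 / real (Suc m))"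
      have "real m \<le> R" "real m \<le> real n" using *(3,4) unfolding inverse_eq_divide[symmetric] inverse_inverse_eq by linarith+
      with * have "good m \<epsilon> R n" unfolding good_def U_def[abs_def] by (intro conjI)
      then show ?thesis by blast
    qed
  qed
  then obtain \<epsilon> R n where "\<And>m. good m (\<epsilon> m) (R m) (n m)" by metis
  then have *: "\<And>m. 0 < \<epsilon> m" "\<And>m. \<epsilon> m < 1 / real (Suc m)" "\<And>m. real m \<le> R m" "\<And>m. real m \<le> real (n m)"
    "\<And>m. L2 (U (\<epsilon> m) (R m) (n m))" "\<And>m. L2norm (\<lambda>x. T t (charf h0) x - U (\<epsilon> m) (R m) (n m) x) \<le> (M + 1) * (1 / real (Suc m))"
    unfolding good_def by blast+
  have \<epsilon>0: "\<epsilon> \<longlonglongrightarrow> 0"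
    by (rule tendsto_sandwich[OF _ _ tendsto_const LIMSEQ_Suc[OF lim_1_over_n]])
      (intro always_eventually allI less_imp_le *(1), intro always_eventually allI less_imp_le *(2))
  let ?w = "\<lambda>x. LINT y|M0. wave x y * h0 y"
  have lim: "(\<lambda>m. U (\<epsilon> m) (R m) (n m) x) \<longlonglongrightarrow> ?w x" for x
    unfolding U_def by (rule approximants_tendsto[OF *(1) \<epsilon>0 *(3) *(4)])
  have TL: "L2 (T t (charf h0))" by (rule T_L2[OF t_nonneg L2_charf])
  have Um: "U (\<epsilon> m) (R m) (n m) \<in> borel_measurable borel" for m using *(5)[of m] by (simp add: L2_def)
  have wm: "?w \<in> borel_measurable borel" by (rule borel_measurable_LIMSEQ_metric[OF Um lim])
  have dm: "(\<lambda>x. T t (charf h0) x - ?w x) \<in> borel_measurable lborel"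
    using TL wm unfolding L2_def measurable_lborel2 by (intro borel_measurable_diff) auto
  have dL: "L2 (\<lambda>x. T t (charf h0) x - U (\<epsilon> m) (R m) (n m) x)" for m by (intro L2_diff TL *(5))
  have dlim: "AE x in lborel. (\<lambda>m. T t (charf h0) x - U (\<epsilon> m) (R m) (n m) x) \<longlonglongrightarrow> T t (charf h0) x - ?w x"
    by (intro AE_I2 tendsto_diff tendsto_const lim)
  have fatou: "L2 (\<lambda>x. T t (charf h0) x - ?w x)" "L2norm (\<lambda>x. T t (charf h0) x - ?w x) \<le> e" if e: "0 < e" for e
  proof -
    have "(\<lambda>m. (M + 1) * (1 / real (Suc m))) \<longlonglongrightarrow> (M + 1) * 0" by (intro tendsto_intros LIMSEQ_Suc[OF lim_1_over_n])
    then have "\<forall>\<^sub>F m in sequentially. (M + 1) * (1 / real (Suc m)) < e" by (rule order_tendstoD) (use e in simp)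
    then have ev: "\<forall>\<^sub>F m in sequentially. L2norm (\<lambda>x. T t (charf h0) x - U (\<epsilon> m) (R m) (n m) x) \<le> e"
      by eventually_elim (rule order_trans[OF *(6)], simp)
    show "L2 (\<lambda>x. T t (charf h0) x - ?w x)" "L2norm (\<lambda>x. T t (charf h0) x - ?w x) \<le> e"
      using L2_fatou[OF dL less_imp_le[OF e] ev dm dlim] by blast+
  qed
  have "L2norm (\<lambda>x. T t (charf h0) x - ?w x) \<le> 0" by (rule field_le_epsilon) (use fatou(2) in simp)
  then have "(LINT x|lborel. (cmod (T t (charf h0) x - ?w x))\<^sup>2) = 0"
    using L2norm_square[of "\<lambda>x. T t (charf h0) x - ?w x"] L2norm_nonneg[of "\<lambda>x. T t (charf h0) x - ?w x"] by (simp del: L2norm_nonneg)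
  moreover have "integrable lborel (\<lambda>x. (cmod (T t (charf h0) x - ?w x))\<^sup>2)" using fatou(1)[of 1] by (simp add: L2_def)
  ultimately have "AE x in lborel. (cmod (T t (charf h0) x - ?w x))\<^sup>2 = 0"
    by (subst (asm) integral_nonneg_eq_0_iff_AE) auto
  then show ?thesis by simp
qed

end

lemma integral_even_power_nonneg:
  fixes g :: "real \<Rightarrow> real" and t :: real
  assumes "even p" "0 \<le> t"
  shows "0 \<le> (LBINT s=0..t. g s ^ p)"
proof -
  have "(LBINT s=0..t. g s ^ p) = (LINT s:{0..t}|lborel. g s ^ p)"
    using interval_integral_Icc[of 0 t "\<lambda>s. g s ^ p"] assms(2) by (simp add: zero_ereal_def)
  also have "\<dots> \<ge> 0"
    unfolding set_lebesgue_integral_def using assms(1) by (intro integral_nonneg_AE AE_I2) (auto simp: zero_le_even_power indicator_def)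
  finally show ?thesis .
qed

theorem theorem1:
  fixes p :: nat and t :: real and \<alpha> :: complex
    and u0 V :: "real \<Rightarrow> complex"
    and M0 N :: "real measure" and h0 hV :: "real \<Rightarrow> complex"
    and T :: "real \<Rightarrow> (real \<Rightarrow> complex) \<Rightarrow> (real \<Rightarrow> complex)"
    and f :: "real \<Rightarrow> (real \<Rightarrow> real) \<Rightarrow> complex"
  assumes p3: "p \<ge> 3"
    and t_pos: "t > 0"
    and alpha_nz: "\<alpha> \<noteq> 0"
    and alpha_even: "even p \<Longrightarrow> Re \<alpha> \<le> 0"
    and alpha_odd: "odd p \<Longrightarrow> Re \<alpha> = 0"
    and M0: "sets M0 = sets borel" "finite_measure M0" "integrable M0 h0"
    and N: "sets N = sets borel" "finite_measure N" "integrable N hV"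
    and u0_def: "\<And>x. u0 x = (\<integral>y. exp (\<i> * complex_of_real (x * y)) * h0 y \<partial>M0)"
    and V_def: "\<And>x. V x = (\<integral>y. exp (\<i> * complex_of_real (x * y)) * hV y \<partial>N)"
    and u0_L2: "L2 u0"
    and T: "C0_generated T \<alpha> p V"
    and f_def: "\<And>x \<eta>. f x \<eta> = u0 (x + \<eta> 0) * exp (LBINT s=0..t. V (x + \<eta> s))"
  shows "(\<forall>x. inF (real p) (real p / (real p - 1)) t (f x))
       \<and> (AE x in lborel. \<forall>M h. FB_rep (real p) (real p / (real p - 1)) t (f x) M h
              \<longrightarrow> I_Phi p \<alpha> t M h = T t u0 x)"
proof -
  define q where "q = real p / (real p - 1)"
  have p2: "2 \<le> p" using p3 by simp
  have \<alpha>1: "Re (\<alpha> * complex_of_real (y ^ p)) \<le> 0" for y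
    using alpha_even alpha_odd by (cases "even p") (auto simp del: of_real_power intro!: mult_nonpos_nonneg zero_le_even_power)
  have sg: "(- 1) ^ p * \<alpha> = \<alpha> \<or> (- 1) ^ p * \<alpha> = - \<alpha> \<and> Re \<alpha> = 0"
    using alpha_odd by (cases "even p") auto
  have \<beta>1: "Re ((- 1) ^ p * \<alpha> * complex_of_real (y ^ p)) \<le> 0" for y
    using sg
  proof (elim disjE conjE)
    assume e: "(- 1) ^ p * \<alpha> = \<alpha>"
    show ?thesis unfolding e by (rule \<alpha>1)
  next
    assume e: "(- 1) ^ p * \<alpha> = - \<alpha>" and r: "Re \<alpha> = 0"
    show ?thesis unfolding e using r by (simp del: of_real_power)
  qed
  \<comment> \<open>For even p the integral of the power is nonnegative; for odd p the coefficient
    is purely imaginary, so the sign of the integral does not matter.\<close>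
  have \<beta>2: "Re ((- 1) ^ p * \<alpha> * complex_of_real (LBINT s=0..t. g s ^ p)) \<le> 0" for g
  proof (cases "even p")
    case True
    then show ?thesis using alpha_even integral_even_power_nonneg[OF True, of t g] t_pos
      by (simp add: mult_nonpos_nonneg)
  next
    case False
    then show ?thesis using alpha_odd by simp
  qed
  \<comment> \<open>Only the function \<open>V\<close> enters \<open>f\<close> and the generator, so
    its measure may be exchanged for any other with the same integrals of the exponentials in
    y.\<close>
  obtain N' h' c where N': "prob_space N'" "sets N' = sets borel" and h': "h' \<in> borel_measurable borel" "0 \<le> c" "\<And>y. cmod (h' y) \<le> c"
    and eq: "\<And>\<phi>. \<phi> \<in> borel_measurable borel \<Longrightarrow> (LINT y|N. \<phi> y * hV y) = (LINT y|N'. \<phi> y * h' y)"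
    by (rule bounded_prob_density[OF N(1) N(3)]) (rule that; assumption)
  interpret P: prob_space N' by fact
  interpret D: dyson N' h' c \<alpha> p t
    by unfold_locales (use N' h' \<alpha>1 t_pos in simp_all)
  have V: "V = D.pot"
    unfolding V_def[abs_def] D.pot_def[abs_def] by (intro ext eq) measurable
  interpret M0: finite_measure M0 by fact
  interpret I: initial_measure M0 h0
    by unfold_locales (rule M0)+
  have u0: "u0 = I.charf h0"
    by (rule ext) (simp only: u0_def I.charf_def)
  interpret F: feynman N' h' c \<alpha> p t T M0 h0
    by unfold_locales (use T t_pos u0_L2 in \<open>simp_all only: V u0\<close>)
  note rep = D.FB_rep_exists[OF t_pos p2 q_def M0 u0_def f_def[unfolded V] \<beta>2]
  have inF: "inF (real p) q t (f x)" for x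
    by (rule rep[of x]) (auto simp: inF_def)
  \<comment> \<open>An arbitrary representation is compared with the constructed one, whose value of
    \<open>I_Phi\<close> is known for every \<open>x\<close>. The exceptional null set in the
    conclusion thus comes from the semigroup alone and is the same for all representations.\<close>
  have val: "I_Phi p \<alpha> t M h = (LINT y|M0. D.wave x y * h0 y)" if R: "FB_rep (real p) q t (f x) M h" for x M h
  proof (rule rep[of x])
    fix M' h''
    assume R': "FB_rep (real p) q t (f x) M' h''" and I: "I_Phi p \<alpha> t M' h'' = (LINT y|M0. D.wave x y * h0 y)"
    show ?thesis
      using FB_rep_action_unique(2)[OF t_pos p2 q_def \<beta>1 \<beta>2 R R'] I by (simp add: I_Phi_def)
  qed
  have "AE x in lborel. \<forall>M h. FB_rep (real p) q t (f x) M h \<longrightarrow> I_Phi p \<alpha> t M h = T t u0 x"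
    using F.semigroup_eq_wave by eventually_elim (simp add: val u0)
  with inF show ?thesis unfolding q_def by blast
qed

end
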